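(* Fix a mass ratio $\mu\in(0,1)$. Then for every $c<H(L_1)$, both regularized energy hypersurfaces $\overline{\Sigma}^E_c$ and $\overline{\Sigma}^M_c$ of the spatial circular restricted three-body problem are of contact type. Furthermore, there exists $\epsilon>0$ such that for every $c$ with $H(L_1)<c<H(L_1)+\epsilon$ the regularized energy hypersurface $\overline{\Sigma}^{E,M}_c$ is also of contact type.
   Context: Hamiltonian. Put $E=(\mu,0,0)$, $M=(-(1-\mu),0,0)\in\mathbb{R}^3$ and $A=(\mathbb{R}^3\setminus\{E,M\})\times\mathbb{R}^3$ with coordinates $(q,p)$ and symplectic form $\omega=\sum_i dp_i\wedge dq_i$. Let $$H(q,p)=\tfrac12|p|^2-\frac{\mu}{|q-M|}-\frac{1-\mu}{|q-E|}+p_1q_2-p_2q_1 .$$ $H$ has five critical points; $L_1$ denotes the one whose position $l^1$ lies on the open segment between $E$ and $M$. $H(L_1)$ is the smallest critical value of $H$. Components of level sets. Let $\Sigma_c=H^{-1}(c)$, let $\pi(q,p)=q$, and let $\mathcal{K}_c=\pi(\Sigma_c)$ (the Hill's region). If $c<H(L_1)$, then $\mathcal{K}_c$ has three connected components, two of them bounded; the bounded ones are denoted $\mathcal{K}^M_c,\mathcal{K}^E_c$, where $M\in\overline{\mathcal{K}^M_c}$ and $E\in\overline{\mathcal{K}^E_c}$. Put $\Sigma^M_c=\pi^{-1}(\mathcal{K}^M_c)\cap\Sigma_c$ and $\Sigma^E_c=\pi^{-1}(\mathcal{K}^E_c)\cap\Sigma_c$. If $c$ is larger than $H(L_1)$ but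 smaller than the second smallest critical value of $H$, then $\mathcal{K}_c$ has two connected components, exactly one of them bounded, denoted $\mathcal{K}^{M,E}_c$ (its closure contains both $E$ and $M$), and $\Sigma^{M,E}_c=\pi^{-1}(\mathcal{K}^{M,E}_c)\cap\Sigma_c$. In the claim $\epsilon$ is in particular small enough that this applies. Moser regularization. Write $T^*S^3=\{(\xi,\eta)\in\mathbb{R}^4\times\mathbb{R}^4:\ |\xi|=1,\ \langle\xi,\eta\rangle=0\}$, $\xi=(\xi_0;\vec\xi)$, $\eta=(\eta_0;\vec\eta)$, with symplectic form the restriction of $\sum_i d\eta_i\wedge d\xi_i$, and let $N=(1,0,0,0)$. For $P\in\{E,M\}$, let $V_P=\{(\xi,\eta)\in T^*S^3:\ \eta\ne0,\ |\eta|(1-\xi_0)<\tfrac12\}$. The map $$q=P+(1-\xi_0)\vec\eta+\eta_0\vec\xi,\qquad p=-\frac{\vec\xi}{1-\xi_0}$$ (the switch map composed with stereographic projection) is a symplectic diffeomorphism from $\{(\xi,\eta)\in V_P:\xi\neq N\}$ onto $\{(q,p)\in A: 0<|q-P|<\tfrac12\}$, with $|q-P|=|\eta|(1-\xi_0)$. Gluing $V_E$ and $V_M$ to $A$ along these two maps gives a symplectic manifold $(W,\omega)$ containing $A$. Near $P=M$ the function $K=(H-c)|q-M|$ extends smoothly over $V_M$, and equals $|\eta|f-\mu$ with $f$ smooth and $f=1$ on the fibre over $N$ (analogously near $E$, with $\mu$ replaced by $1-\mu$), so the collision locus added to a level set is $C_M=\{(N,\eta)\in V_M:|\eta|=\mu\}$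 at the Moon and $C_E=\{(N,\eta)\in V_E:|\eta|=1-\mu\}$ at the Earth. The regularized energy hypersurfaces are the closed hypersurfaces of $W$ $$\overline{\Sigma}^M_c=\Sigma^M_c\cup C_M,\qquad \overline{\Sigma}^E_c=\Sigma^E_c\cup C_E,\qquad \overline{\Sigma}^{E,M}_c=\Sigma^{M,E}_c\cup C_E\cup C_M .$$ Contact type. A hypersurface $S$ in a symplectic manifold $(W,\omega)$ is of contact type if there is a vector field $X$ defined on a neighbourhood of $S$ with $\mathcal{L}_X\omega=\omega$ (a Liouville vector field) that is transverse to $S$. *)

theory Defs
  imports "HOL-Analysis.Analysis"
begin

section \<open>Smooth maps, vector fields and hypersurfaces in embedded manifolds\<close>

text \<open>Meant for open \<open>S\<close>: all iterated directional derivatives of order at most \<open>k\<close> exist and are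
  differentiable (order below \<open>k\<close>) or continuous (order \<open>k\<close>).\<close>

primrec Ck_on :: "nat \<Rightarrow> 'a::euclidean_space set \<Rightarrow> ('a \<Rightarrow> 'b::real_normed_vector) \<Rightarrow> bool" where
  "Ck_on 0 S f \<longleftrightarrow> continuous_on S f"
| "Ck_on (Suc k) S f \<longleftrightarrow>
     f differentiable_on S \<and> (\<forall>v. Ck_on k S (\<lambda>x. frechet_derivative f (at x) v))"

text \<open>Smoothness on an arbitrary subset of a Euclidean space: local smooth extendability.\<close>

definition smooth_on :: "'a::euclidean_space set \<Rightarrow> ('a \<Rightarrow> 'b::real_normed_vector) \<Rightarrow> bool" where
  "smooth_on S f \<longleftrightarrow>
     (\<forall>x\<in>S. \<exists>B g. open B \<and> x \<in> B \<and> (\<forall>k. Ck_on k B g) \<and> (\<forall>y\<in>B \<inter> S. f y = g y))"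

text \<open>Velocities at \<open>x\<close> of smooth curves in \<open>S\<close>; for an embedded submanifold this is \<open>T\<^sub>xS\<close>.\<close>

definition tangent_space :: "'a::euclidean_space set \<Rightarrow> 'a \<Rightarrow> 'a set" where
  "tangent_space S x =
     {v. \<exists>\<gamma> e. 0 < e \<and> smooth_on {-e<..<e} \<gamma> \<and> \<gamma> ` {-e<..<e} \<subseteq> S \<and>
              \<gamma> (0::real) = x \<and> (\<gamma> has_vector_derivative v) (at 0)}"

text \<open>In the following, \<open>V\<close> is an embedded submanifold of a Euclidean space. A subset \<open>T\<close> of \<open>V\<close> is a
  hypersurface of \<open>V\<close> if it is locally a regular level set; regularity is required at \<open>x\<close> itself,
  which suffices as \<open>x\<close> ranges over \<open>T\<close>.\<close>

definition hypersurface_in :: "'a::euclidean_space set \<Rightarrow> 'a set \<Rightarrow> bool" where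
  "hypersurface_in V T \<longleftrightarrow> T \<subseteq> V \<and>
     (\<forall>x\<in>T. \<exists>B (F :: 'a \<Rightarrow> real). open B \<and> x \<in> B \<and> smooth_on B F \<and>
        T \<inter> B = {y \<in> V \<inter> B. F y = 0} \<and>
        (\<exists>v\<in>tangent_space V x. frechet_derivative F (at x) v \<noteq> 0))"

definition vector_field_on :: "'a::euclidean_space set \<Rightarrow> 'a set \<Rightarrow> ('a \<Rightarrow> 'a) \<Rightarrow> bool" where
  "vector_field_on V U X \<longleftrightarrow> smooth_on U X \<and> (\<forall>x\<in>U. X x \<in> tangent_space V x)"

text \<open>Lie derivative along \<open>X\<close> of the restriction to \<open>V\<close> of a 2-form \<open>\<Omega>\<close> of the ambient space, by the
  usual coordinate formula. The derivatives relative to \<open>V\<close> are uniquely determined on tangent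
  vectors of \<open>V\<close>, and the formula is used for tangent \<open>u\<close>, \<open>v\<close> and tangent \<open>X\<close> only.\<close>

definition lie_derivative ::
  "'a::euclidean_space set \<Rightarrow> ('a \<Rightarrow> 'a) \<Rightarrow> ('a \<Rightarrow> 'a \<Rightarrow> 'a \<Rightarrow> real) \<Rightarrow> 'a \<Rightarrow> 'a \<Rightarrow> 'a \<Rightarrow> real" where
  "lie_derivative V X \<Omega> x u v =
     frechet_derivative (\<lambda>y. \<Omega> y u v) (at x within V) (X x)
     + \<Omega> x (frechet_derivative X (at x within V) u) v
     + \<Omega> x u (frechet_derivative X (at x within V) v)"

text \<open>\<open>\<Sum>\<^sub>i dp\<^sub>i \<and> dq\<^sub>i\<close> on pairs \<open>(q, p)\<close>; on pairs \<open>(\<xi>, \<eta>)\<close> it is \<open>\<Sum>\<^sub>i d\<eta>\<^sub>i \<and> d\<xi>\<^sub>i\<close>.\<close>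

definition symp :: "'a::euclidean_space \<times> 'a \<Rightarrow> 'a \<times> 'a \<Rightarrow> real" where
  "symp u v = snd u \<bullet> fst v - fst u \<bullet> snd v"

definition liouville_on ::
  "('a::euclidean_space \<times> 'a) set \<Rightarrow> ('a \<times> 'a) set \<Rightarrow> ('a \<times> 'a \<Rightarrow> 'a \<times> 'a) \<Rightarrow> bool" where
  "liouville_on V U X \<longleftrightarrow>
     (\<forall>x\<in>U. \<forall>u\<in>tangent_space V x. \<forall>v\<in>tangent_space V x.
        lie_derivative V X (\<lambda>_. symp) x u v = symp u v)"

definition transverse_on :: "'a::euclidean_space set \<Rightarrow> ('a \<Rightarrow> 'a) \<Rightarrow> bool" where
  "transverse_on T X \<longleftrightarrow> (\<forall>x\<in>T. X x \<notin> tangent_space T x)"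


section \<open>The spatial circular restricted three-body problem\<close>

datatype body = Earth | Moon

primrec position :: "real \<Rightarrow> body \<Rightarrow> real^3" where
  "position \<mu> Earth = vector [\<mu>, 0, 0]"
| "position \<mu> Moon = vector [-(1 - \<mu>), 0, 0]"

primrec mass :: "real \<Rightarrow> body \<Rightarrow> real" where
  "mass \<mu> Earth = 1 - \<mu>"
| "mass \<mu> Moon = \<mu>"

type_synonym phase = "(real^3) \<times> (real^3)"

definition phase_space :: "real \<Rightarrow> phase set" where
  "phase_space \<mu> = {(q, p). q \<noteq> position \<mu> Earth \<and> q \<noteq> position \<mu> Moon}"

definition H :: "real \<Rightarrow> phase \<Rightarrow> real" where
  "H \<mu> = (\<lambda>(q, p). (norm p)\<^sup>2 / 2 - \<mu> / norm (q - position \<mu> Moon)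
                    - (1 - \<mu>) / norm (q - position \<mu> Earth) + p$1 * q$2 - p$2 * q$1)"

definition critical_point :: "real \<Rightarrow> phase \<Rightarrow> bool" where
  "critical_point \<mu> z \<longleftrightarrow> z \<in> phase_space \<mu> \<and> (H \<mu> has_derivative (\<lambda>_. 0)) (at z)"

definition L1 :: "real \<Rightarrow> phase" where
  "L1 \<mu> = (THE z. critical_point \<mu> z \<and> fst z \<in> open_segment (position \<mu> Earth) (position \<mu> Moon))"

definition energy_level :: "real \<Rightarrow> real \<Rightarrow> phase set" where
  "energy_level \<mu> c = {z \<in> phase_space \<mu>. H \<mu> z = c}"

definition hill_region :: "real \<Rightarrow> real \<Rightarrow> (real^3) set" where
  "hill_region \<mu> c = fst ` energy_level \<mu> c"

definition hill_component :: "real \<Rightarrow> real \<Rightarrow> body \<Rightarrow> (real^3) set" where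
  "hill_component \<mu> c P =
     (THE C. C \<in> components (hill_region \<mu> c) \<and> bounded C \<and> position \<mu> P \<in> closure C)"

definition hill_component_EM :: "real \<Rightarrow> real \<Rightarrow> (real^3) set" where
  "hill_component_EM \<mu> c = (THE C. C \<in> components (hill_region \<mu> c) \<and> bounded C)"

definition \<Sigma> :: "real \<Rightarrow> real \<Rightarrow> body \<Rightarrow> phase set" where
  "\<Sigma> \<mu> c P = {z \<in> energy_level \<mu> c. fst z \<in> hill_component \<mu> c P}"

definition \<Sigma>_EM :: "real \<Rightarrow> real \<Rightarrow> phase set" where
  "\<Sigma>_EM \<mu> c = {z \<in> energy_level \<mu> c. fst z \<in> hill_component_EM \<mu> c}"


section \<open>Moser regularization\<close>

text \<open>\<open>\<real>\<^sup>4\<close> is represented as \<open>\<real> \<times> \<real>\<^sup>3\<close>, according to \<open>\<xi> = (\<xi>\<^sub>0; \<xi>\<^sub>1, \<xi>\<^sub>2, \<xi>\<^sub>3)\<close>.\<close>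

type_synonym real4 = "real \<times> (real^3)"
type_synonym cotangent = "real4 \<times> real4"

definition north :: real4 where
  "north = (1, 0)"

definition TS3 :: "cotangent set" where
  "TS3 = {(\<xi>, \<eta>). norm \<xi> = 1 \<and> \<xi> \<bullet> \<eta> = 0}"

text \<open>The set \<open>V\<^sub>P\<close>, which is the same for both bodies \<open>P\<close>.\<close>

definition moser_domain :: "cotangent set" where
  "moser_domain = {(\<xi>, \<eta>) \<in> TS3. \<eta> \<noteq> 0 \<and> norm \<eta> * (1 - fst \<xi>) < 1 / 2}"

definition moser_map :: "real \<Rightarrow> body \<Rightarrow> cotangent \<Rightarrow> phase" where
  "moser_map \<mu> P = (\<lambda>(\<xi>, \<eta>).
     (position \<mu> P + (1 - fst \<xi>) *\<^sub>R snd \<eta> + fst \<eta> *\<^sub>R snd \<xi>,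
      - (1 / (1 - fst \<xi>)) *\<^sub>R snd \<xi>))"

text \<open>The glued manifold \<open>W\<close>. Each class of identified points is represented by its element in the
  phase space if there is one; the remaining points are those of \<open>V\<^sub>P\<close> over \<open>N\<close>. With these
  representatives, \<^term>\<open>Phase\<close> and \<open>glue \<mu> P\<close> are the inclusions of the phase space and
  of \<open>V\<^sub>P\<close> into \<open>W\<close>.\<close>

datatype wpoint = Phase phase | Collision body cotangent

definition glue :: "real \<Rightarrow> body \<Rightarrow> cotangent \<Rightarrow> wpoint" where
  "glue \<mu> P z = (if fst z = north then Collision P z else Phase (moser_map \<mu> P z))"

definition W :: "real \<Rightarrow> wpoint set" where
  "W \<mu> = Phase ` phase_space \<mu> \<union> (\<Union>P. glue \<mu> P ` moser_domain)"

definition phase_part :: "real \<Rightarrow> wpoint set \<Rightarrow> phase set" where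
  "phase_part \<mu> S = {z \<in> phase_space \<mu>. Phase z \<in> S}"

definition moser_part :: "real \<Rightarrow> body \<Rightarrow> wpoint set \<Rightarrow> cotangent set" where
  "moser_part \<mu> P S = {z \<in> moser_domain. glue \<mu> P z \<in> S}"

definition W_open :: "real \<Rightarrow> wpoint set \<Rightarrow> bool" where
  "W_open \<mu> U \<longleftrightarrow> U \<subseteq> W \<mu> \<and>
     openin (top_of_set (phase_space \<mu>)) (phase_part \<mu> U) \<and>
     (\<forall>P. openin (top_of_set moser_domain) (moser_part \<mu> P U))"

definition W_hypersurface :: "real \<Rightarrow> wpoint set \<Rightarrow> bool" where
  "W_hypersurface \<mu> S \<longleftrightarrow> S \<subseteq> W \<mu> \<and>
     hypersurface_in (phase_space \<mu>) (phase_part \<mu> S) \<and>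
     (\<forall>P. hypersurface_in moser_domain (moser_part \<mu> P S))"

text \<open>A vector field on an open subset \<open>U\<close> of \<open>W\<close> is a vector field on the part of \<open>U\<close> in each of the
  three glued pieces, such that the gluing maps carry the fields \<open>Y P\<close> to \<open>X\<close>.\<close>

definition W_vector_field ::
  "real \<Rightarrow> wpoint set \<Rightarrow> (phase \<Rightarrow> phase) \<Rightarrow> (body \<Rightarrow> cotangent \<Rightarrow> cotangent) \<Rightarrow> bool" where
  "W_vector_field \<mu> U X Y \<longleftrightarrow>
     vector_field_on (phase_space \<mu>) (phase_part \<mu> U) X \<and>
     (\<forall>P. vector_field_on moser_domain (moser_part \<mu> P U) (Y P)) \<and>
     (\<forall>P. \<forall>z\<in>moser_part \<mu> P U. fst z \<noteq> north \<longrightarrow>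
        X (moser_map \<mu> P z) = frechet_derivative (moser_map \<mu> P) (at z) (Y P z))"

definition W_liouville ::
  "real \<Rightarrow> wpoint set \<Rightarrow> (phase \<Rightarrow> phase) \<Rightarrow> (body \<Rightarrow> cotangent \<Rightarrow> cotangent) \<Rightarrow> bool" where
  "W_liouville \<mu> U X Y \<longleftrightarrow> W_vector_field \<mu> U X Y \<and>
     liouville_on (phase_space \<mu>) (phase_part \<mu> U) X \<and>
     (\<forall>P. liouville_on moser_domain (moser_part \<mu> P U) (Y P))"

definition W_transverse ::
  "real \<Rightarrow> wpoint set \<Rightarrow> (phase \<Rightarrow> phase) \<Rightarrow> (body \<Rightarrow> cotangent \<Rightarrow> cotangent) \<Rightarrow> bool" where
  "W_transverse \<mu> S X Y \<longleftrightarrow>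
     transverse_on (phase_part \<mu> S) X \<and> (\<forall>P. transverse_on (moser_part \<mu> P S) (Y P))"

definition contact_type :: "real \<Rightarrow> wpoint set \<Rightarrow> bool" where
  "contact_type \<mu> S \<longleftrightarrow> W_hypersurface \<mu> S \<and>
     (\<exists>U X Y. W_open \<mu> U \<and> S \<subseteq> U \<and> W_liouville \<mu> U X Y \<and> W_transverse \<mu> S X Y)"

definition collision_locus :: "real \<Rightarrow> body \<Rightarrow> cotangent set" where
  "collision_locus \<mu> P = {(\<xi>, \<eta>) \<in> moser_domain. \<xi> = north \<and> norm \<eta> = mass \<mu> P}"

definition regularized_\<Sigma> :: "real \<Rightarrow> real \<Rightarrow> body \<Rightarrow> wpoint set" where
  "regularized_\<Sigma> \<mu> c P = Phase ` \<Sigma> \<mu> c P \<union> glue \<mu> P ` collision_locus \<mu> P"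

definition regularized_\<Sigma>_EM :: "real \<Rightarrow> real \<Rightarrow> wpoint set" where
  "regularized_\<Sigma>_EM \<mu> c =
     Phase ` \<Sigma>_EM \<mu> c \<union> (\<Union>P. glue \<mu> P ` collision_locus \<mu> P)"

end

theory Submission
  imports Defs
begin

text \<open>Write \<open>H = |w|\<^sup>2/2 + U(q)\<close> with \<open>w = \<partial>H/\<partial>p\<close> and the effective potential \<open>U\<close>. The field
  \<open>(q - P) \<partial>/\<partial>q\<close> is Liouville, and in Moser coordinates it becomes \<open>\<eta> \<partial>/\<partial>\<eta>\<close>, which extends over the
  collision fibre and is transverse there. By Cauchy--Schwarz it is transverse to the level set \<open>H = c\<close>
  wherever \<open>u > 0\<close> and \<open>u\<^sup>2 > 2 s (c - U)\<close>, where \<open>u\<close> is the radial derivative of \<open>U\<close> and \<open>s\<close> the squared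
  length of the planar part of the unit vector along \<open>q - P\<close>. The difference of both sides decreases
  along rays from \<open>P\<close> and is nonnegative, for \<open>c \<le> H(L\<^sub>1)\<close>, on the sphere around \<open>P\<close> through \<open>L\<^sub>1\<close>; it
  vanishes only at \<open>L\<^sub>1\<close>. This settles \<open>c < H(L\<^sub>1)\<close>, and for slightly larger \<open>c\<close> the complement of a
  ball around \<open>l\<^sup>1\<close>. In that ball the two radial fields differ by the constant field \<open>\<partial>/\<partial>q\<^sub>1\<close>, which is
  Hamiltonian; they are interpolated by adding to \<open>(q - l\<^sup>1) \<partial>/\<partial>q\<close> the Hamiltonian field of a function
  \<open>k\<close>, found from the quadratic part of \<open>H\<close> at its saddle \<open>L\<^sub>1\<close>.\<close>

section \<open>Calculus of smooth maps\<close>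

text \<open>Just above H(\<open>L1\<close>) the level set comes arbitrarily close to a zero of dH,
  so the estimates at the neck must be homogeneous in the distance to \<open>L1\<close>; a cutoff in
  q_1 alone produces derivative terms without a sign. The quadratic part of H supplies a better
  variable: for a suitable \<gamma> the functions g = p_1 + \<gamma> q_2 and \<theta> satisfy g' =
  \<theta> and \<theta>' = \<kappa> g along its flow, with \<kappa> > 0, and describe the hyperbolic
  plane of the saddle. The Hamiltonian field of \<Phi>(\<theta>/\<tau>) g changes the quadratic part
  at the rate -(\<Phi>' \<kappa> g^2/\<tau> + \<Phi> \<theta>), which is nonnegative if \<Phi> is
  nonincreasing and opposite in sign to \<theta>. So \<Phi> may run from one translation constant to
  the other. Near \<theta> = 0, half of the Euler field centred at \<open>L1\<close> adds the energy
  excess E; a total of order E + \<theta>^2/\<tau> dominates the errors. For larger |\<theta>| the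
  linear term - \<Phi> \<theta> suffices, and the Euler part is switched off slowly in log
  |\<theta>|.\<close>

definition Cinf_on :: "'a::euclidean_space set \<Rightarrow> ('a \<Rightarrow> 'b::real_normed_vector) \<Rightarrow> bool" where
  "Cinf_on S f \<longleftrightarrow> (\<forall>k. Ck_on k S f)"

lemma Ck_on_cong_imp:
  fixes f g :: "'a::euclidean_space \<Rightarrow> 'b::real_normed_vector"
  assumes "open S" "\<And>x. x \<in> S \<Longrightarrow> f x = g x" "Ck_on k S f"
  shows "Ck_on k S g"
  using assms(2,3)
proof (induction k arbitrary: f g)
  case 0
  then show ?case using continuous_on_cong by (metis Ck_on.simps(1))
next
  case (Suc k)
  have d: "f differentiable (at x)" if "x \<in> S" for x
    using Suc.prems(2) that assms(1) by (simp add: differentiable_on_eq_differentiable_at)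
  have g: "g differentiable (at x)" if "x \<in> S" for x
    using d[OF that] Suc.prems(1) assms(1) that unfolding differentiable_def
    by (meson has_derivative_transform_within_open)
  have "frechet_derivative f (at x) v = frechet_derivative g (at x) v" if "x \<in> S" for x v
    using frechet_derivative_transform_within_open[OF d[OF that] assms(1) that] Suc.prems(1) by metis
  then have "Ck_on k S (\<lambda>x. frechet_derivative g (at x) v)" for v
    using Suc.IH[of "\<lambda>x. frechet_derivative f (at x) v" "\<lambda>x. frechet_derivative g (at x) v"]
      Suc.prems(2) by simp
  then show ?case
    using g assms(1) by (simp add: differentiable_on_eq_differentiable_at)
qed

lemma Ck_on_cong:
  fixes f g :: "'a::euclidean_space \<Rightarrow> 'b::real_normed_vector"
  assumes "open S" "\<And>x. x \<in> S \<Longrightarrow> f x = g x"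
  shows "Ck_on k S f \<longleftrightarrow> Ck_on k S g"
  using Ck_on_cong_imp[of S f g k] Ck_on_cong_imp[of S g f k] assms by auto

lemma Ck_on_subset:
  fixes f :: "'a::euclidean_space \<Rightarrow> 'b::real_normed_vector"
  shows "Ck_on k S f \<Longrightarrow> T \<subseteq> S \<Longrightarrow> Ck_on k T f"
  by (induction k arbitrary: f) (auto intro: continuous_on_subset differentiable_on_subset)

lemma Ck_on_SucD:
  fixes f :: "'a::euclidean_space \<Rightarrow> 'b::real_normed_vector"
  shows "Ck_on (Suc k) S f \<Longrightarrow> Ck_on k S f"
proof (induction k arbitrary: f)
  case 0
  then show ?case by (simp add: differentiable_imp_continuous_on)
next
  case (Suc k)
  have "Ck_on k S (\<lambda>x. frechet_derivative f (at x) v)" for v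
    using Suc.IH Suc.prems by simp
  then show ?case using Suc.prems by simp
qed

lemma Ck_on_local:
  fixes f :: "'a::euclidean_space \<Rightarrow> 'b::real_normed_vector"
  assumes "\<And>x. x \<in> S \<Longrightarrow> \<exists>B. open B \<and> x \<in> B \<and> Ck_on k B f"
  shows "Ck_on k S f"
  using assms
proof (induction k arbitrary: f)
  case 0
  have "isCont f x" if x: "x \<in> S" for x
  proof -
    from 0[OF x] obtain B where "open B" "x \<in> B" "Ck_on 0 B f" by blast
    then show ?thesis by (simp add: continuous_on_eq_continuous_at)
  qed
  then show ?case by (simp add: continuous_at_imp_continuous_on)
next
  case (Suc k)
  have "f differentiable (at x)" if x: "x \<in> S" for x
  proof -
    from Suc.prems[OF x] obtain B where "open B" "x \<in> B" "Ck_on (Suc k) B f" by blast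
    then show ?thesis by (simp add: differentiable_on_eq_differentiable_at)
  qed
  then have "f differentiable_on S"
    by (simp add: differentiable_at_imp_differentiable_on)
  moreover have "Ck_on k S (\<lambda>x. frechet_derivative f (at x) v)" for v
  proof (rule Suc.IH)
    fix x assume "x \<in> S"
    then obtain B where "open B" "x \<in> B" "Ck_on (Suc k) B f" using Suc.prems by blast
    then show "\<exists>B. open B \<and> x \<in> B \<and> Ck_on k B (\<lambda>x. frechet_derivative f (at x) v)" by auto
  qed
  ultimately show ?case by simp
qed

lemma Ck_on_SucI:
  fixes f :: "'a::euclidean_space \<Rightarrow> 'b::real_normed_vector"
  assumes "open S" "\<And>x. x \<in> S \<Longrightarrow> (f has_derivative D x) (at x)" "\<And>v. Ck_on k S (\<lambda>x. D x v)"
  shows "Ck_on (Suc k) S f"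
proof -
  have "f differentiable_on S"
    using assms(1,2) by (meson differentiable_def differentiable_on_eq_differentiable_at)
  moreover have "Ck_on k S (\<lambda>x. frechet_derivative f (at x) v)" for v
  proof (rule Ck_on_cong_imp[OF assms(1) _ assms(3)[of v]])
    fix x assume "x \<in> S"
    then show "D x v = frechet_derivative f (at x) v"
      using frechet_derivative_at[OF assms(2)] by metis
  qed
  ultimately show ?thesis by simp
qed

lemma Ck_on_SucE:
  fixes f :: "'a::euclidean_space \<Rightarrow> 'b::real_normed_vector"
  assumes "Ck_on (Suc k) S f" "open S" "x \<in> S"
  shows "(f has_derivative frechet_derivative f (at x)) (at x)"
  using assms by (simp add: differentiable_on_eq_differentiable_at flip: frechet_derivative_works)

lemma Ck_on_const: "Ck_on k S (\<lambda>x::'a::euclidean_space. c::'b::real_normed_vector)"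
  by (induction k arbitrary: c) (auto simp: frechet_derivative_const)

lemma Ck_on_add:
  fixes f g :: "'a::euclidean_space \<Rightarrow> 'b::real_normed_vector"
  assumes "open S" "Ck_on k S f" "Ck_on k S g"
  shows "Ck_on k S (\<lambda>x. f x + g x)"
  using assms(2,3)
proof (induction k arbitrary: f g)
  case 0
  then show ?case by (simp add: continuous_on_add)
next
  case (Suc k)
  show ?case
  proof (rule Ck_on_SucI[OF assms(1)])
    fix x assume "x \<in> S"
    then show "((\<lambda>x. f x + g x) has_derivative
        (\<lambda>v. frechet_derivative f (at x) v + frechet_derivative g (at x) v)) (at x)"
      by (intro has_derivative_add Ck_on_SucE[OF Suc.prems(1) assms(1)]
          Ck_on_SucE[OF Suc.prems(2) assms(1)])
  qed (use Suc in auto)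
qed

lemma Ck_on_bounded_linear:
  fixes f :: "'a::euclidean_space \<Rightarrow> 'b::real_normed_vector"
    and h :: "'b \<Rightarrow> 'c::real_normed_vector"
  assumes "bounded_linear h" "open S" "Ck_on k S f"
  shows "Ck_on k S (\<lambda>x. h (f x))"
  using assms(3)
proof (induction k arbitrary: f)
  case 0
  then show ?case using assms(1) by (simp add: bounded_linear.continuous_on)
next
  case (Suc k)
  show ?case
  proof (rule Ck_on_SucI[OF assms(2)])
    fix x assume "x \<in> S"
    then show "((\<lambda>x. h (f x)) has_derivative (\<lambda>v. h (frechet_derivative f (at x) v))) (at x)"
      by (rule bounded_linear.has_derivative[OF assms(1) Ck_on_SucE[OF Suc.prems assms(2)]])
  qed (use Suc in auto)
qed

lemma Ck_on_bilinear:
  fixes f :: "'a::euclidean_space \<Rightarrow> 'b::real_normed_vector"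
    and g :: "'a \<Rightarrow> 'c::real_normed_vector" and h :: "'b \<Rightarrow> 'c \<Rightarrow> 'd::real_normed_vector"
  assumes "bounded_bilinear h" "open S" "Ck_on k S f" "Ck_on k S g"
  shows "Ck_on k S (\<lambda>x. h (f x) (g x))"
  using assms(3,4)
proof (induction k arbitrary: f g)
  case 0
  then show ?case using assms(1) by (simp add: bounded_bilinear.continuous_on)
next
  case (Suc k)
  show ?case
  proof (rule Ck_on_SucI[OF assms(2)])
    fix x assume "x \<in> S"
    then show "((\<lambda>x. h (f x) (g x)) has_derivative (\<lambda>v. h (f x) (frechet_derivative g (at x) v)
        + h (frechet_derivative f (at x) v) (g x))) (at x)"
      by (intro bounded_bilinear.FDERIV[OF assms(1)] Ck_on_SucE[OF Suc.prems(1) assms(2)]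
          Ck_on_SucE[OF Suc.prems(2) assms(2)])
  next
    fix v
    show "Ck_on k S (\<lambda>x. h (f x) (frechet_derivative g (at x) v)
        + h (frechet_derivative f (at x) v) (g x))"
      using Suc.prems by (intro Ck_on_add assms(2) Suc.IH) (auto intro: Ck_on_SucD)
  qed
qed

lemma Ck_on_sum:
  fixes f :: "'i \<Rightarrow> 'a::euclidean_space \<Rightarrow> 'b::real_normed_vector"
  assumes "open S" "\<And>i. i \<in> I \<Longrightarrow> Ck_on k S (f i)"
  shows "Ck_on k S (\<lambda>x. \<Sum>i\<in>I. f i x)"
  using assms(2)
  by (induction I rule: infinite_finite_induct) (simp_all add: Ck_on_const Ck_on_add assms(1))

lemma Ck_on_compose:
  fixes f :: "'a::euclidean_space \<Rightarrow> 'b::euclidean_space" and g :: "'b \<Rightarrow> 'c::real_normed_vector"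
  assumes "open S" "open T" "f ` S \<subseteq> T" "Ck_on k S f" "Ck_on k T g"
  shows "Ck_on k S (\<lambda>x. g (f x))"
  using assms(4,5)
proof (induction k arbitrary: g)
  case 0
  then show ?case using assms(3) by (auto intro: continuous_on_compose2)
next
  case (Suc k)
  \<comment> \<open>\<open>Ck_on\<close> differentiates in a fixed direction, but the chain rule
    applies the outer derivative to the moving vector f'(x) v. Expanding this vector in the basis
    leaves products of functions of order k, to which the induction hypothesis and the product rule
    apply.\<close>
  define D where "D x v = (\<Sum>b\<in>Basis. (frechet_derivative f (at x) v \<bullet> b) *\<^sub>R
      frechet_derivative g (at (f x)) b)" for x v
  show ?case
  proof (rule Ck_on_SucI[OF assms(1)])
    fix x assume x: "x \<in> S"
    have g: "(g has_derivative frechet_derivative g (at (f x))) (at (f x))"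
      using Suc.prems(2) assms(2,3) x by (intro Ck_on_SucE) auto
    have l: "linear (frechet_derivative g (at (f x)))"
      using g has_derivative_linear by blast
    have "frechet_derivative g (at (f x)) w
        = (\<Sum>b\<in>Basis. (w \<bullet> b) *\<^sub>R frechet_derivative g (at (f x)) b)" for w
      by (subst (1) euclidean_representation[symmetric, of w])
         (simp add: linear_sum[OF l] linear_cmul[OF l])
    then have "D x v = frechet_derivative g (at (f x)) (frechet_derivative f (at x) v)" for v
      unfolding D_def by metis
    then show "((\<lambda>x. g (f x)) has_derivative (\<lambda>v. D x v)) (at x)"
      using has_derivative_compose[OF Ck_on_SucE[OF Suc.prems(1) assms(1) x] g] by simp
  next
    fix v
    have "Ck_on k S (\<lambda>x. frechet_derivative g (at (f x)) b)" for b
      using Suc.IH[of "\<lambda>y. frechet_derivative g (at y) b"] Suc.prems(2) Ck_on_SucD[OF Suc.prems(1)]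
      by simp
    then show "Ck_on k S (\<lambda>x. D x v)"
      unfolding D_def using Suc.prems(1)
      by (intro Ck_on_sum Ck_on_bilinear[OF bounded_bilinear_scaleR] assms(1)
          Ck_on_bounded_linear[OF bounded_linear_inner_left]) auto
  qed
qed

lemma Cinf_on_cong:
  fixes f g :: "'a::euclidean_space \<Rightarrow> 'b::real_normed_vector"
  assumes "open S" "\<And>x. x \<in> S \<Longrightarrow> f x = g x"
  shows "Cinf_on S f \<longleftrightarrow> Cinf_on S g"
  using Ck_on_cong[of S f g] assms unfolding Cinf_on_def by blast

lemma Cinf_on_subset: "Cinf_on S f \<Longrightarrow> T \<subseteq> S \<Longrightarrow> Cinf_on T f"
  unfolding Cinf_on_def using Ck_on_subset by blast

lemma Cinf_on_local:
  fixes f :: "'a::euclidean_space \<Rightarrow> 'b::real_normed_vector"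
  assumes "\<And>x. x \<in> S \<Longrightarrow> \<exists>B g. open B \<and> x \<in> B \<and> Cinf_on B g \<and> (\<forall>y\<in>B. f y = g y)"
  shows "Cinf_on S f"
  unfolding Cinf_on_def
proof (intro allI Ck_on_local)
  fix k x assume "x \<in> S"
  then obtain B g where "open B" "x \<in> B" "Cinf_on B g" "\<forall>y\<in>B. f y = g y" using assms by blast
  then show "\<exists>B. open B \<and> x \<in> B \<and> Ck_on k B f"
    using Ck_on_cong[of B f g k] unfolding Cinf_on_def by blast
qed

lemma Cinf_on_has_derivative:
  fixes f :: "'a::euclidean_space \<Rightarrow> 'b::real_normed_vector"
  assumes "Cinf_on S f" "open S" "x \<in> S"
  shows "(f has_derivative frechet_derivative f (at x)) (at x)"
  using assms Ck_on_SucE unfolding Cinf_on_def by blast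

lemma Cinf_on_continuous_on: "Cinf_on S f \<Longrightarrow> continuous_on S f"
  unfolding Cinf_on_def by (metis Ck_on.simps(1))

lemma Cinf_on_frechet_derivative:
  fixes f :: "'a::euclidean_space \<Rightarrow> 'b::real_normed_vector"
  assumes "Cinf_on S f"
  shows "Cinf_on S (\<lambda>x. frechet_derivative f (at x) v)"
  unfolding Cinf_on_def
proof
  fix k
  have "Ck_on (Suc k) S f" using assms unfolding Cinf_on_def by blast
  then show "Ck_on k S (\<lambda>x. frechet_derivative f (at x) v)" by simp
qed

named_theorems Cinf_intros

lemma Cinf_on_const [Cinf_intros]: "Cinf_on S (\<lambda>x. c)"
  unfolding Cinf_on_def by (simp add: Ck_on_const)

lemma Cinf_on_add [Cinf_intros]:
  "open S \<Longrightarrow> Cinf_on S f \<Longrightarrow> Cinf_on S g \<Longrightarrow> Cinf_on S (\<lambda>x. f x + g x)"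
  unfolding Cinf_on_def by (simp add: Ck_on_add)

lemma Cinf_on_bounded_linear:
  "bounded_linear h \<Longrightarrow> open S \<Longrightarrow> Cinf_on S f \<Longrightarrow> Cinf_on S (\<lambda>x. h (f x))"
  unfolding Cinf_on_def by (simp add: Ck_on_bounded_linear)

lemma Cinf_on_id [Cinf_intros]: "Cinf_on S (\<lambda>x. x)"
proof -
  have "Ck_on k S (\<lambda>x. x)" for k
    by (cases k) (auto simp: Ck_on_const)
  then show ?thesis unfolding Cinf_on_def by blast
qed

lemma Cinf_on_uminus [Cinf_intros]: "open S \<Longrightarrow> Cinf_on S f \<Longrightarrow> Cinf_on S (\<lambda>x. - f x)"
  by (rule Cinf_on_bounded_linear[OF bounded_linear_minus[OF bounded_linear_ident]])

lemma Cinf_on_diff [Cinf_intros]: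
  "open S \<Longrightarrow> Cinf_on S f \<Longrightarrow> Cinf_on S g \<Longrightarrow> Cinf_on S (\<lambda>x. f x - g x)"
  unfolding diff_conv_add_uminus by (intro Cinf_on_add Cinf_on_uminus)

lemma Cinf_on_bilinear:
  "bounded_bilinear h \<Longrightarrow> open S \<Longrightarrow> Cinf_on S f \<Longrightarrow> Cinf_on S g \<Longrightarrow> Cinf_on S (\<lambda>x. h (f x) (g x))"
  unfolding Cinf_on_def by (simp add: Ck_on_bilinear)

lemmas Cinf_on_mult [Cinf_intros] = Cinf_on_bilinear[OF bounded_bilinear_mult]
lemmas Cinf_on_scaleR [Cinf_intros] = Cinf_on_bilinear[OF bounded_bilinear_scaleR]
lemmas Cinf_on_inner [Cinf_intros] = Cinf_on_bilinear[OF bounded_bilinear_inner]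
lemmas Cinf_on_fst [Cinf_intros] = Cinf_on_bounded_linear[OF bounded_linear_fst]
lemmas Cinf_on_snd [Cinf_intros] = Cinf_on_bounded_linear[OF bounded_linear_snd]
lemmas Cinf_on_vec_nth [Cinf_intros] = Cinf_on_bounded_linear[OF bounded_linear_vec_nth]

lemma Cinf_on_power [Cinf_intros]:
  "open S \<Longrightarrow> Cinf_on S f \<Longrightarrow> Cinf_on S (\<lambda>x. f x ^ n :: 'b::real_normed_algebra_1)"
  by (induction n) (simp_all add: Cinf_on_const Cinf_on_mult)

lemma Cinf_on_sum [Cinf_intros]:
  "open S \<Longrightarrow> (\<And>i. i \<in> I \<Longrightarrow> Cinf_on S (f i)) \<Longrightarrow> Cinf_on S (\<lambda>x. \<Sum>i\<in>I. f i x)"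
  unfolding Cinf_on_def by (simp add: Ck_on_sum)

lemma Cinf_on_Pair [Cinf_intros]:
  assumes "open S" "Cinf_on S f" "Cinf_on S g"
  shows "Cinf_on S (\<lambda>x. (f x, g x))"
proof -
  have "Cinf_on S (\<lambda>x. (f x, 0) + (0, g x))"
    by (intro Cinf_on_add assms Cinf_on_bounded_linear[OF _ assms(1,2), of "\<lambda>x. (x, 0)"]
        Cinf_on_bounded_linear[OF _ assms(1,3), of "\<lambda>x. (0, x)"]
        bounded_linear_Pair bounded_linear_ident bounded_linear_zero)
  then show ?thesis by simp
qed

lemma Cinf_on_compose:
  fixes f :: "'a::euclidean_space \<Rightarrow> 'b::euclidean_space" and g :: "'b \<Rightarrow> 'c::real_normed_vector"
  assumes "Cinf_on T g" "open T" "open S" "Cinf_on S f" "\<And>x. x \<in> S \<Longrightarrow> f x \<in> T"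
  shows "Cinf_on S (\<lambda>x. g (f x))"
proof -
  have "f ` S \<subseteq> T" using assms(5) by blast
  then have "Ck_on k S (\<lambda>x. g (f x))" for k
    using Ck_on_compose[of S T f k g] assms(1-4) by (simp add: Cinf_on_def)
  then show ?thesis by (simp add: Cinf_on_def)
qed

lemma Cinf_on_inverse_real: "Cinf_on {x::real. x \<noteq> 0} inverse"
proof -
  have o: "open {x::real. x \<noteq> 0}" by (simp add: open_Collect_neq)
  have "Ck_on k {x::real. x \<noteq> 0} inverse" for k
  proof (induction k)
    case 0
    then show ?case by (auto intro: continuous_intros)
  next
    case (Suc k)
    show ?case
    proof (rule Ck_on_SucI[OF o])
      show "(inverse has_derivative (\<lambda>v. - v * (inverse x * inverse x))) (at x)"
        if "x \<in> {x. x \<noteq> 0}" for x :: real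
        using that by (auto intro!: derivative_eq_intros simp: field_simps power2_eq_square)
      show "Ck_on k {x::real. x \<noteq> 0} (\<lambda>x. - v * (inverse x * inverse x))" for v
        by (intro Ck_on_bilinear[OF bounded_bilinear_mult] o Suc Ck_on_const)
    qed
  qed
  then show ?thesis unfolding Cinf_on_def by blast
qed

lemma Cinf_on_inverse [Cinf_intros]:
  fixes f :: "'a::euclidean_space \<Rightarrow> real"
  shows "open S \<Longrightarrow> Cinf_on S f \<Longrightarrow> (\<And>x. x \<in> S \<Longrightarrow> f x \<noteq> 0) \<Longrightarrow> Cinf_on S (\<lambda>x. inverse (f x))"
  by (rule Cinf_on_compose[OF Cinf_on_inverse_real]) (auto simp: open_Collect_neq)

lemma Cinf_on_divide [Cinf_intros]:
  fixes f g :: "'a::euclidean_space \<Rightarrow> real"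
  shows "open S \<Longrightarrow> Cinf_on S f \<Longrightarrow> Cinf_on S g \<Longrightarrow> (\<And>x. x \<in> S \<Longrightarrow> g x \<noteq> 0) \<Longrightarrow>
    Cinf_on S (\<lambda>x. f x / g x)"
  unfolding divide_inverse by (intro Cinf_intros)

lemma Cinf_on_exp_real: "Cinf_on UNIV (exp :: real \<Rightarrow> real)"
proof -
  have "Ck_on k UNIV (exp :: real \<Rightarrow> real)" for k
  proof (induction k)
    case 0
    then show ?case by (auto intro: continuous_intros)
  next
    case (Suc k)
    show ?case
    proof (rule Ck_on_SucI[OF open_UNIV])
      show "(exp has_derivative (\<lambda>v. v * exp x)) (at x)" for x :: real
        by (auto intro!: derivative_eq_intros)
      show "Ck_on k UNIV (\<lambda>x. v * exp x)" for v :: real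
        by (intro Ck_on_bilinear[OF bounded_bilinear_mult] open_UNIV Suc Ck_on_const)
    qed
  qed
  then show ?thesis unfolding Cinf_on_def by blast
qed

lemma Cinf_on_exp [Cinf_intros]:
  fixes f :: "'a::euclidean_space \<Rightarrow> real"
  shows "open S \<Longrightarrow> Cinf_on S f \<Longrightarrow> Cinf_on S (\<lambda>x. exp (f x))"
  by (rule Cinf_on_compose[OF Cinf_on_exp_real]) auto

lemma Cinf_on_ln_real: "Cinf_on {0::real<..} ln"
proof -
  have "Ck_on k {0::real<..} ln" for k
  proof (cases k)
    case 0
    then show ?thesis by (auto intro!: continuous_intros)
  next
    case (Suc k)
    show ?thesis unfolding Suc
    proof (rule Ck_on_SucI)
      show "(ln has_derivative (\<lambda>v. v * inverse x)) (at x)" if "x \<in> {0<..}" for x :: real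
        using that by (auto intro!: derivative_eq_intros simp: field_simps)
      have "Cinf_on {0<..} (\<lambda>x. v * inverse x)" for v :: real
        by (intro Cinf_intros) auto
      then show "Ck_on k {0<..} (\<lambda>x. v * inverse x)" for v :: real
        unfolding Cinf_on_def by blast
    qed auto
  qed
  then show ?thesis unfolding Cinf_on_def by blast
qed

lemma Cinf_on_ln [Cinf_intros]:
  fixes f :: "'a::euclidean_space \<Rightarrow> real"
  shows "open S \<Longrightarrow> Cinf_on S f \<Longrightarrow> (\<And>x. x \<in> S \<Longrightarrow> f x > 0) \<Longrightarrow> Cinf_on S (\<lambda>x. ln (f x))"
  by (rule Cinf_on_compose[OF Cinf_on_ln_real]) auto

lemma Cinf_on_norm [Cinf_intros]:
  fixes f :: "'a::euclidean_space \<Rightarrow> 'b::real_inner"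
  assumes "open S" "Cinf_on S f" "\<And>x. x \<in> S \<Longrightarrow> f x \<noteq> 0"
  shows "Cinf_on S (\<lambda>x. norm (f x))"
proof -
  have pos: "f x \<bullet> f x > 0" if "x \<in> S" for x using assms(3) that by simp
  \<comment> \<open>The square root is expressed through exp and ln, already known to be smooth,
    where the inner product is positive.\<close>
  have "Cinf_on S (\<lambda>x. exp (1 / 2 * ln (f x \<bullet> f x)))"
    using assms pos by (intro Cinf_intros) auto
  moreover have "exp (1 / 2 * ln (f x \<bullet> f x)) = norm (f x)" if "x \<in> S" for x
    using pos[OF that] by (simp add: norm_eq_sqrt_inner powr_def flip: powr_half_sqrt)
  ultimately show ?thesis
    using Cinf_on_cong[of S "\<lambda>x. exp (1 / 2 * ln (f x \<bullet> f x))" "\<lambda>x. norm (f x)"] assms(1) by blast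
qed

lemma smooth_onI:
  assumes "\<And>x. x \<in> S \<Longrightarrow> \<exists>B g. open B \<and> x \<in> B \<and> Cinf_on B g \<and> (\<forall>y\<in>B \<inter> S. f y = g y)"
  shows "smooth_on S f"
  using assms unfolding smooth_on_def Cinf_on_def by meson

lemma Cinf_on_imp_smooth_on:
  assumes "open S" "Cinf_on S f"
  shows "smooth_on S f"
  by (rule smooth_onI) (use assms in blast)

section \<open>Smooth step functions on the real line\<close>

definition flat :: "nat \<Rightarrow> real \<Rightarrow> real" where
  "flat n x = (if x > 0 then inverse x ^ n * exp (- inverse x) else 0)"

text \<open>From the right, with y = 1/h, the difference quotient is y^(n+1)/exp y, which tends to
  0; from the left it vanishes.\<close>

lemma flat_has_derivative_0: "(flat n has_real_derivative 0) (at 0)"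
proof -
  have "((\<lambda>y::real. y ^ Suc n / exp y) \<longlongrightarrow> 0) at_top"
    by (rule tendsto_power_div_exp_0)
  then have "((\<lambda>h::real. inverse h ^ Suc n / exp (inverse h)) \<longlongrightarrow> 0) (at_right 0)"
    by (rule filterlim_compose[OF _ filterlim_inverse_at_top_right])
  moreover have "\<forall>\<^sub>F h in at_right 0. inverse h ^ Suc n / exp (inverse h) = (flat n h - flat n 0) / (h - 0)"
    by (auto simp: eventually_at_filter flat_def exp_minus divide_inverse algebra_simps)
  ultimately have r: "((\<lambda>h. (flat n h - flat n 0) / (h - 0)) \<longlongrightarrow> 0) (at_right 0)"
    by (rule Lim_transform_eventually)
  have "\<forall>\<^sub>F h in at_left 0. 0 = (flat n h - flat n 0) / (h - 0)"
    by (auto simp: eventually_at_filter flat_def)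
  then have l: "((\<lambda>h. (flat n h - flat n 0) / (h - 0)) \<longlongrightarrow> 0) (at_left 0)"
    by (rule Lim_transform_eventually[OF tendsto_const])
  show ?thesis
    unfolding has_field_derivative_iff using filterlim_split_at_real[OF l r] by simp
qed

lemma flat_has_derivative:
  "(flat n has_real_derivative flat (n + 2) x - real n * flat (n + 1) x) (at x)"
proof -
  consider "x > 0" | "x < 0" | "x = 0" by linarith
  then show ?thesis
  proof cases
    case 1
    have "((\<lambda>x. inverse x ^ n * exp (- inverse x)) has_real_derivative
        flat (n + 2) x - real n * flat (n + 1) x) (at x)"
    proof -
      have "real n * inverse x ^ (n - 1) * (inverse x * inverse x) = real n * inverse x ^ (n + 1)"
        by (cases n) auto
      moreover have "((\<lambda>x. inverse x ^ n * exp (- inverse x)) has_real_derivative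
          inverse x ^ n * (exp (- inverse x) * (inverse x * inverse x))
          - real n * inverse x ^ (n - 1) * (inverse x * inverse x) * exp (- inverse x)) (at x)"
        using 1 by (auto intro!: derivative_eq_intros)
      moreover have "inverse x ^ n * (exp (- inverse x) * (inverse x * inverse x))
          - real n * inverse x ^ (n + 1) * exp (- inverse x) = flat (n + 2) x - real n * flat (n + 1) x"
        using 1 by (simp add: flat_def algebra_simps)
      ultimately show ?thesis by metis
    qed
    then show ?thesis
      by (rule has_field_derivative_transform_within_open[where S = "{0<..}"])
         (use 1 in \<open>auto simp: flat_def\<close>)
  next
    case 2
    have "((\<lambda>x. 0) has_real_derivative flat (n + 2) x - real n * flat (n + 1) x) (at x)"
      using 2 by (simp add: flat_def)
    then show ?thesis
      by (rule has_field_derivative_transform_within_open[where S = "{..<0}"])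
         (use 2 in \<open>auto simp: flat_def\<close>)
  next
    case 3
    then show ?thesis using flat_has_derivative_0[of n] by (simp add: flat_def)
  qed
qed

text \<open>Differentiation turns \<open>flat n\<close> into a combination of
  \<open>flat (n + 2)\<close> and \<open>flat (n + 1)\<close>, so the induction on the order runs
  over all n at once.\<close>

lemma Ck_on_flat: "Ck_on k UNIV (flat n)"
proof (induction k arbitrary: n)
  case 0
  then show ?case
    using flat_has_derivative DERIV_isCont continuous_at_imp_continuous_on
    by (metis Ck_on.simps(1))
next
  case (Suc k)
  show ?case
  proof (rule Ck_on_SucI[OF open_UNIV])
    show "(flat n has_derivative (\<lambda>v. (flat (n + 2) x + (- real n) * flat (n + 1) x) * v)) (at x)" for x
      using flat_has_derivative[of n x] unfolding has_field_derivative_def by simp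
    show "Ck_on k UNIV (\<lambda>x. (flat (n + 2) x + (- real n) * flat (n + 1) x) * v)" for v
      by (intro Ck_on_bilinear[OF bounded_bilinear_mult] Ck_on_add open_UNIV Suc Ck_on_const)
  qed
qed

definition step :: "real \<Rightarrow> real" where
  "step t = flat 0 t / (flat 0 t + flat 0 (1 - t))"

lemma flat_0_mono: "x \<le> y \<Longrightarrow> flat 0 x \<le> flat 0 y"
  by (auto simp: flat_def)

text \<open>The numbers t and 1 - t are never both nonpositive.\<close>

lemma step_denominator: "flat 0 t + flat 0 (1 - t) > 0"
  by (auto simp: flat_def add_pos_pos)

lemma step_eq_0: "t \<le> 0 \<Longrightarrow> step t = 0"
  and step_eq_1: "t \<ge> 1 \<Longrightarrow> step t = 1"
  by (auto simp: step_def flat_def)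

lemma flat_0_nonneg: "flat 0 x \<ge> 0"
  by (simp add: flat_def)

lemma step_bounds: "0 \<le> step t" "step t \<le> 1"
  using flat_0_nonneg[of t] flat_0_nonneg[of "1 - t"] step_denominator[of t]
  by (auto simp: step_def)

lemma step_mono: "x \<le> y \<Longrightarrow> step x \<le> step y"
proof -
  assume "x \<le> y"
  then have "flat 0 x \<le> flat 0 y" "flat 0 (1 - y) \<le> flat 0 (1 - x)"
    by (auto intro: flat_0_mono)
  then have "flat 0 x * flat 0 (1 - y) \<le> flat 0 y * flat 0 (1 - x)"
    by (intro mult_mono flat_0_nonneg) auto
  then show ?thesis
    unfolding step_def using step_denominator[of x] step_denominator[of y]
    by (simp add: divide_simps algebra_simps)
qed

lemma Cinf_on_step_real: "Cinf_on UNIV step"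
proof -
  have f: "Cinf_on UNIV (flat 0)"
    by (simp add: Cinf_on_def Ck_on_flat)
  have "Cinf_on UNIV (\<lambda>t. flat 0 t / (flat 0 t + flat 0 (1 - t)))"
    using step_denominator
    by (intro Cinf_intros f Cinf_on_compose[OF f]) (auto simp: less_imp_neq[symmetric])
  then show ?thesis by (simp add: step_def[abs_def])
qed

lemma Cinf_on_step [Cinf_intros]:
  fixes f :: "'a::euclidean_space \<Rightarrow> real"
  shows "open S \<Longrightarrow> Cinf_on S f \<Longrightarrow> Cinf_on S (\<lambda>x. step (f x))"
  by (rule Cinf_on_compose[OF Cinf_on_step_real]) auto

lemma Cinf_on_has_real_derivative:
  fixes f :: "real \<Rightarrow> real"
  assumes "Cinf_on S f" "open S" "x \<in> S"
  shows "(f has_real_derivative deriv f x) (at x)"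
proof -
  have "f differentiable (at x)"
    using Cinf_on_has_derivative[OF assms] unfolding differentiable_def by blast
  then show ?thesis by (simp add: DERIV_deriv_iff_real_differentiable)
qed

lemma Cinf_on_deriv:
  fixes f :: "real \<Rightarrow> real"
  assumes "Cinf_on S f" "open S"
  shows "Cinf_on S (deriv f)"
proof -
  have "frechet_derivative f (at x) 1 = deriv f x" if "x \<in> S" for x
    using frechet_derivative_at[OF Cinf_on_has_real_derivative[OF assms that, unfolded has_field_derivative_def]]
    by (metis mult.right_neutral)
  then show ?thesis
    using Cinf_on_frechet_derivative[OF assms(1), of 1] Cinf_on_cong[of S "\<lambda>x. frechet_derivative f (at x) 1" "deriv f"] assms(2)
    by blast
qed

lemma step_has_derivative: "(step has_real_derivative deriv step t) (at t)"
  by (rule Cinf_on_has_real_derivative[OF Cinf_on_step_real]) auto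

lemma deriv_step_nonneg: "deriv step t \<ge> 0"
  by (rule mono_on_imp_deriv_nonneg[OF _ step_has_derivative, of UNIV])
     (auto simp: mono_on_def step_mono)

text \<open>The derivative is continuous on the compact interval [0, 1] and vanishes off it, where
  \<open>step\<close> is constant.\<close>

lemma deriv_step_bounded: "\<exists>C>0. \<forall>t. \<bar>deriv step t\<bar> \<le> C"
proof -
  have c: "continuous_on {0..1} (deriv step)"
    using Cinf_on_continuous_on[OF Cinf_on_deriv[OF Cinf_on_step_real]] continuous_on_subset by blast
  have "bounded (deriv step ` {0..1})"
    by (rule compact_imp_bounded[OF compact_continuous_image[OF c compact_Icc]])
  then obtain C where C: "\<And>t. t \<in> {0..1} \<Longrightarrow> \<bar>deriv step t\<bar> \<le> C"
    unfolding bounded_iff by (metis imageI real_norm_def)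
  have "deriv step t = 0" if "t < 0" for t
  proof -
    have "((\<lambda>_. 0) has_real_derivative deriv step t) (at t)"
      by (rule has_field_derivative_transform_within_open[OF step_has_derivative, where S = "{..<0}"])
         (use that in \<open>auto simp: step_eq_0\<close>)
    then show ?thesis using DERIV_unique DERIV_const by blast
  qed
  moreover have "deriv step t = 0" if "t > 1" for t
  proof -
    have "((\<lambda>_. 1) has_real_derivative deriv step t) (at t)"
      by (rule has_field_derivative_transform_within_open[OF step_has_derivative, where S = "{1<..}"])
         (use that in \<open>auto simp: step_eq_1\<close>)
    then show ?thesis using DERIV_unique DERIV_const by blast
  qed
  ultimately have "\<bar>deriv step t\<bar> \<le> max C 1" for t
    using C[of t] by (cases "t < 0"; cases "t > 1") (auto simp: le_max_iff_disj)
  then show ?thesis by (intro exI[of _ "max C 1"]) auto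
qed

section \<open>Symmetry of second derivatives and Hamiltonian vector fields\<close>

lemma Cinf_on_line_derivative:
  fixes f :: "'a::euclidean_space \<Rightarrow> real"
  assumes "Cinf_on S f" "open S" "a + s *\<^sub>R u \<in> S"
  shows "((\<lambda>s. f (a + s *\<^sub>R u)) has_real_derivative frechet_derivative f (at (a + s *\<^sub>R u)) u) (at s)"
proof -
  have D: "(f has_derivative frechet_derivative f (at (a + s *\<^sub>R u))) (at (a + s *\<^sub>R u))"
    by (rule Cinf_on_has_derivative[OF assms])
  have "((\<lambda>s. a + s *\<^sub>R u) has_derivative (\<lambda>h. h *\<^sub>R u)) (at s)"
    by (auto intro!: derivative_eq_intros)
  from has_derivative_compose[OF this D] show ?thesis
    unfolding has_field_derivative_def
    by (rule has_derivative_eq_rhs) (auto simp: linear_cmul[OF has_derivative_linear[OF D]])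
qed

text \<open>The mean value theorem is applied twice: along u to the increment of f in direction v,
  and along v to the derivative of f in direction u.\<close>

lemma second_difference:
  fixes f :: "'a::euclidean_space \<Rightarrow> real"
  assumes f: "Cinf_on S f" "open S" and t: "0 < t"
    and sub: "\<And>s s'. \<bar>s\<bar> \<le> t \<Longrightarrow> \<bar>s'\<bar> \<le> t \<Longrightarrow> x + s *\<^sub>R u + s' *\<^sub>R v \<in> S"
  shows "\<exists>s s'. 0 < s \<and> s < t \<and> 0 < s' \<and> s' < t \<and>
    f (x + t *\<^sub>R u + t *\<^sub>R v) - f (x + t *\<^sub>R u) - f (x + t *\<^sub>R v) + f x =
    t\<^sup>2 * frechet_derivative (\<lambda>y. frechet_derivative f (at y) u) (at (x + s *\<^sub>R u + s' *\<^sub>R v)) v"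
proof -
  let ?D = "\<lambda>y. frechet_derivative f (at y) u"
  have "\<exists>s>0. s < t \<and>
      (f (x + t *\<^sub>R v + t *\<^sub>R u) - f (x + t *\<^sub>R u)) - (f (x + t *\<^sub>R v + 0 *\<^sub>R u) - f (x + 0 *\<^sub>R u)) =
      (t - 0) * (?D (x + t *\<^sub>R v + s *\<^sub>R u) - ?D (x + s *\<^sub>R u))"
  proof (rule MVT2[OF t, where f = "\<lambda>s. f (x + t *\<^sub>R v + s *\<^sub>R u) - f (x + s *\<^sub>R u)"])
    fix s assume s: "0 \<le> s" "s \<le> t"
    have "x + t *\<^sub>R v + s *\<^sub>R u \<in> S"
      using sub[of s t] s t by (simp add: add.assoc add.commute[of "t *\<^sub>R v"])
    moreover have "x + s *\<^sub>R u \<in> S"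
      using sub[of s 0] s t by simp
    ultimately show "((\<lambda>s. f (x + t *\<^sub>R v + s *\<^sub>R u) - f (x + s *\<^sub>R u)) has_real_derivative
        ?D (x + t *\<^sub>R v + s *\<^sub>R u) - ?D (x + s *\<^sub>R u)) (at s)"
      by (intro DERIV_diff Cinf_on_line_derivative[OF f])
  qed
  then obtain s where s: "0 < s" "s < t"
    "f (x + t *\<^sub>R v + t *\<^sub>R u) - f (x + t *\<^sub>R u) - (f (x + t *\<^sub>R v) - f x) =
      t * (?D (x + t *\<^sub>R v + s *\<^sub>R u) - ?D (x + s *\<^sub>R u))" by auto
  have "\<exists>s'>0. s' < t \<and> ?D (x + s *\<^sub>R u + t *\<^sub>R v) - ?D (x + s *\<^sub>R u + 0 *\<^sub>R v) =
      (t - 0) * frechet_derivative ?D (at (x + s *\<^sub>R u + s' *\<^sub>R v)) v"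
    by (rule MVT2[OF t, where f = "\<lambda>s'. ?D (x + s *\<^sub>R u + s' *\<^sub>R v)"])
       (use sub[of s] s t in \<open>auto intro!: Cinf_on_line_derivative[OF Cinf_on_frechet_derivative[OF f(1)] f(2)]\<close>)
  then obtain s' where "0 < s'" "s' < t"
    "?D (x + s *\<^sub>R u + t *\<^sub>R v) - ?D (x + s *\<^sub>R u) =
      t * frechet_derivative ?D (at (x + s *\<^sub>R u + s' *\<^sub>R v)) v" by auto
  with s show ?thesis
    by (intro exI[of _ s] exI[of _ s']) (simp add: algebra_simps power2_eq_square)
qed

text \<open>The second difference is symmetric in u and v. Both mixed derivatives, taken at points
  that tend to x with t, are therefore equal, and continuity gives the equality at x.\<close>

lemma second_derivative_symmetric_real:
  fixes f :: "'a::euclidean_space \<Rightarrow> real"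
  assumes f: "Cinf_on S f" and S: "open S" and x: "x \<in> S"
  shows "frechet_derivative (\<lambda>y. frechet_derivative f (at y) u) (at x) v =
         frechet_derivative (\<lambda>y. frechet_derivative f (at y) v) (at x) u"
proof -
  define P where "P u v y = frechet_derivative (\<lambda>y. frechet_derivative f (at y) u) (at y) v" for u v y
  have cont: "isCont (P u v) x" for u v
    using Cinf_on_continuous_on[OF Cinf_on_frechet_derivative[OF Cinf_on_frechet_derivative[OF f]]]
      S x unfolding P_def by (simp add: continuous_on_eq_continuous_at)
  have "\<bar>P u v x - P v u x\<bar> \<le> e" if e: "e > 0" for e
  proof -
    obtain d1 where d1: "d1 > 0" "\<And>y. dist y x < d1 \<Longrightarrow> \<bar>P u v y - P u v x\<bar> < e / 2"
      using cont[of u v] e unfolding continuous_at_eps_delta dist_real_def by (metis half_gt_zero)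
    obtain d2 where d2: "d2 > 0" "\<And>y. dist y x < d2 \<Longrightarrow> \<bar>P v u y - P v u x\<bar> < e / 2"
      using cont[of v u] e unfolding continuous_at_eps_delta dist_real_def by (metis half_gt_zero)
    obtain d3 where d3: "d3 > 0" "ball x d3 \<subseteq> S"
      using S x open_contains_ball by blast
    define d where "d = min d1 (min d2 d3)"
    \<comment> \<open>Small enough for all points x + s u + s' v with |s|, |s'| \<le> t to lie
      within d of x, in either order of the two vectors.\<close>
    define t where "t = d / (2 * (norm u + norm v + 1))"
    have dpos: "d > 0" using d1 d2 d3 by (simp add: d_def)
    have n: "norm u + norm v + 1 > 0" by (smt (verit) norm_ge_zero)
    have t: "t > 0" using dpos n by (simp add: t_def)
    have small: "dist (x + s *\<^sub>R u' + s' *\<^sub>R v') x < d"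
      if "\<bar>s\<bar> \<le> t" "\<bar>s'\<bar> \<le> t" "norm u' + norm v' = norm u + norm v" for s s' and u' v' :: 'a
    proof -
      have "dist (x + s *\<^sub>R u' + s' *\<^sub>R v') x = norm (s *\<^sub>R u' + s' *\<^sub>R v')"
        by (simp add: dist_norm)
      also have "\<dots> \<le> \<bar>s\<bar> * norm u' + \<bar>s'\<bar> * norm v'"
        using norm_triangle_ineq[of "s *\<^sub>R u'" "s' *\<^sub>R v'"] by simp
      also have "\<dots> \<le> t * norm u' + t * norm v'"
        using that by (intro add_mono mult_right_mono) auto
      also have "\<dots> = t * (norm u + norm v)" using that by (simp flip: distrib_left)
      also have "\<dots> < t * (norm u + norm v + 1) * 2" using mult_strict_left_mono[OF _ t, of "norm u + norm v" "(norm u + norm v + 1) * 2"] n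
        by (simp add: mult.assoc)
      also have "\<dots> = d" using n by (simp add: t_def field_simps)
      finally show ?thesis .
    qed
    have sub: "x + s *\<^sub>R u' + s' *\<^sub>R v' \<in> S"
      if "\<bar>s\<bar> \<le> t" "\<bar>s'\<bar> \<le> t" "norm u' + norm v' = norm u + norm v" for s s' and u' v' :: 'a
      using small[OF that] d3 unfolding d_def by (auto simp: dist_commute)
    let ?\<Delta> = "f (x + t *\<^sub>R u + t *\<^sub>R v) - f (x + t *\<^sub>R u) - f (x + t *\<^sub>R v) + f x"
    obtain s1 s1' where 1: "0 < s1" "s1 < t" "0 < s1'" "s1' < t"
      "?\<Delta> = t\<^sup>2 * P u v (x + s1 *\<^sub>R u + s1' *\<^sub>R v)"
      using second_difference[OF f S t, of x u v] sub[of _ _ u v] unfolding P_def by auto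
    obtain s2 s2' where 2: "0 < s2" "s2 < t" "0 < s2'" "s2' < t"
      "?\<Delta> = t\<^sup>2 * P v u (x + s2 *\<^sub>R v + s2' *\<^sub>R u)"
      using second_difference[OF f S t, of x v u] sub[of _ _ v u] unfolding P_def
      by (auto simp: algebra_simps)
    have "P u v (x + s1 *\<^sub>R u + s1' *\<^sub>R v) = P v u (x + s2 *\<^sub>R v + s2' *\<^sub>R u)"
      using 1(5) 2(5) t by simp
    moreover have "\<bar>P u v (x + s1 *\<^sub>R u + s1' *\<^sub>R v) - P u v x\<bar> < e / 2"
      using small[of s1 s1' u v] 1 by (intro d1) (auto simp: d_def)
    moreover have "\<bar>P v u (x + s2 *\<^sub>R v + s2' *\<^sub>R u) - P v u x\<bar> < e / 2"
      using small[of s2 s2' v u] 2 by (intro d2) (auto simp: d_def)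
    ultimately show ?thesis by linarith
  qed
  then have "P u v x = P v u x"
    by (metis abs_le_zero_iff dense_ge eq_iff_diff_eq_0)
  then show ?thesis by (simp add: P_def)
qed

lemma frechet_derivative_bounded_linear:
  assumes "bounded_linear h" "(f has_derivative D) (at x)"
  shows "frechet_derivative (\<lambda>y. h (f y)) (at x) v = h (D v)"
  using frechet_derivative_at[OF bounded_linear.has_derivative[OF assms]] by metis

lemma second_derivative_symmetric:
  fixes f :: "'a::euclidean_space \<Rightarrow> 'b::euclidean_space"
  assumes f: "Cinf_on S f" and S: "open S" and x: "x \<in> S"
  shows "frechet_derivative (\<lambda>y. frechet_derivative f (at y) u) (at x) v =
         frechet_derivative (\<lambda>y. frechet_derivative f (at y) v) (at x) u"
proof (rule euclidean_eqI)
  fix b :: 'b assume "b \<in> Basis"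
  let ?g = "\<lambda>y. f y \<bullet> b"
  have g: "Cinf_on S ?g"
    by (intro Cinf_on_bounded_linear[OF bounded_linear_inner_left] S f)
  have 1: "frechet_derivative ?g (at y) u = frechet_derivative f (at y) u \<bullet> b" if "y \<in> S" for y u
    by (rule frechet_derivative_bounded_linear[OF bounded_linear_inner_left
          Cinf_on_has_derivative[OF f S that]])
  have 2: "frechet_derivative (\<lambda>y. frechet_derivative ?g (at y) u) (at x) v =
      frechet_derivative (\<lambda>y. frechet_derivative f (at y) u) (at x) v \<bullet> b" for u v
  proof -
    note D = Cinf_on_has_derivative[OF Cinf_on_frechet_derivative[OF f, of u] S x]
    have "((\<lambda>y. frechet_derivative ?g (at y) u) has_derivative
        (\<lambda>v. frechet_derivative (\<lambda>y. frechet_derivative f (at y) u) (at x) v \<bullet> b)) (at x)"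
      by (rule has_derivative_transform_within_open[OF
            bounded_linear.has_derivative[OF bounded_linear_inner_left D] S x]) (simp add: 1)
    then show ?thesis using frechet_derivative_at by metis
  qed
  show "frechet_derivative (\<lambda>y. frechet_derivative f (at y) u) (at x) v \<bullet> b =
      frechet_derivative (\<lambda>y. frechet_derivative f (at y) v) (at x) u \<bullet> b"
    using second_derivative_symmetric_real[OF g S x, of u v] by (simp add: 2)
qed

section \<open>Hamiltonian vector fields\<close>

lemma symp_add_left: "symp (a + b) c = symp a c + symp b c"
  and symp_add_right: "symp a (b + c) = symp a b + symp a c"
  and symp_commute: "symp a b = - symp b a"
  by (auto simp: symp_def algebra_simps inner_commute)

lemma bounded_linear_symp_left: "bounded_linear (\<lambda>u. symp u v)"
  unfolding symp_def
  by (intro bounded_linear_sub bounded_linear_compose[OF bounded_linear_inner_left bounded_linear_snd]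
      bounded_linear_compose[OF bounded_linear_inner_left bounded_linear_fst])

text \<open>The field of Hamilton's equations, q' = dk/dp and p' = - dk/dq.\<close>

definition ham_field :: "('a::euclidean_space \<times> 'a \<Rightarrow> real) \<Rightarrow> 'a \<times> 'a \<Rightarrow> 'a \<times> 'a" where
  "ham_field k z = (\<Sum>b\<in>Basis. frechet_derivative k (at z) (0, b) *\<^sub>R b,
                  - (\<Sum>b\<in>Basis. frechet_derivative k (at z) (b, 0) *\<^sub>R b))"

lemma symp_ham_field:
  assumes "(k has_derivative frechet_derivative k (at z)) (at z)"
  shows "symp (ham_field k z) v = - frechet_derivative k (at z) v"
proof -
  let ?D = "frechet_derivative k (at z)"
  have l: "linear ?D" using assms has_derivative_linear by blast
  have 1: "?D (a, 0) = (\<Sum>b\<in>Basis. (a \<bullet> b) * ?D (b, 0))" for a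
  proof -
    have "(a, 0) = (\<Sum>b\<in>Basis. (a \<bullet> b) *\<^sub>R (b, 0::'a))"
      by (simp add: prod_eq_iff fst_sum snd_sum euclidean_representation)
    then show ?thesis by (simp add: linear_sum[OF l] linear_cmul[OF l] del: scaleR_Pair)
  qed
  have 2: "?D (0, a) = (\<Sum>b\<in>Basis. (a \<bullet> b) * ?D (0, b))" for a
  proof -
    have "(0, a) = (\<Sum>b\<in>Basis. (a \<bullet> b) *\<^sub>R (0::'a, b))"
      by (simp add: prod_eq_iff fst_sum snd_sum euclidean_representation)
    then show ?thesis by (simp add: linear_sum[OF l] linear_cmul[OF l] del: scaleR_Pair)
  qed
  have "?D v = ?D (fst v, 0) + ?D (0, snd v)"
    by (simp flip: linear_add[OF l])
  also have "\<dots> = (\<Sum>b\<in>Basis. (fst v \<bullet> b) * ?D (b, 0)) + (\<Sum>b\<in>Basis. (snd v \<bullet> b) * ?D (0, b))"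
    by (simp only: 1[of "fst v"] 2[of "snd v"])
  finally show ?thesis
    by (simp add: symp_def ham_field_def inner_sum_left inner_sum_right inner_commute mult.commute)
qed

lemma Cinf_on_ham_field:
  "open S \<Longrightarrow> Cinf_on S k \<Longrightarrow> Cinf_on S (ham_field k)"
  unfolding ham_field_def[abs_def] by (intro Cinf_intros Cinf_on_frechet_derivative)

text \<open>The two terms are the second derivative of k in the two orders with opposite signs.
  Hence a Liouville field stays Liouville when a Hamiltonian field is added.\<close>

lemma liouville_ham_field:
  fixes k :: "'a::euclidean_space \<times> 'a \<Rightarrow> real"
  assumes "open S" "Cinf_on S k" "z \<in> S"
  shows "symp (frechet_derivative (ham_field k) (at z) u) v
       + symp u (frechet_derivative (ham_field k) (at z) v) = 0"
proof -
  have 1: "symp (frechet_derivative (ham_field k) (at z) u) v =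
      - frechet_derivative (\<lambda>y. frechet_derivative k (at y) v) (at z) u" for u v
  proof -
    have "((\<lambda>y. symp (ham_field k y) v) has_derivative
        (\<lambda>u. symp (frechet_derivative (ham_field k) (at z) u) v)) (at z)"
      by (intro bounded_linear.has_derivative[OF bounded_linear_symp_left]
          Cinf_on_has_derivative[OF Cinf_on_ham_field[OF assms(1,2)] assms(1,3)])
    moreover have "((\<lambda>y. - frechet_derivative k (at y) v) has_derivative
        (\<lambda>u. - frechet_derivative (\<lambda>y. frechet_derivative k (at y) v) (at z) u)) (at z)"
      by (intro has_derivative_minus
          Cinf_on_has_derivative[OF Cinf_on_frechet_derivative[OF assms(2)] assms(1,3)])
    then have "((\<lambda>y. symp (ham_field k y) v) has_derivative
        (\<lambda>u. - frechet_derivative (\<lambda>y. frechet_derivative k (at y) v) (at z) u)) (at z)"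
      by (rule has_derivative_transform_within_open[OF _ assms(1,3)])
         (simp add: symp_ham_field Cinf_on_has_derivative[OF assms(2,1)])
    ultimately show ?thesis using has_derivative_unique by metis
  qed
  show ?thesis
    using second_derivative_symmetric[OF assms(2,1,3), of u v] 1[of u v] 1[of v u]
      symp_commute[of u] by simp
qed

section \<open>Tangent vectors\<close>

text \<open>V may have positive codimension, so a derivative within V is not unique. On the velocity
  of a curve in V, however, every such derivative is the velocity of the image curve.\<close>

lemma tangent_derivative_eq:
  assumes "v \<in> tangent_space V x" "(f has_derivative D) (at x within V)"
    "(f has_derivative E) (at x within V)"
  shows "D v = E v"
proof -
  obtain \<gamma> e where \<gamma>: "0 < e" "\<gamma> ` {-e<..<e} \<subseteq> V" "\<gamma> (0::real) = x"
    "(\<gamma> has_vector_derivative v) (at 0)"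
    using assms(1) unfolding tangent_space_def by auto
  have "D' v = vector_derivative (\<lambda>t. f (\<gamma> t)) (at 0)" if "(f has_derivative D') (at x within V)" for D'
  proof -
    have "(f has_derivative D') (at (\<gamma> 0) within \<gamma> ` {-e<..<e})"
      using has_derivative_subset[OF that \<gamma>(2)] \<gamma>(3) by simp
    moreover have "(\<gamma> has_derivative (\<lambda>h. h *\<^sub>R v)) (at 0 within {-e<..<e})"
      using \<gamma>(4) has_derivative_at_withinI unfolding has_vector_derivative_def by blast
    ultimately have "((\<lambda>t. f (\<gamma> t)) has_derivative (\<lambda>h. D' (h *\<^sub>R v))) (at 0 within {-e<..<e})"
      using has_derivative_in_compose by blast
    then have "((\<lambda>t. f (\<gamma> t)) has_derivative (\<lambda>h. D' (h *\<^sub>R v))) (at 0)"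
      using at_within_open[of "0::real" "{-e<..<e}"] \<gamma>(1) by simp
    then have "((\<lambda>t. f (\<gamma> t)) has_vector_derivative D' v) (at 0)"
      unfolding has_vector_derivative_def
      by (simp add: linear_cmul[OF has_derivative_linear[OF that]])
    then show ?thesis using vector_derivative_at by metis
  qed
  with assms show ?thesis by metis
qed

lemma frechet_derivative_within_tangent:
  assumes "v \<in> tangent_space V x" "(f has_derivative D) (at x within V)"
  shows "frechet_derivative f (at x within V) v = D v"
proof -
  have "f differentiable (at x within V)"
    using assms(2) unfolding differentiable_def by blast
  then show ?thesis
    using tangent_derivative_eq[OF assms(1) _ assms(2)] frechet_derivative_works by blast
qed

text \<open>Since F vanishes on T near x, the zero map is a derivative of F within T as well, and
  the two agree on tangent vectors. A vector with nonzero derivative is thus transverse to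
  T.\<close>

lemma tangent_derivative_eq_0:
  assumes "v \<in> tangent_space T x" "x \<in> T" "open B" "x \<in> B" "\<And>y. y \<in> T \<inter> B \<Longrightarrow> F y = 0"
    "(F has_derivative D) (at x)"
  shows "D v = 0"
proof -
  obtain d where d: "d > 0" "ball x d \<subseteq> B" using assms(3,4) open_contains_ball by blast
  have "(F has_derivative (\<lambda>_. 0)) (at x within T)"
    by (rule has_derivative_transform_within[OF has_derivative_const d(1) assms(2)])
       (use d assms(5) in \<open>auto simp: dist_commute subset_iff\<close>)
  then show ?thesis
    using tangent_derivative_eq[OF assms(1) has_derivative_at_withinI[OF assms(6)]] by metis
qed

text \<open>The required curve is the image of the line t -> a + t b.\<close>

lemma tangent_spaceI:
  fixes \<Psi> :: "'a::euclidean_space \<Rightarrow> 'b::euclidean_space"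
  assumes "Cinf_on S \<Psi>" "open S" "a \<in> S" "\<Psi> ` S \<subseteq> V" "(\<Psi> has_derivative D) (at a)"
  shows "D b \<in> tangent_space V (\<Psi> a)"
proof -
  obtain d where d: "d > 0" "ball a d \<subseteq> S" using assms(2,3) open_contains_ball by blast
  define e where "e = d / (norm b + 1)"
  have n: "norm b + 1 > 0" by (smt (verit) norm_ge_zero)
  have e: "e > 0" using d n by (simp add: e_def)
  have S: "a + t *\<^sub>R b \<in> S" if "t \<in> {-e<..<e}" for t
  proof -
    have "\<bar>t\<bar> * norm b \<le> e * norm b" using that by (intro mult_right_mono) auto
    also have "\<dots> < e * (norm b + 1)" using e by simp
    also have "\<dots> = d" using n by (simp add: e_def)
    finally have "a + t *\<^sub>R b \<in> ball a d" by (simp add: dist_norm)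
    then show ?thesis using d by blast
  qed
  have "Cinf_on {-e<..<e} (\<lambda>t. \<Psi> (a + t *\<^sub>R b))"
    by (rule Cinf_on_compose[OF assms(1,2)]) (auto intro!: Cinf_intros S)
  moreover have "((\<lambda>t. \<Psi> (a + t *\<^sub>R b)) has_vector_derivative D b) (at 0)"
  proof -
    have "((\<lambda>t. a + t *\<^sub>R b) has_derivative (\<lambda>h. h *\<^sub>R b)) (at 0)"
      by (auto intro!: derivative_eq_intros)
    then have "((\<lambda>t. \<Psi> (a + t *\<^sub>R b)) has_derivative (\<lambda>h. D (h *\<^sub>R b))) (at 0)"
      by (rule has_derivative_compose) (use assms(5) in simp)
    then show ?thesis
      unfolding has_vector_derivative_def
      by (simp add: linear_cmul[OF has_derivative_linear[OF assms(5)]])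
  qed
  ultimately show ?thesis
    unfolding tangent_space_def using e S assms(4)
    by (auto intro!: exI[of _ "\<lambda>t. \<Psi> (a + t *\<^sub>R b)"] exI[of _ e] Cinf_on_imp_smooth_on)
qed

lemma tangent_space_open:
  fixes V :: "'a::euclidean_space set"
  assumes "open V" "x \<in> V"
  shows "tangent_space V x = UNIV"
  using tangent_spaceI[OF Cinf_on_id assms, of V id] tangent_spaceI[OF Cinf_on_id assms, of V "\<lambda>x. x"]
  by auto

section \<open>The inverse of the Moser chart\<close>

primrec other :: "body \<Rightarrow> body" where
  "other Earth = Moon"
| "other Moon = Earth"

lemma UNIV_body: "UNIV = {Earth, Moon}"
  by (auto intro: body.exhaust)

lemma vector3_eq_iff: "(x :: real^3) = y \<longleftrightarrow> x$1 = y$1 \<and> x$2 = y$2 \<and> x$3 = y$3"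
  by (simp add: vec_eq_iff forall_3)

lemma inner3: "(x :: real^3) \<bullet> y = x$1 * y$1 + x$2 * y$2 + x$3 * y$3"
  by (simp add: inner_vec_def sum_3)

lemma position_nth [simp]:
  "position \<mu> Earth $ 1 = \<mu>" "position \<mu> Moon $ 1 = \<mu> - 1"
  "position \<mu> P $ 2 = 0" "position \<mu> P $ 3 = 0"
  by (cases P; simp add: vector_3)+

lemma position_neq: "position \<mu> P \<noteq> position \<mu> (other P)"
  by (cases P) (auto simp: vector3_eq_iff)

lemma norm_position_diff: "norm (position \<mu> P - position \<mu> (other P)) = 1"
  by (cases P) (auto simp: norm_eq_sqrt_inner inner3)

lemma phase_space_iff:
  "z \<in> phase_space \<mu> \<longleftrightarrow> fst z \<noteq> position \<mu> P \<and> fst z \<noteq> position \<mu> (other P)"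
  by (cases P) (auto simp: phase_space_def case_prod_beta)

lemma open_phase_space: "open (phase_space \<mu>)"
proof -
  have "phase_space \<mu> = {z. fst z \<noteq> position \<mu> Earth} \<inter> {z. fst z \<noteq> position \<mu> Moon}"
    by (auto simp: phase_space_def)
  then show ?thesis
    by (auto intro!: open_Int open_Collect_neq continuous_intros)
qed

lemma H_body:
  "H \<mu> (q, p) = (norm p)\<^sup>2 / 2 - mass \<mu> P / norm (q - position \<mu> P)
     - mass \<mu> (other P) / norm (q - position \<mu> (other P)) + p$1 * q$2 - p$2 * q$1"
  by (cases P) (auto simp: H_def)

text \<open>Inverse stereographic projection, \<xi>_0 = (|p|^2 - 1)/(|p|^2 + 1), with its cotangent
  lift after the switch of positions and momenta. Unlike \<open>moser_map\<close> it is smooth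
  everywhere, and its source carries no constraint, so calculations on \<open>TS3\<close> are pulled
  back along it.\<close>

definition moser_inv :: "real \<Rightarrow> body \<Rightarrow> phase \<Rightarrow> cotangent" where
  "moser_inv \<mu> P z =
     ((1 - 2 * inverse (snd z \<bullet> snd z + 1), - ((2 * inverse (snd z \<bullet> snd z + 1)) *\<^sub>R snd z)),
      (- (snd z \<bullet> (fst z - position \<mu> P)),
       ((snd z \<bullet> snd z + 1) / 2) *\<^sub>R (fst z - position \<mu> P)
         - (snd z \<bullet> (fst z - position \<mu> P)) *\<^sub>R snd z))"

lemma inner_self_plus_1_pos: "x \<bullet> x + 1 > (0::real)" for x :: "'a::real_inner"
  by (smt (verit) inner_ge_zero)

lemma Cinf_on_moser_inv: "Cinf_on UNIV (moser_inv \<mu> P)"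
  unfolding moser_inv_def[abs_def]
  by (intro Cinf_intros open_UNIV) (auto simp: less_imp_neq[OF inner_self_plus_1_pos, symmetric])

lemma Cinf_on_moser_map: "Cinf_on {z. fst (fst z) \<noteq> 1} (moser_map \<mu> P)"
proof -
  have "open {z :: cotangent. fst (fst z) \<noteq> 1}"
    by (auto intro!: open_Collect_neq continuous_intros)
  then show ?thesis
    unfolding moser_map_def case_prod_beta by (intro Cinf_intros) auto
qed

lemma moser_map_inv: "moser_map \<mu> P (moser_inv \<mu> P z) = z"
proof -
  define n where "n = snd z \<bullet> snd z + 1"
  define v where "v = fst z - position \<mu> P"
  have "n > 0" using inner_self_plus_1_pos n_def by metis
  then have "fst (moser_map \<mu> P (moser_inv \<mu> P z)) = position \<mu> P + v" "snd (moser_map \<mu> P (moser_inv \<mu> P z)) = snd z"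
    unfolding moser_map_def moser_inv_def n_def[symmetric] v_def[symmetric]
    by (simp_all add: scaleR_right_diff_distrib mult.commute)
  then show ?thesis by (simp add: prod_eq_iff v_def)
qed

lemma fst_moser_inv_neq: "fst (fst (moser_inv \<mu> P z)) \<noteq> 1"
  using inner_self_plus_1_pos[of "snd z"] by (simp add: moser_inv_def)

text \<open>This is |q - P| = |\<eta>| (1 - \<xi>_0), since 1 - \<xi>_0 = 2/(|p|^2 + 1).\<close>

lemma norm_snd_moser_inv:
  "norm (snd (moser_inv \<mu> P z)) = (snd z \<bullet> snd z + 1) / 2 * norm (fst z - position \<mu> P)"
proof -
  define n where "n = snd z \<bullet> snd z + 1"
  define v where "v = fst z - position \<mu> P"
  have n: "n > 0" using inner_self_plus_1_pos n_def by metis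
  have pp: "snd z \<bullet> snd z = n - 1" by (simp add: n_def)
  have "(norm (snd (moser_inv \<mu> P z)))\<^sup>2 = (n / 2 * norm v)\<^sup>2"
    unfolding power_mult_distrib power2_norm_eq_inner moser_inv_def n_def[symmetric] v_def[symmetric]
    by (simp add: inner_diff_left inner_diff_right pp inner_commute[of v "snd z"] algebra_simps power2_eq_square)
  then have "norm (snd (moser_inv \<mu> P z)) = n / 2 * norm v"
    by (rule power2_eq_imp_eq) (use n in auto)
  then show ?thesis by (simp add: n_def v_def)
qed

lemma moser_inv_TS3: "moser_inv \<mu> P z \<in> TS3"
proof -
  define n where "n = snd z \<bullet> snd z + 1"
  have n: "n > 0" using inner_self_plus_1_pos n_def by metis
  have pp: "snd z \<bullet> snd z = n - 1" by (simp add: n_def)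
  have "fst (moser_inv \<mu> P z) \<bullet> fst (moser_inv \<mu> P z) = 1"
    unfolding moser_inv_def n_def[symmetric] using n by (simp add: pp field_simps)
  then have "norm (fst (moser_inv \<mu> P z)) = 1" by (simp add: norm_eq_sqrt_inner)
  moreover have "fst (moser_inv \<mu> P z) \<bullet> snd (moser_inv \<mu> P z) = 0"
  proof -
    define v where "v = fst z - position \<mu> P"
    define a where "a = snd z \<bullet> v"
    show ?thesis
      unfolding moser_inv_def n_def[symmetric] v_def[symmetric] a_def[symmetric]
      using n by (simp add: inner_diff_right pp field_simps flip: a_def)
  qed
  ultimately show ?thesis by (simp add: TS3_def case_prod_beta)
qed

lemma moser_inv_domain:
  assumes "0 < norm (fst z - position \<mu> P)" "norm (fst z - position \<mu> P) < 1 / 2"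
  shows "moser_inv \<mu> P z \<in> moser_domain"
proof -
  have n: "snd z \<bullet> snd z + 1 > 0" by (rule inner_self_plus_1_pos)
  have "norm (snd (moser_inv \<mu> P z)) > 0"
    unfolding norm_snd_moser_inv using n assms by simp
  moreover have "norm (snd (moser_inv \<mu> P z)) * (1 - fst (fst (moser_inv \<mu> P z))) =
      norm (fst z - position \<mu> P)"
    unfolding norm_snd_moser_inv using n by (simp add: moser_inv_def)
  ultimately show ?thesis
    using moser_inv_TS3[of \<mu> P z] assms unfolding moser_domain_def case_prod_beta by auto
qed

lemma TS3_components:
  assumes "(\<xi>, \<eta>) \<in> TS3"
  shows "snd \<xi> \<bullet> snd \<xi> = 1 - fst \<xi> * fst \<xi>" "snd \<xi> \<bullet> snd \<eta> = - (fst \<xi> * fst \<eta>)"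
proof -
  have "\<xi> \<bullet> \<xi> = 1" using assms by (simp add: TS3_def norm_eq_sqrt_inner)
  then show "snd \<xi> \<bullet> snd \<xi> = 1 - fst \<xi> * fst \<xi>" by (simp add: inner_prod_def)
  show "snd \<xi> \<bullet> snd \<eta> = - (fst \<xi> * fst \<eta>)"
    using assms by (simp add: TS3_def inner_prod_def)
qed

lemma TS3_north_iff:
  assumes "z \<in> TS3"
  shows "fst z = north \<longleftrightarrow> fst (fst z) = 1"
proof
  assume 1: "fst (fst z) = 1"
  have "snd (fst z) \<bullet> snd (fst z) = 0"
    using TS3_components(1)[of "fst z" "snd z"] assms 1 by simp
  then show "fst z = north" using 1 by (simp add: north_def prod_eq_iff)
qed (simp add: north_def)

lemma TS3_fst_le: "z \<in> TS3 \<Longrightarrow> fst (fst z) \<le> 1"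
proof -
  assume "z \<in> TS3"
  then have "norm (fst z) = 1" by (simp add: TS3_def case_prod_beta)
  then show ?thesis using norm_fst_le[of "fst (fst z)" "snd (fst z)"] by simp
qed

lemma norm_moser_map:
  assumes "z \<in> TS3"
  shows "norm (fst (moser_map \<mu> P z) - position \<mu> P) = norm (snd z) * (1 - fst (fst z))"
proof -
  obtain \<xi> \<eta> where z: "z = (\<xi>, \<eta>)" by (cases z)
  note c = TS3_components[OF assms[unfolded z]]
  have "(norm (fst (moser_map \<mu> P z) - position \<mu> P))\<^sup>2 = (norm (snd z) * (1 - fst (fst z)))\<^sup>2"
    unfolding power_mult_distrib power2_norm_eq_inner moser_map_def z
    by (simp add: inner_add_left inner_add_right inner_commute[of "snd \<eta>" "snd \<xi>"] c
        inner_prod_def[of \<eta> \<eta>] algebra_simps power2_eq_square)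
  then show ?thesis
    by (rule power2_eq_imp_eq) (use TS3_fst_le[OF assms] in \<open>auto simp: z\<close>)
qed

lemma moser_inv_map:
  assumes "z \<in> TS3" "fst z \<noteq> north"
  shows "moser_inv \<mu> P (moser_map \<mu> P z) = z"
proof -
  obtain \<xi> \<eta> where z: "z = (\<xi>, \<eta>)" by (cases z)
  note c = TS3_components[OF assms(1)[unfolded z]]
  have lt: "1 - fst \<xi> > 0"
    using TS3_fst_le[OF assms(1)] TS3_north_iff[OF assms(1)] assms(2) z by simp
  define e where "e = 1 - fst \<xi>"
  have e: "e > 0" "fst \<xi> = 1 - e" using lt by (auto simp: e_def)
  let ?p = "- (1 / e) *\<^sub>R snd \<xi>"
  let ?v = "e *\<^sub>R snd \<eta> + fst \<eta> *\<^sub>R snd \<xi>"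
  have m: "moser_map \<mu> P z = (position \<mu> P + ?v, ?p)"
    by (simp add: moser_map_def z e_def add.assoc)
  \<comment> \<open>The constraints |\<xi>| = 1 and \<xi> . \<eta> = 0 enter through these two
    products, which recover the coefficients of \<open>moser_inv\<close>.\<close>
  have n: "?p \<bullet> ?p + 1 = 2 / e"
    using e(1) by (simp add: c e(2) field_simps)
  have pv: "?p \<bullet> ?v = - fst \<eta>"
    using e(1) by (simp add: c e(2) inner_add_right field_simps)
  show ?thesis
    unfolding moser_inv_def m fst_conv snd_conv add_diff_cancel_left' n pv
    using e by (simp add: z prod_eq_iff scaleR_add_right)
qed

text \<open>Kept in closed form so that the symplectic condition and the image of the radial field
  can be verified by computation.\<close>

definition moser_inv_deriv :: "real \<Rightarrow> body \<Rightarrow> phase \<Rightarrow> phase \<Rightarrow> cotangent" where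
  "moser_inv_deriv \<mu> P z u =
    (let p = snd z; v = fst z - position \<mu> P; n = p \<bullet> p + 1; \<alpha> = fst u; \<beta> = snd u in
      ((4 * (p \<bullet> \<beta>) * (inverse n * inverse n),
        (4 * (p \<bullet> \<beta>) * (inverse n * inverse n)) *\<^sub>R p - (2 * inverse n) *\<^sub>R \<beta>),
       (- (\<beta> \<bullet> v) - p \<bullet> \<alpha>,
        (p \<bullet> \<beta>) *\<^sub>R v + (n / 2) *\<^sub>R \<alpha> - (\<beta> \<bullet> v + p \<bullet> \<alpha>) *\<^sub>R p - (p \<bullet> v) *\<^sub>R \<beta>)))"

lemma moser_inv_has_derivative:
  "(moser_inv \<mu> P has_derivative moser_inv_deriv \<mu> P z) (at z)"
proof -
  define p where "p = snd z"
  define v where "v = fst z - position \<mu> P"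
  define n where "n = p \<bullet> p + 1"
  have n0: "n > 0" using inner_self_plus_1_pos n_def by metis
  have dv: "((\<lambda>z. fst z - position \<mu> P) has_derivative fst) (at z)"
    by (auto intro!: derivative_eq_intros)
  have dp: "(snd has_derivative snd) (at z)"
    by (auto intro!: derivative_eq_intros)
  have dn: "((\<lambda>z. snd z \<bullet> snd z + 1) has_derivative (\<lambda>u. 2 * (p \<bullet> snd u))) (at z)"
    by (rule has_derivative_eq_rhs[OF has_derivative_add_const[OF has_derivative_inner[OF dp dp]]])
       (auto simp: p_def inner_commute)
  have dm: "((\<lambda>z. inverse (snd z \<bullet> snd z + 1)) has_derivative
      (\<lambda>u. - (2 * (p \<bullet> snd u) * (inverse n * inverse n)))) (at z)"
    by (rule has_derivative_eq_rhs[OF Deriv.has_derivative_inverse[OF _ dn]])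
       (use n0 in \<open>auto simp: n_def p_def\<close>)
  have da: "((\<lambda>z. snd z \<bullet> (fst z - position \<mu> P)) has_derivative
      (\<lambda>u. snd u \<bullet> v + p \<bullet> fst u)) (at z)"
    by (rule has_derivative_eq_rhs[OF has_derivative_inner[OF dp dv]]) (auto simp: p_def v_def)
  have 1: "((\<lambda>z. 1 - 2 * inverse (snd z \<bullet> snd z + 1)) has_derivative
      (\<lambda>u. 4 * (p \<bullet> snd u) * (inverse n * inverse n))) (at z)"
    by (rule has_derivative_eq_rhs[OF has_derivative_diff[OF has_derivative_const
            has_derivative_mult_right[OF dm]]]) auto
  have 2: "((\<lambda>z. - ((2 * inverse (snd z \<bullet> snd z + 1)) *\<^sub>R snd z)) has_derivative
      (\<lambda>u. (4 * (p \<bullet> snd u) * (inverse n * inverse n)) *\<^sub>R p - (2 * inverse n) *\<^sub>R snd u)) (at z)"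
    by (rule has_derivative_eq_rhs[OF has_derivative_minus[OF has_derivative_scaleR[OF
            has_derivative_mult_right[OF dm] dp]]]) (auto simp: p_def n_def)
  have 3: "((\<lambda>z. - (snd z \<bullet> (fst z - position \<mu> P))) has_derivative
      (\<lambda>u. - (snd u \<bullet> v) - p \<bullet> fst u)) (at z)"
    by (rule has_derivative_eq_rhs[OF has_derivative_minus[OF da]]) auto
  have dn2: "((\<lambda>z. (snd z \<bullet> snd z + 1) / 2) has_derivative (\<lambda>u. p \<bullet> snd u)) (at z)"
    by (rule has_derivative_eq_rhs[OF has_derivative_divide[OF dn has_derivative_const]]) auto
  have 4: "((\<lambda>z. ((snd z \<bullet> snd z + 1) / 2) *\<^sub>R (fst z - position \<mu> P)
         - (snd z \<bullet> (fst z - position \<mu> P)) *\<^sub>R snd z) has_derivative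
      (\<lambda>u. (p \<bullet> snd u) *\<^sub>R v + (n / 2) *\<^sub>R fst u - (snd u \<bullet> v + p \<bullet> fst u) *\<^sub>R p - (p \<bullet> v) *\<^sub>R snd u)) (at z)"
    by (rule has_derivative_eq_rhs[OF has_derivative_diff[OF has_derivative_scaleR[OF dn2 dv]
            has_derivative_scaleR[OF da dp]]]) (auto simp: p_def n_def v_def)
  show ?thesis
    unfolding moser_inv_def[abs_def] moser_inv_deriv_def[abs_def] Let_def
      p_def[symmetric] v_def[symmetric] n_def[symmetric]
    by (intro has_derivative_Pair 1 2 3 4)
qed

lemma symp_moser_inv_deriv:
  "symp (moser_inv_deriv \<mu> P z a) (moser_inv_deriv \<mu> P z b) = symp a b"
proof -
  define p where "p = snd z"
  define v where "v = fst z - position \<mu> P"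
  define n where "n = p \<bullet> p + 1"
  define m where "m = inverse n"
  have n: "n > 0" using inner_self_plus_1_pos n_def by metis
  have nm: "n * m = 1" using n by (simp add: m_def)
  have pp: "p \<bullet> p = n - 1" by (simp add: n_def)
  have ip: "((p \<bullet> \<beta>) *\<^sub>R v + (n / 2) *\<^sub>R \<alpha> - (\<beta> \<bullet> v + p \<bullet> \<alpha>) *\<^sub>R p - (p \<bullet> v) *\<^sub>R \<beta>) \<bullet>
      ((4 * (p \<bullet> \<beta>') * (m * m)) *\<^sub>R p - (2 * m) *\<^sub>R \<beta>') =
      4 * (p \<bullet> \<beta>') * (m * m) * (n / 2 * (p \<bullet> \<alpha>) - (\<beta> \<bullet> v + p \<bullet> \<alpha>) * (n - 1))
      - 2 * m * ((p \<bullet> \<beta>) * (\<beta>' \<bullet> v) + n / 2 * (\<alpha> \<bullet> \<beta>') - (\<beta> \<bullet> v + p \<bullet> \<alpha>) * (p \<bullet> \<beta>')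
          - (p \<bullet> v) * (\<beta> \<bullet> \<beta>'))" for \<alpha> \<beta> \<beta>' :: "real^3"
    unfolding inner_diff_left inner_diff_right inner_add_left inner_scaleR_left inner_scaleR_right pp
      inner_commute[of v \<beta>'] inner_commute[of v p] inner_commute[of \<alpha> p] inner_commute[of \<beta> p]
    by (simp add: algebra_simps)
  obtain \<alpha> \<beta> where a: "a = (\<alpha>, \<beta>)" by (cases a)
  obtain \<alpha>' \<beta>' where b: "b = (\<alpha>', \<beta>')" by (cases b)
  \<comment> \<open>The pairing of the \<eta>-part of one image with the \<xi>-part of the other.
    Apart from - \<alpha> . \<beta>' the result is symmetric in \<beta> and \<beta>', so that only
    this term survives antisymmetrisation.\<close>
  have half: "(- (\<beta> \<bullet> v) - p \<bullet> \<alpha>) * (4 * (p \<bullet> \<beta>') * (m * m))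
      + (4 * (p \<bullet> \<beta>') * (m * m) * (n / 2 * (p \<bullet> \<alpha>) - (\<beta> \<bullet> v + p \<bullet> \<alpha>) * (n - 1))
      - 2 * m * ((p \<bullet> \<beta>) * (\<beta>' \<bullet> v) + n / 2 * (\<alpha> \<bullet> \<beta>') - (\<beta> \<bullet> v + p \<bullet> \<alpha>) * (p \<bullet> \<beta>')
          - (p \<bullet> v) * (\<beta> \<bullet> \<beta>')))
      = 2 * m * ((p \<bullet> v) * (\<beta> \<bullet> \<beta>') - (p \<bullet> \<beta>') * (\<beta> \<bullet> v) - (p \<bullet> \<beta>) * (\<beta>' \<bullet> v)) - \<alpha> \<bullet> \<beta>'"
    for \<alpha> \<beta> \<beta>' :: "real^3"
  proof -
    have 1: "(- w - y) * (4 * x * (m * m)) + 4 * x * (m * m) * (n / 2 * y - (w + y) * (n - 1))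
        = - (4 * x * m * w) - 2 * x * y * m" for w x y
    proof -
      have "(- w - y) * (4 * x * (m * m)) + 4 * x * (m * m) * (n / 2 * y - (w + y) * (n - 1))
          = (n * m) * (4 * x * m * (y / 2 - w - y))" by (simp add: algebra_simps)
      then show ?thesis unfolding nm by (simp add: algebra_simps)
    qed
    have 2: "2 * m * (a + n / 2 * b - c - d) = 2 * m * (a - c - d) + b" for a b c d
    proof -
      have "2 * m * (a + n / 2 * b - c - d) = 2 * m * (a - c - d) + (n * m) * b"
        by (simp add: algebra_simps)
      then show ?thesis unfolding nm by simp
    qed
    show ?thesis
      unfolding 2 using 1[of "\<beta> \<bullet> v" "p \<bullet> \<alpha>" "p \<bullet> \<beta>'"]
      by (simp add: algebra_simps)
  qed
  show ?thesis
    unfolding moser_inv_deriv_def Let_def p_def[symmetric] v_def[symmetric] n_def[symmetric]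
      m_def[symmetric] a b symp_def inner_prod_def fst_conv snd_conv ip
      inner_commute[of "(4 * (p \<bullet> \<beta>) * (m * m)) *\<^sub>R p - (2 * m) *\<^sub>R \<beta>"] inner_real_def
    using half[of \<beta> \<alpha> \<beta>'] half[of \<beta>' \<alpha>' \<beta>]
    by (simp add: inner_commute[of \<beta>' \<beta>] inner_commute[of \<alpha>' \<beta>] algebra_simps)
qed

section \<open>A criterion for contact type\<close>

lemma bounded_bilinear_symp: "bounded_bilinear symp"
proof -
  have "bounded_linear (\<lambda>u::'a \<times> 'a. (snd u, - fst u))"
    by (intro bounded_linear_Pair bounded_linear_minus bounded_linear_fst bounded_linear_snd)
  then have "bounded_bilinear (\<lambda>u v::'a \<times> 'a. (snd u, - fst u) \<bullet> v)"
    by (rule bounded_bilinear.comp1[OF bounded_bilinear_inner])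
  moreover have "symp = (\<lambda>u v::'a \<times> 'a. (snd u, - fst u) \<bullet> v)"
    by (intro ext) (simp add: symp_def inner_prod_def)
  ultimately show ?thesis by metis
qed

text \<open>Lie derivatives commute with symplectic maps. Differentiating \<open>rel\<close> shows
  that Y' on an image vector is the image of X' plus a second derivative of \<Psi> in the direction
  of X; as \<Psi> preserves \<open>symp\<close>, these second derivatives cancel. The target may
  have larger dimension, as for the Moser chart, so the conclusion concerns image vectors
  only.\<close>

lemma liouville_push_forward:
  fixes \<Psi> :: "'a::euclidean_space \<times> 'a \<Rightarrow> 'b::euclidean_space \<times> 'b"
  assumes \<Psi>: "Cinf_on S \<Psi>" "open S" "y \<in> S"
    and symp: "\<And>x a b. x \<in> S \<Longrightarrow>
      symp (frechet_derivative \<Psi> (at x) a) (frechet_derivative \<Psi> (at x) b) = symp a b"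
    and X: "(X has_derivative X') (at y)" and Y: "(Y has_derivative Y') (at (\<Psi> y))"
    and rel: "\<And>x. x \<in> S \<Longrightarrow> Y (\<Psi> x) = frechet_derivative \<Psi> (at x) (X x)"
    and liouville: "\<And>a b. symp (X' a) b + symp a (X' b) = symp a b"
  shows "symp (Y' (frechet_derivative \<Psi> (at y) a)) (frechet_derivative \<Psi> (at y) b)
       + symp (frechet_derivative \<Psi> (at y) a) (Y' (frechet_derivative \<Psi> (at y) b)) = symp a b"
proof -
  let ?D = "\<lambda>x. frechet_derivative \<Psi> (at x)"
  let ?D2 = "\<lambda>u v. frechet_derivative (\<lambda>x. ?D x u) (at y) v"
  have D: "(\<Psi> has_derivative ?D x) (at x)" if "x \<in> S" for x
    by (rule Cinf_on_has_derivative[OF \<Psi>(1,2) that])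
  have D2: "((\<lambda>x. ?D x u) has_derivative ?D2 u) (at y)" for u
    by (rule Cinf_on_has_derivative[OF Cinf_on_frechet_derivative[OF \<Psi>(1)] \<Psi>(2,3)])
  \<comment> \<open>In \<open>rel\<close> the direction X x varies with x; the expansion in the
    basis reduces its derivative to second derivatives in fixed directions.\<close>
  have expand: "?D x w = (\<Sum>c\<in>Basis. (w \<bullet> c) *\<^sub>R ?D x c)" if "x \<in> S" for x w
  proof -
    note l = has_derivative_linear[OF D[OF that]]
    have "?D x w = ?D x (\<Sum>c\<in>Basis. (w \<bullet> c) *\<^sub>R c)" by (simp add: euclidean_representation)
    then show ?thesis by (simp add: linear_sum[OF l] linear_cmul[OF l])
  qed
  have expand2: "?D2 w v = (\<Sum>c\<in>Basis. (w \<bullet> c) *\<^sub>R ?D2 c v)" for w v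
  proof -
    have "((\<lambda>x. \<Sum>c\<in>Basis. (w \<bullet> c) *\<^sub>R ?D x c) has_derivative (\<lambda>v. \<Sum>c\<in>Basis. (w \<bullet> c) *\<^sub>R ?D2 c v)) (at y)"
      by (intro has_derivative_sum has_derivative_scaleR_right D2)
    then have "((\<lambda>x. ?D x w) has_derivative (\<lambda>v. \<Sum>c\<in>Basis. (w \<bullet> c) *\<^sub>R ?D2 c v)) (at y)"
      by (rule has_derivative_transform_within_open[OF _ \<Psi>(2,3)]) (rule expand[symmetric])
    from fun_cong[OF has_derivative_unique[OF D2 this], of v] show ?thesis .
  qed
  have YD: "Y' (?D y v) = ?D2 (X y) v + ?D y (X' v)" for v
  proof -
    have "((\<lambda>x. Y (\<Psi> x)) has_derivative (\<lambda>v. Y' (?D y v))) (at y)"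
      by (rule has_derivative_compose[OF D[OF \<Psi>(3)] Y])
    moreover have "((\<lambda>x. \<Sum>c\<in>Basis. (X x \<bullet> c) *\<^sub>R ?D x c) has_derivative
        (\<lambda>v. \<Sum>c\<in>Basis. (X y \<bullet> c) *\<^sub>R ?D2 c v + (X' v \<bullet> c) *\<^sub>R ?D y c)) (at y)"
      by (intro has_derivative_sum has_derivative_scaleR D2 has_derivative_inner_left X)
    then have "((\<lambda>x. Y (\<Psi> x)) has_derivative
        (\<lambda>v. \<Sum>c\<in>Basis. (X y \<bullet> c) *\<^sub>R ?D2 c v + (X' v \<bullet> c) *\<^sub>R ?D y c)) (at y)"
      by (rule has_derivative_transform_within_open[OF _ \<Psi>(2,3)]) (simp only: rel expand[symmetric])
    ultimately have "Y' (?D y v) = (\<Sum>c\<in>Basis. (X y \<bullet> c) *\<^sub>R ?D2 c v + (X' v \<bullet> c) *\<^sub>R ?D y c)"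
      by (rule fun_cong[OF has_derivative_unique])
    then show ?thesis
      by (simp add: sum.distrib expand[OF \<Psi>(3), of "X' v"] expand2[of "X y" v])
  qed
  \<comment> \<open>The derivative, in the direction X y, of a function that is constant because
    \<Psi> is symplectic.\<close>
  have "symp (?D2 a (X y)) (?D y b) + symp (?D y a) (?D2 b (X y)) = 0"
  proof -
    have "((\<lambda>x. symp (?D x a) (?D x b)) has_derivative
        (\<lambda>v. symp (?D2 a v) (?D y b) + symp (?D y a) (?D2 b v))) (at y)"
      by (rule has_derivative_eq_rhs[OF bounded_bilinear.FDERIV[OF bounded_bilinear_symp D2 D2]])
         (simp add: add.commute)
    moreover have "((\<lambda>x. symp (?D x a) (?D x b)) has_derivative (\<lambda>_. 0)) (at y)"
      by (rule has_derivative_transform_within_open[OF has_derivative_const \<Psi>(2,3)]) (simp add: symp)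
    ultimately show ?thesis by (rule fun_cong[OF has_derivative_unique])
  qed
  then show ?thesis
    unfolding YD symp_add_left symp_add_right
    using second_derivative_symmetric[OF \<Psi>, of "X y" a] second_derivative_symmetric[OF \<Psi>, of "X y" b]
      symp[OF \<Psi>(3), of "X' a" b] symp[OF \<Psi>(3), of a "X' b"] liouville[of a b]
    by simp
qed

text \<open>The extension of (H - c) |q - P| over the collision fibre. Replacing |p|^2 + 1 by 2/(1 -
  \<xi>_0) and |q - P| by |\<eta>| (1 - \<xi>_0) removes the pole at P, and the formula is smooth on
  an open subset of the ambient space, not only on \<open>TS3\<close>.\<close>

definition moser_energy :: "real \<Rightarrow> real \<Rightarrow> body \<Rightarrow> cotangent \<Rightarrow> real" where
  "moser_energy \<mu> c P z =
     norm (snd z) * ((1 + fst (fst z)) / 2 - c * (1 - fst (fst z))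
       - mass \<mu> (other P) * (1 - fst (fst z)) / norm (fst (moser_map \<mu> P z) - position \<mu> (other P))
       - snd (fst z) $ 1 * fst (moser_map \<mu> P z) $ 2 + snd (fst z) $ 2 * fst (moser_map \<mu> P z) $ 1)
     - mass \<mu> P"

lemma fst_moser_map:
  "fst (moser_map \<mu> P z) = position \<mu> P + (1 - fst (fst z)) *\<^sub>R snd (snd z) + fst (snd z) *\<^sub>R snd (fst z)"
  by (simp add: moser_map_def case_prod_beta)

lemma Cinf_on_fst_moser_map: "Cinf_on UNIV (\<lambda>z. fst (moser_map \<mu> P z))"
  unfolding fst_moser_map by (intro Cinf_intros) auto

lemma open_fst_moser_map: "open A \<Longrightarrow> open {z. fst (moser_map \<mu> P z) \<in> A}"
  using open_vimage[OF _ Cinf_on_continuous_on[OF Cinf_on_fst_moser_map]] by (simp add: vimage_def)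

lemma Cinf_on_moser_energy:
  assumes "open B" "\<And>z. z \<in> B \<Longrightarrow> snd z \<noteq> 0"
    "\<And>z. z \<in> B \<Longrightarrow> fst (moser_map \<mu> P z) \<noteq> position \<mu> (other P)"
  shows "Cinf_on B (moser_energy \<mu> c P)"
  unfolding moser_energy_def[abs_def]
  using assms by (intro Cinf_intros Cinf_on_subset[OF Cinf_on_fst_moser_map]) auto

lemma moser_energy_inv:
  assumes "q \<noteq> position \<mu> P"
  shows "moser_energy \<mu> c P (moser_inv \<mu> P (q, p)) = (H \<mu> (q, p) - c) * norm (q - position \<mu> P)"
proof -
  define n where "n = p \<bullet> p + 1"
  have n: "n > 0" using inner_self_plus_1_pos n_def by metis
  define r where "r = norm (q - position \<mu> P)"
  have r: "r > 0" using assms by (simp add: r_def)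
  have pp: "(norm p)\<^sup>2 = n - 1" by (simp add: n_def power2_norm_eq_inner)
  define i where "i = 1 / norm (q - position \<mu> (other P))"
  have eq: "mass \<mu> (other P) * (2 * inverse n) / norm (q - position \<mu> (other P)) = mass \<mu> (other P) * (2 * inverse n) * i"
    "mass \<mu> (other P) / norm (q - position \<mu> (other P)) = mass \<mu> (other P) * i"
    by (simp_all add: i_def)
  have f: "fst (fst (moser_inv \<mu> P (q, p))) = 1 - 2 * inverse n"
    "snd (fst (moser_inv \<mu> P (q, p))) = - ((2 * inverse n) *\<^sub>R p)"
    by (simp_all add: moser_inv_def n_def)
  have m: "norm (snd (moser_inv \<mu> P (q, p))) = n / 2 * r"
    unfolding norm_snd_moser_inv by (simp add: n_def r_def)
  have s: "1 - (1 - 2 * inverse n) = 2 * inverse n" by simp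
  show ?thesis
    unfolding moser_energy_def H_body[of \<mu> q p P] moser_map_inv fst_conv f m pp r_def[symmetric] s eq
    using n r by (simp add: field_simps)
qed

lemma moser_domain_map:
  assumes "z \<in> moser_domain"
  shows "norm (fst (moser_map \<mu> P z) - position \<mu> P) < 1 / 2"
    "fst (moser_map \<mu> P z) \<noteq> position \<mu> (other P)"
    "fst z = north \<longleftrightarrow> fst (moser_map \<mu> P z) = position \<mu> P"
    "fst z \<noteq> north \<Longrightarrow> moser_map \<mu> P z \<in> phase_space \<mu>"
    "fst z \<noteq> north \<Longrightarrow> moser_inv \<mu> P (moser_map \<mu> P z) = z"
    "fst z = north \<longleftrightarrow> fst (fst z) = 1"
proof -
  have T: "z \<in> TS3" and e: "snd z \<noteq> 0" and b: "norm (snd z) * (1 - fst (fst z)) < 1 / 2"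
    using assms by (auto simp: moser_domain_def)
  show 1: "norm (fst (moser_map \<mu> P z) - position \<mu> P) < 1 / 2"
    using b norm_moser_map[OF T] by simp
  show 2: "fst (moser_map \<mu> P z) \<noteq> position \<mu> (other P)"
    using 1 norm_position_diff[of \<mu> P] by (auto simp: norm_minus_commute)
  show 3: "fst z = north \<longleftrightarrow> fst (fst z) = 1"
    by (rule TS3_north_iff[OF T])
  show 4: "fst z = north \<longleftrightarrow> fst (moser_map \<mu> P z) = position \<mu> P"
    using norm_moser_map[OF T, of \<mu> P] e 3 by auto
  show "moser_map \<mu> P z \<in> phase_space \<mu>" if "fst z \<noteq> north"
    using phase_space_iff[of _ \<mu> P] 2 4 that by blast
  show "moser_inv \<mu> P (moser_map \<mu> P z) = z" if "fst z \<noteq> north"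
    by (rule moser_inv_map[OF T that])
qed

lemma moser_energy_map:
  assumes "z \<in> moser_domain" "fst z \<noteq> north"
  shows "moser_energy \<mu> c P z =
    (H \<mu> (moser_map \<mu> P z) - c) * norm (fst (moser_map \<mu> P z) - position \<mu> P)"
  using moser_energy_inv[of "fst (moser_map \<mu> P z)" \<mu> P c "snd (moser_map \<mu> P z)"]
    moser_domain_map(3,5)[OF assms(1), of \<mu> P] assms(2) by simp

lemma moser_energy_north:
  assumes "fst z = north"
  shows "moser_energy \<mu> c P z = norm (snd z) - mass \<mu> P"
  using assms by (simp add: moser_energy_def north_def)

text \<open>A common form of the three regularized hypersurfaces, which differ only in the set Q of
  positions.\<close>

definition level_part :: "real \<Rightarrow> real \<Rightarrow> (real^3) set \<Rightarrow> wpoint set" where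
  "level_part \<mu> c Q = Phase ` {z \<in> energy_level \<mu> c. fst z \<in> Q}
     \<union> (\<Union>P\<in>{P. position \<mu> P \<in> Q}. glue \<mu> P ` collision_locus \<mu> P)"

lemma collision_locus_iff:
  "z \<in> collision_locus \<mu> P \<longleftrightarrow> z \<in> moser_domain \<and> fst z = north \<and> norm (snd z) = mass \<mu> P"
  by (auto simp: collision_locus_def)

lemma phase_part_level_part:
  "phase_part \<mu> (level_part \<mu> c Q) = {z \<in> phase_space \<mu>. H \<mu> z = c \<and> fst z \<in> Q}"
  by (auto simp: phase_part_def level_part_def glue_def collision_locus_iff energy_level_def)

lemma moser_part_level_part:
  "moser_part \<mu> P (level_part \<mu> c Q) =
     {z \<in> moser_domain. fst (moser_map \<mu> P z) \<in> Q \<and> moser_energy \<mu> c P z = 0}"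
proof -
  have "glue \<mu> P z \<in> level_part \<mu> c Q \<longleftrightarrow> fst (moser_map \<mu> P z) \<in> Q \<and> moser_energy \<mu> c P z = 0"
    if z: "z \<in> moser_domain" for z
  proof (cases "fst z = north")
    case True
    then have "glue \<mu> P z \<in> level_part \<mu> c Q \<longleftrightarrow> position \<mu> P \<in> Q \<and> norm (snd z) = mass \<mu> P"
      using z by (auto simp: level_part_def glue_def collision_locus_iff)
    then show ?thesis
      using True moser_domain_map(3)[OF z, of \<mu> P] moser_energy_north[OF True] by simp
  next
    case False
    then have "glue \<mu> P z \<in> level_part \<mu> c Q \<longleftrightarrow> moser_map \<mu> P z \<in> energy_level \<mu> c \<and> fst (moser_map \<mu> P z) \<in> Q"
      by (auto simp: level_part_def glue_def collision_locus_iff)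
    then show ?thesis
      using False moser_domain_map(3,4)[OF z, of \<mu> P] moser_energy_map[OF z False, of \<mu> c P]
      by (auto simp: energy_level_def)
  qed
  then show ?thesis by (auto simp: moser_part_def)
qed

lemma frechet_derivative_moser_inv: "frechet_derivative (moser_inv \<mu> P) (at z) = moser_inv_deriv \<mu> P z"
  using frechet_derivative_at[OF moser_inv_has_derivative] by metis

lemma moser_inv_deriv_radial:
  "moser_inv_deriv \<mu> P (q, p) (q - position \<mu> P, 0) = (0, snd (moser_inv \<mu> P (q, p)))"
  by (simp add: moser_inv_deriv_def moser_inv_def Let_def zero_prod_def)

text \<open>The whole fibre over the north pole is included, and not only the collision locus,
  because the set has to be open in \<open>W\<close>.\<close>

definition chart_domain :: "real \<Rightarrow> (real^3) set \<Rightarrow> phase set \<Rightarrow> wpoint set" where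
  "chart_domain \<mu> Q G = Phase ` G \<union>
     (\<Union>P\<in>{P. position \<mu> P \<in> Q}. Collision P ` {z \<in> moser_domain. fst z = north})"

text \<open>The value over the north pole is the one that \<open>moser_inv_deriv_radial\<close>
  gives for the transported radial field nearby.\<close>

definition chart_field :: "real \<Rightarrow> (phase \<Rightarrow> phase) \<Rightarrow> body \<Rightarrow> cotangent \<Rightarrow> cotangent" where
  "chart_field \<mu> X P z = (if fst z = north then (0, snd z)
     else moser_inv_deriv \<mu> P (moser_map \<mu> P z) (X (moser_map \<mu> P z)))"

lemma phase_part_chart_domain: "G \<subseteq> phase_space \<mu> \<Longrightarrow> phase_part \<mu> (chart_domain \<mu> Q G) = G"
  by (auto simp: phase_part_def chart_domain_def)

lemma moser_part_chart_domain:
  "moser_part \<mu> P (chart_domain \<mu> Q G) =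
    {z \<in> moser_domain. if fst z = north then position \<mu> P \<in> Q else moser_map \<mu> P z \<in> G}"
  by (auto simp: moser_part_def chart_domain_def glue_def)

lemma open_moser_chart: "open G \<Longrightarrow> open {z. fst (fst z) \<noteq> 1 \<and> moser_map \<mu> P z \<in> G}"
proof -
  assume "open G"
  have o: "open {z :: cotangent. fst (fst z) \<noteq> 1}"
    by (auto intro!: open_Collect_neq continuous_intros)
  show ?thesis
    using continuous_open_preimage[OF Cinf_on_continuous_on[OF Cinf_on_moser_map] o \<open>open G\<close>, of \<mu> P]
    by (simp add: vimage_def Int_def)
qed

lemma Cinf_on_moser_inv_deriv:
  assumes "open S" "Cinf_on S f" "Cinf_on S g"
  shows "Cinf_on S (\<lambda>z. moser_inv_deriv \<mu> P (f z) (g z))"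
  using assms unfolding moser_inv_deriv_def Let_def
  by (intro Cinf_intros) (auto simp: less_imp_neq[OF inner_self_plus_1_pos, symmetric])

text \<open>Obtained by differentiating \<open>moser_inv\<close> after \<open>moser_map\<close>,
  which is the identity on the domain but not on the ambient space. Tangent vectors thereby take the
  form required by \<open>liouville_push_forward\<close>.\<close>

lemma moser_tangent:
  assumes z: "z \<in> moser_domain" "fst z \<noteq> north" and u: "u \<in> tangent_space moser_domain z"
  shows "\<exists>a. u = moser_inv_deriv \<mu> P (moser_map \<mu> P z) a"
proof -
  have nz: "fst (fst z) \<noteq> 1" using z moser_domain_map(6) by blast
  have o: "open {z :: cotangent. fst (fst z) \<noteq> 1}"
    by (auto intro!: open_Collect_neq continuous_intros)
  obtain d where d: "d > 0" "ball z d \<subseteq> {z. fst (fst z) \<noteq> 1}"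
    using o nz open_contains_ball by blast
  have m: "(moser_map \<mu> P has_derivative frechet_derivative (moser_map \<mu> P) (at z)) (at z)"
    by (rule Cinf_on_has_derivative[OF Cinf_on_moser_map o]) (use nz in simp)
  have "((\<lambda>y. moser_inv \<mu> P (moser_map \<mu> P y)) has_derivative
      (\<lambda>v. moser_inv_deriv \<mu> P (moser_map \<mu> P z) (frechet_derivative (moser_map \<mu> P) (at z) v)))
      (at z within moser_domain)"
    by (rule has_derivative_at_withinI[OF has_derivative_compose[OF m moser_inv_has_derivative]])
  then have "((\<lambda>y. y) has_derivative
      (\<lambda>v. moser_inv_deriv \<mu> P (moser_map \<mu> P z) (frechet_derivative (moser_map \<mu> P) (at z) v)))
      (at z within moser_domain)"
  proof (rule has_derivative_transform_within[OF _ d(1) z(1)])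
    fix y assume "y \<in> moser_domain" "dist y z < d"
    then have "y \<in> ball z d" by (simp add: dist_commute)
    then have "fst (fst y) \<noteq> 1" using d(2) by blast
    then show "moser_inv \<mu> P (moser_map \<mu> P y) = y"
      using moser_domain_map(5)[OF \<open>y \<in> moser_domain\<close>, of \<mu> P]
        moser_domain_map(6)[OF \<open>y \<in> moser_domain\<close>] by blast
  qed
  from tangent_derivative_eq[OF u this has_derivative_ident] show ?thesis by metis
qed

section \<open>Extending a Liouville field over the collision fibres\<close>

context
  fixes \<mu> c :: real and Q :: "(real^3) set" and G :: "phase set" and X :: "phase \<Rightarrow> phase"
  assumes \<mu>: "0 < \<mu>" "\<mu> < 1"
    and Q: "open Q" and G: "open G" "G \<subseteq> phase_space \<mu>"
    and X: "Cinf_on G X"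
    and liouville: "\<And>z u v. z \<in> G \<Longrightarrow>
      symp (frechet_derivative X (at z) u) v + symp u (frechet_derivative X (at z) v) = symp u v"
    and radial: "\<And>P. position \<mu> P \<in> Q \<Longrightarrow> \<exists>e>0. \<forall>z\<in>phase_space \<mu>.
      norm (fst z - position \<mu> P) < e \<longrightarrow> z \<in> G \<and> X z = (fst z - position \<mu> P, 0)"
    and level: "\<And>z. z \<in> phase_space \<mu> \<Longrightarrow> H \<mu> z = c \<Longrightarrow> fst z \<in> Q \<Longrightarrow>
      z \<in> G \<and> (\<exists>D. (H \<mu> has_derivative D) (at z) \<and> D (X z) \<noteq> 0)"
begin

lemma mass_pos: "mass \<mu> P > 0"
  using \<mu> by (cases P) auto

text \<open>By the assumption \<open>radial\<close>, X is (q - P, 0) over a ball around P, and there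
  it is transported to (0, \<eta>). Near the collision fibre the field is thus given by a single
  smooth formula.\<close>

lemma chart_field_collision:
  assumes "position \<mu> P \<in> Q"
  shows "\<exists>B. open B \<and> (\<forall>z. fst z = north \<longrightarrow> z \<in> B) \<and> (\<forall>z\<in>moser_domain \<inter> B.
    z \<in> moser_part \<mu> P (chart_domain \<mu> Q G) \<and> chart_field \<mu> X P z = (0, snd z))"
proof -
  obtain e where e: "e > 0" "\<And>z. z \<in> phase_space \<mu> \<Longrightarrow> norm (fst z - position \<mu> P) < e \<Longrightarrow>
      z \<in> G \<and> X z = (fst z - position \<mu> P, 0)"
    using radial[OF assms] by blast
  define B where "B = {z. fst (moser_map \<mu> P z) \<in> ball (position \<mu> P) e}"
  have "open B" unfolding B_def by (rule open_fst_moser_map) simp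
  moreover have "z \<in> B" if "fst z = north" for z
    using that e(1) by (simp add: B_def fst_moser_map north_def)
  moreover have "z \<in> moser_part \<mu> P (chart_domain \<mu> Q G) \<and> chart_field \<mu> X P z = (0, snd z)"
    if z: "z \<in> moser_domain" "z \<in> B" for z
  proof (cases "fst z = north")
    case True
    then show ?thesis using z assms by (simp add: moser_part_chart_domain chart_field_def)
  next
    case False
    have "moser_map \<mu> P z \<in> G"
      and Xz: "X (moser_map \<mu> P z) = (fst (moser_map \<mu> P z) - position \<mu> P, 0)"
      using e(2)[OF moser_domain_map(4)[OF z(1) False]] z(2)
      by (auto simp: B_def dist_norm norm_minus_commute)
    then show ?thesis
      using z False moser_inv_deriv_radial[of \<mu> P "fst (moser_map \<mu> P z)" "snd (moser_map \<mu> P z)"]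
        moser_domain_map(5)[OF z(1) False, of \<mu> P]
      by (simp add: moser_part_chart_domain chart_field_def)
  qed
  ultimately show ?thesis by blast
qed

lemma Cinf_on_chart_field:
  "Cinf_on {z. fst (fst z) \<noteq> 1 \<and> moser_map \<mu> P z \<in> G} (chart_field \<mu> X P)" (is "Cinf_on ?N _")
proof -
  have o: "open ?N" by (rule open_moser_chart[OF G(1)])
  have m: "Cinf_on ?N (moser_map \<mu> P)"
    by (rule Cinf_on_subset[OF Cinf_on_moser_map]) auto
  have "Cinf_on ?N (\<lambda>z. moser_inv_deriv \<mu> P (moser_map \<mu> P z) (X (moser_map \<mu> P z)))"
    by (intro Cinf_on_moser_inv_deriv o m Cinf_on_compose[OF X G(1)]) auto
  moreover have "moser_inv_deriv \<mu> P (moser_map \<mu> P z) (X (moser_map \<mu> P z)) = chart_field \<mu> X P z"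
    if "z \<in> ?N" for z
    using that by (auto simp: chart_field_def north_def)
  ultimately show ?thesis
    using Cinf_on_cong[of ?N "\<lambda>z. moser_inv_deriv \<mu> P (moser_map \<mu> P z) (X (moser_map \<mu> P z))"
        "chart_field \<mu> X P"] o by blast
qed

lemma chart_cases:
  assumes "z \<in> moser_part \<mu> P (chart_domain \<mu> Q G)"
  obtains (collision) B where "fst z = north" "position \<mu> P \<in> Q" "open B" "z \<in> B"
      "\<And>y. y \<in> moser_domain \<Longrightarrow> y \<in> B \<Longrightarrow>
        y \<in> moser_part \<mu> P (chart_domain \<mu> Q G) \<and> chart_field \<mu> X P y = (0, snd y)"
  | (regular) N where "fst z \<noteq> north" "fst (fst z) \<noteq> 1" "moser_map \<mu> P z \<in> G"
      "N = {z. fst (fst z) \<noteq> 1 \<and> moser_map \<mu> P z \<in> G}" "open N" "z \<in> N"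
      "Cinf_on N (chart_field \<mu> X P)"
proof (cases "fst z = north")
  case True
  then have "position \<mu> P \<in> Q" using assms by (simp add: moser_part_chart_domain)
  then show ?thesis using collision True chart_field_collision[of P] by blast
next
  case False
  have z: "z \<in> moser_domain" "moser_map \<mu> P z \<in> G"
    using assms False by (auto simp: moser_part_chart_domain)
  have "fst (fst z) \<noteq> 1" using moser_domain_map(6)[OF z(1)] False by blast
  then show ?thesis
    using regular[OF False _ z(2) refl open_moser_chart[OF G(1)] _ Cinf_on_chart_field] z(2) by blast
qed

lemma moser_part_subset: "moser_part \<mu> P S \<subseteq> moser_domain"
  by (auto simp: moser_part_def)

lemma W_open_chart_domain: "W_open \<mu> (chart_domain \<mu> Q G)"
  unfolding W_open_def
proof (intro conjI allI)
  show "chart_domain \<mu> Q G \<subseteq> W \<mu>"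
  proof
    fix w assume "w \<in> chart_domain \<mu> Q G"
    then consider z where "w = Phase z" "z \<in> G" | P z where "w = Collision P z" "z \<in> moser_domain" "fst z = north"
      by (auto simp: chart_domain_def)
    then show "w \<in> W \<mu>"
    proof cases
      case 1
      then show ?thesis using G(2) by (auto simp: W_def)
    next
      case 2
      then have "w = glue \<mu> P z" by (simp add: glue_def)
      then show ?thesis using 2 by (auto simp: W_def)
    qed
  qed
  show "openin (top_of_set (phase_space \<mu>)) (phase_part \<mu> (chart_domain \<mu> Q G))"
    using G by (simp add: phase_part_chart_domain open_openin_trans open_phase_space)
  fix P
  show "openin (top_of_set moser_domain) (moser_part \<mu> P (chart_domain \<mu> Q G))" (is "openin _ ?T")
  proof (subst openin_subopen, intro ballI)
    fix z assume z: "z \<in> ?T"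
    then have zd: "z \<in> moser_domain" using moser_part_subset by blast
    from z show "\<exists>T. openin (top_of_set moser_domain) T \<and> z \<in> T \<and> T \<subseteq> ?T"
    proof (cases rule: chart_cases)
      case (collision B)
      then show ?thesis
        using zd by (intro exI[of _ "moser_domain \<inter> B"]) (auto simp: openin_open_Int)
    next
      case (regular N)
      have "moser_domain \<inter> N \<subseteq> ?T"
        using moser_domain_map(6) by (auto simp: regular(4) moser_part_chart_domain)
      then show ?thesis
        using zd regular
        by (intro exI[of _ "moser_domain \<inter> N"]) (auto simp: openin_open_Int)
    qed
  qed
qed

lemma chart_field_tangent:
  assumes "z \<in> moser_part \<mu> P (chart_domain \<mu> Q G)"
  shows "chart_field \<mu> X P z \<in> tangent_space moser_domain z"
  using assms
proof (cases rule: chart_cases)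
  case (collision B)
  have z: "z \<in> moser_domain" using assms moser_part_subset by blast
  obtain \<eta> where z': "z = (north, \<eta>)" using collision(1) by (cases z) auto
  \<comment> \<open>Positive multiples of \<eta> over the north pole stay in the domain, because 1 -
    \<xi>_0 vanishes there.\<close>
  let ?\<Psi> = "\<lambda>t::real. (north, t *\<^sub>R \<eta>)"
  have d: "(?\<Psi> has_derivative (\<lambda>h. (0, h *\<^sub>R \<eta>))) (at 1)"
    by (auto intro!: derivative_eq_intros)
  have "?\<Psi> ` {0<..} \<subseteq> moser_domain"
    using z by (auto simp: z' moser_domain_def TS3_def north_def)
  moreover have "Cinf_on {0<..} ?\<Psi>" by (intro Cinf_intros) auto
  ultimately have "(0, 1 *\<^sub>R \<eta>) \<in> tangent_space moser_domain (?\<Psi> 1)"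
    by (intro tangent_spaceI[OF _ _ _ _ d]) auto
  then have "(0, \<eta>) \<in> tangent_space moser_domain z" by (simp add: z')
  then show ?thesis using collision(5)[OF z collision(4)] z' by simp
next
  case (regular N)
  have z: "z \<in> moser_domain" using assms moser_part_subset by blast
  let ?S = "{y. norm (fst y - position \<mu> P) > 0 \<and> norm (fst y - position \<mu> P) < 1 / 2} :: phase set"
  have "open ?S"
    by (intro open_Collect_conj open_Collect_less continuous_intros)
  moreover have "moser_map \<mu> P z \<in> ?S"
    using moser_domain_map(1,3)[OF z, of \<mu> P] regular(1) by simp
  moreover have "moser_inv \<mu> P ` ?S \<subseteq> moser_domain"
    using moser_inv_domain by auto
  ultimately have "moser_inv_deriv \<mu> P (moser_map \<mu> P z) (X (moser_map \<mu> P z))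
      \<in> tangent_space moser_domain (moser_inv \<mu> P (moser_map \<mu> P z))"
    by (intro tangent_spaceI[OF Cinf_on_subset[OF Cinf_on_moser_inv] _ _ _ moser_inv_has_derivative]) auto
  then show ?thesis
    using regular(1) moser_domain_map(5)[OF z regular(1), of \<mu> P] by (simp add: chart_field_def)
qed

lemma W_vector_field_chart_field: "W_vector_field \<mu> (chart_domain \<mu> Q G) X (chart_field \<mu> X)"
  unfolding W_vector_field_def
proof (intro conjI allI ballI impI)
  show "vector_field_on (phase_space \<mu>) (phase_part \<mu> (chart_domain \<mu> Q G)) X"
    using G X by (auto simp: vector_field_on_def phase_part_chart_domain tangent_space_open open_phase_space
        intro!: Cinf_on_imp_smooth_on)
  fix P
  show "vector_field_on moser_domain (moser_part \<mu> P (chart_domain \<mu> Q G)) (chart_field \<mu> X P)"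
    unfolding vector_field_on_def
  proof (intro conjI ballI chart_field_tangent smooth_onI)
    fix z assume z: "z \<in> moser_part \<mu> P (chart_domain \<mu> Q G)"
    then show "\<exists>B g. open B \<and> z \<in> B \<and> Cinf_on B g \<and>
        (\<forall>y\<in>B \<inter> moser_part \<mu> P (chart_domain \<mu> Q G). chart_field \<mu> X P y = g y)"
    proof (cases rule: chart_cases)
      case (collision B)
      have "Cinf_on B (\<lambda>z. (0, snd z))" using collision(3) by (intro Cinf_intros)
      then show ?thesis using collision moser_part_subset by blast
    next
      case (regular N)
      then show ?thesis by blast
    qed
  qed
  fix z assume z: "z \<in> moser_part \<mu> P (chart_domain \<mu> Q G)" "fst z \<noteq> north"
  then have zd: "z \<in> moser_domain" using moser_part_subset by blast
  have o: "open {z :: cotangent. fst (fst z) \<noteq> 1}"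
    by (auto intro!: open_Collect_neq continuous_intros)
  have inv: "moser_inv \<mu> P (moser_map \<mu> P z) = z"
    by (rule moser_domain_map(5)[OF zd z(2)])
  have m: "(moser_map \<mu> P has_derivative frechet_derivative (moser_map \<mu> P) (at z)) (at z)"
    by (rule Cinf_on_has_derivative[OF Cinf_on_moser_map o])
       (use moser_domain_map(6)[OF zd] z(2) in simp)
  have "((\<lambda>y. moser_map \<mu> P (moser_inv \<mu> P y)) has_derivative
      (\<lambda>v. frechet_derivative (moser_map \<mu> P) (at z) (moser_inv_deriv \<mu> P (moser_map \<mu> P z) v)))
      (at (moser_map \<mu> P z))"
    by (rule has_derivative_compose[OF moser_inv_has_derivative]) (use m inv in simp)
  then have "((\<lambda>y. y) has_derivative
      (\<lambda>v. frechet_derivative (moser_map \<mu> P) (at z) (moser_inv_deriv \<mu> P (moser_map \<mu> P z) v)))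
      (at (moser_map \<mu> P z))"
    by (simp add: moser_map_inv)
  from fun_cong[OF has_derivative_unique[OF has_derivative_ident this], of "X (moser_map \<mu> P z)"]
  show "X (moser_map \<mu> P z) = frechet_derivative (moser_map \<mu> P) (at z) (chart_field \<mu> X P z)"
    using z(2) by (simp add: chart_field_def)
qed

text \<open>The form has constant coefficients, so the first term of \<open>lie_derivative\<close>
  vanishes; on tangent vectors any derivative D within V may stand for the one chosen by
  \<open>frechet_derivative\<close>.\<close>

lemma lie_derivative_symp:
  fixes V :: "('a::euclidean_space \<times> 'a) set"
  assumes "Z x \<in> tangent_space V x" "u \<in> tangent_space V x" "v \<in> tangent_space V x"
    and "(Z has_derivative D) (at x within V)"
  shows "lie_derivative V Z (\<lambda>_. symp) x u v = symp (D u) v + symp u (D v)"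
  unfolding lie_derivative_def
    frechet_derivative_within_tangent[OF assms(1) has_derivative_const]
    frechet_derivative_within_tangent[OF assms(2,4)] frechet_derivative_within_tangent[OF assms(3,4)]
  by simp

lemma W_liouville_chart_field: "W_liouville \<mu> (chart_domain \<mu> Q G) X (chart_field \<mu> X)"
  unfolding W_liouville_def
proof (intro conjI allI W_vector_field_chart_field)
  show "liouville_on (phase_space \<mu>) (phase_part \<mu> (chart_domain \<mu> Q G)) X"
    unfolding liouville_on_def phase_part_chart_domain[OF G(2)]
  proof (intro ballI)
    fix z u v assume z: "z \<in> G"
    then have "z \<in> phase_space \<mu>" using G(2) by blast
    note t = tangent_space_open[OF open_phase_space this]
    have "(X has_derivative frechet_derivative X (at z)) (at z within phase_space \<mu>)"
      by (rule has_derivative_at_withinI[OF Cinf_on_has_derivative[OF X G(1) z]])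
    then show "lie_derivative (phase_space \<mu>) X (\<lambda>_. symp) z u v = symp u v"
      using lie_derivative_symp[where Z = X and x = z and V = "phase_space \<mu>" and u = u and v = v]
        t liouville[OF z] by simp
  qed
  fix P
  show "liouville_on moser_domain (moser_part \<mu> P (chart_domain \<mu> Q G)) (chart_field \<mu> X P)"
    unfolding liouville_on_def
  proof (intro ballI)
    fix z u v assume z: "z \<in> moser_part \<mu> P (chart_domain \<mu> Q G)"
      and u: "u \<in> tangent_space moser_domain z" and v: "v \<in> tangent_space moser_domain z"
    have zd: "z \<in> moser_domain" using z moser_part_subset by blast
    note t = chart_field_tangent[OF z]
    from z show "lie_derivative moser_domain (chart_field \<mu> X P) (\<lambda>_. symp) z u v = symp u v"
    proof (cases rule: chart_cases)
      case (collision B)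
      obtain d where d: "d > 0" "ball z d \<subseteq> B" using collision(3,4) open_contains_ball by blast
      have "((\<lambda>z. (0, snd z)) has_derivative (\<lambda>u. (0, snd u))) (at z within moser_domain)"
        by (auto intro!: derivative_eq_intros)
      then have "(chart_field \<mu> X P has_derivative (\<lambda>u. (0, snd u))) (at z within moser_domain)"
        by (rule has_derivative_transform_within[OF _ d(1) zd])
           (use collision(5) d(2) in \<open>auto simp: dist_commute subset_iff\<close>)
      then show ?thesis
        by (subst lie_derivative_symp[where Z = "chart_field \<mu> X P" and x = z, OF t u v]) (auto simp: symp_def)
    next
      case (regular N)
      let ?Y = "frechet_derivative (chart_field \<mu> X P) (at z)"
      let ?y = "moser_map \<mu> P z"
      have inv: "moser_inv \<mu> P ?y = z" by (rule moser_domain_map(5)[OF zd regular(1)])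
      have Y: "(chart_field \<mu> X P has_derivative ?Y) (at z)"
        by (rule Cinf_on_has_derivative[OF regular(7,5,6)])
      obtain a where a: "u = moser_inv_deriv \<mu> P ?y a"
        using moser_tangent[OF zd regular(1) u] by blast
      obtain b where b: "v = moser_inv_deriv \<mu> P ?y b"
        using moser_tangent[OF zd regular(1) v] by blast
      have rel: "chart_field \<mu> X P (moser_inv \<mu> P x) = frechet_derivative (moser_inv \<mu> P) (at x) (X x)" for x
        using fst_moser_inv_neq[of \<mu> P x]
        by (auto simp: chart_field_def moser_map_inv frechet_derivative_moser_inv north_def)
      have "symp (?Y u) v + symp u (?Y v) = symp a b"
        using liouville_push_forward[where \<Psi> = "moser_inv \<mu> P" and y = ?y and Y = "chart_field \<mu> X P"
            and Y' = ?Y and a = a and b = b, OF Cinf_on_moser_inv open_UNIV UNIV_I _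
            Cinf_on_has_derivative[OF X G(1) regular(3)] _ rel liouville[OF regular(3)]]
          Y inv a b by (simp add: frechet_derivative_moser_inv symp_moser_inv_deriv)
      then show ?thesis
        using a b symp_moser_inv_deriv
        by (subst lie_derivative_symp[where Z = "chart_field \<mu> X P" and x = z,
              OF t u v has_derivative_at_withinI[OF Y]]) auto
    qed
  qed
qed

text \<open>At a collision point the function is t |\<eta>| - m at t \<eta>, so its derivative along
  the field (0, \<eta>) is the mass. Elsewhere it is (H - c) |q - P| in the chart, whose derivative
  along the field is dH(X) |q - P| where H = c.\<close>

lemma moser_energy_regular:
  assumes "z \<in> moser_part \<mu> P (level_part \<mu> c Q)"
  shows "\<exists>B. open B \<and> z \<in> B \<and> (\<forall>y\<in>B. fst (moser_map \<mu> P y) \<in> Q) \<and> Cinf_on B (moser_energy \<mu> c P)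
    \<and> frechet_derivative (moser_energy \<mu> c P) (at z) (chart_field \<mu> X P z) \<noteq> 0
    \<and> z \<in> moser_part \<mu> P (chart_domain \<mu> Q G)"
proof -
  let ?F = "moser_energy \<mu> c P"
  have z: "z \<in> moser_domain" "fst (moser_map \<mu> P z) \<in> Q" "?F z = 0"
    using assms by (auto simp: moser_part_level_part)
  define B where "B = {y. snd y \<noteq> 0} \<inter> {y. fst (moser_map \<mu> P y) \<in> Q - {position \<mu> (other P)}}"
  have B: "open B" unfolding B_def
    by (intro open_Int open_Collect_neq open_fst_moser_map open_Diff Q continuous_intros)
  have zB: "z \<in> B"
    using z moser_domain_map(2)[OF z(1)] by (auto simp: B_def moser_domain_def)
  have F: "Cinf_on B ?F"
    by (rule Cinf_on_moser_energy[OF B]) (auto simp: B_def)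
  have D: "(?F has_derivative frechet_derivative ?F (at z)) (at z)"
    by (rule Cinf_on_has_derivative[OF F B zB])
  have "frechet_derivative ?F (at z) (chart_field \<mu> X P z) \<noteq> 0 \<and> z \<in> moser_part \<mu> P (chart_domain \<mu> Q G)"
  proof (cases "fst z = north")
    case True
    then obtain \<eta> where z': "z = (north, \<eta>)" by (cases z) auto
    have "norm \<eta> = mass \<mu> P" using moser_energy_north[OF True, of \<mu> c P] z(3) z' by simp
    moreover have "((\<lambda>t. (north, t *\<^sub>R \<eta>)) has_derivative (\<lambda>h. (0, h *\<^sub>R \<eta>))) (at 1)"
      by (auto intro!: derivative_eq_intros)
    then have "((\<lambda>t. ?F (north, t *\<^sub>R \<eta>)) has_derivative
        (\<lambda>h. frechet_derivative ?F (at z) (0, h *\<^sub>R \<eta>))) (at 1)"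
      by (rule has_derivative_compose) (use D z' in simp)
    moreover have "((\<lambda>t. t * norm \<eta> - mass \<mu> P) has_derivative (\<lambda>h. h * norm \<eta>)) (at 1)"
      by (auto intro!: derivative_eq_intros)
    then have "((\<lambda>t. ?F (north, t *\<^sub>R \<eta>)) has_derivative (\<lambda>h. h * norm \<eta>)) (at 1)"
      by (rule has_derivative_transform_within_open[where s = "{0<..}"]) (auto simp: moser_energy_north)
    ultimately have "frechet_derivative ?F (at z) (0, 1 *\<^sub>R \<eta>) = 1 * mass \<mu> P"
      by (metis (no_types, lifting) has_derivative_unique)
    moreover have "position \<mu> P \<in> Q"
      using z(2) moser_domain_map(3)[OF z(1), of \<mu> P] True by simp
    ultimately show ?thesis
      using True z(1) mass_pos[of P] z' by (simp add: chart_field_def moser_part_chart_domain)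
  next
    case False
    let ?y = "moser_map \<mu> P z"
    have inv: "moser_inv \<mu> P ?y = z" by (rule moser_domain_map(5)[OF z(1) False])
    have yS: "?y \<in> phase_space \<mu>" by (rule moser_domain_map(4)[OF z(1) False])
    have neq: "fst ?y \<noteq> position \<mu> P" using moser_domain_map(3)[OF z(1), of \<mu> P] False by blast
    have "H \<mu> ?y = c"
      using moser_energy_map[OF z(1) False, of \<mu> c P] z(3) neq by simp
    then obtain D' where yG: "?y \<in> G" and D': "(H \<mu> has_derivative D') (at ?y)" "D' (X ?y) \<noteq> 0"
      using level[OF yS _ z(2)] by blast
    have "((\<lambda>y. norm (fst y - position \<mu> P)) has_derivative
        frechet_derivative (\<lambda>y. norm (fst y - position \<mu> P)) (at ?y)) (at ?y)"
    proof (rule Cinf_on_has_derivative[OF _ open_phase_space yS])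
      show "Cinf_on (phase_space \<mu>) (\<lambda>y. norm (fst y - position \<mu> P))"
        using phase_space_iff[of _ \<mu> P] by (intro Cinf_intros open_phase_space) auto
    qed
    from has_derivative_mult[OF has_derivative_diff[OF D'(1) has_derivative_const[of c]] this]
    have "((\<lambda>y. (H \<mu> y - c) * norm (fst y - position \<mu> P)) has_derivative
        (\<lambda>v. D' v * norm (fst ?y - position \<mu> P))) (at ?y)"
      using \<open>H \<mu> ?y = c\<close> by simp
    then have "((\<lambda>y. ?F (moser_inv \<mu> P y)) has_derivative
        (\<lambda>v. D' v * norm (fst ?y - position \<mu> P))) (at ?y)"
    proof (rule has_derivative_transform_within_open[OF _ open_phase_space yS])
      fix y assume "y \<in> phase_space \<mu>"
      then show "(H \<mu> y - c) * norm (fst y - position \<mu> P) = ?F (moser_inv \<mu> P y)"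
        using moser_energy_inv[of "fst y" \<mu> P c "snd y"] phase_space_iff[of y \<mu> P] by simp
    qed
    moreover have "((\<lambda>y. ?F (moser_inv \<mu> P y)) has_derivative
        (\<lambda>v. frechet_derivative ?F (at z) (moser_inv_deriv \<mu> P ?y v))) (at ?y)"
      by (rule has_derivative_compose[OF moser_inv_has_derivative]) (use D inv in simp)
    ultimately have "frechet_derivative ?F (at z) (moser_inv_deriv \<mu> P ?y (X ?y)) =
        D' (X ?y) * norm (fst ?y - position \<mu> P)"
      by (metis (no_types, lifting) has_derivative_unique)
    then show ?thesis
      using D'(2) neq False z(1) yG by (simp add: chart_field_def moser_part_chart_domain)
  qed
  then show ?thesis using B zB F by (intro exI[of _ B]) (auto simp: B_def)
qed

lemma level_part_subset: "level_part \<mu> c Q \<subseteq> chart_domain \<mu> Q G"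
proof
  fix w assume "w \<in> level_part \<mu> c Q"
  then consider z where "w = Phase z" "z \<in> energy_level \<mu> c" "fst z \<in> Q"
    | P z where "w = glue \<mu> P z" "position \<mu> P \<in> Q" "z \<in> collision_locus \<mu> P"
    by (auto simp: level_part_def)
  then show "w \<in> chart_domain \<mu> Q G"
  proof cases
    case 1
    then show ?thesis using level[of z] by (auto simp: chart_domain_def energy_level_def)
  next
    case 2
    then show ?thesis by (auto simp: chart_domain_def collision_locus_iff glue_def)
  qed
qed

text \<open>In every chart the hypersurface is the zero set of a function with nonzero derivative
  along the field. This one fact gives both regularity and transversality, since the derivative
  annihilates the vectors tangent to the zero set.\<close>

theorem contact_type_level_part: "contact_type \<mu> (level_part \<mu> c Q)"
proof -
  have DH: "(H \<mu> has_derivative frechet_derivative (H \<mu>) (at z)) (at z)"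
    "frechet_derivative (H \<mu>) (at z) (X z) \<noteq> 0" "z \<in> phase_space \<mu>" "z \<in> G"
    if z: "z \<in> phase_part \<mu> (level_part \<mu> c Q)" for z
    using z level[of z] frechet_derivative_at[of "H \<mu>" _ z] by (auto simp: phase_part_level_part)
  have "W_hypersurface \<mu> (level_part \<mu> c Q)"
    unfolding W_hypersurface_def
  proof (intro conjI allI)
    show "level_part \<mu> c Q \<subseteq> W \<mu>"
      using level_part_subset W_open_chart_domain by (auto simp: W_open_def)
    show "hypersurface_in (phase_space \<mu>) (phase_part \<mu> (level_part \<mu> c Q))"
      unfolding hypersurface_in_def
    proof (intro conjI ballI)
      show "phase_part \<mu> (level_part \<mu> c Q) \<subseteq> phase_space \<mu>" by (auto simp: phase_part_def)
      fix z assume z: "z \<in> phase_part \<mu> (level_part \<mu> c Q)"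
      define B where "B = phase_space \<mu> \<inter> fst -` Q"
      have B: "open B" unfolding B_def by (intro open_Int open_phase_space open_vimage_fst Q)
      have HB: "Cinf_on B (\<lambda>z. H \<mu> z - c)"
        unfolding H_def case_prod_beta power2_norm_eq_inner
        by (intro Cinf_intros B) (auto simp: B_def phase_space_def)
      have "((\<lambda>z. H \<mu> z - c) has_derivative frechet_derivative (H \<mu>) (at z)) (at z)"
        using has_derivative_diff[OF DH(1)[OF z] has_derivative_const[of c]] by simp
      then have "frechet_derivative (\<lambda>z. H \<mu> z - c) (at z) (X z) \<noteq> 0"
        using DH(2)[OF z] frechet_derivative_at[of "\<lambda>z. H \<mu> z - c" _ z] by force
      then have t: "\<exists>v\<in>tangent_space (phase_space \<mu>) z. frechet_derivative (\<lambda>z. H \<mu> z - c) (at z) v \<noteq> 0"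
        using tangent_space_open[OF open_phase_space DH(3)[OF z]] by blast
      show "\<exists>B F. open B \<and> z \<in> B \<and> smooth_on B F \<and>
          phase_part \<mu> (level_part \<mu> c Q) \<inter> B = {y \<in> phase_space \<mu> \<inter> B. F y = (0::real)} \<and>
          (\<exists>v\<in>tangent_space (phase_space \<mu>) z. frechet_derivative F (at z) v \<noteq> 0)"
        by (rule exI[of _ B], rule exI[of _ "\<lambda>z. H \<mu> z - c"], intro conjI t B Cinf_on_imp_smooth_on HB)
           (use z DH(3)[OF z] in \<open>auto simp: B_def phase_part_level_part\<close>)
    qed
    fix P
    show "hypersurface_in moser_domain (moser_part \<mu> P (level_part \<mu> c Q))"
      unfolding hypersurface_in_def
    proof (intro conjI ballI moser_part_subset)
      fix z assume z: "z \<in> moser_part \<mu> P (level_part \<mu> c Q)"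
      obtain B where B: "open B" "z \<in> B" "\<forall>y\<in>B. fst (moser_map \<mu> P y) \<in> Q"
        "Cinf_on B (moser_energy \<mu> c P)"
        "frechet_derivative (moser_energy \<mu> c P) (at z) (chart_field \<mu> X P z) \<noteq> 0"
        "z \<in> moser_part \<mu> P (chart_domain \<mu> Q G)"
        using moser_energy_regular[OF z] by blast
      then show "\<exists>B F. open B \<and> z \<in> B \<and> smooth_on B F \<and>
          moser_part \<mu> P (level_part \<mu> c Q) \<inter> B = {y \<in> moser_domain \<inter> B. F y = (0::real)} \<and>
          (\<exists>v\<in>tangent_space moser_domain z. frechet_derivative F (at z) v \<noteq> 0)"
        using chart_field_tangent[OF B(6)]
        by (intro exI[of _ B] exI[of _ "moser_energy \<mu> c P"])
           (auto simp: moser_part_level_part intro!: Cinf_on_imp_smooth_on)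
    qed
  qed
  moreover have "W_transverse \<mu> (level_part \<mu> c Q) X (chart_field \<mu> X)"
    unfolding W_transverse_def transverse_on_def
  proof (intro conjI allI ballI notI)
    fix z assume z: "z \<in> phase_part \<mu> (level_part \<mu> c Q)"
      and t: "X z \<in> tangent_space (phase_part \<mu> (level_part \<mu> c Q)) z"
    have "frechet_derivative (H \<mu>) (at z) (X z) - 0 = 0"
      by (rule tangent_derivative_eq_0[OF t z open_UNIV UNIV_I _
            has_derivative_diff[OF DH(1)[OF z] has_derivative_const[of c]]])
         (auto simp: phase_part_level_part)
    then show False using DH(2)[OF z] by simp
  next
    fix P z assume z: "z \<in> moser_part \<mu> P (level_part \<mu> c Q)"
      and t: "chart_field \<mu> X P z \<in> tangent_space (moser_part \<mu> P (level_part \<mu> c Q)) z"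
    obtain B where B: "open B" "z \<in> B" "Cinf_on B (moser_energy \<mu> c P)"
      "frechet_derivative (moser_energy \<mu> c P) (at z) (chart_field \<mu> X P z) \<noteq> 0"
      using moser_energy_regular[OF z] by blast
    have "frechet_derivative (moser_energy \<mu> c P) (at z) (chart_field \<mu> X P z) = 0"
      by (rule tangent_derivative_eq_0[OF t z B(1,2) _ Cinf_on_has_derivative[OF B(3,1,2)]])
         (auto simp: moser_part_level_part)
    then show False using B(4) by simp
  qed
  ultimately show ?thesis
    unfolding contact_type_def
    using W_open_chart_domain level_part_subset W_liouville_chart_field by blast
qed

end

section \<open>The effective potential along rays from a primary\<close>

text \<open>Parameters of a ray from a body of mass m: r is the distance from it, x the cosine of
  the angle with the direction to the other body, s the squared length of the planar part of the
  unit direction. The distance to the other body is given by the law of cosines.\<close>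

definition ray_dist :: "real \<Rightarrow> real \<Rightarrow> real" where
  "ray_dist x r = sqrt (1 - 2 * r * x + r\<^sup>2)"

definition ray_pot :: "real \<Rightarrow> real \<Rightarrow> real \<Rightarrow> real \<Rightarrow> real" where
  "ray_pot m x s r = - m / r - (1 - m) / ray_dist x r - ((1 - m)\<^sup>2 - 2 * (1 - m) * r * x + r\<^sup>2 * s) / 2"

definition ray_pot' :: "real \<Rightarrow> real \<Rightarrow> real \<Rightarrow> real \<Rightarrow> real" where
  "ray_pot' m x s r = m / r\<^sup>2 + (1 - m) * (r - x) / ray_dist x r ^ 3 + (1 - m) * x - r * s"

definition ray_pot'' :: "real \<Rightarrow> real \<Rightarrow> real \<Rightarrow> real \<Rightarrow> real" where
  "ray_pot'' m x s r = - 2 * m / r ^ 3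
     + (1 - m) * (1 / ray_dist x r ^ 3 - 3 * (r - x)\<^sup>2 / ray_dist x r ^ 5) - s"

text \<open>The balance of forces on the segment between the bodies, that is
  \<open>ray_pot' m 1 1 \<rho> = 0\<close>.\<close>

definition lagrange_radius :: "real \<Rightarrow> real \<Rightarrow> bool" where
  "lagrange_radius m \<rho> \<longleftrightarrow> 0 < \<rho> \<and> \<rho> < 1 \<and> m / \<rho>\<^sup>2 = (1 - m) * (1 / (1 - \<rho>)\<^sup>2 - 1) + \<rho>"

lemma ray_dist_sq:
  assumes "0 \<le> r" "x \<le> 1"
  shows "(ray_dist x r)\<^sup>2 = (1 - r)\<^sup>2 + 2 * r * (1 - x)"
proof -
  have "1 - 2 * r * x + r\<^sup>2 = (1 - r)\<^sup>2 + 2 * r * (1 - x)" by (simp add: power2_eq_square algebra_simps)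
  moreover have "\<dots> \<ge> 0" using assms by simp
  ultimately show ?thesis unfolding ray_dist_def by simp
qed

lemma ray_dist_nonneg: "0 \<le> r \<Longrightarrow> x \<le> 1 \<Longrightarrow> 0 \<le> ray_dist x r"
proof -
  assume "0 \<le> r" "x \<le> 1"
  then have "0 \<le> (1 - r)\<^sup>2 + 2 * r * (1 - x)" by simp
  then show ?thesis unfolding ray_dist_def by (simp add: power2_eq_square algebra_simps)
qed

lemma ray_dist_ge: "0 \<le> r \<Longrightarrow> x \<le> 1 \<Longrightarrow> 1 - r \<le> ray_dist x r"
  by (rule power2_le_imp_le) (auto simp: ray_dist_sq ray_dist_nonneg)

lemma ray_dist_le: "0 \<le> r \<Longrightarrow> -1 \<le> x \<Longrightarrow> x \<le> 1 \<Longrightarrow> ray_dist x r \<le> 1 + r"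
proof (rule power2_le_imp_le)
  assume a: "0 \<le> r" "-1 \<le> x" "x \<le> 1"
  then have "r * (1 - x) \<le> r * 2" by (intro mult_left_mono) auto
  then show "(ray_dist x r)\<^sup>2 \<le> (1 + r)\<^sup>2"
    unfolding ray_dist_sq[OF a(1,3)] by (simp add: power2_eq_square algebra_simps)
qed simp

lemma ray_dist_pos: "0 \<le> r \<Longrightarrow> r < 1 \<Longrightarrow> x \<le> 1 \<Longrightarrow> ray_dist x r > 0"
  using ray_dist_ge[of r x] by simp

lemma ray_dist_has_derivative:
  assumes "0 < r" "r < 1" "x \<le> 1"
  shows "(ray_dist x has_real_derivative (r - x) / ray_dist x r) (at r)"
proof -
  have "1 - 2 * r * x + r\<^sup>2 > 0"
    using ray_dist_pos[of r x] assms by (simp add: ray_dist_def)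
  then show ?thesis
    unfolding ray_dist_def[abs_def]
    by (auto intro!: derivative_eq_intros simp: field_simps)
qed

lemma ray_pot_has_derivative:
  assumes "0 < r" "r < 1" "x \<le> 1"
  shows "(ray_pot m x s has_real_derivative ray_pot' m x s r) (at r)"
proof -
  have d: "ray_dist x r > 0" using ray_dist_pos[of r x] assms by simp
  have 1: "((\<lambda>r. - m / r) has_real_derivative m / r\<^sup>2) (at r)"
    using assms by (auto intro!: derivative_eq_intros simp: power2_eq_square)
  have 2: "((\<lambda>r. inverse (ray_dist x r)) has_real_derivative - ((r - x) / ray_dist x r ^ 3)) (at r)"
    by (rule DERIV_cong[OF DERIV_inverse'[OF ray_dist_has_derivative[OF assms]]])
       (use d in \<open>auto simp: divide_inverse power3_eq_cube\<close>)
  have 3: "((\<lambda>r. ((1 - m)\<^sup>2 - 2 * (1 - m) * r * x + r\<^sup>2 * s) / 2) has_real_derivative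
      r * s - (1 - m) * x) (at r)"
    by (auto intro!: derivative_eq_intros)
  have "((\<lambda>r. - m / r - (1 - m) * inverse (ray_dist x r)
      - ((1 - m)\<^sup>2 - 2 * (1 - m) * r * x + r\<^sup>2 * s) / 2) has_real_derivative ray_pot' m x s r) (at r)"
    unfolding ray_pot'_def
    by (rule DERIV_cong[OF DERIV_diff[OF DERIV_diff[OF 1 DERIV_cmult[OF 2]] 3]]) simp
  then show ?thesis unfolding ray_pot_def[abs_def] by (simp add: inverse_eq_divide)
qed

lemma ray_pot'_has_derivative:
  assumes "0 < r" "r < 1" "x \<le> 1"
  shows "(ray_pot' m x s has_real_derivative ray_pot'' m x s r) (at r)"
proof -
  have d: "ray_dist x r > 0" using ray_dist_pos[of r x] assms by simp
  have 1: "((\<lambda>r. m / r\<^sup>2) has_real_derivative - 2 * m / r ^ 3) (at r)"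
    using assms by (auto intro!: derivative_eq_intros simp: field_simps power2_eq_square power3_eq_cube)
  have "((\<lambda>r. (r - x) / ray_dist x r ^ 3) has_real_derivative
      (1 * ray_dist x r ^ 3 - (r - x) * (3 * ray_dist x r ^ 2 * ((r - x) / ray_dist x r)))
        / (ray_dist x r ^ 3 * ray_dist x r ^ 3)) (at r)"
    using d by (auto intro!: derivative_eq_intros ray_dist_has_derivative[OF assms] simp: power2_eq_square)
  moreover have "(1 * ray_dist x r ^ 3 - (r - x) * (3 * ray_dist x r ^ 2 * ((r - x) / ray_dist x r)))
        / (ray_dist x r ^ 3 * ray_dist x r ^ 3) = 1 / ray_dist x r ^ 3 - 3 * (r - x)\<^sup>2 / ray_dist x r ^ 5"
    using d by (simp add: field_simps power2_eq_square eval_nat_numeral)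
  ultimately have 2: "((\<lambda>r. (r - x) / ray_dist x r ^ 3) has_real_derivative
      1 / ray_dist x r ^ 3 - 3 * (r - x)\<^sup>2 / ray_dist x r ^ 5) (at r)" by metis
  have "((\<lambda>r. m / r\<^sup>2 + (1 - m) * ((r - x) / ray_dist x r ^ 3) + (1 - m) * x - r * s) has_real_derivative
      ray_pot'' m x s r) (at r)"
    unfolding ray_pot''_def
    by (rule DERIV_cong[OF DERIV_diff[OF DERIV_add[OF DERIV_add[OF 1 DERIV_cmult[OF 2]] DERIV_const]
            DERIV_cmult_right[OF DERIV_ident]]]) simp
  then show ?thesis unfolding ray_pot'_def[abs_def] by simp
qed

lemma lagrange_radius_exists:
  assumes "0 < m" "m < 1"
  shows "\<exists>\<rho>. lagrange_radius m \<rho>"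
proof -
  \<comment> \<open>The equation multiplied by r^2 (1 - r)^2, so that the end points make sense; the
    values there are m and m - 1.\<close>
  let ?g = "\<lambda>r. m * (1 - r)\<^sup>2 - r\<^sup>2 * ((1 - m) * (1 - (1 - r)\<^sup>2) + r * (1 - r)\<^sup>2)"
  have "\<exists>r\<ge>0. r \<le> 1 \<and> ?g r = 0"
    by (rule IVT2') (use assms in \<open>auto intro!: continuous_intros\<close>)
  then obtain r where r: "0 \<le> r" "r \<le> 1" "?g r = 0" by blast
  have "r \<noteq> 0" "r \<noteq> 1" using r(3) assms by auto
  with r have r': "0 < r" "r < 1" by auto
  have "m / r\<^sup>2 = (1 - m) * (1 / (1 - r)\<^sup>2 - 1) + r"
    using r(3) r' by (simp add: field_simps)
  then show ?thesis using r' unfolding lagrange_radius_def by blast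
qed

lemma lagrange_radius_other:
  assumes "lagrange_radius m \<rho>"
  shows "lagrange_radius (1 - m) (1 - \<rho>)"
  using assms unfolding lagrange_radius_def by (simp add: algebra_simps)

section \<open>Estimates up to the Lagrange radius\<close>

context
  fixes m \<rho> :: real
  assumes m: "0 < m" "m < 1" and radius: "lagrange_radius m \<rho>"
begin

lemma rho: "0 < \<rho>" "\<rho> < 1"
  and rho_eq: "m / \<rho>\<^sup>2 = (1 - m) * (1 / (1 - \<rho>)\<^sup>2 - 1) + \<rho>"
  using radius unfolding lagrange_radius_def by auto

text \<open>At r = \<rho> the Lagrange equation takes the form m (1 - r)^2 (1 - r^3) = (1 - m) r^2
  (1 - (1 - r)^3). The left-hand side decreases and the right-hand side increases in r, which gives
  an inequality for smaller r. It lets the attraction of the nearby body dominate the tidal term of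
  the other one.\<close>

lemma lagrange_radius_le:
  assumes "0 < r" "r \<le> \<rho>"
  shows "(1 - m) * (3 - 3 * r + r\<^sup>2) / ((1 - r) ^ 3 * (1 + r + r\<^sup>2)) \<le> m / r ^ 3"
proof -
  have eq: "m * (1 - \<rho>)\<^sup>2 = \<rho>\<^sup>2 * ((1 - m) * (1 - (1 - \<rho>)\<^sup>2) + \<rho> * (1 - \<rho>)\<^sup>2)"
    using rho rho_eq by (simp add: field_simps)
  have "m * ((1 - \<rho>)\<^sup>2 * (1 - \<rho> ^ 3)) = (1 - m) * (\<rho>\<^sup>2 * (1 - (1 - \<rho>) ^ 3))"
    using eq by algebra
  moreover have "(1 - m) * (r\<^sup>2 * (1 - (1 - r) ^ 3)) \<le> (1 - m) * (\<rho>\<^sup>2 * (1 - (1 - \<rho>) ^ 3))"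
    using m rho assms
    by (intro mult_left_mono mult_mono power_mono diff_mono order_refl) (auto simp: power_le_one)
  moreover have "m * ((1 - \<rho>)\<^sup>2 * (1 - \<rho> ^ 3)) \<le> m * ((1 - r)\<^sup>2 * (1 - r ^ 3))"
    using m rho assms by (intro mult_left_mono mult_mono power_mono diff_mono order_refl)
      (auto simp: power_le_one)
  ultimately have le: "(1 - m) * (r\<^sup>2 * (1 - (1 - r) ^ 3)) \<le> m * ((1 - r)\<^sup>2 * (1 - r ^ 3))"
    by simp
  have 1: "r\<^sup>2 * (1 - (1 - r) ^ 3) = r ^ 3 * (3 - 3 * r + r\<^sup>2)"
    and 2: "(1 - r)\<^sup>2 * (1 - r ^ 3) = (1 - r) ^ 3 * (1 + r + r\<^sup>2)"
    by algebra+
  have p: "(1 - r) ^ 3 * (1 + r + r\<^sup>2) > 0" "r ^ 3 > 0"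
    using assms rho by (auto intro!: mult_pos_pos add_pos_pos)
  show ?thesis
    using le p unfolding 1 2 by (simp add: divide_simps mult_ac)
qed

text \<open>Only the tidal term of the other body can be positive. As
  \<open>lagrange_radius_le\<close> bounds 2 m/r^3 from below by 2 (1 - m) k/(1 - r)^3, a comparison
  without m remains: 1/d^3 - 3 (r - x)^2/d^5 < 2 k/(1 - r)^3.\<close>

lemma ray_pot''_neg:
  assumes r: "0 < r" "r \<le> \<rho>" and x: "-1 \<le> x" "x \<le> 1"
  shows "ray_pot'' m x s r + s < 0"
proof -
  define d where "d = ray_dist x r"
  have r1: "r < 1" using r rho by simp
  have d: "d > 0" "1 - r \<le> d" using ray_dist_pos[of r x] ray_dist_ge[of r x] r r1 x by (auto simp: d_def)
  have rx: "2 * r * (r - x) = d\<^sup>2 + r\<^sup>2 - 1"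
    unfolding d_def using ray_dist_sq[of r x] r x by (simp add: power2_eq_square algebra_simps)
  define k where "k = (3 - 3 * r + r\<^sup>2) / (1 + r + r\<^sup>2)"
  have q: "1 + r + r\<^sup>2 > 0" using r by (simp add: add_pos_pos)
  have c3: "(1 - r) ^ 3 \<le> d ^ 3" "0 < (1 - r) ^ 3" using d r1 by (auto intro!: power_mono)
  have "1 / d ^ 3 - 3 * (r - x)\<^sup>2 / d ^ 5 < 2 * (k / (1 - r) ^ 3)"
  \<comment> \<open>For r up to 4/5, just below a root of r^2 - 7 r + 5, one has 2 k > 1, and d
    \<ge> 1 - r suffices.\<close>
  proof (cases "r \<le> 4 / 5")
    case True
    have "(4/5 - r) * (31/5 - r) \<ge> 0" using True by (intro mult_nonneg_nonneg) auto
    moreover have "(4/5 - r) * (31/5 - r) = r\<^sup>2 - 7 * r + 124 / 25"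
      by (simp add: power2_eq_square field_simps)
    ultimately have "0 \<le> r\<^sup>2 - 7 * r + 124 / 25" by (simp only:)
    then have "1 + r + r\<^sup>2 < 2 * (3 - 3 * r + r\<^sup>2)" by argo
    then have "1 < 2 * k" using q by (simp add: k_def less_divide_eq)
    from divide_strict_right_mono[OF this c3(2)]
    have "1 / (1 - r) ^ 3 < 2 * (k / (1 - r) ^ 3)" by simp
    moreover have "1 / d ^ 3 \<le> 1 / (1 - r) ^ 3"
      by (rule divide_left_mono[OF c3(1) zero_le_one mult_pos_pos[OF zero_less_power[OF d(1)] c3(2)]])
    moreover have "0 \<le> 3 * (r - x)\<^sup>2 / d ^ 5" using d by simp
    ultimately show ?thesis by linarith
  next
    case False
    have "(1 - r) * (4 - r) \<ge> 0" using r1 by simp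
    then have "2 / 3 \<le> 2 * k" using q by (simp add: k_def field_simps power2_eq_square)
    from divide_right_mono[OF this, of "(1 - r) ^ 3"] c3
    have k: "2 / 3 / (1 - r) ^ 3 \<le> 2 * (k / (1 - r) ^ 3)" by simp
    show ?thesis
    \<comment> \<open>Only 2 k \<ge> 2/3 is left. Since (23/20)^3 > 3/2, a distance d of at least
      23/20 (1 - r) is enough. A smaller d means that the ray points closely at the other body; then
      3 (r - x)^2 \<ge> d^2 and the left-hand side is not positive.\<close>
    proof (cases "23 / 20 * (1 - r) \<le> d")
      case True
      then have "(23 / 20 * (1 - r)) ^ 3 \<le> d ^ 3" using r1 by (intro power_mono) auto
      moreover have "(23 / 20 * (1 - r)) ^ 3 = 12167 / 8000 * (1 - r) ^ 3"
        by (subst power_mult_distrib) (simp add: power3_eq_cube)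
      ultimately have c4: "3 / 2 * (1 - r) ^ 3 < d ^ 3" using c3(2) by linarith
      have "1 / d ^ 3 < 1 / (3 / 2 * (1 - r) ^ 3)"
        by (rule divide_strict_left_mono[OF c4]) (use c3(2) d(1) in \<open>intro mult_pos_pos zero_less_power | simp\<close>)+
      then have "1 / d ^ 3 < 2 / 3 / (1 - r) ^ 3" by simp
      moreover have "0 \<le> 3 * (r - x)\<^sup>2 / d ^ 5" using d by simp
      ultimately show ?thesis using k by linarith
    next
      case dlt: False
      then have "d\<^sup>2 \<le> (23 / 20 * (1 - r))\<^sup>2" using d by (intro power_mono) auto
      moreover have "(23 / 20 * (1 - r))\<^sup>2 = 529 / 400 * (1 - r)\<^sup>2"
        by (subst power_mult_distrib) (simp add: power2_eq_square)
      ultimately have d2: "d\<^sup>2 \<le> 529 / 400 * (1 - r)\<^sup>2" by (simp only:)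
      have "529 / 400 * (1 - r)\<^sup>2 + r\<^sup>2 - 1 = - ((1 - r) * (929 / 400 * r - 129 / 400))"
        by (simp add: power2_eq_square field_simps)
      moreover have "(1 - r) * (3 / 2) \<le> (1 - r) * (929 / 400 * r - 129 / 400)"
        using False r1 by (intro mult_left_mono) auto
      ultimately have "3 / 2 * (1 - r) \<le> - (2 * r * (r - x))" using rx d2 by simp
      also have "- (2 * r * (r - x)) \<le> 2 * \<bar>r - x\<bar>"
      proof -
        have "- (2 * r * (r - x)) \<le> \<bar>2 * r * (r - x)\<bar>" by simp
        also have "\<dots> = 2 * (r * \<bar>r - x\<bar>)" using r by (simp add: abs_mult)
        also have "\<dots> \<le> 2 * \<bar>r - x\<bar>" using r r1 by (simp add: mult_left_le_one_le)
        finally show ?thesis .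
      qed
      finally have "3 / 4 * (1 - r) \<le> \<bar>r - x\<bar>" by simp
      then have "(3 / 4 * (1 - r))\<^sup>2 \<le> \<bar>r - x\<bar>\<^sup>2" using r1 by (intro power_mono) auto
      moreover have "(3 / 4 * (1 - r))\<^sup>2 = 9 / 16 * (1 - r)\<^sup>2"
        by (subst power_mult_distrib) (simp add: power2_eq_square)
      ultimately have "d\<^sup>2 \<le> 3 * (r - x)\<^sup>2"
        using d2 zero_le_power2[of "1 - r"] power2_abs[of "r - x"] by linarith
      then have "d\<^sup>2 / d ^ 5 \<le> 3 * (r - x)\<^sup>2 / d ^ 5" using d by (intro divide_right_mono) auto
      moreover have "d\<^sup>2 / d ^ 5 = 1 / d ^ 3" using d by (simp add: field_simps eval_nat_numeral)
      moreover have "0 < 2 / 3 / (1 - r) ^ 3" using c3 by simp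
      ultimately show ?thesis using k by linarith
    qed
  qed
  then have "(1 - m) * (1 / d ^ 3 - 3 * (r - x)\<^sup>2 / d ^ 5) < (1 - m) * (2 * (k / (1 - r) ^ 3))"
    using m by (intro mult_strict_left_mono) auto
  also have "\<dots> = 2 * ((1 - m) * (3 - 3 * r + r\<^sup>2) / ((1 - r) ^ 3 * (1 + r + r\<^sup>2)))"
    by (simp add: k_def mult_ac)
  also have "\<dots> \<le> 2 * (m / r ^ 3)"
    using lagrange_radius_le[OF r] by simp
  finally have "(1 - m) * (1 / d ^ 3 - 3 * (r - x)\<^sup>2 / d ^ 5) < 2 * (m / r ^ 3)" .
  moreover have "ray_pot'' m x s r + s = (1 - m) * (1 / d ^ 3 - 3 * (r - x)\<^sup>2 / d ^ 5) - 2 * (m / r ^ 3)"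
    by (simp add: ray_pot''_def d_def)
  ultimately show ?thesis by (simp only: diff_less_0_iff_less)
qed

lemma ray_pot'_at_rho:
  assumes x: "-1 \<le> x" "x \<le> 1" and s: "s \<le> 1"
  shows "ray_pot' m x s \<rho> \<ge> 0" "x < 1 \<Longrightarrow> ray_pot' m x s \<rho> > 0"
proof -
  define d where "d = ray_dist x \<rho>"
  have d: "d > 0" "1 - \<rho> \<le> d" "d \<le> 1 + \<rho>"
    using ray_dist_pos[of \<rho> x] ray_dist_ge[of \<rho> x] ray_dist_le[of \<rho> x] rho x by (auto simp: d_def)
  have dl: "1 - \<rho> > 0" using rho by simp
  \<comment> \<open>Eliminating m/\<rho>^2 by the Lagrange equation leaves (1 - m) T plus the
    nonnegative \<rho> (1 - s), so that the sign of T decides.\<close>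
  define T where "T = 1 / (1 - \<rho>)\<^sup>2 - 1 + x + (\<rho> - x) / d ^ 3"
  have "ray_pot' m x s \<rho> = (1 - m) * T + \<rho> * (1 - s)"
    unfolding ray_pot'_def rho_eq T_def d_def by (simp add: algebra_simps)
  moreover have "\<rho> * (1 - s) \<ge> 0" using rho s by simp
  moreover have "T \<ge> 0 \<and> (x < 1 \<longrightarrow> T > 0)"
  \<comment> \<open>The sign of \<rho> - x determines whether the largest or the smallest possible d
    is the worst one.\<close>
  proof (cases "x < \<rho>")
    case True
    have "(\<rho> - x) / (1 + \<rho>) ^ 3 \<le> (\<rho> - x) / d ^ 3"
      using True d rho by (intro divide_left_mono power_mono) auto
    moreover have "x + (\<rho> - x) / (1 + \<rho>) ^ 3 \<ge> - 1 + 1 / (1 + \<rho>)\<^sup>2"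
    proof -
      have "1 / (1 + \<rho>) ^ 3 \<le> 1" using rho by simp
      then have "0 \<le> (1 + x) * (1 - 1 / (1 + \<rho>) ^ 3)" using x by simp
      also have "\<dots> = 1 + x - (1 + x) / (1 + \<rho>) ^ 3" by (simp add: algebra_simps)
      also have "(1 + x) / (1 + \<rho>) ^ 3 = (1 + \<rho>) / (1 + \<rho>) ^ 3 - (\<rho> - x) / (1 + \<rho>) ^ 3"
        by (simp flip: diff_divide_distrib)
      also have "(1 + \<rho>) / (1 + \<rho>) ^ 3 = 1 / (1 + \<rho>)\<^sup>2"
        using rho by (simp add: power2_eq_square power3_eq_cube)
      finally show ?thesis by linarith
    qed
    moreover have "1 / (1 - \<rho>)\<^sup>2 + 1 / (1 + \<rho>)\<^sup>2 > 2"
    proof -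
      have "((1 - \<rho>) * (1 + \<rho>))\<^sup>2 < 1"
      proof -
        have "0 \<le> (1 - \<rho>) * (1 + \<rho>)" using rho by simp
        moreover have "(1 - \<rho>) * (1 + \<rho>) = 1 - \<rho>\<^sup>2" by (simp add: power2_eq_square algebra_simps)
        then have "(1 - \<rho>) * (1 + \<rho>) < 1" using rho by simp
        ultimately show ?thesis by (simp only: power_less_one_iff) simp
      qed
      then have a: "(1 - \<rho>)\<^sup>2 * (1 + \<rho>)\<^sup>2 < 1" by (simp add: power_mult_distrib)
      have p: "(1 - \<rho>)\<^sup>2 * (1 + \<rho>)\<^sup>2 > 0" using rho by simp
      have "1 / (1 - \<rho>)\<^sup>2 + 1 / (1 + \<rho>)\<^sup>2 = (2 + 2 * \<rho>\<^sup>2) / ((1 - \<rho>)\<^sup>2 * (1 + \<rho>)\<^sup>2)"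
        using rho by (simp add: divide_simps) (simp add: power2_eq_square algebra_simps)
      also have "\<dots> > 2" using a p by (simp add: pos_less_divide_eq) (smt (verit) zero_le_power2)
      finally show ?thesis .
    qed
    ultimately have "T > 0" unfolding T_def by linarith
    then show ?thesis by simp
  next
    case False
    have "(x - \<rho>) / d ^ 3 \<le> (x - \<rho>) / (1 - \<rho>) ^ 3"
      using False d dl by (intro divide_left_mono power_mono) auto
    moreover have "(\<rho> - x) / d ^ 3 = - ((x - \<rho>) / d ^ 3)"
      by (simp add: divide_simps)
    moreover have "(x - \<rho>) / (1 - \<rho>) ^ 3 = (1 - \<rho>) / (1 - \<rho>) ^ 3 - (1 - x) / (1 - \<rho>) ^ 3"
      by (simp flip: diff_divide_distrib)
    moreover have "(1 - \<rho>) / (1 - \<rho>) ^ 3 = 1 / (1 - \<rho>)\<^sup>2"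
      using dl by (simp add: power2_eq_square power3_eq_cube)
    ultimately have T: "T \<ge> (1 - x) / (1 - \<rho>) ^ 3 - (1 - x)"
      unfolding T_def by argo
    have c3: "(1 - \<rho>) ^ 3 > 0" "(1 - \<rho>) ^ 3 < 1"
      using rho dl by (simp_all add: power_less_one_iff)
    show ?thesis
    proof (cases "x < 1")
      case True
      then have "(1 - x) / 1 < (1 - x) / (1 - \<rho>) ^ 3"
        using c3 by (intro divide_strict_left_mono) auto
      then have "T > 0" using T by simp
      then show ?thesis by simp
    next
      case False
      then show ?thesis using x T by simp
    qed
  qed
  ultimately show "ray_pot' m x s \<rho> \<ge> 0" "x < 1 \<Longrightarrow> ray_pot' m x s \<rho> > 0"
    using m by (auto intro!: add_nonneg_nonneg add_pos_nonneg mult_nonneg_nonneg)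
qed

lemma ray_pot'_decreasing:
  assumes "0 < a" "a < b" "b \<le> \<rho>" and x: "-1 \<le> x" "x \<le> 1" and s: "0 \<le> s"
  shows "ray_pot' m x s b < ray_pot' m x s a"
proof (rule DERIV_neg_imp_decreasing[OF assms(2)])
  fix r assume "a \<le> r" "r \<le> b"
  then show "\<exists>y. (ray_pot' m x s has_real_derivative y) (at r) \<and> y < 0"
    using ray_pot'_has_derivative[of r x m s] ray_pot''_neg[of r x s] assms rho
    by (intro exI[of _ "ray_pot'' m x s r"]) auto
qed

lemma ray_pot'_pos:
  assumes "0 < r" "r < \<rho>" and x: "-1 \<le> x" "x \<le> 1" and s: "0 \<le> s" "s \<le> 1"
  shows "ray_pot' m x s r > 0"
  using ray_pot'_decreasing[OF assms(1,2) order_refl x s(1)] ray_pot'_at_rho(1)[OF x s(2)] by simp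

text \<open>With e = 1 - \<rho> the law of cosines turns \<rho> (1 - x) into (d^2 - e^2)/2, and the
  main part of the difference acquires the factor d - e \<ge> 0. The other factor is positive
  because d e < 1 and d + e \<le> 2.\<close>

lemma ray_pot_at_rho:
  assumes x: "-1 \<le> x" "x \<le> 1" and s: "s \<le> 1"
  shows "ray_pot m 1 1 \<rho> \<le> ray_pot m x s \<rho>" "x < 1 \<Longrightarrow> ray_pot m 1 1 \<rho> < ray_pot m x s \<rho>"
proof -
  define d where "d = ray_dist x \<rho>"
  define e where "e = 1 - \<rho>"
  have d: "d > 0" "e \<le> d" "d \<le> 1 + \<rho>"
    using ray_dist_pos[of \<rho> x] ray_dist_ge[of \<rho> x] ray_dist_le[of \<rho> x] rho x by (auto simp: d_def e_def)
  have e: "0 < e" "e < 1" using rho by (auto simp: e_def)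
  have d1: "ray_dist 1 \<rho> = e"
    by (rule power2_eq_imp_eq)
       (use ray_dist_sq[of \<rho> 1] ray_dist_nonneg[of \<rho> 1] rho in \<open>auto simp: e_def\<close>)
  have dd: "\<rho> * (1 - x) = (d - e) * (d + e) / 2"
    using ray_dist_sq[of \<rho> x] rho x unfolding d_def e_def by (simp add: power2_eq_square algebra_simps)
  have "ray_pot m x s \<rho> - ray_pot m 1 1 \<rho> = (1 - m) * (1 / e - 1 / d - \<rho> * (1 - x)) + \<rho>\<^sup>2 * (1 - s) / 2"
  proof -
    have *: "(1 - m) / e = (1 - m) * (1 / e)" "(1 - m) / d = (1 - m) * (1 / d)" by simp_all
    show ?thesis
      unfolding ray_pot_def d1 d_def[symmetric] * by (simp add: algebra_simps diff_divide_distrib add_divide_distrib)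
  qed
  also have "1 / e - 1 / d - \<rho> * (1 - x) = (d - e) * (1 / (d * e) - (d + e) / 2)"
    unfolding dd using d e by (simp add: field_simps)
  finally have eq: "ray_pot m x s \<rho> - ray_pot m 1 1 \<rho> =
      (1 - m) * ((d - e) * (1 / (d * e) - (d + e) / 2)) + \<rho>\<^sup>2 * (1 - s) / 2" .
  have "d * e < 1"
  proof -
    have "d * e \<le> (1 + \<rho>) * (1 - \<rho>)" using d e by (intro mult_mono) (auto simp: e_def)
    also have "\<dots> < 1" using rho by (simp add: algebra_simps)
    finally show ?thesis .
  qed
  then have "1 / (d * e) > 1" using d e by simp
  moreover have "(d + e) / 2 \<le> 1" using d by (simp add: e_def)
  ultimately have k: "1 / (d * e) - (d + e) / 2 > 0" by linarith
  have "\<rho>\<^sup>2 * (1 - s) / 2 \<ge> 0" using s by simp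
  moreover have "(1 - m) * ((d - e) * (1 / (d * e) - (d + e) / 2)) \<ge> 0"
    using m d k by simp
  ultimately show "ray_pot m 1 1 \<rho> \<le> ray_pot m x s \<rho>" using eq by linarith
  assume "x < 1"
  then have "(d - e) * (d + e) > 0" using dd rho by (metis diff_gt_0_iff_gt half_gt_zero_iff mult_pos_pos)
  then have "d > e" using d e by (simp add: zero_less_mult_iff)
  then have "(1 - m) * ((d - e) * (1 / (d * e) - (d + e) / 2)) > 0" using m k by simp
  then show "ray_pot m 1 1 \<rho> < ray_pot m x s \<rho>"
    using eq \<open>\<rho>\<^sup>2 * (1 - s) / 2 \<ge> 0\<close> by linarith
qed

text \<open>With u the radial derivative of the potential, the derivative in r is 2 u (u' + s);
  hence the shift by s in \<open>ray_pot''_neg\<close>.\<close>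

lemma ray_discriminant_decreasing:
  assumes "0 < a" "a < b" "b \<le> \<rho>" and x: "-1 \<le> x" "x \<le> 1" and s: "0 \<le> s" "s \<le> 1"
  shows "(ray_pot' m x s b)\<^sup>2 - 2 * s * (c - ray_pot m x s b)
       < (ray_pot' m x s a)\<^sup>2 - 2 * s * (c - ray_pot m x s a)"
proof (rule DERIV_neg_imp_decreasing_open[OF assms(2)])
  fix r assume r: "a < r" "r < b"
  have r1: "0 < r" "r < 1" using r assms rho by auto
  have "((\<lambda>r. (ray_pot' m x s r)\<^sup>2 - 2 * s * (c - ray_pot m x s r)) has_real_derivative
      2 * ray_pot' m x s r * ray_pot'' m x s r + 2 * s * ray_pot' m x s r) (at r)"
    by (auto intro!: derivative_eq_intros ray_pot_has_derivative ray_pot'_has_derivative r1 x)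
  moreover have "2 * ray_pot' m x s r * ray_pot'' m x s r + 2 * s * ray_pot' m x s r =
      2 * (ray_pot' m x s r * (ray_pot'' m x s r + s))"
    by (simp add: algebra_simps)
  moreover have "ray_pot' m x s r * (ray_pot'' m x s r + s) < 0"
    using ray_pot'_pos[of r x s] ray_pot''_neg[of r x s] r assms by (intro mult_pos_neg) auto
  ultimately show "\<exists>y. ((\<lambda>r. (ray_pot' m x s r)\<^sup>2 - 2 * s * (c - ray_pot m x s r))
      has_real_derivative y) (at r) \<and> y < 0" by (metis mult_pos_neg zero_less_numeral)
next
  have "continuous_on {a..b} (ray_pot m x s)" "continuous_on {a..b} (ray_pot' m x s)"
    using assms rho by (auto intro!: DERIV_continuous_on[OF has_field_derivative_at_within]
        ray_pot_has_derivative ray_pot'_has_derivative)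
  then show "continuous_on {a..b} (\<lambda>r. (ray_pot' m x s r)\<^sup>2 - 2 * s * (c - ray_pot m x s r))"
    by (intro continuous_intros)
qed

lemma ray_discriminant_pos:
  assumes r: "0 < r" "r \<le> \<rho>" "r < \<rho> \<or> x < 1" and x: "-1 \<le> x" "x \<le> 1" and s: "0 \<le> s" "s \<le> 1"
    and c: "c \<le> ray_pot m 1 1 \<rho>"
  shows "(ray_pot' m x s r)\<^sup>2 - 2 * s * (c - ray_pot m x s r) > 0"
proof -
  have nn: "2 * s * (c - ray_pot m x s \<rho>) \<le> 0"
    using ray_pot_at_rho(1)[OF x s(2)] c s by (simp add: mult_nonneg_nonpos)
  show ?thesis
  proof (cases "r < \<rho>")
    case True
    then show ?thesis
      using ray_discriminant_decreasing[OF r(1) True order_refl x s, of c] nn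
      by (smt (verit) zero_le_power2)
  next
    case False
    then have "r = \<rho>" "x < 1" using r by auto
    then show ?thesis
      using ray_pot'_at_rho(2)[OF x s(2)] nn by (smt (verit) zero_less_power2)
  qed
qed

end

section \<open>The effective potential and the Hill's region\<close>

declare position.simps [simp del]

definition eff_pot :: "real \<Rightarrow> real^3 \<Rightarrow> real" where
  "eff_pot \<mu> q = - (mass \<mu> Earth / norm (q - position \<mu> Earth)) - mass \<mu> Moon / norm (q - position \<mu> Moon)
     - ((q$1)\<^sup>2 + (q$2)\<^sup>2) / 2"

definition eff_grad :: "real \<Rightarrow> real^3 \<Rightarrow> real^3" where
  "eff_grad \<mu> q = (mass \<mu> Earth / norm (q - position \<mu> Earth) ^ 3) *\<^sub>R (q - position \<mu> Earth)
     + (mass \<mu> Moon / norm (q - position \<mu> Moon) ^ 3) *\<^sub>R (q - position \<mu> Moon) - vector [q$1, q$2, 0]"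

text \<open>The velocity \<open>\<partial>H/\<partial>p\<close> in the rotating frame.\<close>

definition vel :: "phase \<Rightarrow> real^3" where
  "vel z = vector [snd z $ 1 + fst z $ 2, snd z $ 2 - fst z $ 1, snd z $ 3]"

lemma vel_nth [simp]: "vel z $ 1 = snd z $ 1 + fst z $ 2" "vel z $ 2 = snd z $ 2 - fst z $ 1" "vel z $ 3 = snd z $ 3"
  by (simp_all add: vel_def vector_3)

lemma eff_pot_body:
  "eff_pot \<mu> q = - (mass \<mu> P / norm (q - position \<mu> P)) - mass \<mu> (other P) / norm (q - position \<mu> (other P))
     - ((q$1)\<^sup>2 + (q$2)\<^sup>2) / 2"
  by (cases P) (auto simp: eff_pot_def)

lemma eff_grad_body:
  "eff_grad \<mu> q = (mass \<mu> P / norm (q - position \<mu> P) ^ 3) *\<^sub>R (q - position \<mu> P)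
     + (mass \<mu> (other P) / norm (q - position \<mu> (other P)) ^ 3) *\<^sub>R (q - position \<mu> (other P))
     - vector [q$1, q$2, 0]"
  by (cases P) (auto simp: eff_grad_def)

lemma H_eq: "H \<mu> z = (norm (vel z))\<^sup>2 / 2 + eff_pot \<mu> (fst z)"
  unfolding H_def eff_pot_def case_prod_beta power2_norm_eq_inner
  by (simp add: inner3 power2_eq_square field_simps)

definition H_deriv :: "real \<Rightarrow> phase \<Rightarrow> phase \<Rightarrow> real" where
  "H_deriv \<mu> z u = eff_grad \<mu> (fst z) \<bullet> fst u + vel z \<bullet> snd u + vel z $ 1 * fst u $ 2 - vel z $ 2 * fst u $ 1"

lemma inverse_norm_has_derivative:
  fixes a :: "'a::real_inner"
  assumes "q \<noteq> a"
  shows "((\<lambda>q. k / norm (q - a)) has_derivative (\<lambda>u. - ((k / norm (q - a) ^ 3) *\<^sub>R (q - a)) \<bullet> u)) (at q)"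
proof -
  have n: "norm (q - a) > 0" using assms by simp
  have "((\<lambda>q. q - a) has_derivative (\<lambda>u. u)) (at q)"
    by (auto intro!: derivative_eq_intros)
  then have "((\<lambda>q. norm (q - a)) has_derivative (\<lambda>u. sgn (q - a) \<bullet> u)) (at q)"
    by (rule has_derivative_compose[where f = "\<lambda>q. q - a" and g = norm])
       (use has_derivative_norm[of "q - a"] assms in \<open>simp add: inner_commute\<close>)
  from has_derivative_mult_right[OF Deriv.has_derivative_inverse[OF _ this], of k] n
  have "((\<lambda>q. k * inverse (norm (q - a))) has_derivative
      (\<lambda>u. k * - (inverse (norm (q - a)) * (sgn (q - a) \<bullet> u) * inverse (norm (q - a))))) (at q)"
    by simp
  then have "((\<lambda>q. k / norm (q - a)) has_derivative
      (\<lambda>u. k * - (inverse (norm (q - a)) * (sgn (q - a) \<bullet> u) * inverse (norm (q - a))))) (at q)"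
    by (simp add: divide_inverse)
  then show ?thesis
  proof (rule has_derivative_eq_rhs, intro ext)
    fix u
    show "k * - (inverse (norm (q - a)) * (sgn (q - a) \<bullet> u) * inverse (norm (q - a)))
        = - ((k / norm (q - a) ^ 3) *\<^sub>R (q - a)) \<bullet> u"
      using n unfolding sgn_div_norm inner_scaleR_left inner_minus_left
      by (simp add: field_simps power3_eq_cube)
  qed
qed

lemma eff_pot_has_derivative:
  assumes "q \<noteq> position \<mu> Earth" "q \<noteq> position \<mu> Moon"
  shows "(eff_pot \<mu> has_derivative (\<lambda>u. eff_grad \<mu> q \<bullet> u)) (at q)"
proof -
  have "((\<lambda>q::real^3. ((q$1)\<^sup>2 + (q$2)\<^sup>2) / 2) has_derivative (\<lambda>u. vector [q$1, q$2, 0] \<bullet> u)) (at q)"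
  proof -
    have n: "((\<lambda>q::real^3. q $ i) has_derivative (\<lambda>u. u $ i)) (at q)" for i
      by (rule bounded_linear_imp_has_derivative[OF bounded_linear_vec_nth])
    show ?thesis
      by (rule has_derivative_eq_rhs, (rule derivative_intros n)+) (auto simp: inner3 vector_3)
  qed
  from has_derivative_diff[OF has_derivative_diff[OF has_derivative_minus[OF
          inverse_norm_has_derivative[OF assms(1), of "mass \<mu> Earth"]]
        inverse_norm_has_derivative[OF assms(2), of "mass \<mu> Moon"]] this]
  show ?thesis
    unfolding eff_pot_def[abs_def] eff_grad_def
    by (simp add: inner_add_left inner_diff_left)
qed

lemma vel_has_derivative:
  "(vel has_derivative (\<lambda>u. vector [snd u $ 1 + fst u $ 2, snd u $ 2 - fst u $ 1, snd u $ 3])) (at z)"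
proof -
  let ?D = "\<lambda>u :: phase. vector [snd u $ 1 + fst u $ 2, snd u $ 2 - fst u $ 1, snd u $ 3] :: real^3"
  have "linear ?D"
    by (rule linearI) (auto simp: vector3_eq_iff vector_3 algebra_simps)
  then have "(?D has_derivative ?D) (at z)"
    by (intro bounded_linear_imp_has_derivative) (simp add: linear_conv_bounded_linear)
  then show ?thesis by (simp add: vel_def[abs_def])
qed

lemma H_has_derivative:
  assumes "z \<in> phase_space \<mu>"
  shows "(H \<mu> has_derivative H_deriv \<mu> z) (at z)"
proof -
  have q: "fst z \<noteq> position \<mu> Earth" "fst z \<noteq> position \<mu> Moon"
    using assms by (auto simp: phase_space_def)
  have 1: "((\<lambda>z. eff_pot \<mu> (fst z)) has_derivative (\<lambda>u. eff_grad \<mu> (fst z) \<bullet> fst u)) (at z)"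
    by (rule has_derivative_compose[where f = fst and g = "eff_pot \<mu>", OF _ eff_pot_has_derivative[OF q]])
       (rule has_derivative_fst[OF has_derivative_ident])
  have 2: "((\<lambda>z. (vel z \<bullet> vel z) / 2) has_derivative
      (\<lambda>u. vel z \<bullet> vector [snd u $ 1 + fst u $ 2, snd u $ 2 - fst u $ 1, snd u $ 3])) (at z)"
    by (rule has_derivative_eq_rhs[OF has_derivative_divide[OF
            has_derivative_inner[OF vel_has_derivative vel_has_derivative] has_derivative_const]])
       (auto simp: inner_commute)
  show ?thesis
    unfolding H_eq[abs_def] power2_norm_eq_inner
    by (rule has_derivative_eq_rhs[OF has_derivative_add[OF 2 1]])
       (auto simp: H_deriv_def inner3 vector_3 algebra_simps)
qed

definition axis_vec :: "real \<Rightarrow> body \<Rightarrow> real^3" where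
  "axis_vec \<mu> P = position \<mu> (other P) - position \<mu> P"

primrec orient :: "body \<Rightarrow> real" where
  "orient Earth = -1"
| "orient Moon = 1"

lemma orient_sq [simp]: "orient P * orient P = 1" "(orient P)\<^sup>2 = 1" by (cases P; simp)+

lemma axis_vec_nth [simp]: "axis_vec \<mu> P $ 1 = orient P" "axis_vec \<mu> P $ 2 = 0" "axis_vec \<mu> P $ 3 = 0"
  by (cases P; simp add: axis_vec_def)+

lemma mass_other: "mass \<mu> (other P) = 1 - mass \<mu> P"
  by (cases P) auto

lemma inner_axis_vec: "v \<bullet> axis_vec \<mu> P = orient P * v$1"
  by (simp add: inner3)

lemma unit_bounds:
  fixes v :: "real^3"
  assumes "norm v = 1"
  shows "-1 \<le> orient P * v$1" "orient P * v$1 \<le> 1" "0 \<le> (v$1)\<^sup>2 + (v$2)\<^sup>2" "(v$1)\<^sup>2 + (v$2)\<^sup>2 \<le> 1"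
proof -
  have "\<bar>v$1\<bar> \<le> 1" using component_le_norm_cart[of v 1] assms by simp
  then show "-1 \<le> orient P * v$1" "orient P * v$1 \<le> 1" by (cases P; auto)+
  have "v \<bullet> v = 1" using assms by (simp add: norm_eq_sqrt_inner)
  then have "(v$1)\<^sup>2 + (v$2)\<^sup>2 + (v$3)\<^sup>2 = 1" by (simp add: inner3 power2_eq_square)
  then show "(v$1)\<^sup>2 + (v$2)\<^sup>2 \<le> 1" by (smt (verit) zero_le_power2)
qed simp

lemma norm_ray:
  assumes "norm v = 1" "0 < r"
  shows "norm (position \<mu> P + r *\<^sub>R v - position \<mu> P) = r"
    "norm (position \<mu> P + r *\<^sub>R v - position \<mu> (other P)) = ray_dist (orient P * v$1) r"
proof -
  show "norm (position \<mu> P + r *\<^sub>R v - position \<mu> P) = r" using assms by simp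
  have vv: "v$1 * v$1 + v$2 * v$2 + v$3 * v$3 = 1"
    using assms(1) by (simp add: norm_eq_sqrt_inner inner3)
  have "(position \<mu> P + r *\<^sub>R v - position \<mu> (other P)) \<bullet> (position \<mu> P + r *\<^sub>R v - position \<mu> (other P))
      = r\<^sup>2 * (v$1 * v$1 + v$2 * v$2 + v$3 * v$3) - 2 * r * (orient P * v$1) + 1"
    by (cases P) (simp_all add: inner3 power2_eq_square algebra_simps)
  then show "norm (position \<mu> P + r *\<^sub>R v - position \<mu> (other P)) = ray_dist (orient P * v$1) r"
    unfolding norm_eq_sqrt_inner ray_dist_def vv by (simp add: algebra_simps)
qed

lemma eff_pot_ray:
  assumes "norm v = 1" "0 < r"
  shows "eff_pot \<mu> (position \<mu> P + r *\<^sub>R v) =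
    ray_pot (mass \<mu> P) (orient P * v$1) ((v$1)\<^sup>2 + (v$2)\<^sup>2) r"
proof -
  have "((position \<mu> P + r *\<^sub>R v)$1)\<^sup>2 + ((position \<mu> P + r *\<^sub>R v)$2)\<^sup>2 =
      (1 - mass \<mu> P)\<^sup>2 - 2 * (1 - mass \<mu> P) * r * (orient P * v$1) + r\<^sup>2 * ((v$1)\<^sup>2 + (v$2)\<^sup>2)"
    by (cases P) (simp_all add: power2_eq_square algebra_simps)
  then show ?thesis
    unfolding eff_pot_body[of _ _ P] norm_ray[OF assms] ray_pot_def by (simp add: mass_other)
qed

lemma eff_grad_ray:
  assumes "norm v = 1" "0 < r"
  shows "eff_grad \<mu> (position \<mu> P + r *\<^sub>R v) \<bullet> v =
    ray_pot' (mass \<mu> P) (orient P * v$1) ((v$1)\<^sup>2 + (v$2)\<^sup>2) r"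
proof -
  have vv: "v \<bullet> v = 1" using assms(1) by (simp add: norm_eq_sqrt_inner)
  have 1: "(position \<mu> P + r *\<^sub>R v - position \<mu> P) \<bullet> v = r" by (simp add: vv)
  have 2: "(position \<mu> P + r *\<^sub>R v - position \<mu> (other P)) \<bullet> v = r - orient P * v$1"
  proof -
    have eq: "position \<mu> P + r *\<^sub>R v - position \<mu> (other P) = r *\<^sub>R v - axis_vec \<mu> P"
      by (simp add: axis_vec_def)
    show ?thesis
      unfolding eq inner_diff_left inner_commute[of "axis_vec \<mu> P"] inner_axis_vec by (simp add: vv)
  qed
  have 3: "vector [(position \<mu> P + r *\<^sub>R v)$1, (position \<mu> P + r *\<^sub>R v)$2, 0] \<bullet> v =
      r * ((v$1)\<^sup>2 + (v$2)\<^sup>2) - (1 - mass \<mu> P) * (orient P * v$1)"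
    by (cases P) (simp_all add: inner3 vector_3 power2_eq_square algebra_simps)
  have 4: "(a *\<^sub>R X + b *\<^sub>R Y - Z) \<bullet> v = a * (X \<bullet> v) + b * (Y \<bullet> v) - Z \<bullet> v" for a b and X Y Z :: "real^3"
    by (simp add: inner_diff_left inner_add_left)
  show ?thesis
    unfolding eff_grad_body[of _ _ P] 4 1 2 3 norm_ray[OF assms] ray_pot'_def mass_other
    using assms(2) by (simp add: power2_eq_square power3_eq_cube)
qed

lemma polar:
  fixes q a :: "real^3"
  assumes "q \<noteq> a"
  obtains v where "norm v = 1" "q = a + norm (q - a) *\<^sub>R v"
proof
  show "norm (sgn (q - a)) = 1" using assms by (simp add: norm_sgn)
  show "q = a + norm (q - a) *\<^sub>R sgn (q - a)" using assms by (simp add: sgn_div_norm)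
qed

text \<open>Transversality of the field \<open>(q - P) \<partial>/\<partial>q\<close>: by the Cauchy--Schwarz inequality the Coriolis term is at
  most \<open>r \<surd>s |vel|\<close>.\<close>

lemma H_deriv_radial_pos:
  assumes v: "norm v = 1" and r: "0 < r" and z: "fst z = position \<mu> P + r *\<^sub>R v"
    and pos: "ray_pot' (mass \<mu> P) (orient P * v$1) ((v$1)\<^sup>2 + (v$2)\<^sup>2) r > 0"
    and disc: "(ray_pot' (mass \<mu> P) (orient P * v$1) ((v$1)\<^sup>2 + (v$2)\<^sup>2) r)\<^sup>2
      - 2 * ((v$1)\<^sup>2 + (v$2)\<^sup>2) * (H \<mu> z - eff_pot \<mu> (fst z)) > 0"
  shows "H_deriv \<mu> z (fst z - position \<mu> P, 0) > 0"
proof -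
  let ?u = "ray_pot' (mass \<mu> P) (orient P * v$1) ((v$1)\<^sup>2 + (v$2)\<^sup>2) r"
  let ?w = "vel z"
  have eq: "H_deriv \<mu> z (fst z - position \<mu> P, 0) = r * (?u + (?w$1 * v$2 - ?w$2 * v$1))"
    unfolding H_deriv_def using eff_grad_ray[OF v r, of \<mu> P] z by (simp add: algebra_simps)
  have "(?w$1 * v$2 - ?w$2 * v$1)\<^sup>2 \<le> ((?w$1)\<^sup>2 + (?w$2)\<^sup>2) * ((v$1)\<^sup>2 + (v$2)\<^sup>2)"
  proof -
    have "((?w$1)\<^sup>2 + (?w$2)\<^sup>2) * ((v$1)\<^sup>2 + (v$2)\<^sup>2) - (?w$1 * v$2 - ?w$2 * v$1)\<^sup>2 = (?w$1 * v$1 + ?w$2 * v$2)\<^sup>2"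
      by algebra
    then show ?thesis by (smt (verit) zero_le_power2)
  qed
  also have "\<dots> \<le> (norm ?w)\<^sup>2 * ((v$1)\<^sup>2 + (v$2)\<^sup>2)"
    unfolding power2_norm_eq_inner inner3 by (intro mult_right_mono) (auto simp: power2_eq_square)
  also have "\<dots> = 2 * ((v$1)\<^sup>2 + (v$2)\<^sup>2) * (H \<mu> z - eff_pot \<mu> (fst z))"
    unfolding H_eq by simp
  also have "\<dots> < ?u\<^sup>2" using disc by simp
  finally have "\<bar>?w$1 * v$2 - ?w$2 * v$1\<bar> < ?u"
    using pos by (metis abs_le_square_iff abs_of_pos not_le)
  then show ?thesis unfolding eq using r by (intro mult_pos_pos) auto
qed

lemma hill_region_eq:
  "hill_region \<mu> c = {q. q \<noteq> position \<mu> Earth \<and> q \<noteq> position \<mu> Moon \<and> eff_pot \<mu> q \<le> c}"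
proof (intro equalityI subsetI)
  fix q assume "q \<in> hill_region \<mu> c"
  then obtain z where "z \<in> phase_space \<mu>" "H \<mu> z = c" "q = fst z"
    by (auto simp: hill_region_def energy_level_def)
  then show "q \<in> {q. q \<noteq> position \<mu> Earth \<and> q \<noteq> position \<mu> Moon \<and> eff_pot \<mu> q \<le> c}"
    by (auto simp: H_eq phase_space_def)
next
  fix q assume q: "q \<in> {q. q \<noteq> position \<mu> Earth \<and> q \<noteq> position \<mu> Moon \<and> eff_pot \<mu> q \<le> c}"
  \<comment> \<open>The momentum whose velocity in the rotating frame is vertical, with the length
    prescribed by the energy.\<close>
  define z where "z = (q, vector [- q$2, q$1, sqrt (2 * (c - eff_pot \<mu> q))] :: real^3)"
  have "(norm (vel z))\<^sup>2 = 2 * (c - eff_pot \<mu> q)"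
    unfolding power2_norm_eq_inner inner3 using q by (simp add: z_def vector_3)
  then have "H \<mu> z = c" unfolding H_eq by (simp add: z_def field_simps)
  then have "z \<in> energy_level \<mu> c"
    using q by (simp add: energy_level_def z_def phase_space_def)
  then show "q \<in> hill_region \<mu> c" unfolding hill_region_def z_def by force
qed

lemma continuous_on_eff_pot:
  "continuous_on {q. q \<noteq> position \<mu> Earth \<and> q \<noteq> position \<mu> Moon} (eff_pot \<mu>)"
  unfolding eff_pot_def[abs_def] by (intro continuous_intros) auto

text \<open>Both radii come from a single choice, so that the spheres around the two bodies touch in
  one point, \<open>lpos\<close>.\<close>

definition radius :: "real \<Rightarrow> body \<Rightarrow> real" where
  "radius \<mu> P = (case P of Moon \<Rightarrow> SOME \<rho>. lagrange_radius \<mu> \<rho>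
     | Earth \<Rightarrow> 1 - (SOME \<rho>. lagrange_radius \<mu> \<rho>))"

definition lpos :: "real \<Rightarrow> real^3" where
  "lpos \<mu> = position \<mu> Moon + radius \<mu> Moon *\<^sub>R axis_vec \<mu> Moon"

lemma norm_axis_vec: "norm (axis_vec \<mu> P) = 1"
  using norm_position_diff[of \<mu> P] by (simp add: axis_vec_def norm_minus_commute)

lemma radius_other: "radius \<mu> (other P) = 1 - radius \<mu> P"
  by (cases P) (auto simp: radius_def)

lemma lpos_body: "lpos \<mu> = position \<mu> P + radius \<mu> P *\<^sub>R axis_vec \<mu> P"
  using radius_other[of \<mu> Moon] by (cases P) (auto simp: lpos_def vector3_eq_iff)

lemma in_components_clopen:
  assumes "connected A" "A \<noteq> {}" "openin (top_of_set S) A" "closedin (top_of_set S) A"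
  shows "A \<in> components S"
proof -
  have sub: "A \<subseteq> S" using assms(3) openin_imp_subset by blast
  have "C \<subseteq> A" if C: "connected C" "C \<subseteq> S" "A \<subseteq> C" for C
  proof -
    have "openin (top_of_set C) (C \<inter> A)" "closedin (top_of_set C) (C \<inter> A)"
      using openin_subtopology_Int2[OF assms(3), of C] closedin_subtopology_Int_closed assms(3,4) C
      by (metis Int_commute openin_subset_trans closedin_subset_trans inf.absorb_iff2 inf_le1)+
    then have "C \<inter> A = {} \<or> C \<inter> A = C" using C(1) by (simp add: connected_clopen)
    then show "C \<subseteq> A" using C(3) assms(2) by blast
  qed
  then show ?thesis
    using assms(1,2) sub by (auto simp: in_components_maximal)
qed

lemma connected_starlike:
  assumes "connected B" "B \<subseteq> A" "B \<noteq> {}"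
    and "\<And>q. q \<in> A \<Longrightarrow> \<exists>T. connected T \<and> T \<subseteq> A \<and> q \<in> T \<and> T \<inter> B \<noteq> {}"
  shows "connected A"
proof -
  let ?F = "{T \<union> B |T. connected T \<and> T \<subseteq> A \<and> T \<inter> B \<noteq> {}}"
  have "connected (\<Union>?F)"
  proof (rule connected_Union)
    show "connected S" if "S \<in> ?F" for S using that assms(1) by (auto intro: connected_Un)
    show "\<Inter>?F \<noteq> {}" using assms(3) by blast
  qed
  moreover have "\<Union>?F = A"
  proof (intro equalityI subsetI)
    fix q assume "q \<in> A"
    then obtain T where "connected T" "T \<subseteq> A" "q \<in> T" "T \<inter> B \<noteq> {}" using assms(4) by meson
    then show "q \<in> \<Union>?F" by (intro UnionI[of "T \<union> B"]) auto
  qed (use assms(2) in auto)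
  ultimately show ?thesis by simp
qed

section \<open>The point L1 and the components below its energy\<close>

context
  fixes \<mu> :: real
  assumes \<mu>: "0 < \<mu>" "\<mu> < 1"
begin

lemma mass_bounds: "0 < mass \<mu> P" "mass \<mu> P < 1"
  using \<mu> by (cases P; simp)+

lemma lagrange_radius_body: "lagrange_radius (mass \<mu> P) (radius \<mu> P)"
proof -
  have 1: "lagrange_radius \<mu> (radius \<mu> Moon)"
    unfolding radius_def using someI_ex[OF lagrange_radius_exists[OF \<mu>]] by simp
  show ?thesis
    using 1 lagrange_radius_other[OF 1] radius_other[of \<mu> Moon] by (cases P) auto
qed

lemma radius_bounds: "0 < radius \<mu> P" "radius \<mu> P < 1"
  using lagrange_radius_body[of P] unfolding lagrange_radius_def by auto

lemma ray_pot'_axis: "ray_pot' (mass \<mu> P) 1 1 (radius \<mu> P) = 0"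
proof -
  let ?\<rho> = "radius \<mu> P"
  have d: "ray_dist 1 ?\<rho> = 1 - ?\<rho>"
    by (rule power2_eq_imp_eq)
       (use ray_dist_sq[of ?\<rho> 1] ray_dist_nonneg[of ?\<rho> 1] radius_bounds[of P] in auto)
  have e: "(?\<rho> - 1) / (1 - ?\<rho>) ^ 3 = - (1 / (1 - ?\<rho>)\<^sup>2)"
    using radius_bounds[of P] by (simp add: divide_simps power2_eq_square power3_eq_cube)
  have l: "mass \<mu> P / ?\<rho>\<^sup>2 = (1 - mass \<mu> P) * (1 / (1 - ?\<rho>)\<^sup>2 - 1) + ?\<rho>"
    using lagrange_radius_body[of P] unfolding lagrange_radius_def by blast
  have "(1 - mass \<mu> P) * (?\<rho> - 1) / (1 - ?\<rho>) ^ 3 = (1 - mass \<mu> P) * - (1 / (1 - ?\<rho>)\<^sup>2)"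
    unfolding e[symmetric] by simp
  then show ?thesis
    unfolding ray_pot'_def d l by (simp add: algebra_simps)
qed

lemma lpos_neq: "lpos \<mu> \<noteq> position \<mu> P"
  using radius_bounds[of P] norm_axis_vec[of \<mu> P] unfolding lpos_body[of \<mu> P] by auto

lemma eff_grad_lpos: "eff_grad \<mu> (lpos \<mu>) = 0"
proof -
  have "eff_grad \<mu> (lpos \<mu>) \<bullet> axis_vec \<mu> Moon = 0"
    using eff_grad_ray[where v = "axis_vec \<mu> Moon" and P = Moon and \<mu> = \<mu>, OF norm_axis_vec radius_bounds(1)[of Moon]] ray_pot'_axis[of Moon]
    unfolding lpos_def by simp
  then have "eff_grad \<mu> (lpos \<mu>) $ 1 = 0" by (simp add: inner3)
  moreover have "eff_grad \<mu> (lpos \<mu>) $ 2 = 0" "eff_grad \<mu> (lpos \<mu>) $ 3 = 0"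
    by (simp_all add: eff_grad_def lpos_def vector_3)
  ultimately show ?thesis by (simp add: vector3_eq_iff)
qed

text \<open>The momentum is that of a particle at rest in the rotating frame.\<close>

definition lpoint :: phase where
  "lpoint = (lpos \<mu>, vector [0, lpos \<mu> $ 1, 0])"

text \<open>At a critical point the velocity and the gradient of U vanish. Every other point of the
  segment is closer to one of the bodies than the radius of that body, and there the radial
  derivative of U is positive.\<close>

lemma L1_eq: "L1 \<mu> = lpoint"
  unfolding L1_def
proof (rule the_equality)
  have in_phase: "lpoint \<in> phase_space \<mu>" using lpos_neq by (simp add: lpoint_def phase_space_def)
  have "vel lpoint = 0" by (simp add: vector3_eq_iff lpoint_def vector_3 lpos_def)
  then have "H_deriv \<mu> lpoint = (\<lambda>_. 0)"
    using eff_grad_lpos by (auto simp: H_deriv_def lpoint_def)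
  then have "critical_point \<mu> lpoint"
    using H_has_derivative[OF in_phase] in_phase by (simp add: critical_point_def)
  moreover have "lpos \<mu> \<in> open_segment (position \<mu> Earth) (position \<mu> Moon)"
    unfolding in_segment using radius_bounds[of Earth] lpos_body[of \<mu> Earth] position_neq[of \<mu> Earth]
    by (intro conjI exI[of _ "radius \<mu> Earth"]) (auto simp: axis_vec_def algebra_simps)
  ultimately show "critical_point \<mu> lpoint \<and> fst lpoint \<in> open_segment (position \<mu> Earth) (position \<mu> Moon)"
    by (simp add: lpoint_def)
next
  fix z assume z: "critical_point \<mu> z \<and> fst z \<in> open_segment (position \<mu> Earth) (position \<mu> Moon)"
  then have ph: "z \<in> phase_space \<mu>" and "(H \<mu> has_derivative (\<lambda>_. 0)) (at z)"
    by (auto simp: critical_point_def)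
  then have D0: "H_deriv \<mu> z u = 0" for u
    using fun_cong[OF has_derivative_unique[OF H_has_derivative]] by metis
  have "vel z \<bullet> vel z = 0" using D0[of "(0, vel z)"] by (simp add: H_deriv_def)
  then have v0: "vel z = 0" by simp
  then have v0': "vel z $ i = 0" for i by simp
  have g0: "eff_grad \<mu> (fst z) \<bullet> v = 0" for v
    using D0[of "(v, 0)"] unfolding H_deriv_def v0' by simp
  obtain t where t: "0 < t" "t < 1" "fst z = (1 - t) *\<^sub>R position \<mu> Earth + t *\<^sub>R position \<mu> Moon"
    using z by (auto simp: in_segment)
  have ray: "ray_pot' (mass \<mu> P) 1 1 r = 0" if "fst z = position \<mu> P + r *\<^sub>R axis_vec \<mu> P" "0 < r" for P r
    using eff_grad_ray[where v = "axis_vec \<mu> P" and P = P and \<mu> = \<mu>, OF norm_axis_vec that(2)] g0[of "axis_vec \<mu> P"] that(1) by simp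
  have zE: "fst z = position \<mu> Earth + t *\<^sub>R axis_vec \<mu> Earth"
    and zM: "fst z = position \<mu> Moon + (1 - t) *\<^sub>R axis_vec \<mu> Moon"
    using t(3) by (auto simp: axis_vec_def algebra_simps)
  have "\<not> r < radius \<mu> P" if "fst z = position \<mu> P + r *\<^sub>R axis_vec \<mu> P" "0 < r" for P r
    using ray[OF that] ray_pot'_pos[OF mass_bounds lagrange_radius_body[of P] that(2), of 1 1] by auto
  from this[OF zE t(1)] this[OF zM] t have "t = radius \<mu> Earth"
    using radius_other[of \<mu> Earth] by simp
  then have "fst z = lpos \<mu>" using zE lpos_body[of \<mu> Earth] by simp
  moreover have "snd z $ 1 = - fst z $ 2" "snd z $ 2 = fst z $ 1" "snd z $ 3 = 0"
    using v0'[of 1] v0'[of 2] v0'[of 3] by auto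
  ultimately show "z = lpoint"
    by (simp add: lpoint_def prod_eq_iff vector3_eq_iff vector_3 lpos_def)
qed

lemma eff_pot_lpos: "eff_pot \<mu> (lpos \<mu>) = ray_pot (mass \<mu> P) 1 1 (radius \<mu> P)"
  using eff_pot_ray[where v = "axis_vec \<mu> P" and P = P and \<mu> = \<mu>, OF norm_axis_vec radius_bounds(1)[of P]] unfolding lpos_body[of \<mu> P] by simp

lemma H_L1: "H \<mu> (L1 \<mu>) = eff_pot \<mu> (lpos \<mu>)"
proof -
  have "vel lpoint = 0" by (simp add: vector3_eq_iff lpoint_def vector_3 lpos_def)
  then show ?thesis by (simp add: L1_eq H_eq lpoint_def)
qed

lemma eff_pot_sphere:
  assumes "norm (q - position \<mu> P) = radius \<mu> P"
  shows "eff_pot \<mu> (lpos \<mu>) \<le> eff_pot \<mu> q" "q \<noteq> lpos \<mu> \<Longrightarrow> eff_pot \<mu> (lpos \<mu>) < eff_pot \<mu> q"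
proof -
  have "q \<noteq> position \<mu> P" using assms radius_bounds[of P] by auto
  then obtain v where v: "norm v = 1" "q = position \<mu> P + radius \<mu> P *\<^sub>R v"
    using polar[of q "position \<mu> P"] assms by metis
  note b = unit_bounds(1,2)[OF v(1), of P] unit_bounds(3,4)[OF v(1)]
  note e = eff_pot_ray[where P = P and \<mu> = \<mu>, OF v(1) radius_bounds(1)[of P], folded v(2)]
  show "eff_pot \<mu> (lpos \<mu>) \<le> eff_pot \<mu> q"
    unfolding eff_pot_lpos[of P] e
    by (rule ray_pot_at_rho(1)[OF mass_bounds lagrange_radius_body[of P] b(1,2,4)])
  assume "q \<noteq> lpos \<mu>"
  have "orient P * v$1 < 1"
  proof (rule ccontr)
    assume "\<not> orient P * v$1 < 1"
    then have 1: "orient P * v$1 = 1" using b(2) by simp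
    then have v1: "v$1 = orient P" by (cases P) auto
    have "v \<bullet> v = 1" using v(1) by (simp add: norm_eq_sqrt_inner)
    then have "v$2 * v$2 + v$3 * v$3 = 0" using v1 by (simp add: inner3)
    then have "v = axis_vec \<mu> P"
      using v1 by (simp add: vector3_eq_iff sum_squares_eq_zero_iff)
    then show False using v(2) lpos_body[of \<mu> P] \<open>q \<noteq> lpos \<mu>\<close> by simp
  qed
  then show "eff_pot \<mu> (lpos \<mu>) < eff_pot \<mu> q"
    unfolding eff_pot_lpos[of P] e
    by (rule ray_pot_at_rho(2)[OF mass_bounds lagrange_radius_body[of P] b(1,2,4)])
qed

lemma eff_pot_ray_mono:
  assumes v: "norm v = 1" and r: "0 < a" "a \<le> b" "b \<le> radius \<mu> P"
  shows "eff_pot \<mu> (position \<mu> P + a *\<^sub>R v) \<le> eff_pot \<mu> (position \<mu> P + b *\<^sub>R v)"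
proof -
  note b = unit_bounds(1,2)[OF v, of P] unit_bounds(3,4)[OF v]
  have "ray_pot (mass \<mu> P) (orient P * v$1) ((v$1)\<^sup>2 + (v$2)\<^sup>2) a \<le>
      ray_pot (mass \<mu> P) (orient P * v$1) ((v$1)\<^sup>2 + (v$2)\<^sup>2) b"
  proof (rule DERIV_nonneg_imp_nondecreasing[OF r(2)])
    fix t assume t: "a \<le> t" "t \<le> b"
    have "0 \<le> ray_pot' (mass \<mu> P) (orient P * v$1) ((v$1)\<^sup>2 + (v$2)\<^sup>2) t"
    proof (cases "t < radius \<mu> P")
      case True
      show ?thesis
        by (rule less_imp_le[OF ray_pot'_pos[OF mass_bounds lagrange_radius_body[of P] _ True b]])
          (use t r in simp)
    next
      case False
      then have "t = radius \<mu> P" using t r by simp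
      then show ?thesis
        using ray_pot'_at_rho(1)[OF mass_bounds lagrange_radius_body[of P] b(1,2,4)] by simp
    qed
    then show "\<exists>y. (ray_pot (mass \<mu> P) (orient P * v$1) ((v$1)\<^sup>2 + (v$2)\<^sup>2) has_real_derivative y) (at t) \<and> 0 \<le> y"
      using ray_pot_has_derivative[of t "orient P * v$1" "mass \<mu> P" "(v$1)\<^sup>2 + (v$2)\<^sup>2"]
        t r radius_bounds[of P] b(2)
      by (intro exI conjI) auto
  qed
  then show ?thesis using eff_pot_ray[OF v] r by simp
qed

lemma eff_pot_near:
  "\<exists>e>0. e < radius \<mu> P \<and> ball (position \<mu> P) e - {position \<mu> P} \<subseteq> hill_region \<mu> c"
proof -
  \<comment> \<open>The second term makes the body's own attraction exceed |c| + 1; all other terms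
    of the potential are at most 0.\<close>
  define e where "e = min (radius \<mu> P / 2) (mass \<mu> P / (\<bar>c\<bar> + 1))"
  have e: "e > 0" "e < radius \<mu> P"
    using radius_bounds[of P] mass_bounds(1)[of P] by (auto simp: e_def divide_pos_pos)
  have "q \<in> hill_region \<mu> c" if q: "q \<in> ball (position \<mu> P) e - {position \<mu> P}" for q
  proof -
    have n: "0 < norm (q - position \<mu> P)" "norm (q - position \<mu> P) < e"
      using q by (auto simp: dist_norm norm_minus_commute)
    have "norm (q - position \<mu> P) < mass \<mu> P / (\<bar>c\<bar> + 1)" using n(2) by (simp add: e_def)
    then have "\<bar>c\<bar> + 1 < mass \<mu> P / norm (q - position \<mu> P)"
      using n(1) by (simp add: field_simps pos_less_divide_eq add_pos_nonneg)
    moreover have "mass \<mu> (other P) / norm (q - position \<mu> (other P)) \<ge> 0"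
      using mass_bounds(1)[of "other P"] by simp
    ultimately have "eff_pot \<mu> q \<le> c"
      unfolding eff_pot_body[of _ _ P] by (smt (verit) zero_le_power2 divide_nonneg_pos)
    moreover have "q \<noteq> position \<mu> P" "q \<noteq> position \<mu> (other P)"
      using n e norm_position_diff[of \<mu> P] radius_bounds[of P] by (auto simp: norm_minus_commute)
    ultimately show ?thesis by (cases P) (auto simp: hill_region_eq)
  qed
  then show ?thesis using e by blast
qed

lemma connected_punctured: "connected (ball (position \<mu> P) e - {position \<mu> P})"
  by (rule connected_punctured_ball) simp

lemma other_far: "norm (q - position \<mu> P) < 1 \<Longrightarrow> q \<noteq> position \<mu> (other P)"
  using norm_position_diff[of \<mu> P] by (auto simp: norm_minus_commute)

lemma hill_radial:
  assumes "q \<in> hill_region \<mu> c" "q \<in> ball (position \<mu> P) (radius \<mu> P)" "0 < t" "t \<le> 1"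
  shows "position \<mu> P + t *\<^sub>R (q - position \<mu> P) \<in> hill_region \<mu> c \<inter> ball (position \<mu> P) (radius \<mu> P)"
proof -
  have neq: "q \<noteq> position \<mu> P" using assms(1) by (cases P) (auto simp: hill_region_eq)
  then obtain v where v: "norm v = 1" "q = position \<mu> P + norm (q - position \<mu> P) *\<^sub>R v"
    using polar by metis
  define r where "r = norm (q - position \<mu> P)"
  have r: "0 < r" "r < radius \<mu> P" using neq assms(2) by (auto simp: r_def dist_norm norm_minus_commute)
  have tr: "0 < t * r" "t * r \<le> r" using assms r by (auto simp: mult_left_le_one_le)
  have eq: "position \<mu> P + t *\<^sub>R (q - position \<mu> P) = position \<mu> P + (t * r) *\<^sub>R v"
    using v(2) by (metis add_diff_cancel_left' r_def scaleR_scaleR)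
  have n: "norm (position \<mu> P + (t * r) *\<^sub>R v - position \<mu> P) = t * r" using v(1) tr by simp
  have "eff_pot \<mu> (position \<mu> P + (t * r) *\<^sub>R v) \<le> eff_pot \<mu> q"
    using eff_pot_ray_mono[OF v(1) tr less_imp_le[OF r(2)]] v(2) r_def by simp
  also have "\<dots> \<le> c" using assms(1) by (simp add: hill_region_eq)
  finally have U: "eff_pot \<mu> (position \<mu> P + (t * r) *\<^sub>R v) \<le> c" .
  have "position \<mu> P + (t * r) *\<^sub>R v \<noteq> position \<mu> (other P)"
    by (rule other_far, unfold n) (use tr r radius_bounds[of P] in linarith)
  moreover have "position \<mu> P + (t * r) *\<^sub>R v \<noteq> position \<mu> P" using n tr by auto
  ultimately have "position \<mu> P + (t * r) *\<^sub>R v \<in> hill_region \<mu> c"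
    using U by (cases P) (auto simp: hill_region_eq)
  moreover have "position \<mu> P + (t * r) *\<^sub>R v \<in> ball (position \<mu> P) (radius \<mu> P)"
    using v(1) tr(1) le_less_trans[OF tr(2) r(2)] by (simp add: dist_norm)
  ultimately show ?thesis unfolding eq by blast
qed

text \<open>U is nondecreasing along rays up to the radius, so with every point the set contains the
  half-open segment towards P; near P it contains a punctured ball, which is connected.\<close>

lemma connected_hill_ball: "connected (hill_region \<mu> c \<inter> ball (position \<mu> P) (radius \<mu> P))" (is "connected ?A")
proof -
  obtain e where e: "e > 0" "e < radius \<mu> P" "ball (position \<mu> P) e - {position \<mu> P} \<subseteq> hill_region \<mu> c"
    using eff_pot_near by blast
  let ?B = "ball (position \<mu> P) e - {position \<mu> P}"
  show ?thesis
  proof (rule connected_starlike[of ?B])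
    show "connected ?B" by (rule connected_punctured)
    show "?B \<subseteq> ?A" using e by auto
    have "position \<mu> P + (e / 2) *\<^sub>R axis_vec \<mu> P \<in> ?B"
      using e norm_axis_vec[of \<mu> P] by (auto simp: dist_norm)
    then show "?B \<noteq> {}" by blast
    fix q assume q: "q \<in> ?A"
    let ?T = "(\<lambda>t. position \<mu> P + t *\<^sub>R (q - position \<mu> P)) ` {0<..1}"
    have "connected ?T" by (intro connected_continuous_image continuous_intros) simp
    moreover have "?T \<subseteq> ?A"
      by (rule image_subsetI, rule hill_radial) (use q in auto)
    moreover have "q \<in> ?T" by (rule image_eqI[of _ _ 1]) auto
    moreover have "?T \<inter> ?B \<noteq> {}"
    proof -
      have neq: "q \<noteq> position \<mu> P" using q by (cases P) (auto simp: hill_region_eq)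
      define n where "n = norm (q - position \<mu> P)"
      have n: "n > 0" using neq by (simp add: n_def)
      define t where "t = min 1 (e / (2 * n))"
      have t: "0 < t" "t \<le> 1" using n e by (auto simp: t_def)
      have "t * n \<le> e / (2 * n) * n" using n by (intro mult_right_mono) (auto simp: t_def)
      then have "t * n < e" using n e by simp
      then have "position \<mu> P + t *\<^sub>R (q - position \<mu> P) \<in> ?B"
        using t neq by (auto simp: dist_norm n_def)
      moreover have "position \<mu> P + t *\<^sub>R (q - position \<mu> P) \<in> ?T"
        by (rule imageI) (use t in simp)
      ultimately show ?thesis by (meson disjoint_iff)
    qed
    ultimately show "\<exists>T. connected T \<and> T \<subseteq> ?A \<and> q \<in> T \<and> T \<inter> ?B \<noteq> {}"
      by (intro exI[of _ ?T] conjI)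
  qed
qed

lemma hill_component_unique:
  assumes "A \<in> components (hill_region \<mu> c)" "C \<in> components (hill_region \<mu> c)"
    "position \<mu> P \<in> closure C" "hill_region \<mu> c \<inter> ball (position \<mu> P) (radius \<mu> P) \<subseteq> A"
  shows "C = A"
proof -
  have "C \<inter> ball (position \<mu> P) (radius \<mu> P) \<noteq> {}"
    using assms(3) radius_bounds(1)[of P] open_Int_closure_eq_empty[of "ball (position \<mu> P) (radius \<mu> P)" C]
    by (auto simp: Int_commute)
  then have "C \<inter> A \<noteq> {}" using in_components_subset[OF assms(2)] assms(4) by blast
  then show ?thesis using components_eq[OF assms(2,1)] by blast
qed

lemma position_in_closure:
  assumes "hill_region \<mu> c \<inter> ball (position \<mu> P) (radius \<mu> P) \<subseteq> A"
  shows "position \<mu> P \<in> closure A"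
proof -
  obtain e where e: "e > 0" "e < radius \<mu> P" "ball (position \<mu> P) e - {position \<mu> P} \<subseteq> hill_region \<mu> c"
    using eff_pot_near by blast
  show ?thesis
    unfolding closure_approachable
  proof (intro allI impI)
    fix d :: real assume d: "d > 0"
    define y where "y = position \<mu> P + (min d e / 2) *\<^sub>R axis_vec \<mu> P"
    have "dist y (position \<mu> P) = min d e / 2"
      using norm_axis_vec[of \<mu> P] d e by (simp add: y_def dist_norm)
    moreover from this have "y \<in> ball (position \<mu> P) e - {position \<mu> P}"
      using d e by (auto simp: dist_commute)
    moreover from this have "y \<in> hill_region \<mu> c" "y \<in> ball (position \<mu> P) (radius \<mu> P)" using e by auto
    then have "y \<in> A" using assms by blast
    ultimately show "\<exists>y\<in>A. dist y (position \<mu> P) < d"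
      using e d by (intro bexI[of _ y]) auto
  qed
qed

lemma contact_type_below:
  assumes c: "c < H \<mu> (L1 \<mu>)"
  shows "contact_type \<mu> (regularized_\<Sigma> \<mu> c P)"
proof -
  let ?B = "ball (position \<mu> P) (radius \<mu> P)"
  let ?A = "hill_region \<mu> c \<inter> ?B"
  have c': "c < eff_pot \<mu> (lpos \<mu>)" using c H_L1 by simp
  \<comment> \<open>On the sphere through l the potential is at least U(l) > c. The Hill's region
    therefore misses the sphere, and the open and the closed ball cut out the same set.\<close>
  have "closedin (top_of_set (hill_region \<mu> c)) ?A"
  proof -
    have "q \<in> ?B" if "q \<in> hill_region \<mu> c" "q \<in> cball (position \<mu> P) (radius \<mu> P)" for q
      using eff_pot_sphere(1)[of q P] c' that by (force simp: hill_region_eq dist_norm norm_minus_commute)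
    then have "?A = hill_region \<mu> c \<inter> cball (position \<mu> P) (radius \<mu> P)" by auto
    then show ?thesis by (simp add: closedin_closed_Int)
  qed
  moreover have "openin (top_of_set (hill_region \<mu> c)) ?A" by (simp add: openin_open_Int)
  moreover have "?A \<noteq> {}" using position_in_closure[of c P ?A] by auto
  ultimately have comp: "?A \<in> components (hill_region \<mu> c)"
    by (intro in_components_clopen connected_hill_ball)
  have "hill_component \<mu> c P = ?A"
    unfolding hill_component_def
  proof (rule the_equality)
    have "bounded ?A" by (rule bounded_subset[OF bounded_ball]) auto
    then show "?A \<in> components (hill_region \<mu> c) \<and> bounded ?A \<and> position \<mu> P \<in> closure ?A"
      using comp position_in_closure by blast
  qed (use hill_component_unique[OF comp] in blast)
  moreover have "position \<mu> P' \<in> ?B \<longleftrightarrow> P' = P" for P'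
    using radius_bounds[of P] norm_position_diff[of \<mu> P] by (cases P; cases P') (auto simp: dist_norm norm_minus_commute)
  ultimately have eq: "regularized_\<Sigma> \<mu> c P = level_part \<mu> c ?B"
    unfolding regularized_\<Sigma>_def level_part_def \<Sigma>_def by (auto simp: hill_region_def)
  let ?G = "phase_space \<mu> \<inter> fst -` ?B"
  let ?X = "\<lambda>z :: phase. (fst z - position \<mu> P, 0 :: real^3)"
  have G: "open ?G" by (intro open_Int open_phase_space open_vimage_fst open_ball)
  have D: "(?X has_derivative (\<lambda>u. (fst u, 0))) (at z)" for z
    by (auto intro!: derivative_eq_intros)
  show ?thesis
    unfolding eq
  proof (rule contact_type_level_part[OF \<mu> open_ball G])
    show "Cinf_on ?G ?X" by (intro Cinf_intros G)
    show "symp (frechet_derivative ?X (at z) u) v + symp u (frechet_derivative ?X (at z) v) = symp u v" for z u v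
      by (simp add: symp_def flip: frechet_derivative_at[OF D])
  next
    fix P' assume "position \<mu> P' \<in> ?B"
    then have "P' = P" using \<open>\<And>P'. position \<mu> P' \<in> ?B \<longleftrightarrow> P' = P\<close> by blast
    then show "\<exists>e>0. \<forall>z\<in>phase_space \<mu>. norm (fst z - position \<mu> P') < e \<longrightarrow>
        z \<in> ?G \<and> ?X z = (fst z - position \<mu> P', 0)"
      using radius_bounds[of P] by (intro exI[of _ "radius \<mu> P"]) (auto simp: dist_norm norm_minus_commute)
  next
    fix z assume z: "z \<in> phase_space \<mu>" "H \<mu> z = c" "fst z \<in> ?B"
    have neq: "fst z \<noteq> position \<mu> P" using z(1) phase_space_iff[of z \<mu> P] by blast
    define r where "r = norm (fst z - position \<mu> P)"
    obtain v where v: "norm v = 1" "fst z = position \<mu> P + r *\<^sub>R v"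
      using polar[OF neq] r_def by metis
    have r: "0 < r" "r < radius \<mu> P" using neq z(3) by (auto simp: r_def dist_norm norm_minus_commute)
    note b = unit_bounds(1,2)[OF v(1), of P] unit_bounds(3,4)[OF v(1)]
    have "H_deriv \<mu> z (fst z - position \<mu> P, 0) > 0"
    proof (rule H_deriv_radial_pos[OF v(1) r(1) v(2)])
      show "0 < ray_pot' (mass \<mu> P) (orient P * v$1) ((v$1)\<^sup>2 + (v$2)\<^sup>2) r"
        by (rule ray_pot'_pos[OF mass_bounds lagrange_radius_body[of P] r b])
      show "0 < (ray_pot' (mass \<mu> P) (orient P * v$1) ((v$1)\<^sup>2 + (v$2)\<^sup>2) r)\<^sup>2
          - 2 * ((v$1)\<^sup>2 + (v$2)\<^sup>2) * (H \<mu> z - eff_pot \<mu> (fst z))"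
        using ray_discriminant_pos[OF mass_bounds lagrange_radius_body[of P] r(1) _ _ b, of c] r c'
          eff_pot_lpos[of P] z(2) v(2) eff_pot_ray[where P = P and \<mu> = \<mu>, OF v(1) r(1)] by simp
    qed
    then show "z \<in> ?G \<and> (\<exists>D. (H \<mu> has_derivative D) (at z) \<and> D (?X z) \<noteq> 0)"
      using z H_has_derivative[OF z(1)] by (auto intro!: exI[of _ "H_deriv \<mu> z"])
  qed auto
qed

end

section \<open>Absence of compact components of the Hill's region\<close>

definition kepler_deriv :: "real \<Rightarrow> real^3 \<Rightarrow> real^3 \<Rightarrow> real^3" where
  "kepler_deriv k d u = (k / norm d ^ 3) *\<^sub>R u - (3 * k * (d \<bullet> u) / norm d ^ 5) *\<^sub>R d"

lemma kepler_has_derivative: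
  fixes a :: "real^3"
  assumes "q \<noteq> a"
  shows "((\<lambda>q. (k / norm (q - a) ^ 3) *\<^sub>R (q - a)) has_derivative kepler_deriv k (q - a)) (at q)"
proof -
  define n where "n = norm (q - a)"
  have n: "n > 0" using assms by (simp add: n_def)
  have d: "((\<lambda>q. q - a) has_derivative (\<lambda>u. u)) (at q)"
    by (auto intro!: derivative_eq_intros)
  have i: "((\<lambda>q. 1 / norm (q - a)) has_derivative (\<lambda>u. - ((1 / n ^ 3) *\<^sub>R (q - a)) \<bullet> u)) (at q)"
    using inverse_norm_has_derivative[OF assms, of 1] by (simp add: n_def)
  have p: "((\<lambda>q. k * (1 / norm (q - a)) ^ 3) has_derivative (\<lambda>u. - (3 * k * ((q - a) \<bullet> u) / n ^ 5))) (at q)"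
  proof (rule has_derivative_eq_rhs[OF has_derivative_mult_right[OF has_derivative_power[OF i]]], rule ext)
    fix u
    have "- ((1 / n ^ 3) *\<^sub>R (q - a)) \<bullet> u = - (1 / n ^ 3) * ((q - a) \<bullet> u)"
      by (simp only: inner_minus_left inner_scaleR_left)
    then show "k * (of_nat 3 * (- ((1 / n ^ 3) *\<^sub>R (q - a)) \<bullet> u) * (1 / norm (q - a)) ^ (3 - 1)) =
        - (3 * k * ((q - a) \<bullet> u) / n ^ 5)"
      using n by (simp add: n_def[symmetric] field_simps eval_nat_numeral)
  qed
  have "((\<lambda>q. (k * (1 / norm (q - a)) ^ 3) *\<^sub>R (q - a)) has_derivative kepler_deriv k (q - a)) (at q)"
    by (rule has_derivative_eq_rhs[OF has_derivative_scaleR[OF p d]])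
       (rule ext, simp add: kepler_deriv_def n_def[symmetric] power_one_over)
  then show ?thesis by (simp add: power_one_over)
qed

definition eff_hess :: "real \<Rightarrow> real^3 \<Rightarrow> real^3 \<Rightarrow> real^3" where
  "eff_hess \<mu> q u = kepler_deriv (mass \<mu> Earth) (q - position \<mu> Earth) u
     + kepler_deriv (mass \<mu> Moon) (q - position \<mu> Moon) u - vector [u$1, u$2, 0]"

lemma eff_grad_has_derivative:
  assumes "q \<noteq> position \<mu> Earth" "q \<noteq> position \<mu> Moon"
  shows "(eff_grad \<mu> has_derivative eff_hess \<mu> q) (at q)"
proof -
  let ?D = "\<lambda>u :: real^3. vector [u$1, u$2, 0] :: real^3"
  have "linear ?D" by (rule linearI) (auto simp: vector3_eq_iff vector_3)
  then have "(?D has_derivative ?D) (at q)"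
    by (intro bounded_linear_imp_has_derivative) (simp add: linear_conv_bounded_linear)
  from has_derivative_diff[OF has_derivative_add[OF kepler_has_derivative[OF assms(1), of "mass \<mu> Earth"]
        kepler_has_derivative[OF assms(2), of "mass \<mu> Moon"]] this]
  show ?thesis unfolding eff_grad_def[abs_def] eff_hess_def[abs_def] .
qed

text \<open>The Newtonian potential is harmonic away from its centre.\<close>

lemma kepler_deriv_trace:
  assumes "d \<noteq> 0"
  shows "kepler_deriv k d (axis 1 1) $ 1 + kepler_deriv k d (axis 2 1) $ 2 + kepler_deriv k d (axis 3 1) $ 3 = 0"
proof -
  define n where "n = norm d"
  have n: "n > 0" using assms by (simp add: n_def)
  have nn: "d$1 * d$1 + d$2 * d$2 + d$3 * d$3 = n * n"
    unfolding n_def by (metis inner3 norm_eq_sqrt_inner inner_ge_zero real_sqrt_mult_self abs_of_nonneg)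
  have "kepler_deriv k d (axis 1 1) $ 1 + kepler_deriv k d (axis 2 1) $ 2 + kepler_deriv k d (axis 3 1) $ 3 =
      3 * k / n ^ 3 - 3 * k / n ^ 5 * (d$1 * d$1 + d$2 * d$2 + d$3 * d$3)"
    by (simp add: kepler_deriv_def inner3 n_def[symmetric] axis_def algebra_simps)
  also have "\<dots> = 0" unfolding nn using n by (simp add: field_simps eval_nat_numeral)
  finally show ?thesis .
qed

lemma eff_pot_line_derivative:
  assumes "q + t *\<^sub>R v \<noteq> position \<mu> Earth" "q + t *\<^sub>R v \<noteq> position \<mu> Moon"
  shows "((\<lambda>t. eff_pot \<mu> (q + t *\<^sub>R v)) has_real_derivative eff_grad \<mu> (q + t *\<^sub>R v) \<bullet> v) (at t)"
proof -
  have "((\<lambda>t. q + t *\<^sub>R v) has_derivative (\<lambda>h. h *\<^sub>R v)) (at t)"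
    by (auto intro!: derivative_eq_intros)
  from has_derivative_compose[OF this eff_pot_has_derivative[OF assms]]
  show ?thesis
    unfolding has_field_derivative_def by (rule has_derivative_eq_rhs) auto
qed

text \<open>The Laplacian of U is -2, contributed by the centrifugal term alone, so U has no local
  minimum: at a critical point some diagonal entry of the Hessian is negative, and the corresponding
  axis is a direction of descent.\<close>

lemma eff_pot_descent:
  assumes q: "q \<noteq> position \<mu> Earth" "q \<noteq> position \<mu> Moon"
  shows "\<exists>v d. d > 0 \<and> (\<forall>t. 0 < t \<and> t < d \<longrightarrow> eff_pot \<mu> (q + t *\<^sub>R v) < eff_pot \<mu> q)"
proof (cases "eff_grad \<mu> q = 0")
  case False
  have "((\<lambda>t. eff_pot \<mu> (q + t *\<^sub>R - eff_grad \<mu> q)) has_real_derivative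
      eff_grad \<mu> (q + 0 *\<^sub>R - eff_grad \<mu> q) \<bullet> - eff_grad \<mu> q) (at 0)"
    by (rule eff_pot_line_derivative) (use q in auto)
  then have "((\<lambda>t. eff_pot \<mu> (q + t *\<^sub>R - eff_grad \<mu> q)) has_real_derivative
      - (eff_grad \<mu> q \<bullet> eff_grad \<mu> q)) (at 0)" by simp
  from DERIV_neg_dec_right[OF this] False
  obtain d where "d > 0" "\<forall>h>0. h < d \<longrightarrow> eff_pot \<mu> (q + (0 + h) *\<^sub>R - eff_grad \<mu> q) < eff_pot \<mu> (q + 0 *\<^sub>R - eff_grad \<mu> q)"
    by auto
  then show ?thesis by (intro exI[of _ "- eff_grad \<mu> q"] exI[of _ d]) auto
next
  case True
  have "eff_hess \<mu> q (axis 1 1) $ 1 + eff_hess \<mu> q (axis 2 1) $ 2 + eff_hess \<mu> q (axis 3 1) $ 3 = - 2"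
    using kepler_deriv_trace[of "q - position \<mu> Earth" "mass \<mu> Earth"]
      kepler_deriv_trace[of "q - position \<mu> Moon" "mass \<mu> Moon"] q
    by (simp add: eff_hess_def vector_3 axis_def algebra_simps)
  then obtain i where i: "eff_hess \<mu> q (axis i 1) $ i < 0"
    by (smt (verit))
  let ?e = "axis i 1 :: real^3"
  have o: "open {x. x \<noteq> position \<mu> Earth \<and> x \<noteq> position \<mu> Moon}"
    by (intro open_Collect_conj open_Collect_neq continuous_intros)
  have "\<exists>e>0. ball q e \<subseteq> {x. x \<noteq> position \<mu> Earth \<and> x \<noteq> position \<mu> Moon}"
    using o q open_contains_ball by blast
  then obtain e where e: "e > 0" "ball q e \<subseteq> {x. x \<noteq> position \<mu> Earth \<and> x \<noteq> position \<mu> Moon}" by blast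
  have ok: "q + t *\<^sub>R ?e \<noteq> position \<mu> Earth" "q + t *\<^sub>R ?e \<noteq> position \<mu> Moon" if "\<bar>t\<bar> < e" for t
  proof -
    have "q + t *\<^sub>R ?e \<in> ball q e" using that by (simp add: dist_norm)
    then show "q + t *\<^sub>R ?e \<noteq> position \<mu> Earth" "q + t *\<^sub>R ?e \<noteq> position \<mu> Moon" using e(2) by blast+
  qed
  have "((\<lambda>t. q + t *\<^sub>R ?e) has_derivative (\<lambda>h. h *\<^sub>R ?e)) (at 0)"
    by (auto intro!: derivative_eq_intros)
  from has_derivative_compose[OF this, of "eff_grad \<mu>" "eff_hess \<mu> q"] eff_grad_has_derivative[OF q]
  have D: "((\<lambda>t. eff_grad \<mu> (q + t *\<^sub>R ?e)) has_derivative (\<lambda>h. eff_hess \<mu> q (h *\<^sub>R ?e))) (at 0)" by simp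
  have "((\<lambda>t. eff_grad \<mu> (q + t *\<^sub>R ?e) $ i) has_real_derivative eff_hess \<mu> q ?e $ i) (at 0)"
    unfolding has_field_derivative_def
    by (rule has_derivative_eq_rhs[OF bounded_linear.has_derivative[OF bounded_linear_vec_nth D]])
       (auto simp: linear_cmul[OF has_derivative_linear[OF eff_grad_has_derivative[OF q]]])
  from DERIV_neg_dec_right[OF this i] True
  obtain d where d: "d > 0" "\<And>h. 0 < h \<Longrightarrow> h < d \<Longrightarrow> eff_grad \<mu> (q + h *\<^sub>R ?e) $ i < 0" by auto
  have "eff_pot \<mu> (q + t *\<^sub>R ?e) < eff_pot \<mu> q" if t: "0 < t" "t < min d e" for t
  proof -
    have "eff_pot \<mu> (q + t *\<^sub>R ?e) < eff_pot \<mu> (q + 0 *\<^sub>R ?e)"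
    proof (rule DERIV_neg_imp_decreasing_open[OF t(1)])
      fix x assume x: "0 < x" "x < t"
      then have "((\<lambda>t. eff_pot \<mu> (q + t *\<^sub>R ?e)) has_real_derivative eff_grad \<mu> (q + x *\<^sub>R ?e) \<bullet> ?e) (at x)"
        using t by (intro eff_pot_line_derivative ok) auto
      moreover have "eff_grad \<mu> (q + x *\<^sub>R ?e) \<bullet> ?e < 0"
        using d(2)[of x] x t by (simp add: inner_axis)
      ultimately show "\<exists>y. ((\<lambda>t. eff_pot \<mu> (q + t *\<^sub>R ?e)) has_real_derivative y) (at x) \<and> y < 0" by blast
    next
      show "continuous_on {0..t} (\<lambda>t. eff_pot \<mu> (q + t *\<^sub>R ?e))"
        by (rule continuous_on_compose2[OF continuous_on_eff_pot])
           (use ok t in \<open>auto intro!: continuous_intros\<close>)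
    qed
    then show ?thesis by simp
  qed
  then show ?thesis using d e by (intro exI[of _ ?e] exI[of _ "min d e"]) auto
qed

text \<open>Otherwise the component is compact, and the minimum of U on it could be lowered along a
  short segment inside the Hill's region. This serves the uniqueness that
  \<open>hill_component_EM\<close> presupposes.\<close>

lemma bounded_hill_component_closure:
  assumes C: "C \<in> components (hill_region \<mu> c)" "bounded C"
  shows "position \<mu> Earth \<in> closure C \<or> position \<mu> Moon \<in> closure C"
proof (rule ccontr)
  assume n: "\<not> (position \<mu> Earth \<in> closure C \<or> position \<mu> Moon \<in> closure C)"
  have CH: "C \<subseteq> hill_region \<mu> c" using in_components_subset[OF C(1)] .
  have sub: "closure C \<subseteq> {q. q \<noteq> position \<mu> Earth \<and> q \<noteq> position \<mu> Moon}" using n by auto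
  have cont: "continuous_on (closure C) (eff_pot \<mu>)"
    by (rule continuous_on_subset[OF continuous_on_eff_pot sub])
  have "closure C \<subseteq> hill_region \<mu> c"
  proof
    fix q assume q: "q \<in> closure C"
    have "eff_pot \<mu> q \<le> c"
      by (rule continuous_le_on_closure[OF cont q]) (use CH in \<open>auto simp: hill_region_eq\<close>)
    then show "q \<in> hill_region \<mu> c" using q sub by (auto simp: hill_region_eq)
  qed
  then have "closure C \<subseteq> C"
    using components_maximal[OF C(1) connected_imp_connected_closure[OF in_components_connected[OF C(1)]]]
      closure_subset[of C] in_components_nonempty[OF C(1)] by blast
  then have cl: "closure C = C" using closure_subset by blast
  have "compact C" using C(2) closed_closure[of C] unfolding cl by (simp add: compact_eq_bounded_closed)
  then obtain q where q: "q \<in> C" "\<And>y. y \<in> C \<Longrightarrow> eff_pot \<mu> q \<le> eff_pot \<mu> y"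
    using continuous_attains_inf[of C "eff_pot \<mu>"] cont in_components_nonempty[OF C(1)] unfolding cl by blast
  have qn: "q \<noteq> position \<mu> Earth" "q \<noteq> position \<mu> Moon" using q(1) CH by (auto simp: hill_region_eq)
  obtain v d where vd: "d > 0" "\<And>t. 0 < t \<Longrightarrow> t < d \<Longrightarrow> eff_pot \<mu> (q + t *\<^sub>R v) < eff_pot \<mu> q"
    using eff_pot_descent[OF qn] by blast
  have o: "open ((\<lambda>t. q + t *\<^sub>R v) -` {q. q \<noteq> position \<mu> Earth \<and> q \<noteq> position \<mu> Moon})"
    by (intro open_vimage open_Collect_conj open_Collect_neq continuous_intros)
  moreover have "0 \<in> (\<lambda>t. q + t *\<^sub>R v) -` {q. q \<noteq> position \<mu> Earth \<and> q \<noteq> position \<mu> Moon}" using qn by simp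
  ultimately obtain e where e: "e > 0"
    "ball 0 e \<subseteq> (\<lambda>t. q + t *\<^sub>R v) -` {q. q \<noteq> position \<mu> Earth \<and> q \<noteq> position \<mu> Moon}"
    using open_contains_ball by blast
  define h where "h = min d e / 2"
  have h: "0 < h" "h < d" "h < e" using vd e by (auto simp: h_def)
  let ?T = "(\<lambda>t. q + t *\<^sub>R v) ` {0..h}"
  have "connected ?T" by (intro connected_continuous_image continuous_intros) simp
  moreover have "?T \<subseteq> hill_region \<mu> c"
  proof (rule image_subsetI)
    fix t assume t: "t \<in> {0..h}"
    then have "t \<in> ball 0 e" using h by simp
    then have "q + t *\<^sub>R v \<noteq> position \<mu> Earth \<and> q + t *\<^sub>R v \<noteq> position \<mu> Moon" using e(2) by blast
    moreover have "eff_pot \<mu> (q + t *\<^sub>R v) \<le> eff_pot \<mu> q"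
      using vd(2)[of t] t h by (cases "t = 0") auto
    then have "eff_pot \<mu> (q + t *\<^sub>R v) \<le> c" using q(1) CH by (auto simp: hill_region_eq)
    ultimately show "q + t *\<^sub>R v \<in> hill_region \<mu> c" by (simp add: hill_region_eq)
  qed
  moreover have "q \<in> ?T" using h by (intro image_eqI[of _ _ 0]) auto
  ultimately have "?T \<subseteq> C" using components_maximal[OF C(1)] q(1) by blast
  moreover have "q + h *\<^sub>R v \<in> ?T" by (rule imageI) (use h in simp)
  ultimately have "q + h *\<^sub>R v \<in> C" by blast
  then show False using q(2) vd(2)[OF h(1,2)] by force
qed

section \<open>Energies slightly above the critical value\<close>

context
  fixes \<mu> :: real
  assumes \<mu>: "0 < \<mu>" "\<mu> < 1"
begin

lemmas mass_bounds' = mass_bounds[OF \<mu>]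
lemmas lagrange_radius_body' = lagrange_radius_body[OF \<mu>]
lemmas radius_bounds' = radius_bounds[OF \<mu>]

text \<open>At the critical energy the discriminant is positive off l, hence bounded below by
  compactness, and raising the energy lowers it by at most twice the increment.\<close>

lemma discriminant_margin:
  assumes d: "0 < d" "d \<le> radius \<mu> P / 2"
  shows "\<exists>e>0. \<forall>c v r. c < eff_pot \<mu> (lpos \<mu>) + e \<longrightarrow> norm v = 1 \<longrightarrow> 0 < r \<longrightarrow> r \<le> radius \<mu> P \<longrightarrow>
    d \<le> norm (position \<mu> P + r *\<^sub>R v - lpos \<mu>) \<longrightarrow>
    0 < (ray_pot' (mass \<mu> P) (orient P * v$1) ((v$1)\<^sup>2 + (v$2)\<^sup>2) r)\<^sup>2
      - 2 * ((v$1)\<^sup>2 + (v$2)\<^sup>2) * (c - ray_pot (mass \<mu> P) (orient P * v$1) ((v$1)\<^sup>2 + (v$2)\<^sup>2) r)"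
proof -
  let ?\<rho> = "radius \<mu> P"
  note rb = radius_bounds'[of P]
  define f where "f c v r = (ray_pot' (mass \<mu> P) (orient P * v$1) ((v$1)\<^sup>2 + (v$2)\<^sup>2) r)\<^sup>2
      - 2 * ((v$1)\<^sup>2 + (v$2)\<^sup>2) * (c - ray_pot (mass \<mu> P) (orient P * v$1) ((v$1)\<^sup>2 + (v$2)\<^sup>2) r)"
    for c r and v :: "real^3"
  \<comment> \<open>Small radii are left out because the potential is singular at P; monotonicity
    along rays covers them.\<close>
  define K where "K = (sphere 0 1 \<times> {?\<rho> / 2..?\<rho>}) \<inter> {w. d \<le> norm (position \<mu> P + snd w *\<^sub>R fst w - lpos \<mu>)}"
  let ?C = "eff_pot \<mu> (lpos \<mu>)"
  have K: "norm v = 1 \<and> ?\<rho> / 2 \<le> r \<and> r \<le> ?\<rho> \<and> d \<le> norm (position \<mu> P + r *\<^sub>R v - lpos \<mu>)"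
    if "(v, r) \<in> K" for v r using that by (auto simp: K_def)
  have "compact K"
    unfolding K_def
    by (intro compact_Int_closed compact_Times compact_sphere compact_Icc closed_Collect_le continuous_intros)
  moreover have "continuous_on K (\<lambda>w. f ?C (fst w) (snd w))"
  proof -
    have "ray_dist (orient P * fst w $ 1) (snd w) \<noteq> 0" "snd w \<noteq> 0" if "w \<in> K" for w
    proof -
      have w: "norm (fst w) = 1" "?\<rho> / 2 \<le> snd w" "snd w \<le> ?\<rho>" using K[of "fst w" "snd w"] that by auto
      then show "snd w \<noteq> 0" using rb by simp
      have "ray_dist (orient P * fst w $ 1) (snd w) > 0"
        by (rule ray_dist_pos) (use w rb unit_bounds(2)[OF w(1), of P] in auto)
      then show "ray_dist (orient P * fst w $ 1) (snd w) \<noteq> 0" by simp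
    qed
    then show ?thesis
      unfolding f_def ray_pot'_def ray_pot_def ray_dist_def
      by (intro continuous_intros) (auto simp: ray_dist_def)
  qed
  moreover have pos: "f ?C v r > 0" if "(v, r) \<in> K" for v r
  proof -
    note k = K[OF that]
    then have v: "norm v = 1" by blast
    note b = unit_bounds(1,2)[OF v, of P] unit_bounds(3,4)[OF v]
    have "r < ?\<rho> \<or> orient P * v$1 < 1"
    proof (rule ccontr)
      assume "\<not> (r < ?\<rho> \<or> orient P * v$1 < 1)"
      then have 1: "r = ?\<rho>" "orient P * v$1 = 1" using b k by auto
      then have v1: "v$1 = orient P" by (cases P) auto
      have "v \<bullet> v = 1" using v by (simp add: norm_eq_sqrt_inner)
      then have "v$2 * v$2 + v$3 * v$3 = 0" using v1 by (simp add: inner3)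
      then have "v = axis_vec \<mu> P" using v1 by (simp add: vector3_eq_iff sum_squares_eq_zero_iff)
      then show False using k 1 lpos_body[of \<mu> P] d by simp
    qed
    then show ?thesis
      unfolding f_def
      by (intro ray_discriminant_pos[OF mass_bounds' lagrange_radius_body'[of P]] b)
         (use k rb eff_pot_lpos[OF \<mu>, of P] in auto)
  qed
  ultimately obtain k where k: "k > 0" "\<And>v r. (v, r) \<in> K \<Longrightarrow> k \<le> f ?C v r"
  proof (cases "K = {}")
    case True
    then show ?thesis using that[of 1] by auto
  next
    case False
    assume "compact K" "continuous_on K (\<lambda>w. f ?C (fst w) (snd w))"
    then obtain w where w: "w \<in> K" "\<And>y. y \<in> K \<Longrightarrow> f ?C (fst w) (snd w) \<le> f ?C (fst y) (snd y)"
      using continuous_attains_inf[OF _ False] by blast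
    have "f ?C (fst w) (snd w) > 0" using pos[of "fst w" "snd w"] w(1) by simp
    then show ?thesis using that[of "f ?C (fst w) (snd w)"] w(2) by force
  qed
  have main: "0 < f c v r" if c: "c < ?C + k / 2" and v: "norm v = 1" and r: "0 < r" "r \<le> ?\<rho>"
    and far: "d \<le> norm (position \<mu> P + r *\<^sub>R v - lpos \<mu>)" for c v r
  proof -
    note b = unit_bounds(1,2)[OF v, of P] unit_bounds(3,4)[OF v]
    have onK: "0 < f c v r" if "(v, r) \<in> K" for r
    proof -
      have "f c v r = f ?C v r - 2 * ((v$1)\<^sup>2 + (v$2)\<^sup>2) * (c - ?C)" by (simp add: f_def algebra_simps)
      moreover have "((v$1)\<^sup>2 + (v$2)\<^sup>2) * (c - ?C) < k / 2"
      proof (cases "c \<le> ?C")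
        case True
        then have "((v$1)\<^sup>2 + (v$2)\<^sup>2) * (c - ?C) \<le> 0" using b by (intro mult_nonneg_nonpos) auto
        then show ?thesis using k by linarith
      next
        case False
        then have "((v$1)\<^sup>2 + (v$2)\<^sup>2) * (c - ?C) \<le> 1 * (c - ?C)" using b by (intro mult_right_mono) auto
        also have "\<dots> < k / 2" using c by argo
        finally show ?thesis .
      qed
      ultimately show ?thesis using k(2)[OF that] by linarith
    qed
    show ?thesis
    proof (cases "?\<rho> / 2 \<le> r")
      case True
      then show ?thesis using v r far by (intro onK) (auto simp: K_def)
    next
      case False
      \<comment> \<open>The comparison point at radius \<rho>/2 is at distance at least \<rho>/2
        \<ge> d from l, hence belongs to K.\<close>
      have "?\<rho> / 2 \<le> norm (position \<mu> P + (?\<rho> / 2) *\<^sub>R v - lpos \<mu>)"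
        using norm_triangle_ineq2[of "?\<rho> *\<^sub>R axis_vec \<mu> P" "(?\<rho> / 2) *\<^sub>R v"] v rb norm_axis_vec[of \<mu> P]
        by (simp add: lpos_body[of \<mu> P] norm_minus_commute)
      then have "0 < f c v (?\<rho> / 2)" using v rb d by (intro onK) (auto simp: K_def)
      also have "\<dots> < f c v r"
        unfolding f_def
        by (intro ray_discriminant_decreasing[OF mass_bounds' lagrange_radius_body'[of P]] b)
           (use False r rb in auto)
      finally show ?thesis .
    qed
  qed
  show ?thesis
    by (rule exI[of _ "k / 2"]) (use k(1) main in \<open>auto simp: f_def\<close>)
qed

text \<open>U exceeds U(l) on the sphere off l, hence by a fixed margin on the compact part outside
  a ball around l.\<close>

lemma sphere_margin:
  assumes "0 < d"
  shows "\<exists>e>0. \<forall>q. norm (q - position \<mu> P) = radius \<mu> P \<longrightarrow> d \<le> norm (q - lpos \<mu>) \<longrightarrow>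
    eff_pot \<mu> (lpos \<mu>) + e \<le> eff_pot \<mu> q"
proof -
  define K where "K = sphere (position \<mu> P) (radius \<mu> P) \<inter> {q. d \<le> norm (q - lpos \<mu>)}"
  have K: "norm (q - position \<mu> P) = radius \<mu> P" "q \<noteq> lpos \<mu>" if "q \<in> K" for q
    using that assms by (auto simp: K_def dist_norm norm_minus_commute)
  have "compact K"
    unfolding K_def by (intro compact_Int_closed compact_sphere closed_Collect_le continuous_intros)
  moreover have "continuous_on K (eff_pot \<mu>)"
  proof (rule continuous_on_subset[OF continuous_on_eff_pot])
    have "q \<noteq> position \<mu> P \<and> q \<noteq> position \<mu> (other P)" if "q \<in> K" for q
      using K(1)[OF that] radius_bounds'[of P] other_far[OF \<mu>, of q P] by auto
    then show "K \<subseteq> {q. q \<noteq> position \<mu> Earth \<and> q \<noteq> position \<mu> Moon}" by (cases P) auto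
  qed
  ultimately obtain e where "e > 0" "\<And>q. q \<in> K \<Longrightarrow> eff_pot \<mu> (lpos \<mu>) + e \<le> eff_pot \<mu> q"
  proof (cases "K = {}")
    case True
    then show ?thesis using that[of 1] by auto
  next
    case False
    assume "compact K" "continuous_on K (eff_pot \<mu>)"
    then obtain w where w: "w \<in> K" "\<And>y. y \<in> K \<Longrightarrow> eff_pot \<mu> w \<le> eff_pot \<mu> y"
      using continuous_attains_inf[OF _ False] by blast
    show ?thesis
      using that[of "eff_pot \<mu> w - eff_pot \<mu> (lpos \<mu>)"] w eff_pot_sphere(2)[OF \<mu> K(1)[OF w(1)] K(2)[OF w(1)]]
      by force
  qed
  then show ?thesis by (intro exI[of _ e]) (auto simp: K_def dist_norm norm_minus_commute)
qed

end

section \<open>Cutoff functions and the quadratic model at the saddle\<close>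

text \<open>The values \<rho> and \<rho> - 1 are the translations that turn (q - l) d/dq into the
  radial fields at the Moon and at the Earth. In between, \<Phi> decreases through 0, and its bounds
  are homogeneous in u, as the estimates at the saddle require.\<close>

lemma saddle_profile_exists:
  fixes \<rho> :: real
  assumes \<rho>: "0 < \<rho>" "\<rho> < 1"
  shows "\<exists>\<Phi> C. Cinf_on UNIV \<Phi> \<and> C \<ge> 1 \<and> (\<forall>u\<le>-1. \<Phi> u = \<rho>) \<and> (\<forall>u\<ge>1. \<Phi> u = \<rho> - 1) \<and>
    (\<forall>u. \<bar>u\<bar> \<le> 1 \<longrightarrow> deriv \<Phi> u \<le> 0 \<and> \<bar>deriv \<Phi> u\<bar> \<le> C \<and> \<bar>\<Phi> u\<bar> \<le> C * \<bar>u\<bar> \<and>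
      min \<rho> (1 - \<rho>) * u\<^sup>2 \<le> - u * \<Phi> u) \<and> (\<forall>u. \<bar>u\<bar> > 1 \<longrightarrow> deriv \<Phi> u = 0)"
proof -
  define m where "m = min \<rho> (1 - \<rho>)"
  have m: "0 < m" "m \<le> \<rho>" "m \<le> 1 - \<rho>" "m \<le> 1" using \<rho> by (auto simp: m_def)
  \<comment> \<open>The line of slope - m is blended into each constant by a step between |u| = 1/2
    and |u| = 1; at most one of the two steps is nonzero.\<close>
  define \<Phi> where "\<Phi> u = - m * u + step (- 2 * u - 1) * (\<rho> + m * u) + step (2 * u - 1) * (m * u - (1 - \<rho>))" for u
  obtain Cs where Cs: "Cs > 0" "\<And>t. \<bar>deriv step t\<bar> \<le> Cs" using deriv_step_bounded by blast
  have smooth: "Cinf_on UNIV \<Phi>"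
    unfolding \<Phi>_def[abs_def] by (intro Cinf_intros open_UNIV)
  have left: "\<Phi> u = \<rho>" if "u \<le> -1" for u
    using that by (simp add: \<Phi>_def step_eq_0 step_eq_1)
  have right: "\<Phi> u = \<rho> - 1" if "u \<ge> 1" for u
    using that by (simp add: \<Phi>_def step_eq_0 step_eq_1)
  have D: "(\<Phi> has_real_derivative - m * (1 - step (- 2 * u - 1) - step (2 * u - 1))
      - 2 * (deriv step (- 2 * u - 1) * (\<rho> + m * u))
      - 2 * (deriv step (2 * u - 1) * (1 - \<rho> - m * u))) (at u)" for u
  proof -
    have 1: "((\<lambda>u. step (- 2 * u - 1)) has_real_derivative deriv step (- 2 * u - 1) * - 2) (at u)"
      by (rule DERIV_chain2[OF step_has_derivative]) (auto intro!: derivative_eq_intros)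
    have 2: "((\<lambda>u. step (2 * u - 1)) has_real_derivative deriv step (2 * u - 1) * 2) (at u)"
      by (rule DERIV_chain2[OF step_has_derivative]) (auto intro!: derivative_eq_intros)
    show ?thesis unfolding \<Phi>_def[abs_def]
      by (rule derivative_eq_intros 1 2 refl)+ (simp add: algebra_simps)
  qed
  have D': "deriv \<Phi> u = - m * (1 - step (- 2 * u - 1) - step (2 * u - 1))
      - 2 * (deriv step (- 2 * u - 1) * (\<rho> + m * u)) - 2 * (deriv step (2 * u - 1) * (1 - \<rho> - m * u))" for u
    by (rule DERIV_imp_deriv[OF D])
  have disj: "step (- 2 * u - 1) = 0 \<or> step (2 * u - 1) = 0" for u
    using step_eq_0[of "- 2 * u - 1"] step_eq_0[of "2 * u - 1"] by linarith
  have main: "deriv \<Phi> u \<le> 0 \<and> \<bar>deriv \<Phi> u\<bar> \<le> 5 + 10 * Cs \<and> \<bar>\<Phi> u\<bar> \<le> (5 + 10 * Cs) * \<bar>u\<bar> \<and> m * u\<^sup>2 \<le> - u * \<Phi> u"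
    if u: "\<bar>u\<bar> \<le> 1" for u
  proof -
    have mu: "\<bar>m * u\<bar> \<le> m" using u m by (simp add: abs_mult mult_left_le)
    have f1: "0 \<le> \<rho> + m * u" "\<rho> + m * u \<le> 2" "0 \<le> 1 - \<rho> - m * u" "1 - \<rho> - m * u \<le> 2"
      using mu m \<rho> by linarith+
    define a where "a = m * (1 - step (- 2 * u - 1) - step (2 * u - 1))"
    define b where "b = deriv step (- 2 * u - 1) * (\<rho> + m * u)"
    define d where "d = deriv step (2 * u - 1) * (1 - \<rho> - m * u)"
    have s01: "0 \<le> 1 - step (- 2 * u - 1) - step (2 * u - 1)" "1 - step (- 2 * u - 1) - step (2 * u - 1) \<le> 1"
      using disj[of u] step_bounds[of "- 2 * u - 1"] step_bounds[of "2 * u - 1"] by auto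
    have a: "0 \<le> a" "a \<le> 1"
      using s01 m mult_mono[of m 1 "1 - step (- 2 * u - 1) - step (2 * u - 1)" 1] by (auto simp: a_def)
    have b: "0 \<le> b" "b \<le> Cs * 2"
      using f1 deriv_step_nonneg[of "- 2 * u - 1"] Cs(2)[of "- 2 * u - 1"] Cs(1)
        mult_mono[of "deriv step (- 2 * u - 1)" Cs "\<rho> + m * u" 2] by (auto simp: b_def)
    have d: "0 \<le> d" "d \<le> Cs * 2"
      using f1 deriv_step_nonneg[of "2 * u - 1"] Cs(2)[of "2 * u - 1"] Cs(1)
        mult_mono[of "deriv step (2 * u - 1)" Cs "1 - \<rho> - m * u" 2] by (auto simp: d_def)
    have e: "deriv \<Phi> u = - a - 2 * b - 2 * d" unfolding D' a_def b_def d_def by simp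
    have 1: "deriv \<Phi> u \<le> 0" "\<bar>deriv \<Phi> u\<bar> \<le> 5 + 10 * Cs"
      unfolding e using a b d Cs(1) by linarith+
    have 2: "\<bar>\<Phi> u\<bar> \<le> 5 * \<bar>u\<bar> \<and> m * u\<^sup>2 \<le> - u * \<Phi> u"
    proof (cases "u \<ge> 0")
      case True
      define s where "s = step (2 * u - 1)"
      have s: "0 \<le> s" "s \<le> 1" using step_bounds by (auto simp: s_def)
      have \<Phi>: "\<Phi> u = - m * u + s * (m * u - (1 - \<rho>))" using True by (simp add: \<Phi>_def step_eq_0 s_def)
      \<comment> \<open>The step vanishes for u \<le> 1/2, so it is bounded by 2 u and not only by
        1; this makes the bound on \<Phi> linear in u.\<close>
      have su: "s \<le> 2 * u" using s step_eq_0[of "2 * u - 1"] True by (cases "u \<le> 1 / 2") (auto simp: s_def)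
      have "\<bar>s * (m * u - (1 - \<rho>))\<bar> \<le> (2 * u) * 2"
        unfolding abs_mult using s su f1 by (intro mult_mono) auto
      moreover have "\<bar>- m * u\<bar> \<le> 1 * u" unfolding abs_mult using True m by (intro mult_mono) auto
      ultimately have "\<bar>\<Phi> u\<bar> \<le> 5 * \<bar>u\<bar>" unfolding \<Phi> using True by linarith
      moreover have "0 \<le> s * (u * ((1 - \<rho>) - m * u))" using s True f1 by (intro mult_nonneg_nonneg) auto
      then have "m * u\<^sup>2 \<le> - u * \<Phi> u" unfolding \<Phi> by (simp add: power2_eq_square algebra_simps)
      ultimately show ?thesis by blast
    next
      case False
      define s where "s = step (- 2 * u - 1)"
      have s: "0 \<le> s" "s \<le> 1" using step_bounds by (auto simp: s_def)
      have \<Phi>: "\<Phi> u = - m * u + s * (\<rho> + m * u)" using False by (simp add: \<Phi>_def step_eq_0 s_def)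
      have su: "s \<le> - 2 * u" using s step_eq_0[of "- 2 * u - 1"] False by (cases "u \<ge> - (1 / 2)") (auto simp: s_def)
      have "\<bar>s * (\<rho> + m * u)\<bar> \<le> (- 2 * u) * 2"
        unfolding abs_mult using s su f1 by (intro mult_mono) auto
      moreover have "\<bar>- m * u\<bar> \<le> 1 * (- u)" unfolding abs_mult using False m by (intro mult_mono) auto
      ultimately have "\<bar>\<Phi> u\<bar> \<le> 5 * \<bar>u\<bar>" unfolding \<Phi> using False by linarith
      moreover have "0 \<le> s * ((- u) * (\<rho> + m * u))" using s False f1 by (intro mult_nonneg_nonneg) auto
      then have "m * u\<^sup>2 \<le> - u * \<Phi> u" unfolding \<Phi> by (simp add: power2_eq_square algebra_simps)
      ultimately show ?thesis by blast
    qed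
    have "5 * \<bar>u\<bar> \<le> (5 + 10 * Cs) * \<bar>u\<bar>" using Cs(1) by (intro mult_right_mono) auto
    then show ?thesis using 1 2 by linarith
  qed
  have D\<Phi>: "(\<Phi> has_real_derivative deriv \<Phi> u) (at u)" for u
    by (rule Cinf_on_has_real_derivative[OF smooth]) auto
  have out: "deriv \<Phi> u = 0" if "\<bar>u\<bar> > 1" for u
  proof (cases "u > 1")
    case True
    have "((\<lambda>_. \<rho> - 1) has_real_derivative deriv \<Phi> u) (at u)"
      by (rule has_field_derivative_transform_within_open[OF D\<Phi>, where S = "{1<..}"])
         (use True right in auto)
    then show ?thesis using DERIV_unique DERIV_const by blast
  next
    case False
    then have "u < -1" using that by auto
    have "((\<lambda>_. \<rho>) has_real_derivative deriv \<Phi> u) (at u)"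
      by (rule has_field_derivative_transform_within_open[OF D\<Phi>, where S = "{..<-1}"])
         (use \<open>u < -1\<close> left in auto)
    then show ?thesis using DERIV_unique DERIV_const by blast
  qed
  show ?thesis
    unfolding m_def[symmetric]
    by (rule exI[of _ \<Phi>], rule exI[of _ "5 + 10 * Cs"], intro conjI allI impI smooth)
       (insert left right main out Cs(1), simp, blast+)
qed

text \<open>The cutoff varies on a logarithmic scale, so that \<open>u T'(u)\<close> can be made arbitrarily small.\<close>

lemma log_cutoff_exists:
  fixes e :: real
  assumes e: "0 < e"
  shows "\<exists>T K. Cinf_on UNIV T \<and> K > 1 \<and> (\<forall>u. \<bar>u\<bar> \<le> 1 \<longrightarrow> T u = 1) \<and> (\<forall>u. \<bar>u\<bar> \<ge> K \<longrightarrow> T u = 0) \<and>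
    (\<forall>u. 0 \<le> T u \<and> T u \<le> 1) \<and> (\<forall>u. \<bar>u * deriv T u\<bar> \<le> e) \<and> (\<forall>u. \<bar>u\<bar> \<le> 1 \<longrightarrow> deriv T u = 0)"
proof -
  obtain Cs where Cs: "Cs > 0" "\<And>t. \<bar>deriv step t\<bar> \<le> Cs" using deriv_step_bounded by blast
  \<comment> \<open>For T(u) = 1 - step (h ln u^2) one has u T'(u) = - 2 h step'(h ln u^2), which is
    at most 2 h Cs = e in absolute value.\<close>
  define h where "h = e / (2 * Cs)"
  have h: "h > 0" using e Cs by (simp add: h_def)
  define T where "T u = 1 - step (h * ln (u\<^sup>2))" for u
  have T1: "T u = 1" if "\<bar>u\<bar> \<le> 1" for u
  proof -
    have "u\<^sup>2 \<le> 1" using that by (simp add: abs_square_le_1)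
    then have "ln (u\<^sup>2) \<le> 0" by (cases "u = 0") auto
    then show ?thesis using h by (simp add: T_def step_eq_0 mult_nonneg_nonpos)
  qed
  have T01: "0 \<le> T u" "T u \<le> 1" for u using step_bounds[of "h * ln (u\<^sup>2)"] by (auto simp: T_def)
  have smooth: "Cinf_on UNIV T"
  proof (rule Cinf_on_local)
    fix u :: real
    show "\<exists>B g. open B \<and> u \<in> B \<and> Cinf_on B g \<and> (\<forall>y\<in>B. T y = g y)"
    proof (cases "u = 0")
      case True
      have "Cinf_on {-1<..<1} (\<lambda>_::real. 1::real)" by (intro Cinf_intros)
      then show ?thesis using True T1
        by (intro exI[of _ "{-1<..<1}"] exI[of _ "\<lambda>_. 1"]) auto
    next
      case False
      have o: "open {u::real. u \<noteq> 0}" by (simp add: open_Collect_neq)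
      have "Cinf_on {u. u \<noteq> 0} T"
        unfolding T_def[abs_def] by (intro Cinf_intros o) auto
      then show ?thesis using False o by blast
    qed
  qed
  have DT: "(T has_real_derivative deriv T u) (at u)" for u
    by (rule Cinf_on_has_real_derivative[OF smooth]) auto
  have D1: "deriv T u = 0" if "\<bar>u\<bar> \<le> 1" for u
    by (rule DERIV_local_max[OF DT zero_less_one]) (use T1[OF that] T01 in auto)
  have bound: "\<bar>u * deriv T u\<bar> \<le> e" for u
  proof (cases "u = 0")
    case False
    have "((\<lambda>u. h * ln (u\<^sup>2)) has_real_derivative h * (2 / u)) (at u)"
    proof (rule DERIV_cong)
      have u2: "u\<^sup>2 > 0" using False by simp
      show "((\<lambda>u. h * ln (u\<^sup>2)) has_real_derivative h * (inverse (u\<^sup>2) * (2 * u))) (at u)"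
        using u2 by (auto intro!: derivative_eq_intros simp: divide_inverse)
      show "h * (inverse (u\<^sup>2) * (2 * u)) = h * (2 / u)"
        using False by (simp add: field_simps power2_eq_square)
    qed
    from DERIV_diff[OF DERIV_const[of 1] DERIV_chain2[OF step_has_derivative this]]
    have "deriv T u = 0 - deriv step (h * ln (u\<^sup>2)) * (h * (2 / u))"
      unfolding T_def[abs_def] by (rule DERIV_imp_deriv)
    then have "u * deriv T u = - (2 * h * deriv step (h * ln (u\<^sup>2)))" using False by simp
    then have "\<bar>u * deriv T u\<bar> = 2 * h * \<bar>deriv step (h * ln (u\<^sup>2))\<bar>" using h by (simp add: abs_mult)
    also have "\<dots> \<le> 2 * h * Cs" using h by (intro mult_left_mono Cs(2)) auto
    also have "\<dots> = e" using Cs(1) by (simp add: h_def)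
    finally show ?thesis .
  qed (use e in auto)
  \<comment> \<open>The value of |u| at which h ln u^2 reaches 1.\<close>
  define K where "K = exp (1 / (2 * h))"
  have K: "K > 1" using h by (simp add: K_def)
  have T0: "T u = 0" if "\<bar>u\<bar> \<ge> K" for u
  proof -
    have "exp (1 / (2 * h)) \<le> \<bar>u\<bar>" using that K_def by simp
    moreover have "\<bar>u\<bar> > 0" using that K by linarith
    ultimately have "1 / (2 * h) \<le> ln \<bar>u\<bar>" by (simp add: ln_ge_iff)
    moreover have "ln (u\<^sup>2) = 2 * ln \<bar>u\<bar>" using \<open>\<bar>u\<bar> > 0\<close> ln_realpow[of "\<bar>u\<bar>" 2] by simp
    ultimately have "1 \<le> h * ln (u\<^sup>2)" using h by (simp add: field_simps)
    then show ?thesis by (simp add: T_def step_eq_1)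
  qed
  show ?thesis
    by (rule exI[of _ T], rule exI[of _ K]) (use smooth K T1 T0 T01 bound D1 in auto)
qed

lemma abs_mult_le: "\<bar>x\<bar> \<le> a \<Longrightarrow> \<bar>y\<bar> \<le> b \<Longrightarrow> \<bar>x * y\<bar> \<le> a * b" for x y a b :: real
  by (metis abs_ge_zero abs_mult mult_mono')

section \<open>Positivity in the quadratic model with error terms\<close>

context
  fixes A \<gamma> \<kappa> :: real
  assumes A: "A \<ge> 4" and \<gamma>: "0 < \<gamma>" "\<gamma> \<le> 1 / 2" and \<kappa>: "0 \<le> \<kappa>"
    and eig1: "\<kappa> = 2 * A - 1 - 2 * \<gamma>" and eig2: "(1 + \<gamma>) * (A - 1) = \<kappa> * (1 - \<gamma>)"
begin

text \<open>The quadratic energy is negative only in y_1, and y_1 is controlled by \<theta> and w_2: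
  as 1 + 2 A \<ge> 9, the negative term costs at most half of w_2^2 plus a multiple of \<theta>^2.
  Hence E and \<theta>^2 bound the whole vector (y, w). The last bound will exclude opposite signs
  of \<theta> and y_1 on the sphere |y| = d.\<close>

lemma saddle_coercive:
  fixes y1 y2 y3 w1 w2 w3 R \<epsilon> E \<theta> n N :: real
  assumes n: "n = y1\<^sup>2 + y2\<^sup>2 + y3\<^sup>2" and N: "N = n + (w1\<^sup>2 + w2\<^sup>2 + w3\<^sup>2)"
    and \<theta>: "\<theta> = (1 + 2 * A) * y1 + (1 + \<gamma>) * w2"
    and E: "(w1\<^sup>2 + w2\<^sup>2 + w3\<^sup>2) / 2 + (- (1 + 2 * A) * y1\<^sup>2 + (A - 1) * y2\<^sup>2 + A * y3\<^sup>2) / 2 + R = E"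
    and R: "\<bar>R\<bar> \<le> \<epsilon> * n" and \<epsilon>: "\<epsilon> \<le> 1 / 48" and E0: "0 \<le> E"
  shows "N \<le> 6 * E + \<theta>\<^sup>2" "w2\<^sup>2 \<le> 5 * E + 2 / 3 * \<theta>\<^sup>2" "\<theta> * y1 \<le> 0 \<Longrightarrow> \<theta>\<^sup>2 \<le> 9 * E"
proof -
  define a where "a = 1 + 2 * A"
  have a: "a \<ge> 9" using A by (simp add: a_def)
  have g2: "(1 + \<gamma>)\<^sup>2 \<le> 9 / 4"
    using power_mono[of "1 + \<gamma>" "3 / 2" 2] \<gamma> by (simp add: power2_eq_square)
  have g2w: "((1 + \<gamma>) * w2)\<^sup>2 \<le> 9 / 4 * w2\<^sup>2"
    unfolding power_mult_distrib by (intro mult_right_mono g2) simp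
  have n0: "0 \<le> n" "n \<le> N" unfolding n N by simp_all
  have Rn: "\<bar>R\<bar> \<le> N / 48"
  proof -
    have "\<epsilon> * n \<le> 1 / 48 * n" using \<epsilon> n0 by (intro mult_right_mono) auto
    then show ?thesis using R n0 by argo
  qed
  have ay: "(a * y1)\<^sup>2 = a * (a * y1\<^sup>2)" by (simp add: power2_eq_square)
  have ge9: "9 * (a * y1\<^sup>2) \<le> (a * y1)\<^sup>2" "9 * y1\<^sup>2 \<le> a * y1\<^sup>2"
    unfolding ay using a by (auto intro!: mult_right_mono)
  have "(a * y1)\<^sup>2 \<le> 2 * \<theta>\<^sup>2 + 2 * ((1 + \<gamma>) * w2)\<^sup>2"
  proof -
    have "2 * \<theta>\<^sup>2 + 2 * ((1 + \<gamma>) * w2)\<^sup>2 - (a * y1)\<^sup>2 = (\<theta> + (1 + \<gamma>) * w2)\<^sup>2"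
      unfolding \<theta> a_def by algebra
    then show ?thesis by (smt (verit) zero_le_power2)
  qed
  then have key: "a * y1\<^sup>2 \<le> 2 / 9 * \<theta>\<^sup>2 + w2\<^sup>2 / 2" using ge9 g2w by argo
  have Eq: "w1\<^sup>2 + w2\<^sup>2 + w3\<^sup>2 - a * y1\<^sup>2 + (A - 1) * y2\<^sup>2 + A * y3\<^sup>2 = 2 * E - 2 * R"
    using E unfolding a_def by argo
  have p: "3 * y2\<^sup>2 \<le> (A - 1) * y2\<^sup>2" "4 * y3\<^sup>2 \<le> A * y3\<^sup>2" "0 \<le> y2\<^sup>2" "0 \<le> y3\<^sup>2" "0 \<le> w1\<^sup>2" "0 \<le> w3\<^sup>2" "0 \<le> w2\<^sup>2" "0 \<le> y1\<^sup>2" "0 \<le> \<theta>\<^sup>2"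
    using A by (auto intro!: mult_right_mono)
  have Rb: "- (N / 48) \<le> R" "R \<le> N / 48" using Rn by argo+
  have Ne: "N = y1\<^sup>2 + y2\<^sup>2 + y3\<^sup>2 + w1\<^sup>2 + w2\<^sup>2 + w3\<^sup>2" unfolding N n by simp
  show N1: "N \<le> 6 * E + \<theta>\<^sup>2" using key Eq p ge9(2) Rb Ne E0 by argo
  show "w2\<^sup>2 \<le> 5 * E + 2 / 3 * \<theta>\<^sup>2" using key Eq p ge9(2) Rb N1 E0 by argo
  assume neg: "\<theta> * y1 \<le> 0"
  have "\<theta>\<^sup>2 + (a * y1)\<^sup>2 \<le> ((1 + \<gamma>) * w2)\<^sup>2"
  proof -
    have "((1 + \<gamma>) * w2)\<^sup>2 - (\<theta>\<^sup>2 + (a * y1)\<^sup>2) = - (2 * a) * (\<theta> * y1)"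
      unfolding \<theta> a_def by algebra
    moreover have "- (2 * a) * (\<theta> * y1) \<ge> 0" using neg a by (intro mult_nonpos_nonpos) auto
    ultimately show ?thesis by argo
  qed
  then have "\<theta>\<^sup>2 + 9 * (a * y1\<^sup>2) \<le> 9 / 4 * w2\<^sup>2" using ge9 g2w by argo
  moreover have "0 \<le> a * y1\<^sup>2" using ge9(2) p by argo
  ultimately have "4 / 9 * \<theta>\<^sup>2 \<le> w2\<^sup>2 - a * y1\<^sup>2" by argo
  then show "\<theta>\<^sup>2 \<le> 9 * E" using Eq p Rb N1 E0 by argo
qed

text \<open>The right-hand side is that of \<open>neck_rate\<close> for \<beta> = \<gamma> \<alpha>
  and \<zeta> = -1/2. Half of the Euler field contributes E, the term with \<alpha>' a nonnegative
  multiple of g^2, and - \<alpha> \<theta> at least m \<theta>^2/\<tau>. All errors come from the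
  remainders e1, e2, e3 and R.\<close>

lemma saddle_inner:
  fixes y1 y2 y3 w1 w2 w3 e1 e2 e3 R \<epsilon> E \<theta> \<nu> \<alpha> \<alpha>' \<tau> C m :: real
  assumes \<theta>: "\<theta> = (1 + 2 * A) * y1 + (1 + \<gamma>) * w2"
    and G: "G1 = - (1 + 2 * A) * y1 + e1" "G2 = (A - 1) * y2 + e2" "G3 = A * y3 + e3"
    and E: "(w1\<^sup>2 + w2\<^sup>2 + w3\<^sup>2) / 2 + (- (1 + 2 * A) * y1\<^sup>2 + (A - 1) * y2\<^sup>2 + A * y3\<^sup>2) / 2 + R = E"
    and b: "\<bar>y1\<bar> \<le> \<nu>" "\<bar>y2\<bar> \<le> \<nu>" "\<bar>y3\<bar> \<le> \<nu>" "\<bar>w1\<bar> \<le> \<nu>"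
      "\<bar>e1\<bar> \<le> \<epsilon> * \<nu>" "\<bar>e2\<bar> \<le> \<epsilon> * \<nu>" "\<bar>e3\<bar> \<le> \<epsilon> * \<nu>" "\<bar>R\<bar> \<le> \<epsilon> * \<nu>\<^sup>2" "0 \<le> \<nu>" "0 \<le> \<epsilon>"
    and \<tau>: "0 < \<tau>" "\<tau> \<le> 1" and C: "0 \<le> C"
    and \<alpha>: "\<alpha>' \<le> 0" "\<bar>\<alpha>'\<bar> \<le> C" "\<bar>\<alpha>\<bar> \<le> C * \<bar>\<theta> / \<tau>\<bar>" "m * (\<theta> / \<tau>)\<^sup>2 \<le> - (\<theta> / \<tau>) * \<alpha>"
  shows "E + m * \<theta>\<^sup>2 / \<tau> - \<epsilon> / \<tau> * (4 * C + 3) * (\<nu>\<^sup>2 + \<theta>\<^sup>2) \<le>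
    (y1 * G1 + y2 * G2 + y3 * G3) - w2 * y1 + w1 * y2
    - ((\<alpha>' * (w1 - y2) + \<gamma> * \<alpha>' * y2) * (((1 + 2 * A) * w1 - (1 + \<gamma>) * (G2 + 2 * w1)) / \<tau>)
      + \<alpha> * (w2 - G1) + \<gamma> * \<alpha> * w2
      - 1 / 2 * (w1\<^sup>2 + w2\<^sup>2 + w3\<^sup>2 - 2 * w1 * y2 + 2 * w2 * y1 - (y1 * G1 + y2 * G2 + y3 * G3)))" (is "?L \<le> ?rate")
proof -
  define g where "g = w1 - (1 - \<gamma>) * y2"
  \<comment> \<open>The two equations for \<gamma> and \<kappa> say that the derivative of \<theta>
    along the linearised flow is \<kappa> g. The same g is the factor of \<alpha>' in the next step,
    and together they form a square.\<close>
  have thd: "(1 + 2 * A) * w1 - (1 + \<gamma>) * (G2 + 2 * w1) = \<kappa> * g - (1 + \<gamma>) * e2"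
    unfolding G g_def using eig1 eig2 by algebra
  have gg: "\<alpha>' * (w1 - y2) + \<gamma> * \<alpha>' * y2 = \<alpha>' * g" by (simp add: g_def algebra_simps)
  define ye where "ye = y1 * e1 + y2 * e2 + y3 * e3"
  have r1: "?rate = E - R + ye / 2 - \<alpha>' * g * ((\<kappa> * g - (1 + \<gamma>) * e2) / \<tau>) - \<alpha> * (\<theta> - e1)"
    unfolding thd gg unfolding G ye_def E[symmetric] \<theta>
    by (simp add: field_simps power2_eq_square)
  have r2: "\<alpha>' * g * ((\<kappa> * g - (1 + \<gamma>) * e2) / \<tau>) = (\<alpha>' * \<kappa> * g\<^sup>2) / \<tau> - (1 + \<gamma>) * (\<alpha>' * g * e2) / \<tau>"
    by (simp add: power2_eq_square algebra_simps diff_divide_distrib add_divide_distrib)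
  have rate: "?rate = E + ye / 2 - R - (\<alpha>' * \<kappa> * g\<^sup>2) / \<tau> + (1 + \<gamma>) * (\<alpha>' * g * e2) / \<tau> - \<alpha> * \<theta> + \<alpha> * e1"
    unfolding r1 r2 by (simp add: algebra_simps)
  have yi: "\<bar>y1 * e1\<bar> \<le> \<nu> * (\<epsilon> * \<nu>)" "\<bar>y2 * e2\<bar> \<le> \<nu> * (\<epsilon> * \<nu>)" "\<bar>y3 * e3\<bar> \<le> \<nu> * (\<epsilon> * \<nu>)"
    by (rule abs_mult_le; fact b)+
  have \<nu>2: "\<nu> * (\<epsilon> * \<nu>) = \<epsilon> * \<nu>\<^sup>2" by (simp add: power2_eq_square)
  have nn: "0 \<le> \<epsilon> * \<nu>\<^sup>2" using b(10) by simp
  have 1: "- (3 * (\<epsilon> * \<nu>\<^sup>2)) \<le> ye / 2 - R"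
  proof -
    have "- (\<epsilon> * \<nu>\<^sup>2) \<le> y1 * e1" "- (\<epsilon> * \<nu>\<^sup>2) \<le> y2 * e2" "- (\<epsilon> * \<nu>\<^sup>2) \<le> y3 * e3"
      using yi[unfolded \<nu>2] by (simp_all only: abs_le_iff minus_le_iff)
    moreover have "R \<le> \<epsilon> * \<nu>\<^sup>2" using b(8) by (simp only: abs_le_iff)
    moreover have "- (3 * n) \<le> (a + b + c) / 2 - R" if "- n \<le> a" "- n \<le> b" "- n \<le> c" "R \<le> n" "0 \<le> n"
      for a b c n :: real using that by argo
    ultimately show ?thesis using nn unfolding ye_def by blast
  qed
  have "\<epsilon> * \<nu>\<^sup>2 \<le> \<epsilon> * \<nu>\<^sup>2 / \<tau>" using \<tau> nn by (simp add: le_divide_eq mult_left_le)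
  then have 1: "- (3 * (\<epsilon> * \<nu>\<^sup>2 / \<tau>)) \<le> ye / 2 - R" using 1 by argo
  have 2: "0 \<le> - (\<alpha>' * \<kappa> * g\<^sup>2) / \<tau>"
    using \<alpha>(1) \<kappa> \<tau> by (intro divide_nonneg_pos) (auto simp: mult_nonpos_nonneg mult.assoc)
  have gb: "\<bar>g\<bar> \<le> 2 * \<nu>"
  proof -
    have "\<bar>(1 - \<gamma>) * y2\<bar> \<le> 1 * \<nu>" by (rule abs_mult_le[OF _ b(2)]) (use \<gamma> in simp)
    then show ?thesis unfolding g_def using b(4) by argo
  qed
  have "\<bar>\<alpha>' * g * e2\<bar> \<le> C * (2 * \<nu>) * (\<epsilon> * \<nu>)"
    by (rule abs_mult_le[OF abs_mult_le[OF \<alpha>(2) gb] b(6)])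
  then have "\<bar>(1 + \<gamma>) * (\<alpha>' * g * e2)\<bar> \<le> 3 / 2 * (C * (2 * \<nu>) * (\<epsilon> * \<nu>))"
    by (rule abs_mult_le[rotated]) (use \<gamma> in simp)
  also have "\<dots> = 3 * C * (\<epsilon> * \<nu>\<^sup>2)" by (simp add: power2_eq_square)
  finally have "- (3 * C * (\<epsilon> * \<nu>\<^sup>2)) \<le> (1 + \<gamma>) * (\<alpha>' * g * e2)" by argo
  from divide_right_mono[OF this, of \<tau>]
  have 3: "- (3 * C * (\<epsilon> * \<nu>\<^sup>2 / \<tau>)) \<le> (1 + \<gamma>) * (\<alpha>' * g * e2) / \<tau>" using \<tau> by simp
  have 4: "m * \<theta>\<^sup>2 / \<tau> \<le> - (\<alpha> * \<theta>)"
  proof -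
    have "\<tau> * (m * (\<theta> / \<tau>)\<^sup>2) \<le> \<tau> * (- (\<theta> / \<tau>) * \<alpha>)" using \<alpha>(4) \<tau> by (intro mult_left_mono) auto
    then show ?thesis using \<tau> by (simp add: power2_eq_square field_simps)
  qed
  have 5: "- (C * (\<epsilon> / \<tau> * (\<nu>\<^sup>2 + \<theta>\<^sup>2))) \<le> \<alpha> * e1"
  proof -
    have "\<bar>\<alpha> * e1\<bar> \<le> C * \<bar>\<theta> / \<tau>\<bar> * (\<epsilon> * \<nu>)"
      by (rule abs_mult_le[OF \<alpha>(3) b(5)])
    also have "\<dots> = C * (\<epsilon> / \<tau> * (\<nu> * \<bar>\<theta>\<bar>))" using \<tau> by (simp add: abs_mult)
    also have "\<dots> \<le> C * (\<epsilon> / \<tau> * (\<nu>\<^sup>2 + \<theta>\<^sup>2))"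
    proof (intro mult_left_mono)
      have "0 \<le> (\<nu> - \<bar>\<theta>\<bar>)\<^sup>2 + \<nu>\<^sup>2 + \<theta>\<^sup>2" by simp
      also have "\<dots> = 2 * (\<nu>\<^sup>2 + \<theta>\<^sup>2 - \<nu> * \<bar>\<theta>\<bar>)" by (simp add: power2_eq_square algebra_simps)
      finally show "\<nu> * \<bar>\<theta>\<bar> \<le> \<nu>\<^sup>2 + \<theta>\<^sup>2" by argo
    qed (use b(10) \<tau> C in auto)
    finally show ?thesis by argo
  qed
  have 6: "(3 * C + 3) * (\<epsilon> * \<nu>\<^sup>2 / \<tau>) \<le> (3 * C + 3) * (\<epsilon> / \<tau> * (\<nu>\<^sup>2 + \<theta>\<^sup>2))"
    using C b(10) \<tau> by (intro mult_left_mono) (auto simp: divide_right_mono mult_left_mono)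
  have "E + m * \<theta>\<^sup>2 / \<tau> - (3 * C + 3) * (\<epsilon> * \<nu>\<^sup>2 / \<tau>) - C * (\<epsilon> / \<tau> * (\<nu>\<^sup>2 + \<theta>\<^sup>2)) \<le> ?rate"
  proof -
    have d: "(3 * C + 3) * (\<epsilon> * \<nu>\<^sup>2 / \<tau>) = 3 * C * (\<epsilon> * \<nu>\<^sup>2 / \<tau>) + 3 * (\<epsilon> * \<nu>\<^sup>2 / \<tau>)"
      by (rule distrib_right)
    have comb: "E + k4 - (3 * C * X + 3 * X) - z \<le> E + ye / 2 - R - k2 + k3 - aa + k5"
      if "- (3 * X) \<le> ye / 2 - R" "0 \<le> - k2" "- (3 * C * X) \<le> k3" "k4 \<le> - aa" "- z \<le> k5"
      for k2 k3 k4 k5 aa X z :: real using that by argo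
    show ?thesis
      unfolding rate d by (rule comb[OF 1 _ 3 4 5]) (use 2 in simp)
  qed
  moreover have "?L = E + m * \<theta>\<^sup>2 / \<tau> - (3 * C + 3) * (\<epsilon> / \<tau> * (\<nu>\<^sup>2 + \<theta>\<^sup>2)) - C * (\<epsilon> / \<tau> * (\<nu>\<^sup>2 + \<theta>\<^sup>2))"
  proof -
    have "X * (4 * C + 3) * Y = (3 * C + 3) * (X * Y) + C * (X * Y)" for X Y :: real by algebra
    then show ?thesis by (simp only: diff_diff_eq)
  qed
  ultimately show ?thesis using 6 by argo
qed

text \<open>For |\<theta>| > \<tau> the profile has a constant value s, and T multiplies the Euler
  part. The positive term - s \<theta> is linear, so the quadratic terms are absorbed by the
  smallness of \<beta>. The term with T' is of the order of \<theta> itself however small the neck;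
  only the smallness of u T'(u) controls it.\<close>

lemma saddle_outer:
  fixes y1 y2 y3 w1 w2 w3 e1 e2 e3 R \<epsilon> E \<theta> \<nu> s T T' \<tau> \<eta> \<beta> m :: real
  assumes \<theta>: "\<theta> = (1 + 2 * A) * y1 + (1 + \<gamma>) * w2"
    and G: "G1 = - (1 + 2 * A) * y1 + e1" "G2 = (A - 1) * y2 + e2" "G3 = A * y3 + e3"
    and E: "(w1\<^sup>2 + w2\<^sup>2 + w3\<^sup>2) / 2 + (- (1 + 2 * A) * y1\<^sup>2 + (A - 1) * y2\<^sup>2 + A * y3\<^sup>2) / 2 + R = E"
    and b: "\<bar>y1\<bar> \<le> \<nu>" "\<bar>y2\<bar> \<le> \<nu>" "\<bar>y3\<bar> \<le> \<nu>" "\<bar>w1\<bar> \<le> \<nu>" "\<bar>w2\<bar> \<le> \<nu>" "\<bar>w3\<bar> \<le> \<nu>"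
      "\<bar>e1\<bar> \<le> \<epsilon> * \<nu>" "\<bar>e2\<bar> \<le> \<epsilon> * \<nu>" "\<bar>e3\<bar> \<le> \<epsilon> * \<nu>" "\<bar>R\<bar> \<le> \<epsilon> * \<nu>\<^sup>2" "0 \<le> \<nu>" "0 \<le> \<epsilon>" "\<epsilon> \<le> 1"
    and \<tau>: "0 < \<tau>" "\<tau> < \<bar>\<theta>\<bar>" and s: "s * \<theta> < 0" "m \<le> \<bar>s\<bar>" "\<bar>s\<bar> \<le> 1" and T: "0 \<le> T" "T \<le> 1"
    and T': "\<bar>\<theta> / \<tau> * T'\<bar> \<le> \<eta>" and small: "\<nu> \<le> 2 * \<bar>\<theta>\<bar>" "\<nu> \<le> \<beta>" "\<beta> \<le> 1"
    and w2: "\<gamma> * \<bar>w2\<bar> \<le> \<bar>\<theta>\<bar> / 2" and E0: "0 \<le> E"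
  shows "\<bar>\<theta>\<bar> * (m / 2 - 2 * \<epsilon> - 16 * \<eta> * (\<kappa> + 1) - 2 * \<beta> * (4 * A + 8)) \<le>
    (y1 * G1 + y2 * G2 + y3 * G3) - w2 * y1 + w1 * y2
    - ((\<gamma> * s * T' * y2 - T' / 2 * (y1 * w1 + y2 * w2 + y3 * w3)) * (((1 + 2 * A) * w1 - (1 + \<gamma>) * (G2 + 2 * w1)) / \<tau>)
      + s * (w2 - G1) + \<gamma> * s * T * w2
      - T / 2 * (w1\<^sup>2 + w2\<^sup>2 + w3\<^sup>2 - 2 * w1 * y2 + 2 * w2 * y1 - (y1 * G1 + y2 * G2 + y3 * G3)))" (is "?L \<le> ?rate")
proof -
  define g where "g = w1 - (1 - \<gamma>) * y2"
  have thd: "(1 + 2 * A) * w1 - (1 + \<gamma>) * (G2 + 2 * w1) = \<kappa> * g - (1 + \<gamma>) * e2"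
    unfolding G g_def using eig1 eig2 by algebra
  define yG where "yG = y1 * G1 + y2 * G2 + y3 * G3"
  define ye where "ye = y1 * e1 + y2 * e2 + y3 * e3"
  define B where "B = \<gamma> * s * y2 - (y1 * w1 + y2 * w2 + y3 * w3) / 2"
  define d where "d = \<kappa> * g - (1 + \<gamma>) * e2"
  have half: "yG / 2 + (w1\<^sup>2 + w2\<^sup>2 + w3\<^sup>2) / 2 = E + (ye / 2 - R)"
    unfolding yG_def ye_def E[symmetric] G by (simp add: field_simps power2_eq_square)
  have sth: "s * (w2 - G1) = s * (\<theta> - \<gamma> * w2 - e1)"
    unfolding \<theta> G by (simp add: algebra_simps)
  have "?rate = (1 - T) * (yG - w2 * y1 + w1 * y2) + T * (yG / 2 + (w1\<^sup>2 + w2\<^sup>2 + w3\<^sup>2) / 2)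
      - s * (\<theta> - \<gamma> * w2 - e1) - \<gamma> * s * T * w2 - T' * B * (d / \<tau>)"
    unfolding thd sth unfolding yG_def[symmetric] d_def[symmetric] B_def
    by (simp add: algebra_simps add_divide_distrib diff_divide_distrib)
  then have rate: "?rate = (1 - T) * (yG - w2 * y1 + w1 * y2) + T * (E + (ye / 2 - R))
      - s * \<theta> + (1 - T) * (s * (\<gamma> * w2)) + s * e1 - T' * B * (d / \<tau>)"
    unfolding half by (simp add: algebra_simps)
  have abs3: "- x \<le> y" "y \<le> x" if "\<bar>y\<bar> \<le> x" for x y :: real
    using that by (simp_all add: abs_le_iff)
  have \<nu>\<nu>: "\<nu> * \<nu> = \<nu>\<^sup>2" "\<nu> * (\<epsilon> * \<nu>) = \<epsilon> * \<nu>\<^sup>2" by (simp_all add: power2_eq_square)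
  have \<nu>0: "0 \<le> \<nu>\<^sup>2" by simp
  have \<epsilon>\<nu>: "0 \<le> \<epsilon> * \<nu>\<^sup>2" "\<epsilon> * \<nu>\<^sup>2 \<le> \<nu>\<^sup>2"
    using b(12,13) by (auto intro: mult_left_le_one_le)
  have pw: "\<bar>w2 * y1\<bar> \<le> \<nu>\<^sup>2" "\<bar>w1 * y2\<bar> \<le> \<nu>\<^sup>2" "\<bar>y1 * w1\<bar> \<le> \<nu>\<^sup>2" "\<bar>y2 * w2\<bar> \<le> \<nu>\<^sup>2" "\<bar>y3 * w3\<bar> \<le> \<nu>\<^sup>2"
    unfolding \<nu>\<nu>(1)[symmetric] by (rule abs_mult_le; fact b)+
  have yi: "\<bar>y1 * e1\<bar> \<le> \<epsilon> * \<nu>\<^sup>2" "\<bar>y2 * e2\<bar> \<le> \<epsilon> * \<nu>\<^sup>2" "\<bar>y3 * e3\<bar> \<le> \<epsilon> * \<nu>\<^sup>2"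
    unfolding \<nu>\<nu>(2)[symmetric] by (rule abs_mult_le; fact b)+
  have sq: "y * y \<le> \<nu>\<^sup>2" if "\<bar>y\<bar> \<le> \<nu>" for y
    using abs_mult_le[OF that that] by (simp add: power2_eq_square)
  have ysq: "y1 * y1 \<le> \<nu>\<^sup>2" "y2 * y2 \<le> \<nu>\<^sup>2" "y3 * y3 \<le> \<nu>\<^sup>2" "0 \<le> y1 * y1" "0 \<le> y2 * y2" "0 \<le> y3 * y3"
    using sq[OF b(1)] sq[OF b(2)] sq[OF b(3)] by simp_all
  have yGb: "- ((4 * A + 3) * \<nu>\<^sup>2) \<le> yG"
  proof -
    have eq: "yG = - ((1 + 2 * A) * (y1 * y1)) + (A - 1) * (y2 * y2) + A * (y3 * y3) + ye"
      unfolding yG_def ye_def G by (simp add: algebra_simps)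
    have "(1 + 2 * A) * (y1 * y1) \<le> (1 + 2 * A) * \<nu>\<^sup>2" using A ysq by (intro mult_left_mono) auto
    also have "\<dots> = \<nu>\<^sup>2 + 2 * (A * \<nu>\<^sup>2)" by (simp add: algebra_simps)
    finally have p: "(1 + 2 * A) * (y1 * y1) \<le> \<nu>\<^sup>2 + 2 * (A * \<nu>\<^sup>2)" .
    have q: "0 \<le> (A - 1) * (y2 * y2)" "0 \<le> A * (y3 * y3)" "0 \<le> A * \<nu>\<^sup>2" using A by auto
    have t: "- (3 * \<nu>\<^sup>2) \<le> ye"
      using abs3[OF yi(1)] abs3[OF yi(2)] abs3[OF yi(3)] \<epsilon>\<nu> unfolding ye_def by argo
    have u: "4 * \<nu>\<^sup>2 \<le> A * \<nu>\<^sup>2" using A by (intro mult_right_mono) auto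
    have lin: "- (4 * u + 3 * v) \<le> - p + q + r + t"
      if "p \<le> v + 2 * u" "0 \<le> q" "0 \<le> r" "0 \<le> u" "- (3 * v) \<le> t" "4 * v \<le> u" "0 \<le> v"
      for p q r t u v :: real using that by argo
    have "(4 * A + 3) * \<nu>\<^sup>2 = 4 * (A * \<nu>\<^sup>2) + 3 * \<nu>\<^sup>2" by (simp add: algebra_simps)
    then show ?thesis unfolding eq using lin[OF p q t u \<nu>0] by simp
  qed
  have 1: "- ((4 * A + 5) * \<nu>\<^sup>2) \<le> (1 - T) * (yG - w2 * y1 + w1 * y2)"
  proof -
    have l: "- ((4 * A + 5) * \<nu>\<^sup>2) \<le> yG - w2 * y1 + w1 * y2"
    proof -
      have "(4 * A + 5) * \<nu>\<^sup>2 = (4 * A + 3) * \<nu>\<^sup>2 + 2 * \<nu>\<^sup>2" by (simp add: algebra_simps)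
      then show ?thesis using yGb abs3[OF pw(1)] abs3[OF pw(2)] by argo
    qed
    have "0 \<le> (4 * A + 5) * \<nu>\<^sup>2" using A by simp
    then have "(1 - T) * ((4 * A + 5) * \<nu>\<^sup>2) \<le> (4 * A + 5) * \<nu>\<^sup>2" using T by (intro mult_left_le_one_le) auto
    moreover have "(1 - T) * (- ((4 * A + 5) * \<nu>\<^sup>2)) \<le> (1 - T) * (yG - w2 * y1 + w1 * y2)"
      using l T by (intro mult_left_mono) auto
    ultimately show ?thesis by argo
  qed
  have 2: "- (3 * \<nu>\<^sup>2) \<le> T * (E + (ye / 2 - R))"
  proof -
    have "- (3 * \<nu>\<^sup>2) \<le> E + (ye / 2 - R)" 
      using abs3[OF yi(1)] abs3[OF yi(2)] abs3[OF yi(3)] abs3[OF b(10)] \<epsilon>\<nu> E0 unfolding ye_def by argo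
    then have "T * (- (3 * \<nu>\<^sup>2)) \<le> T * (E + (ye / 2 - R))" using T by (intro mult_left_mono)
    moreover have "T * (3 * \<nu>\<^sup>2) \<le> 3 * \<nu>\<^sup>2" using T by (intro mult_left_le_one_le) auto
    ultimately show ?thesis by argo
  qed
  have 3: "m / 2 * \<bar>\<theta>\<bar> \<le> - (s * \<theta>) + (1 - T) * (s * (\<gamma> * w2))"
  proof -
    have "- (s * \<theta>) = \<bar>s\<bar> * \<bar>\<theta>\<bar>" using s(1) by (simp flip: abs_mult)
    moreover have "\<bar>(1 - T) * (s * (\<gamma> * w2))\<bar> \<le> \<bar>s\<bar> * (\<bar>\<theta>\<bar> / 2)"
    proof -
      have "\<bar>(1 - T) * (s * (\<gamma> * w2))\<bar> = (1 - T) * (\<bar>s\<bar> * (\<gamma> * \<bar>w2\<bar>))" using T \<gamma> by (simp add: abs_mult)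
      also have "\<dots> \<le> \<bar>s\<bar> * (\<gamma> * \<bar>w2\<bar>)" using T \<gamma> by (intro mult_left_le_one_le) auto
      also have "\<dots> \<le> \<bar>s\<bar> * (\<bar>\<theta>\<bar> / 2)" using w2 by (intro mult_left_mono) auto
      finally show ?thesis .
    qed
    moreover have "m * \<bar>\<theta>\<bar> \<le> \<bar>s\<bar> * \<bar>\<theta>\<bar>" using s by (intro mult_right_mono) auto
    ultimately show ?thesis unfolding abs_le_iff by argo
  qed
  have 4: "- (2 * \<epsilon> * \<bar>\<theta>\<bar>) \<le> s * e1"
  proof -
    have "\<bar>s * e1\<bar> \<le> 1 * (\<epsilon> * \<nu>)" by (rule abs_mult_le[OF s(3) b(7)])
    moreover have "\<epsilon> * \<nu> \<le> \<epsilon> * (2 * \<bar>\<theta>\<bar>)" by (rule mult_left_mono[OF small(1) b(12)])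
    ultimately show ?thesis by (simp add: abs_le_iff)
  qed
  \<comment> \<open>The product of two factors of order \<nu> is of order \<theta>^2 by
    \<open>small\<close>, which cancels the 1/|\<theta>| in the bound for T'/\<tau>.\<close>
  have 5: "\<bar>T' * B * (d / \<tau>)\<bar> \<le> 16 * \<eta> * (\<kappa> + 1) * \<bar>\<theta>\<bar>"
  proof -
    have th: "\<bar>\<theta>\<bar> > 0" using \<tau> by argo
    have gb: "\<bar>g\<bar> \<le> 2 * \<nu>"
    proof -
      have "\<bar>(1 - \<gamma>) * y2\<bar> \<le> 1 * \<nu>" by (rule abs_mult_le[OF _ b(2)]) (use \<gamma> in simp)
      then show ?thesis unfolding g_def using b(4) by (simp add: abs_le_iff)
    qed
    have db: "\<bar>d\<bar> \<le> (2 * \<kappa> + 2) * \<nu>"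
    proof -
      have "\<bar>\<kappa> * g\<bar> \<le> \<kappa> * (2 * \<nu>)" by (rule abs_mult_le[OF _ gb]) (use \<kappa> in simp)
      moreover have "\<bar>(1 + \<gamma>) * e2\<bar> \<le> 2 * (1 * \<nu>)"
        by (rule abs_mult_le[OF _ order_trans[OF b(8) mult_right_mono[OF b(13) b(11)]]]) (use \<gamma> in simp)
      moreover have "(2 * \<kappa> + 2) * \<nu> = \<kappa> * (2 * \<nu>) + 2 * (1 * \<nu>)" by (simp add: algebra_simps)
      ultimately show ?thesis unfolding d_def by (simp add: abs_le_iff)
    qed
    have Bb: "\<bar>B\<bar> \<le> 2 * \<nu>"
    proof -
      have "\<bar>\<gamma> * s * y2\<bar> \<le> 1 / 2 * 1 * \<nu>" by (rule abs_mult_le[OF abs_mult_le[OF _ s(3)] b(2)]) (use \<gamma> in simp)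
      moreover have "\<nu>\<^sup>2 \<le> 1 * \<nu>" unfolding power2_eq_square by (rule mult_right_mono[OF order_trans[OF small(2,3)] b(11)])
      ultimately show ?thesis
        unfolding B_def abs_le_iff using abs3[OF pw(3)] abs3[OF pw(4)] abs3[OF pw(5)] by argo
    qed
    have T'b: "\<bar>T' / \<tau>\<bar> \<le> \<eta> / \<bar>\<theta>\<bar>"
      using T' th \<tau> by (simp add: abs_mult field_simps)
    have "\<bar>T' * B * (d / \<tau>)\<bar> = \<bar>T' / \<tau>\<bar> * \<bar>B\<bar> * \<bar>d\<bar>" by (simp add: abs_mult)
    also have "\<dots> \<le> \<eta> / \<bar>\<theta>\<bar> * (2 * \<nu>) * ((2 * \<kappa> + 2) * \<nu>)"
      by (rule mult_mono'[OF mult_mono'[OF T'b Bb]  db]) simp_all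
    also have "\<dots> = \<eta> / \<bar>\<theta>\<bar> * (4 * (\<kappa> + 1)) * (\<nu> * \<nu>)" by (simp add: algebra_simps)
    also have "\<dots> \<le> \<eta> / \<bar>\<theta>\<bar> * (4 * (\<kappa> + 1)) * ((2 * \<bar>\<theta>\<bar>) * (2 * \<bar>\<theta>\<bar>))"
      by (rule mult_left_mono[OF mult_mono'[OF small(1) small(1) b(11) b(11)]])
         (intro mult_nonneg_nonneg order_trans[OF abs_ge_zero T'b], use \<kappa> in simp_all)
    also have "\<dots> = 16 * \<eta> * (\<kappa> + 1) * \<bar>\<theta>\<bar>" using th by (simp add: field_simps)
    finally show ?thesis .
  qed
  have 6: "(4 * A + 8) * \<nu>\<^sup>2 \<le> 2 * \<beta> * (4 * A + 8) * \<bar>\<theta>\<bar>"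
  proof -
    have "\<nu>\<^sup>2 \<le> \<beta> * (2 * \<bar>\<theta>\<bar>)" unfolding power2_eq_square
      by (rule mult_mono'[OF small(2,1) b(11) b(11)])
    then have "(4 * A + 8) * \<nu>\<^sup>2 \<le> (4 * A + 8) * (\<beta> * (2 * \<bar>\<theta>\<bar>))" using A by (intro mult_left_mono) auto
    then show ?thesis by (simp add: algebra_simps)
  qed
  have e: "(4 * A + 8) * \<nu>\<^sup>2 = (4 * A + 5) * \<nu>\<^sup>2 + 3 * \<nu>\<^sup>2" by (simp add: algebra_simps)
  have "?L = m / 2 * \<bar>\<theta>\<bar> - 2 * \<epsilon> * \<bar>\<theta>\<bar> - 16 * \<eta> * (\<kappa> + 1) * \<bar>\<theta>\<bar> - 2 * \<beta> * (4 * A + 8) * \<bar>\<theta>\<bar>"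
    by (simp add: algebra_simps)
  also have "\<dots> \<le> ?rate"
    unfolding rate using 1 2 3 4 abs3[OF 5] 6 e by argo
  finally show ?thesis .
qed

end

section \<open>The neck region\<close>

text \<open>The Hamiltonian field of H, expressed through the velocity.\<close>

definition ham_dir :: "real \<Rightarrow> phase \<Rightarrow> phase" where
  "ham_dir \<mu> z = (vel z, - (eff_grad \<mu> (fst z) + vector [- vel z $ 2, vel z $ 1, 0]))"

lemma H_deriv_symp: "H_deriv \<mu> z u = symp u (ham_dir \<mu> z)"
  by (simp add: H_deriv_def symp_def ham_dir_def inner3 vector_3 algebra_simps)

lemma H_deriv_add: "H_deriv \<mu> z (u + v) = H_deriv \<mu> z u + H_deriv \<mu> z v"
  by (simp add: H_deriv_symp symp_add_left)

text \<open>Antisymmetry of the Poisson bracket: H changes along the field of k at minus the rate at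
  which k changes along the field of H.\<close>

lemma H_deriv_ham_field:
  assumes "(k has_derivative D) (at z)"
  shows "H_deriv \<mu> z (ham_field k z) = - D (ham_dir \<mu> z)"
proof -
  have "frechet_derivative k (at z) = D" using frechet_derivative_at[OF assms] by simp
  then show ?thesis using symp_ham_field[of k z] assms by (simp add: H_deriv_symp)
qed

text \<open>The derivative of p_1 + \<gamma> q_2 along the linearised flow at \<open>L1\<close>; the
  difference in the second summand is the velocity w_2.\<close>

definition neck_phase :: "real \<Rightarrow> real \<Rightarrow> real \<Rightarrow> phase \<Rightarrow> real" where
  "neck_phase \<mu> A \<gamma> z = (1 + 2 * A) * (fst z $ 1 - lpos \<mu> $ 1) + (1 + \<gamma>) * (snd z $ 2 - fst z $ 1)"

text \<open>The Hamiltonian whose vector field is added to \<open>(q - l) \<partial>/\<partial>q\<close>. For \<open>\<zeta> = -1/2\<close> and \<open>\<alpha> = \<beta> = 0\<close> the sum is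
  half of the Euler field centred at the saddle; for constant \<open>\<alpha>\<close> and \<open>\<beta> = \<zeta> = 0\<close> it is \<open>(q - P) \<partial>/\<partial>q\<close> with
  \<open>P = l - \<alpha> e\<^sub>1\<close>.\<close>

definition neck_ham :: "real \<Rightarrow> real \<Rightarrow> real \<Rightarrow> real \<Rightarrow> (real \<Rightarrow> real) \<Rightarrow> (real \<Rightarrow> real) \<Rightarrow> (real \<Rightarrow> real) \<Rightarrow> phase \<Rightarrow> real" where
  "neck_ham \<mu> A \<gamma> \<tau> \<alpha> \<beta> \<zeta> z =
     \<alpha> (neck_phase \<mu> A \<gamma> z / \<tau>) * (snd z $ 1) + \<beta> (neck_phase \<mu> A \<gamma> z / \<tau>) * (fst z $ 2)
     + \<zeta> (neck_phase \<mu> A \<gamma> z / \<tau>) * ((fst z - lpos \<mu>) \<bullet> (snd z - vector [0, lpos \<mu> $ 1, 0]))"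

lemma lpos_nth [simp]: "lpos \<mu> $ 2 = 0" "lpos \<mu> $ 3 = 0"
  by (simp_all add: lpos_def)

lemma Cinf_on_neck_ham:
  assumes "Cinf_on UNIV \<alpha>" "Cinf_on UNIV \<beta>" "Cinf_on UNIV \<zeta>" "\<tau> > 0"
  shows "Cinf_on UNIV (neck_ham \<mu> A \<gamma> \<tau> \<alpha> \<beta> \<zeta>)"
proof -
  have u: "Cinf_on UNIV (\<lambda>z. neck_phase \<mu> A \<gamma> z / \<tau>)"
    unfolding neck_phase_def using assms(4) by (intro Cinf_intros open_UNIV) auto
  note c = Cinf_on_compose[OF _ open_UNIV open_UNIV u UNIV_I]
  show ?thesis
    unfolding neck_ham_def[abs_def] by (intro Cinf_intros open_UNIV c assms)
qed

text \<open>The subtracted bracket is the derivative of \<open>neck_ham\<close> along the flow of H,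
  and the factor divided by \<tau> is that of \<open>neck_phase\<close>.\<close>

lemma neck_rate:
  fixes z :: phase and \<mu> A \<gamma> \<tau> \<alpha>' \<beta>' \<zeta>' :: real and \<alpha> \<beta> \<zeta> :: "real \<Rightarrow> real"
  defines "u \<equiv> neck_phase \<mu> A \<gamma> z / \<tau>" and "y \<equiv> fst z - lpos \<mu>" and "w \<equiv> vel z" and "G \<equiv> eff_grad \<mu> (fst z)"
  assumes \<tau>: "\<tau> > 0"
    and D: "(\<alpha> has_real_derivative \<alpha>') (at u)" "(\<beta> has_real_derivative \<beta>') (at u)" "(\<zeta> has_real_derivative \<zeta>') (at u)"
  shows "H_deriv \<mu> z ((y, 0) + ham_field (neck_ham \<mu> A \<gamma> \<tau> \<alpha> \<beta> \<zeta>) z) =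
    (y$1 * G$1 + y$2 * G$2 + y$3 * G$3) - w$2 * y$1 + w$1 * y$2
    - ((\<alpha>' * (w$1 - y$2) + \<beta>' * y$2 + \<zeta>' * (y$1 * w$1 + y$2 * w$2 + y$3 * w$3))
        * (((1 + 2 * A) * w$1 - (1 + \<gamma>) * (G$2 + 2 * w$1)) / \<tau>)
      + \<alpha> u * (w$2 - G$1) + \<beta> u * w$2
      + \<zeta> u * ((w$1)\<^sup>2 + (w$2)\<^sup>2 + (w$3)\<^sup>2 - 2 * w$1 * y$2 + 2 * w$2 * y$1 - (y$1 * G$1 + y$2 * G$2 + y$3 * G$3)))"
proof -
  let ?\<theta>' = "\<lambda>v :: phase. (1 + 2 * A) * (fst v $ 1) + (1 + \<gamma>) * (snd v $ 2 - fst v $ 1)"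
  define \<pi> where "\<pi> = snd z - vector [0, lpos \<mu> $ 1, 0]"
  have nf: "((\<lambda>z :: phase. fst z $ i) has_derivative (\<lambda>v. fst v $ i)) (at z)" for i
    by (rule bounded_linear_imp_has_derivative[OF bounded_linear_compose[OF bounded_linear_vec_nth bounded_linear_fst]])
  have ns: "((\<lambda>z :: phase. snd z $ i) has_derivative (\<lambda>v. snd v $ i)) (at z)" for i
    by (rule bounded_linear_imp_has_derivative[OF bounded_linear_compose[OF bounded_linear_vec_nth bounded_linear_snd]])
  have "(neck_phase \<mu> A \<gamma> has_derivative ?\<theta>') (at z)"
    unfolding neck_phase_def[abs_def]
    by (rule has_derivative_eq_rhs, (rule derivative_intros nf ns)+) (rule ext, simp)
  from has_derivative_divide[OF this has_derivative_const[of \<tau>]] \<tau>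
  have U: "((\<lambda>z. neck_phase \<mu> A \<gamma> z / \<tau>) has_derivative (\<lambda>v. ?\<theta>' v / \<tau>)) (at z)"
    by (auto elim!: has_derivative_eq_rhs simp: field_simps)
  have c: "((\<lambda>z. f (neck_phase \<mu> A \<gamma> z / \<tau>)) has_derivative (\<lambda>v. f' * (?\<theta>' v / \<tau>))) (at z)"
    if "(f has_real_derivative f') (at u)" for f f'
    by (rule has_derivative_compose[OF U, of f "\<lambda>h. f' * h"])
       (use that in \<open>simp add: has_field_derivative_def u_def\<close>)
  have yp: "((\<lambda>z. (fst z - lpos \<mu>) \<bullet> (snd z - vector [0, lpos \<mu> $ 1, 0])) has_derivative
      (\<lambda>v. y \<bullet> snd v + fst v \<bullet> \<pi>)) (at z)"
    unfolding y_def \<pi>_def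
    by (rule has_derivative_inner) (auto intro!: derivative_eq_intros)
  have "(neck_ham \<mu> A \<gamma> \<tau> \<alpha> \<beta> \<zeta> has_derivative
      (\<lambda>v. \<alpha> u * (snd v $ 1) + \<alpha>' * (?\<theta>' v / \<tau>) * (snd z $ 1) + (\<beta> u * (fst v $ 2) + \<beta>' * (?\<theta>' v / \<tau>) * (fst z $ 2))
        + (\<zeta> u * (y \<bullet> snd v + fst v \<bullet> \<pi>) + \<zeta>' * (?\<theta>' v / \<tau>) * (y \<bullet> \<pi>)))) (at z)"
    unfolding neck_ham_def[abs_def] u_def
    using has_derivative_add[OF has_derivative_add[OF has_derivative_mult[OF c[OF D(1)] ns[of 1]]
          has_derivative_mult[OF c[OF D(2)] nf[of 2]]] has_derivative_mult[OF c[OF D(3)] yp]]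
    unfolding u_def y_def \<pi>_def .
  from H_deriv_ham_field[OF this, of \<mu>]
  have 1: "H_deriv \<mu> z (ham_field (neck_ham \<mu> A \<gamma> \<tau> \<alpha> \<beta> \<zeta>) z) =
     - (\<alpha> u * (w$2 - G$1) + \<alpha>' * (((1 + 2 * A) * w$1 - (1 + \<gamma>) * (G$2 + 2 * w$1)) / \<tau>) * (snd z $ 1)
       + (\<beta> u * w$2 + \<beta>' * (((1 + 2 * A) * w$1 - (1 + \<gamma>) * (G$2 + 2 * w$1)) / \<tau>) * (fst z $ 2))
       + (\<zeta> u * (w \<bullet> \<pi> - (y$1 * (G$1 - w$2) + y$2 * (G$2 + w$1) + y$3 * G$3))
         + \<zeta>' * (((1 + 2 * A) * w$1 - (1 + \<gamma>) * (G$2 + 2 * w$1)) / \<tau>) * (y \<bullet> \<pi>)))"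
  proof -
    have t: "?\<theta>' (ham_dir \<mu> z) = (1 + 2 * A) * w$1 - (1 + \<gamma>) * (G$2 + 2 * w$1)"
      unfolding ham_dir_def G_def w_def by (simp add: vector_3 algebra_simps del: vel_nth)
    have s1: "snd (ham_dir \<mu> z) $ 1 = w$2 - G$1" "fst (ham_dir \<mu> z) $ 2 = w$2"
      unfolding ham_dir_def G_def w_def by (simp_all add: vector_3 del: vel_nth)
    have s2: "y \<bullet> snd (ham_dir \<mu> z) + fst (ham_dir \<mu> z) \<bullet> \<pi>
        = w \<bullet> \<pi> - (y$1 * (G$1 - w$2) + y$2 * (G$2 + w$1) + y$3 * G$3)"
      unfolding ham_dir_def G_def w_def inner3 by (simp add: vector_3 algebra_simps del: vel_nth)
    show ?thesis
      using \<open>H_deriv \<mu> z (ham_field _ z) = _\<close> unfolding t s1 s2 .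
  qed
  \<comment> \<open>Momenta relative to \<open>L1\<close> in terms of velocities: rotation shifts p
    by (- q_2, q_1, 0).\<close>
  have p: "snd z $ 1 = w$1 - y$2" "fst z $ 2 = y$2" "\<pi>$1 = w$1 - y$2" "\<pi>$2 = w$2 + y$1" "\<pi>$3 = w$3"
    by (simp_all add: w_def y_def \<pi>_def vector_3)
  have 2: "w \<bullet> \<pi> = (w$1)\<^sup>2 + (w$2)\<^sup>2 + (w$3)\<^sup>2 - w$1 * y$2 + w$2 * y$1" "y \<bullet> \<pi> = y$1 * w$1 + y$2 * w$2 + y$3 * w$3"
    unfolding inner3 p by (simp_all add: power2_eq_square algebra_simps)
  have 3: "H_deriv \<mu> z (y, 0) = (y$1 * G$1 + y$2 * G$2 + y$3 * G$3) - w$2 * y$1 + w$1 * y$2"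
    unfolding H_deriv_def G_def w_def by (simp add: inner3 mult.commute del: vel_nth)
  define X where "X = ((1 + 2 * A) * w$1 - (1 + \<gamma>) * (G$2 + 2 * w$1)) / \<tau>"
  show ?thesis
    unfolding H_deriv_add 1 2 3 p X_def[symmetric] by (simp add: algebra_simps)
qed

context
  fixes \<mu> :: real
  assumes \<mu>: "0 < \<mu>" "\<mu> < 1"
begin

text \<open>The strength A of the tidal forces at l: the Hessian of U there is diagonal with entries
  - (1 + 2 A), A - 1 and A.\<close>

definition stiffness :: real where
  "stiffness = mass \<mu> Earth / radius \<mu> Earth ^ 3 + mass \<mu> Moon / radius \<mu> Moon ^ 3"

text \<open>The Lagrange equation and (1 + 2 \<rho>) (1 - \<rho>)^2 \<le> 1 give m/\<rho>^3 \<ge> 1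
  + 2 (1 - m) for each body, and the masses add up to 1.\<close>

lemma stiffness_ge: "stiffness \<ge> 4"
proof -
  have "mass \<mu> P / radius \<mu> P ^ 3 \<ge> 1 + 2 * (1 - mass \<mu> P)" for P
  proof -
    let ?r = "radius \<mu> P" and ?m = "mass \<mu> P"
    have r: "0 < ?r" "?r < 1" using radius_bounds[OF \<mu>] by auto
    have "?m / ?r\<^sup>2 = (1 - ?m) * (1 / (1 - ?r)\<^sup>2 - 1) + ?r"
      using lagrange_radius_body[OF \<mu>, of P] unfolding lagrange_radius_def by blast
    moreover have "2 * ?r \<le> 1 / (1 - ?r)\<^sup>2 - 1"
    proof -
      have "(1 + 2 * ?r) * (1 - ?r)\<^sup>2 = 1 - ?r\<^sup>2 * (3 - 2 * ?r)" by algebra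
      moreover have "0 \<le> ?r\<^sup>2 * (3 - 2 * ?r)" using r by simp
      ultimately have "(1 + 2 * ?r) * (1 - ?r)\<^sup>2 \<le> 1" by argo
      then have "1 + 2 * ?r \<le> 1 / (1 - ?r)\<^sup>2" using r by (simp add: pos_le_divide_eq)
      then show ?thesis by argo
    qed
    then have "(1 - ?m) * (2 * ?r) \<le> (1 - ?m) * (1 / (1 - ?r)\<^sup>2 - 1)"
      using mass_bounds[OF \<mu>, of P] by (intro mult_left_mono) auto
    ultimately have "?r * (1 + 2 * (1 - ?m)) \<le> ?m / ?r\<^sup>2" by (simp add: algebra_simps)
    then have "?r * (1 + 2 * (1 - ?m)) / ?r \<le> ?m / ?r\<^sup>2 / ?r" using r by (intro divide_right_mono) auto
    then show ?thesis using r by (simp add: power2_eq_square power3_eq_cube)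
  qed
  from this[of Earth] this[of Moon] show ?thesis unfolding stiffness_def by simp
qed

lemma eff_hess_lpos:
  "eff_hess \<mu> (lpos \<mu>) u = vector [- (1 + 2 * stiffness) * u$1, (stiffness - 1) * u$2, stiffness * u$3]"
proof -
  have k: "kepler_deriv (mass \<mu> P) (lpos \<mu> - position \<mu> P) u =
      (mass \<mu> P / radius \<mu> P ^ 3) *\<^sub>R vector [- 2 * u$1, u$2, u$3]" for P
  proof -
    have r: "radius \<mu> P > 0" using radius_bounds[OF \<mu>] by auto
    have d: "lpos \<mu> - position \<mu> P = radius \<mu> P *\<^sub>R axis_vec \<mu> P" by (simp add: lpos_body[of \<mu> P])
    have n: "norm (radius \<mu> P *\<^sub>R axis_vec \<mu> P) = radius \<mu> P" using r norm_axis_vec[of \<mu> P] by simp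
    have i: "(radius \<mu> P *\<^sub>R axis_vec \<mu> P) \<bullet> u = radius \<mu> P * orient P * u$1" by (simp add: inner3)
    have o: "orient P * (orient P * x) = x" for x by (cases P) auto
    show ?thesis
      unfolding kepler_deriv_def d n i using r
      by (simp add: vector3_eq_iff vector_3 field_simps eval_nat_numeral o)
  qed
  define a b where "a = mass \<mu> Earth / radius \<mu> Earth ^ 3" and "b = mass \<mu> Moon / radius \<mu> Moon ^ 3"
  show ?thesis
    unfolding eff_hess_def k stiffness_def a_def[symmetric] b_def[symmetric]
    by (simp add: vector3_eq_iff vector_3 algebra_simps)
qed

text \<open>The bound for the gradient is its differentiability at l, where it vanishes. The one for
  the potential follows by the mean value theorem on the segment from l to l + y.\<close>

lemma quadratic_approximation:
  assumes \<epsilon>: "0 < \<epsilon>"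
  shows "\<exists>d>0. \<forall>y. norm y < d \<longrightarrow>
    norm (eff_grad \<mu> (lpos \<mu> + y) - vector [- (1 + 2 * stiffness) * y$1, (stiffness - 1) * y$2, stiffness * y$3]) \<le> \<epsilon> * norm y \<and>
    \<bar>eff_pot \<mu> (lpos \<mu> + y) - eff_pot \<mu> (lpos \<mu>)
      - (- (1 + 2 * stiffness) * (y$1)\<^sup>2 + (stiffness - 1) * (y$2)\<^sup>2 + stiffness * (y$3)\<^sup>2) / 2\<bar> \<le> \<epsilon> * (norm y)\<^sup>2"
proof -
  define \<Lambda> :: "real^3 \<Rightarrow> real^3" where "\<Lambda> y = vector [- (1 + 2 * stiffness) * y$1, (stiffness - 1) * y$2, stiffness * y$3]" for y
  have "eff_hess \<mu> (lpos \<mu>) = \<Lambda>" by (rule ext) (simp only: eff_hess_lpos \<Lambda>_def)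
  then have "(eff_grad \<mu> has_derivative \<Lambda>) (at (lpos \<mu>))"
    using eff_grad_has_derivative[OF lpos_neq[OF \<mu>] lpos_neq[OF \<mu>]] by simp
  then obtain d1 where d1: "d1 > 0"
    "\<And>x. norm (x - lpos \<mu>) < d1 \<Longrightarrow> norm (eff_grad \<mu> x - eff_grad \<mu> (lpos \<mu>) - \<Lambda> (x - lpos \<mu>)) \<le> \<epsilon> * norm (x - lpos \<mu>)"
    using \<epsilon> unfolding has_derivative_at_alt by blast
  define d where "d = min d1 (min (radius \<mu> Earth) (radius \<mu> Moon))"
  have d: "d > 0" using d1 radius_bounds[OF \<mu>] by (simp add: d_def)
  have g: "norm (eff_grad \<mu> (lpos \<mu> + y) - \<Lambda> y) \<le> \<epsilon> * norm y" if "norm y < d" for y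
    using d1(2)[of "lpos \<mu> + y"] that eff_grad_lpos[OF \<mu>] by (simp add: d_def)
  have neq: "lpos \<mu> + y \<noteq> position \<mu> P" if "norm y < d" for y P
  proof
    assume "lpos \<mu> + y = position \<mu> P"
    then have "y = - (radius \<mu> P *\<^sub>R axis_vec \<mu> P)"
      unfolding lpos_body[of \<mu> P] by (simp add: eq_neg_iff_add_eq_0 add.commute)
    then have "norm y = radius \<mu> P" using norm_axis_vec[of \<mu> P] radius_bounds[OF \<mu>, of P] by simp
    then show False using that by (cases P) (auto simp: d_def)
  qed
  have \<Lambda>s: "\<Lambda> (t *\<^sub>R y) = t *\<^sub>R \<Lambda> y" for t y by (simp add: \<Lambda>_def vector3_eq_iff vector_3)
  have U: "\<bar>eff_pot \<mu> (lpos \<mu> + y) - eff_pot \<mu> (lpos \<mu>) - (\<Lambda> y \<bullet> y) / 2\<bar> \<le> \<epsilon> * (norm y)\<^sup>2" if y: "norm y < d" for y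
  proof -
    define h where "h t = eff_pot \<mu> (lpos \<mu> + t *\<^sub>R y) - t\<^sup>2 * (\<Lambda> y \<bullet> y) / 2" for t
    have ty: "norm (t *\<^sub>R y) < d" if "0 \<le> t" "t \<le> 1" for t
      using mult_left_le_one_le[of "norm y" t] that y by simp
    have "\<exists>t>0. t < 1 \<and> h 1 - h 0 = (1 - 0) * (eff_grad \<mu> (lpos \<mu> + t *\<^sub>R y) \<bullet> y - t * (\<Lambda> y \<bullet> y))"
    proof (rule MVT2)
      fix t :: real assume t: "0 \<le> t" "t \<le> 1"
      have "((\<lambda>t. t\<^sup>2 * (\<Lambda> y \<bullet> y) / 2) has_real_derivative t * (\<Lambda> y \<bullet> y)) (at t)"
        by (auto intro!: derivative_eq_intros)
      then show "(h has_real_derivative eff_grad \<mu> (lpos \<mu> + t *\<^sub>R y) \<bullet> y - t * (\<Lambda> y \<bullet> y)) (at t)"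
        unfolding h_def[abs_def] by (intro DERIV_diff eff_pot_line_derivative neq ty[OF t])
    qed simp
    then obtain t where t: "0 < t" "t < 1" "h 1 - h 0 = eff_grad \<mu> (lpos \<mu> + t *\<^sub>R y) \<bullet> y - t * (\<Lambda> y \<bullet> y)" by auto
    have "\<bar>h 1 - h 0\<bar> = \<bar>(eff_grad \<mu> (lpos \<mu> + t *\<^sub>R y) - \<Lambda> (t *\<^sub>R y)) \<bullet> y\<bar>"
      unfolding t(3) \<Lambda>s by (simp add: inner_diff_left)
    also have "\<dots> \<le> norm (eff_grad \<mu> (lpos \<mu> + t *\<^sub>R y) - \<Lambda> (t *\<^sub>R y)) * norm y"
      by (rule Cauchy_Schwarz_ineq2)
    also have "\<dots> \<le> \<epsilon> * norm (t *\<^sub>R y) * norm y"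
      using g[OF ty, of t] t by (intro mult_right_mono) auto
    also have "\<dots> \<le> \<epsilon> * norm y * norm y"
      using t \<epsilon> by (intro mult_right_mono mult_left_mono) (auto simp: mult_left_le_one_le)
    finally show ?thesis by (simp add: h_def power2_eq_square algebra_simps)
  qed
  have "\<Lambda> y \<bullet> y = - (1 + 2 * stiffness) * (y$1)\<^sup>2 + (stiffness - 1) * (y$2)\<^sup>2 + stiffness * (y$3)\<^sup>2" for y
    by (simp add: \<Lambda>_def inner3 vector_3 power2_eq_square)
  then show ?thesis using d g U unfolding \<Lambda>_def by auto
qed

lemma saddle_slope_exists:
  "\<exists>\<gamma>>0. \<gamma> \<le> 1 / 2 \<and> (1 + \<gamma>) * (stiffness - 1) = (2 * stiffness - 1 - 2 * \<gamma>) * (1 - \<gamma>)"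
proof -
  \<comment> \<open>The condition on \<gamma> expands to 2 \<gamma>^2 - 3 A \<gamma> + A = 0; the
    left-hand side is A at 0 and (1 - A)/2 at 1/2.\<close>
  let ?f = "\<lambda>g. 2 * g\<^sup>2 - 3 * stiffness * g + stiffness"
  have "\<exists>g\<ge>0. g \<le> 1 / 2 \<and> ?f g = 0"
  proof (rule IVT2')
    show "?f (1 / 2) \<le> 0" using stiffness_ge by (simp add: power2_eq_square)
    show "0 \<le> ?f 0" using stiffness_ge by simp
  qed (auto intro!: continuous_intros)
  then obtain g where g: "0 \<le> g" "g \<le> 1 / 2" "?f g = 0" by blast
  have "g \<noteq> 0" using g(3) stiffness_ge by auto
  moreover have "(1 + g) * (stiffness - 1) = (2 * stiffness - 1 - 2 * g) * (1 - g)"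
    using g(3) by (simp add: power2_eq_square algebra_simps)
  ultimately show ?thesis using g by (intro exI[of _ g]) auto
qed

end

text \<open>The Liouville field near \<open>L\<^sub>1\<close> will be \<open>(q - l) \<partial>/\<partial>q\<close> plus the Hamiltonian field of \<open>k\<close>; where
  \<open>\<theta>\<close> is large, the latter is a constant translation in \<open>q\<close>, and the sum is the radial field centred at
  one of the bodies.\<close>

definition neck_field :: "real \<Rightarrow> real \<Rightarrow> real \<Rightarrow> (phase \<Rightarrow> real) \<Rightarrow> (phase \<Rightarrow> real) \<Rightarrow> real \<Rightarrow> bool" where
  "neck_field \<mu> d e k \<theta> \<tau> \<longleftrightarrow> 0 < e \<and> Cinf_on UNIV k \<and> continuous_on UNIV \<theta> \<and>
    (\<forall>z. \<theta> z < - \<tau> \<longrightarrow> k z = radius \<mu> Moon * snd z $ 1) \<and>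
    (\<forall>z. \<tau> < \<theta> z \<longrightarrow> k z = (radius \<mu> Moon - 1) * snd z $ 1) \<and>
    (\<forall>z. eff_pot \<mu> (lpos \<mu>) < H \<mu> z \<longrightarrow> H \<mu> z < eff_pot \<mu> (lpos \<mu>) + e \<longrightarrow> norm (fst z - lpos \<mu>) \<le> d \<longrightarrow>
      0 < H_deriv \<mu> z ((fst z - lpos \<mu>, 0) + ham_field k z) \<and>
      (norm (fst z - lpos \<mu>) = d \<longrightarrow>
        (fst z $ 1 \<le> lpos \<mu> $ 1 \<longrightarrow> \<theta> z < - \<tau>) \<and> (lpos \<mu> $ 1 \<le> fst z $ 1 \<longrightarrow> \<tau> < \<theta> z))) \<and>
    (\<forall>q. norm (q - lpos \<mu>) = d \<longrightarrow> (\<forall>P. radius \<mu> P \<le> norm (q - position \<mu> P)) \<longrightarrow>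
      eff_pot \<mu> (lpos \<mu>) + e \<le> eff_pot \<mu> q)"

context
  fixes \<mu> :: real
  assumes \<mu>: "0 < \<mu>" "\<mu> < 1"
begin

text \<open>The order of the constants \<epsilon>, d, \<tau>, \<epsilon>1, e matters. Where
  |\<theta>| \<le> \<tau> and \<theta>^2 \<ge> E, error and main term m \<theta>^2/\<tau> both carry
  1/\<tau>, so \<epsilon> and d can be chosen before \<tau>. Where \<theta>^2 < E the main term E
  has no such factor, and an error bound \<epsilon>1 of order \<tau> is required; but there |y|^2
  \<le> 7 E, so this bound is available once e is small.\<close>

lemma neck_field_exists:
  assumes d0: "0 < d0"
  shows "\<exists>d e k \<theta> \<tau>. 0 < d \<and> d \<le> d0 \<and> neck_field \<mu> d e k \<theta> \<tau>"
proof -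
  let ?A = "stiffness \<mu>" and ?l = "lpos \<mu>" and ?\<rho> = "radius \<mu> Moon"
  let ?c = "eff_pot \<mu> ?l"
  have A: "?A \<ge> 4" by (rule stiffness_ge[OF \<mu>])
  have \<rho>: "0 < ?\<rho>" "?\<rho> < 1" using radius_bounds[OF \<mu>] by auto
  define m where "m = min ?\<rho> (1 - ?\<rho>)"
  have m: "0 < m" "m \<le> ?\<rho>" "m \<le> 1 - ?\<rho>" "m \<le> 1 / 2" using \<rho> by (auto simp: m_def min_def)
  obtain \<gamma> where \<gamma>: "\<gamma> > 0" "\<gamma> \<le> 1 / 2" and eig: "(1 + \<gamma>) * (?A - 1) = (2 * ?A - 1 - 2 * \<gamma>) * (1 - \<gamma>)"
    using saddle_slope_exists[OF \<mu>] by blast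
  define \<kappa> where "\<kappa> = 2 * ?A - 1 - 2 * \<gamma>"
  have \<kappa>: "0 \<le> \<kappa>" using A \<gamma> by (simp add: \<kappa>_def)
  note eig2 = eig[folded \<kappa>_def]
  obtain \<Phi> C where \<Phi>: "Cinf_on UNIV \<Phi>" and C: "C \<ge> 1" and \<Phi>l: "\<And>u. u \<le> -1 \<Longrightarrow> \<Phi> u = ?\<rho>"
    and \<Phi>r: "\<And>u. u \<ge> 1 \<Longrightarrow> \<Phi> u = ?\<rho> - 1"
    and \<Phi>in: "\<And>u. \<bar>u\<bar> \<le> 1 \<Longrightarrow> deriv \<Phi> u \<le> 0 \<and> \<bar>deriv \<Phi> u\<bar> \<le> C \<and> \<bar>\<Phi> u\<bar> \<le> C * \<bar>u\<bar> \<and> m * u\<^sup>2 \<le> - u * \<Phi> u"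
    and \<Phi>out: "\<And>u. \<bar>u\<bar> > 1 \<Longrightarrow> deriv \<Phi> u = 0"
    using saddle_profile_exists[OF \<rho>] unfolding m_def[symmetric] by blast
  define c4 where "c4 = 4 * C + 3"
  have c4: "c4 \<ge> 7" using C by (simp add: c4_def)
  \<comment> \<open>As c4 is the error coefficient of \<open>saddle_inner\<close>, this keeps the
    error below half of m \<theta>^2/\<tau> when \<nu>^2 + \<theta>^2 \<le> 8 \<theta>^2.\<close>
  define \<epsilon> where "\<epsilon> = m / (16 * c4)"
  have \<epsilon>: "0 < \<epsilon>" "16 * c4 * \<epsilon> = m" using m c4 by (auto simp: \<epsilon>_def)
  have \<epsilon>': "\<epsilon> \<le> m / 112"
  proof -
    have "7 * \<epsilon> \<le> c4 * \<epsilon>" using c4 \<epsilon>(1) by (intro mult_right_mono) auto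
    then show ?thesis using \<epsilon>(2) by simp
  qed
  \<comment> \<open>With these \<eta> and \<beta> the last two errors of \<open>saddle_outer\<close>
    are m/16 each; together with 2 \<epsilon> they stay below m/2.\<close>
  define \<eta> where "\<eta> = m / (256 * (\<kappa> + 1))"
  have \<eta>: "0 < \<eta>" "16 * \<eta> * (\<kappa> + 1) = m / 16" using m \<kappa> by (auto simp: \<eta>_def field_simps)
  define \<beta> where "\<beta> = m / (32 * (4 * ?A + 8))"
  have \<beta>: "0 < \<beta>" "2 * \<beta> * (4 * ?A + 8) = m / 16" using m A by (auto simp: \<beta>_def field_simps)
  have \<beta>m: "\<beta> \<le> m" using m A by (simp add: \<beta>_def pos_divide_le_eq)
  obtain T K where T: "Cinf_on UNIV T" and K: "K > 1" and T1: "\<And>u. \<bar>u\<bar> \<le> 1 \<Longrightarrow> T u = 1"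
    and T0: "\<And>u. \<bar>u\<bar> \<ge> K \<Longrightarrow> T u = 0" and T01: "\<And>u. 0 \<le> T u \<and> T u \<le> 1"
    and T': "\<And>u. \<bar>u * deriv T u\<bar> \<le> \<eta>" and T'1: "\<And>u. \<bar>u\<bar> \<le> 1 \<Longrightarrow> deriv T u = 0"
    using log_cutoff_exists[OF \<eta>(1)] by blast
  define \<Lambda> :: "real^3 \<Rightarrow> real^3" where "\<Lambda> y = vector [- (1 + 2 * ?A) * y$1, (?A - 1) * y$2, ?A * y$3]" for y
  define Q where "Q y = (- (1 + 2 * ?A) * (y$1)\<^sup>2 + (?A - 1) * (y$2)\<^sup>2 + ?A * (y$3)\<^sup>2) / 2" for y :: "real^3"
  have quad: "\<exists>d>0. \<forall>y. norm y < d \<longrightarrow> norm (eff_grad \<mu> (?l + y) - \<Lambda> y) \<le> e * norm y \<and>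
      \<bar>eff_pot \<mu> (?l + y) - ?c - Q y\<bar> \<le> e * (norm y)\<^sup>2" if "0 < e" for e
    using quadratic_approximation[OF \<mu> that] unfolding \<Lambda>_def Q_def .
  obtain \<delta>0 where \<delta>0: "\<delta>0 > 0" and q0: "\<And>y. norm y < \<delta>0 \<Longrightarrow> norm (eff_grad \<mu> (?l + y) - \<Lambda> y) \<le> \<epsilon> * norm y \<and>
      \<bar>eff_pot \<mu> (?l + y) - ?c - Q y\<bar> \<le> \<epsilon> * (norm y)\<^sup>2"
    using quad[OF \<epsilon>(1)] by blast
  \<comment> \<open>Through \<open>dsq\<close>, the last bound makes \<nu> \<le> \<beta> on the
    level set over the ball, the negative energy term being at most (1 + 2 A) d^2.\<close>
  define d where "d = min d0 (min (\<delta>0 / 2) (\<beta> / (2 * ?A + 4)))"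
  have d: "0 < d" "d \<le> d0" "d < \<delta>0" "d \<le> \<beta> / (2 * ?A + 4)"
    using d0 \<delta>0 \<beta> A by (auto simp: d_def)
  have dsq: "(2 * ?A + 4) * d\<^sup>2 \<le> \<beta>\<^sup>2 / 4"
  proof -
    have a0: "2 * ?A + 4 \<ge> 4" using A by simp
    have "(2 * ?A + 4) * d \<le> \<beta>" using d(4) a0 by (simp add: pos_le_divide_eq mult.commute)
    then have "((2 * ?A + 4) * d)\<^sup>2 \<le> \<beta>\<^sup>2" using d a0 by (intro power_mono) auto
    moreover have "4 * ((2 * ?A + 4) * d\<^sup>2) \<le> (2 * ?A + 4) * ((2 * ?A + 4) * d\<^sup>2)"
      using a0 by (intro mult_right_mono) auto
    ultimately show ?thesis by (simp add: power_mult_distrib power2_eq_square mult_ac)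
  qed
  define \<tau>\<^sub>2 where "\<tau>\<^sub>2 = d / 4"
  \<comment> \<open>On the sphere |y| = d coercivity gives \<theta>^2 > d^2/2, so |\<theta>| exceeds
    d/4 there, the threshold beyond which T vanishes. The inner scale is smaller by the factor K
    over which T decays.\<close>
  define \<tau> where "\<tau> = \<tau>\<^sub>2 / K"
  have d1: "d \<le> 1"
  proof -
    have "\<beta> / (2 * ?A + 4) \<le> \<beta> / 1" using \<beta>(1) A by (intro divide_left_mono) auto
    then show ?thesis using d(4) \<beta>m m by simp
  qed
  have \<tau>: "0 < \<tau>" "\<tau> \<le> 1" "\<tau> * K = \<tau>\<^sub>2" "0 < \<tau>\<^sub>2" "\<tau> \<le> \<tau>\<^sub>2"
  proof -
    show "0 < \<tau>\<^sub>2" "0 < \<tau>" "\<tau> * K = \<tau>\<^sub>2" using d K by (auto simp: \<tau>_def \<tau>\<^sub>2_def)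
    show "\<tau> \<le> \<tau>\<^sub>2" using K d by (auto simp: \<tau>_def \<tau>\<^sub>2_def pos_divide_le_eq)
    then show "\<tau> \<le> 1" using d1 by (simp add: \<tau>\<^sub>2_def)
  qed
  define \<epsilon>1 where "\<epsilon>1 = min (1 / 48) (\<tau> / (16 * c4))"
  have \<epsilon>1: "0 < \<epsilon>1" "\<epsilon>1 \<le> 1 / 48" "16 * c4 * \<epsilon>1 \<le> \<tau>"
  proof -
    show "0 < \<epsilon>1" "\<epsilon>1 \<le> 1 / 48" using \<tau> c4 by (auto simp: \<epsilon>1_def)
    have "\<epsilon>1 \<le> \<tau> / (16 * c4)" by (simp add: \<epsilon>1_def)
    then show "16 * c4 * \<epsilon>1 \<le> \<tau>" using c4 by (simp add: pos_le_divide_eq mult.commute)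
  qed
  obtain \<delta>1 where \<delta>1: "\<delta>1 > 0" and q1: "\<And>y. norm y < \<delta>1 \<Longrightarrow> norm (eff_grad \<mu> (?l + y) - \<Lambda> y) \<le> \<epsilon>1 * norm y \<and>
      \<bar>eff_pot \<mu> (?l + y) - ?c - Q y\<bar> \<le> \<epsilon>1 * (norm y)\<^sup>2"
    using quad[OF \<epsilon>1(1)] by blast
  \<comment> \<open>The bounds serve in turn for \<nu> \<le> 2 |\<theta>| and |w_2| \<le> |\<theta>|
    when |\<theta>| > \<tau>, for the behaviour of \<theta> and of U on the sphere |y| = d, for
    \<nu> \<le> \<beta>, and for the access to \<epsilon>1.\<close>
  define e where "e = min (\<tau>\<^sup>2 / 15) (min (d\<^sup>2 / 20) (min (\<beta>\<^sup>2 / 4) (\<delta>1\<^sup>2 / 8)))"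
  have e: "0 < e" "e \<le> \<tau>\<^sup>2 / 15" "e \<le> d\<^sup>2 / 20" "e \<le> \<beta>\<^sup>2 / 4" "e \<le> \<delta>1\<^sup>2 / 8"
    using \<tau> d \<beta> \<delta>1 by (auto simp: e_def)
  define \<theta> where "\<theta> = neck_phase \<mu> ?A \<gamma>"
  define k where "k = neck_ham \<mu> ?A \<gamma> \<tau> \<Phi> (\<lambda>u. \<gamma> * \<Phi> u * T u) (\<lambda>u. - T u / 2)"
  have k: "Cinf_on UNIV k"
    unfolding k_def by (intro Cinf_on_neck_ham Cinf_intros \<Phi> T open_UNIV \<tau>(1)) auto
  have D\<Phi>: "(\<Phi> has_real_derivative deriv \<Phi> u) (at u)" for u
    by (rule Cinf_on_has_real_derivative[OF \<Phi>]) auto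
  have DT: "(T has_real_derivative deriv T u) (at u)" for u
    by (rule Cinf_on_has_real_derivative[OF T]) auto
  have D\<beta>: "((\<lambda>u. \<gamma> * \<Phi> u * T u) has_real_derivative \<gamma> * (deriv \<Phi> u * T u + \<Phi> u * deriv T u)) (at u)" for u
    by (rule DERIV_cong, (rule derivative_intros D\<Phi> DT)+) (simp add: algebra_simps)
  have D\<zeta>: "((\<lambda>u. - T u / 2) has_real_derivative - deriv T u / 2) (at u)" for u
    by (rule DERIV_cdivide[OF DERIV_minus[OF DT]])
  have side: "k z = \<Phi> (\<theta> z / \<tau>) * snd z $ 1" if "\<tau>\<^sub>2 \<le> \<bar>\<theta> z\<bar>" for z
  proof -
    have "K \<le> \<bar>\<theta> z / \<tau>\<bar>" using that \<tau> by (simp add: abs_mult pos_le_divide_eq mult.commute)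
    then have "T (\<theta> z / \<tau>) = 0" by (rule T0)
    then show ?thesis unfolding k_def neck_ham_def \<theta>_def by simp
  qed
  have left: "k z = ?\<rho> * snd z $ 1" if "\<theta> z < - \<tau>\<^sub>2" for z
  proof -
    have "\<theta> z / \<tau> \<le> -1" using that \<tau> by (simp add: pos_divide_le_eq)
    then show ?thesis using side[of z] that \<tau> \<Phi>l by simp
  qed
  have right: "k z = (?\<rho> - 1) * snd z $ 1" if "\<tau>\<^sub>2 < \<theta> z" for z
  proof -
    have "\<theta> z / \<tau> \<ge> 1" using that \<tau> by (simp add: pos_le_divide_eq)
    then show ?thesis using side[of z] that \<tau> \<Phi>r by simp
  qed
  have cont: "continuous_on UNIV \<theta>"
    unfolding \<theta>_def neck_phase_def[abs_def] by (intro continuous_intros)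
  have main: "0 < H_deriv \<mu> z ((fst z - ?l, 0) + ham_field k z) \<and>
      (norm (fst z - ?l) = d \<longrightarrow> (fst z $ 1 \<le> ?l $ 1 \<longrightarrow> \<theta> z < - \<tau>\<^sub>2) \<and> (?l $ 1 \<le> fst z $ 1 \<longrightarrow> \<tau>\<^sub>2 < \<theta> z))"
    if z: "?c < H \<mu> z" "H \<mu> z < ?c + e" "norm (fst z - ?l) \<le> d" for z
  proof -
    define E where "E = H \<mu> z - ?c"
    have E: "0 < E" "E < e" using z by (auto simp: E_def)
    define y where "y = fst z - ?l"
    define w where "w = vel z"
    define G where "G = eff_grad \<mu> (fst z)"
    define g where "g = G - \<Lambda> y"
    define R where "R = eff_pot \<mu> (fst z) - ?c - Q y"
    have zy: "fst z = ?l + y" by (simp add: y_def)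
    have yd: "norm y \<le> d" using z(3) by (simp add: y_def)
    define n where "n = (y$1)\<^sup>2 + (y$2)\<^sup>2 + (y$3)\<^sup>2"
    define N where "N = n + ((w$1)\<^sup>2 + (w$2)\<^sup>2 + (w$3)\<^sup>2)"
    define \<nu> where "\<nu> = sqrt N"
    have nn: "(norm y)\<^sup>2 = n" "(norm w)\<^sup>2 = (w$1)\<^sup>2 + (w$2)\<^sup>2 + (w$3)\<^sup>2"
      unfolding power2_norm_eq_inner by (simp_all add: n_def inner3 power2_eq_square)
    have N0: "0 \<le> N" "n \<le> N" "0 \<le> n" by (simp_all add: N_def n_def)
    have \<nu>: "\<nu>\<^sup>2 = N" "0 \<le> \<nu>" using N0 by (simp_all add: \<nu>_def)
    have le\<nu>: "\<bar>x\<bar> \<le> \<nu>" if "x\<^sup>2 \<le> N" for x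
      using that real_le_rsqrt[of "\<bar>x\<bar>" N] by (simp add: \<nu>_def)
    have yw: "\<bar>y$1\<bar> \<le> \<nu>" "\<bar>y$2\<bar> \<le> \<nu>" "\<bar>y$3\<bar> \<le> \<nu>" "\<bar>w$1\<bar> \<le> \<nu>" "\<bar>w$2\<bar> \<le> \<nu>" "\<bar>w$3\<bar> \<le> \<nu>"
      by (rule le\<nu>, simp add: N_def n_def)+
    have y\<nu>: "norm y \<le> \<nu>" using le\<nu>[of "norm y"] N0 nn by simp
    have Geq: "G$1 = - (1 + 2 * ?A) * y$1 + g$1" "G$2 = (?A - 1) * y$2 + g$2" "G$3 = ?A * y$3 + g$3"
      by (simp_all add: g_def \<Lambda>_def vector_3)
    have th: "\<theta> z = (1 + 2 * ?A) * y$1 + (1 + \<gamma>) * w$2"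
      by (simp add: \<theta>_def neck_phase_def y_def w_def)
    have en: "((w$1)\<^sup>2 + (w$2)\<^sup>2 + (w$3)\<^sup>2) / 2
        + (- (1 + 2 * ?A) * (y$1)\<^sup>2 + (?A - 1) * (y$2)\<^sup>2 + ?A * (y$3)\<^sup>2) / 2 + R = E"
      using H_eq[of \<mu> z] nn(2) by (simp add: E_def R_def Q_def w_def)
    have bounds: "\<bar>g$1\<bar> \<le> x * \<nu>" "\<bar>g$2\<bar> \<le> x * \<nu>" "\<bar>g$3\<bar> \<le> x * \<nu>" "\<bar>R\<bar> \<le> x * \<nu>\<^sup>2" "\<bar>R\<bar> \<le> x * n"
      if "norm (eff_grad \<mu> (?l + y) - \<Lambda> y) \<le> x * norm y \<and> \<bar>eff_pot \<mu> (?l + y) - ?c - Q y\<bar> \<le> x * (norm y)\<^sup>2" "0 < x" for x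
    proof -
      have "norm g \<le> x * norm y" using that by (simp add: g_def G_def zy)
      also have "\<dots> \<le> x * \<nu>" using y\<nu> that by (intro mult_left_mono) auto
      finally have gn: "norm g \<le> x * \<nu>" .
      show "\<bar>g$1\<bar> \<le> x * \<nu>" "\<bar>g$2\<bar> \<le> x * \<nu>" "\<bar>g$3\<bar> \<le> x * \<nu>"
        by (rule order_trans[OF component_le_norm_cart gn])+
      show "\<bar>R\<bar> \<le> x * n" using that nn by (simp add: R_def zy)
      also have "\<dots> \<le> x * \<nu>\<^sup>2" using that N0 \<nu> by (intro mult_left_mono) auto
      finally show "\<bar>R\<bar> \<le> x * \<nu>\<^sup>2" .
    qed
    have yd0: "norm y < \<delta>0" using yd d by simp
    note b0 = bounds[OF q0[OF yd0] \<epsilon>(1)]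
    have \<epsilon>48: "\<epsilon> \<le> 1 / 48" using \<epsilon>' m by simp
    note co = saddle_coercive[OF A \<gamma> \<kappa> \<kappa>_def eig2 n_def N_def th en b0(5) \<epsilon>48 less_imp_le[OF E(1)]]
    \<comment> \<open>If \<theta> y_1 \<le> 0, then \<theta>^2 \<le> 9 E < d^2/2, against \<theta>^2
      > d^2/2. Hence y_1 is nonzero and \<theta> has its sign.\<close>
    have "norm (fst z - ?l) = d \<longrightarrow> (fst z $ 1 \<le> ?l $ 1 \<longrightarrow> \<theta> z < - \<tau>\<^sub>2) \<and> (?l $ 1 \<le> fst z $ 1 \<longrightarrow> \<tau>\<^sub>2 < \<theta> z)"
    proof (intro impI)
      assume "norm (fst z - ?l) = d"
      then have "n = d\<^sup>2" using nn by (simp add: y_def)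
      then have big: "d\<^sup>2 / 2 < (\<theta> z)\<^sup>2" using co(1) N0 E e(3) by argo
      then have "\<not> \<theta> z * y$1 \<le> 0" using co(3) E e(3) by argo
      moreover have "\<tau>\<^sub>2 < \<bar>\<theta> z\<bar>"
      proof (rule ccontr)
        assume "\<not> \<tau>\<^sub>2 < \<bar>\<theta> z\<bar>"
        then have "\<bar>\<theta> z\<bar>\<^sup>2 \<le> \<tau>\<^sub>2\<^sup>2" by (intro power_mono) auto
        moreover have "\<tau>\<^sub>2\<^sup>2 = d\<^sup>2 / 16" by (simp add: \<tau>\<^sub>2_def power_divide)
        moreover have "0 < d\<^sup>2" using d(1) by simp
        ultimately show False using big power2_abs[of "\<theta> z"] by argo
      qed
      ultimately show "(fst z $ 1 \<le> ?l $ 1 \<longrightarrow> \<theta> z < - \<tau>\<^sub>2) \<and> (?l $ 1 \<le> fst z $ 1 \<longrightarrow> \<tau>\<^sub>2 < \<theta> z)"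
        by (auto simp: y_def not_le zero_less_mult_iff abs_if split: if_splits)
    qed
    moreover
    define u where "u = \<theta> z / \<tau>"
    note rate = neck_rate[where \<mu> = \<mu> and z = z and A = ?A and \<gamma> = \<gamma> and \<tau> = \<tau>, OF \<tau>(1) D\<Phi> D\<beta> D\<zeta>,
        folded \<theta>_def k_def, folded y_def w_def G_def u_def]
    have "0 < H_deriv \<mu> z ((y, 0) + ham_field k z)"
    proof (cases "\<bar>\<theta> z\<bar> \<le> \<tau>")
      case True
      then have u: "\<bar>u\<bar> \<le> 1" using \<tau> by (simp add: u_def)
      note f = \<Phi>in[OF u]
      have f': "- deriv \<Phi> u \<le> C" by (rule abs_le_D2) (use f in blast)
      define L where "L x = E + m * (\<theta> z)\<^sup>2 / \<tau> - x / \<tau> * (4 * C + 3) * (\<nu>\<^sup>2 + (\<theta> z)\<^sup>2)" for x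
      have inner: "L x \<le> H_deriv \<mu> z ((y, 0) + ham_field k z)"
        if "\<bar>g$1\<bar> \<le> x * \<nu>" "\<bar>g$2\<bar> \<le> x * \<nu>" "\<bar>g$3\<bar> \<le> x * \<nu>" "\<bar>R\<bar> \<le> x * \<nu>\<^sup>2" "0 \<le> x" for x
        unfolding rate L_def T1[OF u] T'1[OF u]
        using saddle_inner[where \<alpha> = "\<Phi> u" and \<alpha>' = "deriv \<Phi> u" and m = m and C = C, OF A \<gamma> \<kappa> \<kappa>_def eig2 th Geq en yw(1-4) that(1-4) \<nu>(2) that(5) \<tau>(1,2)]
          f f' C by (simp add: u_def)
      \<comment> \<open>X stands for the larger of \<theta>^2 and E, and Y for a bound on the error;
        both cases below use this computation.\<close>
      have "0 < L x" if "\<nu>\<^sup>2 + (\<theta> z)\<^sup>2 \<le> 8 * X" "c4 * x / \<tau> * (8 * X) \<le> Y" "2 * Y = E + m * (\<theta> z)\<^sup>2 / \<tau> \<or> Y < E + m * (\<theta> z)\<^sup>2 / \<tau>" "0 \<le> x" for x X Y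
      proof -
        have pos: "0 < E + m * (\<theta> z)\<^sup>2 / \<tau>" using E m \<tau> by (simp add: add_pos_nonneg)
        have "x / \<tau> * (4 * C + 3) * (\<nu>\<^sup>2 + (\<theta> z)\<^sup>2) \<le> x / \<tau> * (4 * C + 3) * (8 * X)"
          using that C \<tau> by (intro mult_left_mono) auto
        also have "\<dots> = c4 * x / \<tau> * (8 * X)" by (simp add: c4_def)
        finally show ?thesis using that pos unfolding L_def by argo
      qed note Lpos = this
      show ?thesis
      proof (cases "E \<le> (\<theta> z)\<^sup>2")
        case True
        have "0 < L \<epsilon>"
        proof (rule Lpos)
          show "\<nu>\<^sup>2 + (\<theta> z)\<^sup>2 \<le> 8 * (\<theta> z)\<^sup>2" using co(1) True \<nu> by argo
          have "c4 * \<epsilon> / \<tau> * (8 * (\<theta> z)\<^sup>2) = (16 * c4 * \<epsilon>) * (\<theta> z)\<^sup>2 / \<tau> / 2" by simp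
          then show "c4 * \<epsilon> / \<tau> * (8 * (\<theta> z)\<^sup>2) \<le> m * (\<theta> z)\<^sup>2 / \<tau> / 2" unfolding \<epsilon>(2) by simp
          have "0 \<le> m * (\<theta> z)\<^sup>2 / \<tau>" using m \<tau> by simp
          then show "2 * (m * (\<theta> z)\<^sup>2 / \<tau> / 2) = E + m * (\<theta> z)\<^sup>2 / \<tau> \<or> m * (\<theta> z)\<^sup>2 / \<tau> / 2 < E + m * (\<theta> z)\<^sup>2 / \<tau>"
            using E by argo
        qed (use \<epsilon> in simp)
        also have "\<dots> \<le> H_deriv \<mu> z ((y, 0) + ham_field k z)" by (rule inner[OF b0(1-4)]) (use \<epsilon> in simp)
        finally show ?thesis .
      next
        case False
        have "n < \<delta>1\<^sup>2" using co(1) False N0 E e(5) by argo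
        then have "norm y < \<delta>1" using nn \<delta>1 power2_less_imp_less[of "norm y" \<delta>1] by simp
        note b1 = bounds[OF q1[OF this] \<epsilon>1(1)]
        have "0 < L \<epsilon>1"
        proof (rule Lpos)
          show "\<nu>\<^sup>2 + (\<theta> z)\<^sup>2 \<le> 8 * E" using co(1) False \<nu> by argo
          have "c4 * \<epsilon>1 / \<tau> * (8 * E) = (16 * c4 * \<epsilon>1) * E / \<tau> / 2" by simp
          also have "\<dots> \<le> \<tau> * E / \<tau> / 2" using \<epsilon>1 E \<tau> by (intro divide_right_mono mult_right_mono) auto
          finally show "c4 * \<epsilon>1 / \<tau> * (8 * E) \<le> E / 2" using \<tau> by simp
          have "0 \<le> m * (\<theta> z)\<^sup>2 / \<tau>" using m \<tau> by simp
          then show "2 * (E / 2) = E + m * (\<theta> z)\<^sup>2 / \<tau> \<or> E / 2 < E + m * (\<theta> z)\<^sup>2 / \<tau>" using E by argo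
        qed (use \<epsilon>1 in simp)
        also have "\<dots> \<le> H_deriv \<mu> z ((y, 0) + ham_field k z)" by (rule inner[OF b1(1-4)]) (use \<epsilon>1 in simp)
        finally show ?thesis .
      qed
    next
      case False
      then have t: "\<tau> < \<bar>\<theta> z\<bar>" by simp
      then have u: "\<bar>u\<bar> > 1" using \<tau> by (simp add: u_def)
      have s: "\<Phi> u * \<theta> z < 0" "m \<le> \<bar>\<Phi> u\<bar>" "\<bar>\<Phi> u\<bar> \<le> 1"
      proof -
        consider "u > 1" | "u < -1" using u by linarith
        then have "\<Phi> u * \<theta> z < 0 \<and> m \<le> \<bar>\<Phi> u\<bar> \<and> \<bar>\<Phi> u\<bar> \<le> 1"
        proof cases
          case 1
          then have "\<theta> z > 0" using \<tau> by (auto simp: u_def pos_less_divide_eq)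
          then show ?thesis using 1 \<Phi>r[of u] \<rho> m by (simp add: mult_less_0_iff)
        next
          case 2
          then have "\<theta> z < 0" using \<tau> by (auto simp: u_def pos_divide_less_eq)
          then show ?thesis using 2 \<Phi>l[of u] \<rho> m by (simp add: mult_less_0_iff)
        qed
        then show "\<Phi> u * \<theta> z < 0" "m \<le> \<bar>\<Phi> u\<bar>" "\<bar>\<Phi> u\<bar> \<le> 1" by auto
      qed
      have t2: "\<tau>\<^sup>2 \<le> (\<theta> z)\<^sup>2" using t \<tau> power_mono[of \<tau> "\<bar>\<theta> z\<bar>" 2] by simp
      have "N \<le> (2 * \<bar>\<theta> z\<bar>)\<^sup>2" using co(1) E e(2) t2 by (simp add: power_mult_distrib)
      then have small: "\<nu> \<le> 2 * \<bar>\<theta> z\<bar>" unfolding \<nu>(1)[symmetric] by (rule power2_le_imp_le) simp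
      have "N \<le> \<beta>\<^sup>2"
      proof -
        have "n \<le> d\<^sup>2" using yd nn power_mono[of "norm y" d 2] by simp
        then have nb: "(2 * ?A + 4) * n \<le> \<beta>\<^sup>2 / 4"
          using A \<open>n \<le> d\<^sup>2\<close> by (intro order_trans[OF mult_left_mono dsq]) auto
        have "(1 + 2 * ?A) * (y$1)\<^sup>2 \<le> (1 + 2 * ?A) * n" using A by (intro mult_left_mono) (auto simp: n_def)
        moreover have "0 \<le> (?A - 1) * (y$2)\<^sup>2" "0 \<le> ?A * (y$3)\<^sup>2" using A by auto
        moreover have "\<epsilon> * n \<le> 1 * n" using \<epsilon>48 N0 by (intro mult_right_mono) auto
        moreover have "- R \<le> \<epsilon> * n" using b0(5) by (simp add: abs_le_iff)
        moreover have "(2 * ?A + 4) * n = (1 + 2 * ?A) * n + 3 * n" by (simp add: algebra_simps)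
        moreover have "- (1 + 2 * ?A) * (y$1)\<^sup>2 = - ((1 + 2 * ?A) * (y$1)\<^sup>2)" by (simp add: algebra_simps)
        ultimately show ?thesis using en nb E e(4) N0 unfolding N_def by argo
      qed
      then have small2: "\<nu> \<le> \<beta>" unfolding \<nu>(1)[symmetric] by (rule power2_le_imp_le) (use \<beta> in simp)
      have w2: "\<gamma> * \<bar>w$2\<bar> \<le> \<bar>\<theta> z\<bar> / 2"
      proof -
        have "(w$2)\<^sup>2 \<le> \<bar>\<theta> z\<bar>\<^sup>2" using co(2) E e(2) t2 power2_abs[of "\<theta> z"] by argo
        then have "\<bar>w$2\<bar> \<le> \<bar>\<theta> z\<bar>" by (simp add: abs_le_square_iff)
        then have "\<gamma> * \<bar>w$2\<bar> \<le> 1 / 2 * \<bar>\<theta> z\<bar>" using \<gamma> by (intro mult_mono) auto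
        then show ?thesis by simp
      qed
      have T'u: "\<bar>\<theta> z / \<tau> * deriv T u\<bar> \<le> \<eta>" using T'[of u] by (simp add: u_def)
      have "0 < \<bar>\<theta> z\<bar> * (m / 2 - 2 * \<epsilon> - 16 * \<eta> * (\<kappa> + 1) - 2 * \<beta> * (4 * ?A + 8))"
        unfolding \<eta>(2) \<beta>(2) using t \<tau> \<epsilon>' m by (intro mult_pos_pos) auto
      also have "\<dots> \<le> H_deriv \<mu> z ((y, 0) + ham_field k z)"
        unfolding rate \<Phi>out[OF u]
        using saddle_outer[where s = "\<Phi> u" and T = "T u" and T' = "deriv T u" and m = m, OF A \<gamma> \<kappa> \<kappa>_def eig2 th Geq en yw b0(1-4) \<nu>(2)
            _ _ \<tau>(1) t s _ _ T'u small small2 _ w2 less_imp_le[OF E(1)]] T01[of u] \<epsilon> \<epsilon>48 \<beta>m m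
        by (simp add: mult.assoc)
      finally show ?thesis .
    qed
    ultimately show ?thesis unfolding y_def by blast
  qed
  \<comment> \<open>A point outside both balls satisfies 2 m |y_1| \<le> d^2, so y is almost
    orthogonal to the axis, where the quadratic part of U is at least 3/2 |y|^2.\<close>
  have frontier: "?c + e \<le> eff_pot \<mu> q" if q: "norm (q - ?l) = d" "\<And>P. radius \<mu> P \<le> norm (q - position \<mu> P)" for q
  proof -
    define y where "y = q - ?l"
    have qy: "q = ?l + y" by (simp add: y_def)
    have n: "(y$1)\<^sup>2 + (y$2)\<^sup>2 + (y$3)\<^sup>2 = d\<^sup>2"
      using q(1) by (simp add: y_def[symmetric] norm_eq_sqrt_inner inner3 power2_eq_square) (metis inner3 inner_ge_zero real_sqrt_pow2 power2_eq_square)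
    have o: "0 \<le> 2 * (radius \<mu> P * (orient P * y$1)) + d\<^sup>2" for P
    proof -
      have "q - position \<mu> P = y + radius \<mu> P *\<^sub>R axis_vec \<mu> P" by (simp add: qy lpos_body[of \<mu> P])
      then have "(norm (q - position \<mu> P))\<^sup>2 = d\<^sup>2 + 2 * (radius \<mu> P * (orient P * y$1)) + (radius \<mu> P)\<^sup>2"
        unfolding power2_norm_eq_inner n[symmetric]
        by (simp add: inner3 power2_eq_square algebra_simps)
      moreover have "(radius \<mu> P)\<^sup>2 \<le> (norm (q - position \<mu> P))\<^sup>2"
        using q(2)[of P] radius_bounds[OF \<mu>, of P] by (intro power_mono) auto
      ultimately show ?thesis by simp
    qed
    have "2 * m * \<bar>y$1\<bar> \<le> d\<^sup>2"
    proof (cases "y$1 \<ge> 0")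
      case True
      have "m * y$1 \<le> (1 - ?\<rho>) * y$1" using True m by (intro mult_right_mono) auto
      moreover have "0 \<le> - 2 * ((1 - ?\<rho>) * y$1) + d\<^sup>2" using o[of Earth] radius_other[of \<mu> Moon] by simp
      ultimately show ?thesis using True by simp
    next
      case False
      have "m * (- y$1) \<le> ?\<rho> * (- y$1)" using False m by (intro mult_right_mono) auto
      moreover have "0 \<le> 2 * (?\<rho> * y$1) + d\<^sup>2" using o[of Moon] by simp
      moreover have "?\<rho> * (- y$1) = - (?\<rho> * y$1)" by simp
      moreover have "2 * m * \<bar>y$1\<bar> = 2 * (m * (- y$1))" using False by simp
      ultimately show ?thesis by argo
    qed
    then have "(2 * m * \<bar>y$1\<bar>)\<^sup>2 \<le> (d\<^sup>2)\<^sup>2" using m by (intro power_mono) auto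
    then have "4 * m\<^sup>2 * (y$1)\<^sup>2 \<le> d\<^sup>2 * d\<^sup>2" by (simp add: power_mult_distrib power2_eq_square mult_ac)
    then have "(2 * ?A + 4) * (4 * m\<^sup>2 * (y$1)\<^sup>2) \<le> ((2 * ?A + 4) * d\<^sup>2) * d\<^sup>2"
      using A mult_left_mono[of "4 * m\<^sup>2 * (y$1)\<^sup>2" "d\<^sup>2 * d\<^sup>2" "2 * ?A + 4"] by (simp add: mult_ac)
    also have "\<dots> \<le> (m\<^sup>2 / 4) * d\<^sup>2"
    proof (rule mult_right_mono)
      have "\<beta>\<^sup>2 \<le> m\<^sup>2" using \<beta> \<beta>m by (intro power_mono) auto
      then show "(2 * ?A + 4) * d\<^sup>2 \<le> m\<^sup>2 / 4" using dsq by argo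
    qed simp
    finally have "m\<^sup>2 * (16 * ((2 * ?A + 4) * (y$1)\<^sup>2)) \<le> m\<^sup>2 * d\<^sup>2" by (simp add: mult_ac)
    then have ay: "16 * ((2 * ?A + 4) * (y$1)\<^sup>2) \<le> d\<^sup>2" using m by (simp add: mult_le_cancel_left_pos)
    have "norm y < \<delta>0" "(norm y)\<^sup>2 = d\<^sup>2" using q(1) d by (simp_all add: y_def)
    then have R: "\<bar>eff_pot \<mu> q - ?c - Q y\<bar> \<le> \<epsilon> * d\<^sup>2" using q0[of y] qy by simp
    have aux: "?c + e \<le> U" if "Q0 - X \<le> U - ?c" "X \<le> 1 / 48 * D" "2 * Q0 = - a + b + c" "3 * y2 \<le> b" "3 * y3 \<le> c"
      "16 * (a + 3 * y1) \<le> D" "y1 + y2 + y3 = D" "e \<le> D / 20" "0 \<le> D" for U Q0 X D a b c y1 y2 y3 :: real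
      using that by (simp add: field_simps)
    show ?thesis
    proof (rule aux)
      show "Q y - \<epsilon> * d\<^sup>2 \<le> eff_pot \<mu> q - ?c" using R unfolding abs_le_iff by argo
      show "\<epsilon> * d\<^sup>2 \<le> 1 / 48 * d\<^sup>2" using \<epsilon>' m by (intro mult_right_mono) auto
      show "2 * Q y = - ((1 + 2 * ?A) * (y$1)\<^sup>2) + (?A - 1) * (y$2)\<^sup>2 + ?A * (y$3)\<^sup>2"
        by (simp add: Q_def field_simps)
      show "3 * (y$2)\<^sup>2 \<le> (?A - 1) * (y$2)\<^sup>2" "3 * (y$3)\<^sup>2 \<le> ?A * (y$3)\<^sup>2"
        using A by (intro mult_right_mono; simp)+
      have "(2 * ?A + 4) * (y$1)\<^sup>2 = (1 + 2 * ?A) * (y$1)\<^sup>2 + 3 * (y$1)\<^sup>2" by (simp add: algebra_simps)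
      then show "16 * ((1 + 2 * ?A) * (y$1)\<^sup>2 + 3 * (y$1)\<^sup>2) \<le> d\<^sup>2" using ay by simp
    qed (use n e(3) in simp_all)
  qed
  have "neck_field \<mu> d e k \<theta> \<tau>\<^sub>2"
    unfolding neck_field_def using e(1) k cont left right main frontier by blast
  then show ?thesis using d(1,2) by blast
qed

end

section \<open>Assembling the field above the critical energy\<close>

lemma UN_body: "(\<Union>P. f P) = f Earth \<union> f Moon"
  unfolding UNIV_body by simp

context
  fixes \<mu> :: real
  assumes \<mu>: "0 < \<mu>" "\<mu> < 1"
begin

lemma ball_side:
  assumes "q \<in> ball (position \<mu> P) (radius \<mu> P)"
  shows "orient P * q$1 < orient P * lpos \<mu> $ 1"
proof -
  have "\<bar>(q - position \<mu> P)$1\<bar> < radius \<mu> P"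
    using component_le_norm_cart[of "q - position \<mu> P" 1] assms by (simp add: dist_norm norm_minus_commute)
  moreover have "lpos \<mu> $ 1 = position \<mu> P $ 1 + radius \<mu> P * orient P"
    by (simp add: lpos_body[of \<mu> P])
  ultimately show ?thesis by (cases P) auto
qed

text \<open>The hypotheses keep the boundary of the union of the three balls out of the Hill's
  region, so a component that meets the union lies in it and is bounded. By
  \<open>bounded_hill_component_closure\<close> a bounded component has a body in its closure, and
  so is the one that contains the segment between the bodies, on which U \<le> U(l) < c.\<close>

lemma hill_component_EM_eq:
  assumes d: "0 < d" and c: "eff_pot \<mu> (lpos \<mu>) < c"
    and margin: "\<And>P q. norm (q - position \<mu> P) = radius \<mu> P \<Longrightarrow> d \<le> norm (q - lpos \<mu>) \<Longrightarrow> c < eff_pot \<mu> q"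
    and frontier: "\<And>q. norm (q - lpos \<mu>) = d \<Longrightarrow> (\<And>P. radius \<mu> P \<le> norm (q - position \<mu> P)) \<Longrightarrow> c < eff_pot \<mu> q"
  shows "hill_component_EM \<mu> c =
    hill_region \<mu> c \<inter> ((\<Union>P. ball (position \<mu> P) (radius \<mu> P)) \<union> ball (lpos \<mu>) d)"
proof -
  let ?S = "hill_region \<mu> c" and ?B = "\<lambda>P. ball (position \<mu> P) (radius \<mu> P)"
  let ?Q = "(\<Union>P. ?B P) \<union> ball (lpos \<mu>) d"
  let ?K = "(\<Union>P. cball (position \<mu> P) (radius \<mu> P)) \<union> cball (lpos \<mu>) d"
  have Q: "open ?Q" "bounded ?Q" and K: "closed ?K"
    unfolding UN_body by (auto simp: bounded_ball)
  have SK: "q \<in> ?Q" if q: "q \<in> ?S" "q \<in> ?K" for q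
  proof (rule ccontr)
    assume n: "q \<notin> ?Q"
    have r: "radius \<mu> P \<le> norm (q - position \<mu> P)" for P
      using n by (auto simp: dist_norm norm_minus_commute not_less)
    have dd: "d \<le> norm (q - lpos \<mu>)" using n by (auto simp: dist_norm norm_minus_commute not_less)
    consider P where "norm (q - position \<mu> P) \<le> radius \<mu> P" | "norm (q - lpos \<mu>) \<le> d"
      using q(2) by (auto simp: dist_norm norm_minus_commute)
    then have "c < eff_pot \<mu> q"
    proof cases
      case (1 P)
      then show ?thesis using margin[OF antisym[OF 1 r]] dd by simp
    next
      case 2
      then show ?thesis using frontier[OF antisym[OF 2 dd] r] by simp
    qed
    then show False using q(1) by (simp add: hill_region_eq)
  qed
  have clop: "C \<subseteq> ?Q" if C: "C \<in> components ?S" "C \<inter> ?Q \<noteq> {}" for C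
  proof -
    have CS: "C \<subseteq> ?S" by (rule in_components_subset[OF C(1)])
    have "?Q \<subseteq> ?K" using ball_subset_cball by blast
    then have "C \<inter> ?Q = C \<inter> ?K" using SK CS by blast
    then have "closedin (top_of_set C) (C \<inter> ?Q)" using K by (simp add: closedin_closed_Int)
    moreover have "openin (top_of_set C) (C \<inter> ?Q)" using Q by (simp add: openin_open_Int)
    ultimately have "C \<inter> ?Q = {} \<or> C \<inter> ?Q = C"
      using in_components_connected[OF C(1)] connected_clopen by blast
    then show ?thesis using C(2) by blast
  qed
  \<comment> \<open>Each piece includes half of the segment up to l, the common point that joins the
    two.\<close>
  define A where "A P = ?S \<inter> ?B P \<union> (\<lambda>a. position \<mu> P + a *\<^sub>R axis_vec \<mu> P) ` {0<..radius \<mu> P}" for P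
  have seg: "position \<mu> P + a *\<^sub>R axis_vec \<mu> P \<in> ?S" if "a \<in> {0<..radius \<mu> P}" for P a
  proof -
    have "eff_pot \<mu> (position \<mu> P + a *\<^sub>R axis_vec \<mu> P) \<le> c"
      using eff_pot_ray_mono[OF \<mu> norm_axis_vec, of a "radius \<mu> P" P \<mu> P] that c
      unfolding lpos_body[of \<mu> P, symmetric] by simp
    moreover have n: "norm (position \<mu> P + a *\<^sub>R axis_vec \<mu> P - position \<mu> P) = a"
      using that by (simp add: norm_axis_vec)
    then have "position \<mu> P + a *\<^sub>R axis_vec \<mu> P \<noteq> position \<mu> (other P)"
      by (intro other_far[OF \<mu>]) (use that radius_bounds[OF \<mu>, of P] in simp)
    moreover have "position \<mu> P + a *\<^sub>R axis_vec \<mu> P \<noteq> position \<mu> P" using n that by auto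
    ultimately show ?thesis by (cases P) (auto simp: hill_region_eq)
  qed
  have lA: "lpos \<mu> \<in> A P" for P
    using radius_bounds(1)[OF \<mu>, of P] lpos_body[of \<mu> P] by (auto simp: A_def)
  have "connected (A P)" for P
    unfolding A_def
  proof (rule connected_Un[OF connected_hill_ball[OF \<mu>]])
    show "connected ((\<lambda>a. position \<mu> P + a *\<^sub>R axis_vec \<mu> P) ` {0<..radius \<mu> P})"
      by (intro connected_continuous_image continuous_intros) simp
    define q where "q = position \<mu> P + (radius \<mu> P / 2) *\<^sub>R axis_vec \<mu> P"
    have "q \<in> ?S" unfolding q_def by (rule seg) (use radius_bounds(1)[OF \<mu>, of P] in simp)
    moreover have "q \<in> ?B P"
      using radius_bounds(1)[OF \<mu>, of P] by (simp add: q_def dist_norm norm_axis_vec)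
    moreover have "q \<in> (\<lambda>a. position \<mu> P + a *\<^sub>R axis_vec \<mu> P) ` {0<..radius \<mu> P}"
      unfolding q_def by (rule imageI) (use radius_bounds(1)[OF \<mu>, of P] in simp)
    ultimately show "?S \<inter> ?B P \<inter> (\<lambda>a. position \<mu> P + a *\<^sub>R axis_vec \<mu> P) ` {0<..radius \<mu> P} \<noteq> {}"
      by blast
  qed
  then have "connected (A Earth \<union> A Moon)" using lA[of Earth] lA[of Moon] by (intro connected_Un) auto
  moreover have "A P \<subseteq> ?S" for P using seg by (auto simp: A_def)
  ultimately obtain C where C: "C \<in> components ?S" "A Earth \<union> A Moon \<subseteq> C"
    using exists_component_superset[of "A Earth \<union> A Moon" ?S] lA by blast
  have AC: "A P \<subseteq> C" for P using C(2) by (cases P) auto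
  have "lpos \<mu> \<in> ?Q" using d by simp
  then have CQ: "C \<subseteq> ?Q" using clop[OF C(1)] AC lA by blast
  have uniq: "D = C" if D: "D \<in> components ?S" "bounded D" for D
  proof -
    obtain P where "position \<mu> P \<in> closure D"
      using bounded_hill_component_closure[OF D] by blast
    moreover have "?S \<inter> ?B P \<subseteq> C" using AC[of P] by (auto simp: A_def)
    ultimately show ?thesis using hill_component_unique[OF \<mu> C(1) D(1)] by blast
  qed
  have "hill_component_EM \<mu> c = C"
    unfolding hill_component_EM_def
  proof (rule the_equality)
    show "C \<in> components ?S \<and> bounded C" using C(1) bounded_subset[OF Q(2) CQ] by blast
  qed (use uniq in blast)
  moreover have "?S \<inter> ?Q \<subseteq> C"
  proof
    fix q assume q: "q \<in> ?S \<inter> ?Q"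
    then obtain D where D: "D \<in> components ?S" "q \<in> D"
      using Union_components[of ?S] by blast
    then have "D \<subseteq> ?Q" using clop q by blast
    then show "q \<in> C" using uniq D bounded_subset[OF Q(2)] by blast
  qed
  ultimately show ?thesis using CQ in_components_subset[OF C(1)] by blast
qed

lemma contact_type_above:
  "\<exists>\<epsilon>>0. \<forall>c. H \<mu> (L1 \<mu>) < c \<and> c < H \<mu> (L1 \<mu>) + \<epsilon> \<longrightarrow> contact_type \<mu> (regularized_\<Sigma>_EM \<mu> c)"
proof -
  let ?l = "lpos \<mu>"
  let ?c = "eff_pot \<mu> ?l"
  \<comment> \<open>Half of the smaller radius keeps the neck ball away from both bodies.\<close>
  define d0 where "d0 = min (radius \<mu> Moon) (radius \<mu> Earth) / 2"
  have "0 < d0" using radius_bounds(1)[OF \<mu>] by (simp add: d0_def)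
  from neck_field_exists[OF \<mu> this] obtain d e k \<theta> \<tau> where d: "0 < d" "d \<le> d0"
    and N: "neck_field \<mu> d e k \<theta> \<tau>" by blast
  note N = N[unfolded neck_field_def]
  have e: "0 < e" and k: "Cinf_on UNIV k" and \<theta>: "continuous_on UNIV \<theta>" using N by blast+
  have left: "k z = radius \<mu> Moon * snd z $ 1" if "\<theta> z < - \<tau>" for z using N that by blast
  have right: "k z = (radius \<mu> Moon - 1) * snd z $ 1" if "\<tau> < \<theta> z" for z using N that by blast
  have neck: "0 < H_deriv \<mu> z ((fst z - ?l, 0) + ham_field k z)"
      "norm (fst z - ?l) = d \<Longrightarrow> fst z $ 1 \<le> ?l $ 1 \<Longrightarrow> \<theta> z < - \<tau>"
      "norm (fst z - ?l) = d \<Longrightarrow> ?l $ 1 \<le> fst z $ 1 \<Longrightarrow> \<tau> < \<theta> z"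
    if "?c < H \<mu> z" "H \<mu> z < ?c + e" "norm (fst z - ?l) \<le> d" for z
    using N that by blast+
  have frontier: "?c + e \<le> eff_pot \<mu> q"
    if "norm (q - ?l) = d" "\<And>P. radius \<mu> P \<le> norm (q - position \<mu> P)" for q
    using N that by blast
  have dP: "d \<le> radius \<mu> P / 2" for P using d(2) by (cases P) (auto simp: d0_def)
  have lP: "norm (position \<mu> P - ?l) = radius \<mu> P" for P
    using radius_bounds(1)[OF \<mu>, of P] by (simp add: lpos_body[of \<mu> P] norm_axis_vec)
  have "\<forall>P. \<exists>e>0. \<forall>c v r. c < ?c + e \<longrightarrow> norm v = 1 \<longrightarrow> 0 < r \<longrightarrow> r \<le> radius \<mu> P \<longrightarrow>
      d \<le> norm (position \<mu> P + r *\<^sub>R v - ?l) \<longrightarrow>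
      0 < (ray_pot' (mass \<mu> P) (orient P * v$1) ((v$1)\<^sup>2 + (v$2)\<^sup>2) r)\<^sup>2
        - 2 * ((v$1)\<^sup>2 + (v$2)\<^sup>2) * (c - ray_pot (mass \<mu> P) (orient P * v$1) ((v$1)\<^sup>2 + (v$2)\<^sup>2) r)"
    using discriminant_margin[OF \<mu> d(1) dP] by (rule allI)
  from choice[OF this] obtain e1 where e1: "\<And>P. 0 < e1 P" and
    disc: "\<And>P c v r. c < ?c + e1 P \<Longrightarrow> norm v = 1 \<Longrightarrow> 0 < r \<Longrightarrow> r \<le> radius \<mu> P \<Longrightarrow>
      d \<le> norm (position \<mu> P + r *\<^sub>R v - ?l) \<Longrightarrow>
      0 < (ray_pot' (mass \<mu> P) (orient P * v$1) ((v$1)\<^sup>2 + (v$2)\<^sup>2) r)\<^sup>2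
        - 2 * ((v$1)\<^sup>2 + (v$2)\<^sup>2) * (c - ray_pot (mass \<mu> P) (orient P * v$1) ((v$1)\<^sup>2 + (v$2)\<^sup>2) r)"
    by blast
  have "\<forall>P. \<exists>e>0. \<forall>q. norm (q - position \<mu> P) = radius \<mu> P \<longrightarrow> d \<le> norm (q - ?l) \<longrightarrow> ?c + e \<le> eff_pot \<mu> q"
    using sphere_margin[OF \<mu> d(1)] by (rule allI)
  from choice[OF this] obtain e2 where e2: "\<And>P. 0 < e2 P"
    and sphere: "\<And>P q. norm (q - position \<mu> P) = radius \<mu> P \<Longrightarrow> d \<le> norm (q - ?l) \<Longrightarrow> ?c + e2 P \<le> eff_pot \<mu> q"
    by blast
  define \<epsilon> where "\<epsilon> = min e (min (min (e1 Earth) (e1 Moon)) (min (e2 Earth) (e2 Moon)))"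
  have \<epsilon>: "0 < \<epsilon>" "\<epsilon> \<le> e" using e e1 e2 by (simp_all add: \<epsilon>_def)
  have \<epsilon>P: "\<epsilon> \<le> e1 P" "\<epsilon> \<le> e2 P" for P by (cases P; simp add: \<epsilon>_def)+

  let ?base = "\<lambda>P (z :: phase). (fst z - position \<mu> P, 0 :: real^3)"
  let ?neck = "\<lambda>z. (fst z - ?l, 0) + ham_field k z"
  let ?N = "{z :: phase. norm (fst z - ?l) < d}"
  define side where "side P = (case P of Moon \<Rightarrow> {z. \<theta> z < - \<tau>} | Earth \<Rightarrow> {z. \<tau> < \<theta> z})" for P
  define X where "X z = (if norm (fst z - ?l) < d then ?neck z
    else if fst z $ 1 < ?l $ 1 then ?base Moon z else ?base Earth z)" for z
  \<comment> \<open>Open sets on which X is radial. Points with |q - l| = d belong to them only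
    through \<open>side P\<close>, which is open and reaches into the neck ball; this overlap makes
    X smooth across the change of formula.\<close>
  define F where "F P = fst -` (ball (position \<mu> P) (radius \<mu> P) - {position \<mu> P})
    \<inter> (side P \<union> {z. d < norm (fst z - ?l)})" for P
  define G where "G = ?N \<union> (\<Union>P. F P)"
  have side_open: "open (side P)" for P
    using \<theta> by (cases P) (auto simp: side_def intro!: open_Collect_less continuous_intros)
  have F_open: "open (F P)" for P
    unfolding F_def
    by (intro open_Int open_Un side_open open_vimage_fst open_Diff open_ball closed_singleton open_Collect_less continuous_intros)
  have N_open: "open ?N" by (intro open_Collect_less continuous_intros)
  have G_open: "open G" unfolding G_def by (intro open_Un N_open open_UN ballI F_open)
  have neck_side: "?neck z = ?base P z" if z: "z \<in> side P" for P z
  proof -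
    \<comment> \<open>On the side of P the function k is a p_1, whose field is the translation a
      d/dq_1, and l - P is a times the first unit vector.\<close>
    define a where "a = orient P * radius \<mu> P"
    have ka: "k w = a * snd w $ 1" if "w \<in> side P" for w
      using that left right radius_other[of \<mu> Moon] by (cases P) (auto simp: side_def a_def)
    have "((\<lambda>w :: phase. a * snd w $ 1) has_derivative (\<lambda>u. a * snd u $ 1)) (at z)"
      by (auto intro!: derivative_eq_intros bounded_linear.has_derivative[OF bounded_linear_vec_nth])
    then have "(k has_derivative (\<lambda>u. a * snd u $ 1)) (at z)"
      by (rule has_derivative_transform_within_open[OF _ side_open z]) (simp add: ka)
    then have D: "frechet_derivative k (at z) = (\<lambda>u. a * snd u $ 1)" by (simp flip: frechet_derivative_at)
    have "(\<Sum>b\<in>Basis. (a * b $ 1) *\<^sub>R b) = (\<Sum>b\<in>Basis. ((a *\<^sub>R axis 1 1) \<bullet> b) *\<^sub>R b :: real^3)"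
      by (intro sum.cong) (simp_all add: inner_axis')
    also have "\<dots> = a *\<^sub>R axis 1 1" by (rule euclidean_representation)
    finally have "ham_field k z = (a *\<^sub>R axis 1 1, 0)" by (simp add: ham_field_def D)
    moreover have "?l - position \<mu> P = a *\<^sub>R axis 1 1"
      by (simp add: lpos_body[of \<mu> P] vector3_eq_iff a_def axis_def)
    then have "fst z - ?l + a *\<^sub>R axis 1 1 = fst z - position \<mu> P" by (simp add: algebra_simps)
    ultimately show ?thesis by simp
  qed
  have X_F: "X z = ?base P z" if z: "z \<in> F P" for P z
  proof (cases "norm (fst z - ?l) < d")
    case True
    then have "z \<in> side P" using z by (auto simp: F_def)
    then show ?thesis using neck_side True by (simp add: X_def)
  next
    case False
    have "orient P * fst z $ 1 < orient P * ?l $ 1" by (rule ball_side) (use z in \<open>auto simp: F_def\<close>)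
    then show ?thesis using False by (cases P) (auto simp: X_def)
  qed
  have local: "\<exists>B g. open B \<and> z \<in> B \<and> Cinf_on B g \<and> (\<forall>w\<in>B. X w = g w) \<and>
      (\<forall>u v. symp (frechet_derivative g (at z) u) v + symp u (frechet_derivative g (at z) v) = symp u v)"
    if z: "z \<in> G" for z
  proof -
    consider "z \<in> ?N" | P where "z \<in> F P" using z by (auto simp: G_def)
    then show ?thesis
    proof cases
      case 1
      have "(?neck has_derivative (\<lambda>u. (fst u, 0) + frechet_derivative (ham_field k) (at z) u)) (at z)"
        by (auto intro!: derivative_eq_intros Cinf_on_has_derivative[OF Cinf_on_ham_field[OF open_UNIV k] open_UNIV])
      note D = frechet_derivative_at[OF this, symmetric]
      have "symp ((fst u, 0) + frechet_derivative (ham_field k) (at z) u) v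
          + symp u ((fst v, 0) + frechet_derivative (ham_field k) (at z) v) = symp u v" for u v
        using liouville_ham_field[OF open_UNIV k UNIV_I, of z u v]
        by (simp add: symp_def inner_add_left inner_add_right)
      moreover have "Cinf_on ?N ?neck"
        by (intro Cinf_intros N_open Cinf_on_ham_field Cinf_on_subset[OF k]) simp
      ultimately show ?thesis
        using 1 N_open by (intro exI[of _ ?N] exI[of _ ?neck]) (simp add: D X_def)
    next
      case (2 P)
      have "(?base P has_derivative (\<lambda>u. (fst u, 0))) (at z)"
        by (auto intro!: derivative_eq_intros)
      note D = frechet_derivative_at[OF this, symmetric]
      have "Cinf_on (F P) (?base P)" by (intro Cinf_intros F_open)
      then show ?thesis
        using 2 F_open X_F by (intro exI[of _ "F P"] exI[of _ "?base P"]) (simp add: D symp_def)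
    qed
  qed
  have nl: "radius \<mu> P - d \<le> norm (q - position \<mu> P)" if "norm (q - ?l) \<le> d" for q P
    using norm_triangle_ineq4[of "q - ?l" "q - position \<mu> P"] lP[of P] that by (simp add: norm_minus_commute)
  have G_phase: "G \<subseteq> phase_space \<mu>"
  proof
    fix z assume "z \<in> G"
    then consider "z \<in> ?N" | P where "z \<in> F P" by (auto simp: G_def)
    then show "z \<in> phase_space \<mu>"
    proof cases
      case 1
      then have "fst z \<noteq> position \<mu> P" for P
        using nl[of "fst z" P] dP[of P] d(1) by auto
      then show ?thesis using phase_space_iff[of z \<mu> Earth] by blast
    next
      case (2 P)
      then have "norm (fst z - position \<mu> P) < 1"
        using radius_bounds[OF \<mu>, of P] by (simp add: F_def dist_norm norm_minus_commute)
      then show ?thesis using other_far[OF \<mu>] 2 phase_space_iff[of z \<mu> P] by (simp add: F_def)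
    qed
  qed
  let ?Q = "(\<Union>P. ball (position \<mu> P) (radius \<mu> P)) \<union> ball ?l d"
  show ?thesis
  proof (intro exI[of _ \<epsilon>] conjI allI impI \<epsilon>(1))
    fix c assume "H \<mu> (L1 \<mu>) < c \<and> c < H \<mu> (L1 \<mu>) + \<epsilon>"
    then have c: "?c < c" "c < ?c + \<epsilon>" by (simp_all add: H_L1[OF \<mu>])
    have "hill_component_EM \<mu> c = hill_region \<mu> c \<inter> ?Q"
    proof (rule hill_component_EM_eq[OF d(1) c(1)])
      show "c < eff_pot \<mu> q" if "norm (q - position \<mu> P) = radius \<mu> P" "d \<le> norm (q - ?l)" for P q
        using sphere[OF that] c(2) \<epsilon>P(2)[of P] by linarith
      show "c < eff_pot \<mu> q" if "norm (q - ?l) = d" "\<And>P. radius \<mu> P \<le> norm (q - position \<mu> P)" for q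
        using frontier[OF that] c(2) \<epsilon>(2) by simp
    qed
    then have "\<Sigma>_EM \<mu> c = {z \<in> energy_level \<mu> c. fst z \<in> ?Q}"
      unfolding \<Sigma>_EM_def hill_region_def by blast
    moreover have "position \<mu> P \<in> ?Q" for P
      by (rule UnI1, rule UN_I[of P]) (use radius_bounds(1)[OF \<mu>, of P] in simp_all)
    then have "{P. position \<mu> P \<in> ?Q} = UNIV" by blast
    ultimately have eq: "regularized_\<Sigma>_EM \<mu> c = level_part \<mu> c ?Q"
      unfolding regularized_\<Sigma>_EM_def level_part_def by simp
    show "contact_type \<mu> (regularized_\<Sigma>_EM \<mu> c)"
      unfolding eq
    proof (rule contact_type_level_part[OF \<mu> _ G_open G_phase])
      show "open ?Q" by (intro open_Un open_UN ballI open_ball)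
      show "Cinf_on G X"
      proof (rule Cinf_on_local)
        fix z assume "z \<in> G"
        from local[OF this] show "\<exists>B g. open B \<and> z \<in> B \<and> Cinf_on B g \<and> (\<forall>w\<in>B. X w = g w)"
          by (elim exE conjE) (intro exI conjI; assumption)
      qed
    next
      fix z u v assume "z \<in> G"
      from local[OF this] obtain B g where B: "open B" "z \<in> B" "Cinf_on B g" "\<forall>w\<in>B. X w = g w"
        and L: "\<forall>u v. symp (frechet_derivative g (at z) u) v + symp u (frechet_derivative g (at z) v) = symp u v"
        by (elim exE conjE) (rule that; assumption)
      have "(X has_derivative frechet_derivative g (at z)) (at z)"
        by (rule has_derivative_transform_within_open[OF Cinf_on_has_derivative[OF B(3,1,2)] B(1,2)]) (simp add: B(4))
      then show "symp (frechet_derivative X (at z) u) v + symp u (frechet_derivative X (at z) v) = symp u v"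
        using L by (simp only: frechet_derivative_at[symmetric])
    next
      fix P
      have "z \<in> G \<and> X z = ?base P z"
        if z: "z \<in> phase_space \<mu>" "norm (fst z - position \<mu> P) < radius \<mu> P - d" for z
      proof -
        have "d < norm (fst z - ?l)" using nl[of "fst z" P] z(2) by argo
        then have "z \<in> F P"
          using z d(1) phase_space_iff[of z \<mu> P] by (simp add: F_def dist_norm norm_minus_commute)
        then show ?thesis using X_F by (auto simp: G_def)
      qed
      moreover have "0 < radius \<mu> P - d" using dP[of P] d(1) by simp
      ultimately show "\<exists>e>0. \<forall>z\<in>phase_space \<mu>. norm (fst z - position \<mu> P) < e \<longrightarrow> z \<in> G \<and> X z = ?base P z"
        by blast
    next
      fix z assume z: "z \<in> phase_space \<mu>" "H \<mu> z = c" "fst z \<in> ?Q"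
      have Hz: "?c < H \<mu> z" "H \<mu> z < ?c + e" using z(2) c \<epsilon>(2) by auto
      have "z \<in> G \<and> H_deriv \<mu> z (X z) > 0"
      proof (cases "norm (fst z - ?l) < d")
        case True
        then show ?thesis using neck(1)[OF Hz] by (simp add: G_def X_def)
      next
        case False
        then obtain P where P: "fst z \<in> ball (position \<mu> P) (radius \<mu> P)"
          using z(3) by (auto simp: dist_norm norm_minus_commute)
        have neq: "fst z \<noteq> position \<mu> P" using z(1) phase_space_iff[of z \<mu> P] by blast
        \<comment> \<open>On the boundary of the neck ball the energy bound forces \<theta> beyond
          the threshold on the side of P, where the radial formula holds.\<close>
        have "z \<in> side P" if n: "norm (fst z - ?l) = d"
        proof -
          have "orient P * fst z $ 1 < orient P * ?l $ 1" by (rule ball_side[OF P])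
          then show ?thesis using neck(2,3)[OF Hz _ n] n by (cases P) (auto simp: side_def)
        qed
        then have F: "z \<in> F P" using P neq False by (auto simp: F_def not_less)
        define r where "r = norm (fst z - position \<mu> P)"
        obtain v where v: "norm v = 1" "fst z = position \<mu> P + r *\<^sub>R v"
          using polar[OF neq] r_def by metis
        have r: "0 < r" "r < radius \<mu> P" using neq P by (auto simp: r_def dist_norm norm_minus_commute)
        note b = unit_bounds(1,2)[OF v(1), of P] unit_bounds(3,4)[OF v(1)]
        have "H_deriv \<mu> z (?base P z) > 0"
        proof (rule H_deriv_radial_pos[OF v(1) r(1) v(2)])
          show "0 < ray_pot' (mass \<mu> P) (orient P * v$1) ((v$1)\<^sup>2 + (v$2)\<^sup>2) r"
            by (rule ray_pot'_pos[OF mass_bounds[OF \<mu>] lagrange_radius_body[OF \<mu>, of P] r b])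
          have "c < ?c + e1 P" using c(2) \<epsilon>P(1)[of P] by linarith
          then show "0 < (ray_pot' (mass \<mu> P) (orient P * v$1) ((v$1)\<^sup>2 + (v$2)\<^sup>2) r)\<^sup>2
              - 2 * ((v$1)\<^sup>2 + (v$2)\<^sup>2) * (H \<mu> z - eff_pot \<mu> (fst z))"
            using disc[OF _ v(1) r(1) less_imp_le[OF r(2)], of c] False z(2) v(2)
              eff_pot_ray[where P = P and \<mu> = \<mu>, OF v(1) r(1)] by simp
        qed
        then show ?thesis using X_F[OF F] F by (auto simp: G_def)
      qed
      then show "z \<in> G \<and> (\<exists>D. (H \<mu> has_derivative D) (at z) \<and> D (X z) \<noteq> 0)"
        using H_has_derivative[OF z(1)] by (auto intro!: exI[of _ "H_deriv \<mu> z"])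
    qed
  qed
qed

end

theorem theorem1p1:
  fixes \<mu> :: real
  assumes "0 < \<mu>" and "\<mu> < 1"
  shows "(\<forall>c. c < H \<mu> (L1 \<mu>) \<longrightarrow>
            contact_type \<mu> (regularized_\<Sigma> \<mu> c Earth) \<and>
            contact_type \<mu> (regularized_\<Sigma> \<mu> c Moon)) \<and>
         (\<exists>\<epsilon>>0. \<forall>c. H \<mu> (L1 \<mu>) < c \<and> c < H \<mu> (L1 \<mu>) + \<epsilon> \<longrightarrow>
            contact_type \<mu> (regularized_\<Sigma>_EM \<mu> c))"
  using contact_type_below[OF assms] contact_type_above[OF assms] by blast

end
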